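(* Let $n\ge2$ and let $\lambda$ be a partition of length at most $2n$. Then there exist two bijections $$\Phi:\mathsf{SST}^{\widehat{\mathfrak g}\text{-dom}}_{2n}(\lambda)\to\mathsf{SST}^{\mathfrak k\text{-hw}}_{2n}(\lambda),\qquad \Psi:\mathsf{SST}^{\widehat{\mathfrak g}\text{-dom}}_{2n}(\lambda)\to\mathsf{SST}^{\mathfrak k\text{-lw}}_{2n}(\lambda)$$ such that for each $T\in\mathsf{SST}^{\widehat{\mathfrak g}\text{-dom}}_{2n}(\lambda)$, $$\mathrm{wt}_{\widehat{\mathfrak g}}(T)=\mathrm{wt}_{\mathfrak k}(\Phi(T)),\qquad \mathrm{wt}_{\widehat{\mathfrak g}}(T)=\mathrm{wt}_{\mathfrak k}(\Psi(T)).$$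
   Context: Tableaux. $(x,y)$ denotes the box in column $x$ and row $y$ (rows numbered from top to bottom), and $T(x,y)$ the entry there. $\mathsf{SST}_{2n}(\lambda)$ is the set of semistandard tableaux of shape $\lambda$ (rows weakly increasing, columns strictly increasing downwards) with entries in $\{1,\dots,2n\}$. $T[m]$ is the number of entries of $T$ equal to $m$, and $\overline i=2n+1-i$. $\widehat{\mathfrak g}$-dominant tableaux. Let $\widehat P_{\mathbb R}$ be the real vector space with basis $\widehat\varepsilon_1,\dots,\widehat\varepsilon_n$, and put $\widehat\varepsilon_{\overline i}=-\widehat\varepsilon_i$ for $1\le i\le n$. For $T\in\mathsf{SST}_{2n}(\lambda)$ with $N$ boxes let $i_1\cdots i_N$ be its inverse column word: read entries from the rightmost column to the leftmost, top to bottom in each column. Let $\widehat\pi_T:[0,1]\to\widehat P_{\mathbb R}$ be the piecewise-linear path $\widehat\pi_T(t)=\sum_{k=1}^{j-1}\widehat\varepsilon_{i_k}+(Nt-(j-1))\widehat\varepsilon_{i_j}$ for $\frac{j-1}N\le t\le\frac jN$. $T$ is $\widehat{\mathfrak g}$-dominant if the image of $\widehat\pi_T$ lies in $\{\sum x_i\widehat\varepsilon_i: x_1\ge\cdots\ge x_n\ge0\}$; $\mathsf{SST}^{\widehat{\mathfrak g}\text{-dom}}_{2n}(\lambda)$ is the set of such $T\in\mathsf{SST}_{2n}(\lambda)$. Put $\mathrm{wt}_{\widehat{\mathfrak g}}(T)=\widehat\pi_T(1)=\sum_{i=1}^n(T[i]-T[\overline i])\widehat\varepsilon_i$. The operation $\mathsf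 P^{A\mathrm{II}}$. For a one-column semistandard tableau $S$ of length $l$, let $S'$ (resp. $S''$) be obtained by deleting its last box (resp. last two boxes), and define a set $\mathrm{rem}(S)$ recursively: $\mathrm{rem}(S)=\emptyset$ if $l\le1$; if $l\ge2$, $S(1,l)$ is even, $S(1,l-1)=S(1,l)-1$ and $S(1,l)<2l-\#\mathrm{rem}(S'')-1$, then $\mathrm{rem}(S)=\mathrm{rem}(S'')\sqcup\{S(1,l-1),S(1,l)\}$; otherwise $\mathrm{rem}(S)=\mathrm{rem}(S')$. Let $\mathrm{red}(S)$ be the one-column tableau with the entries of $S$ not in $\mathrm{rem}(S)$. For a positive integer $m$ and a semistandard tableau $S$, $m\to S$ denotes Schensted column insertion: insert $m$ in the first column, appending it at the bottom if it is larger than all entries there, otherwise replacing the smallest entry $\ge m$ and inserting the replaced entry in the next column in the same way, and so on. For a one-column tableau $C$ of length $l$, $C*S=C(1,l)\to(C(1,l-1)\to(\cdots\to(C(1,1)\to S)))$. For a semistandard tableau $S$ with first column $S_1$ and remaining columns $S_{\ge2}$, let $\mathrm{suc}(S)=\mathrm{red}(S_1)*S_{\ge2}$. Iterating $\mathrm{suc}$ stabilizes, and $\mathsf P^{A\mathrm{II}}(S)=\mathrm{suc}^N(S)$ for any $N$ with $\mathrm{suc}^{N+1}(S)=\mathrm{suc}^N(S)$. $\mathfrak k$-highest/lowest weight tableaux. Let $a_k=2k-\frac{1+(-1)^k}2$, $b_k=2k-\frac{1+(-1)^{k+1}}2$ for $1\le k\le n$ (so $(a_k)=2,3,6,7,\dots$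 and $(b_k)=1,4,5,8,\dots$). $S\in\mathsf{SST}_{2n}(\lambda)$ is a $\mathfrak k$-highest weight (resp. $\mathfrak k$-lowest weight) tableau if $\mathsf P^{A\mathrm{II}}(S)$ has at most $n$ rows and for each $k$ every entry in its $k$-th row equals $a_k$ (resp. $b_k$). $\mathsf{SST}^{\mathfrak k\text{-hw}}_{2n}(\lambda)$ and $\mathsf{SST}^{\mathfrak k\text{-lw}}_{2n}(\lambda)$ are the sets of such tableaux of shape $\lambda$. Put $\mathrm{wt}_{\mathfrak k}(S)=\sum_{i=1}^n(S[a_i]-S[b_i])\widetilde\varepsilon_i$, where $\widetilde\varepsilon_1,\dots,\widetilde\varepsilon_n$ is a basis of the weight lattice of $\mathfrak k\cong\mathfrak{sp}_{2n}(\mathbb C)$; weights are compared by identifying $\widetilde\varepsilon_i$ with $\widehat\varepsilon_i$.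
   Formalization: The condition on Ψ is proved with a minus sign, wt_ĝ(T) = −wt_𝔨(Ψ(T)); as printed it fails for n = 2, λ = (1), where the only dominant tableau [1] has weight ε̂₁ and the only 𝔨-lowest weight tableau [1] has wt_𝔨 = −ε̃₁. *)

theory Defs
  imports Complex_Main
begin

text \<open>
  A tableau is the list of its columns, from left to right, each column being listed from top to
  bottom.  Lists are indexed from 0, so \<open>T ! (x - 1) ! (y - 1)\<close> is the entry \<open>T(x,y)\<close> in column
  \<open>x\<close> and row \<open>y\<close>.
\<close>

type_synonym tableau = "nat list list"

definition is_partition :: "nat list \<Rightarrow> bool" where
  "is_partition lam \<longleftrightarrow> sorted_wrt (\<ge>) lam \<and> (\<forall>p\<in>set lam. 0 < p)"

definition boxes :: "tableau \<Rightarrow> (nat \<times> nat) set" where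
  "boxes T = {(x, y). x < length T \<and> y < length (T ! x)}"

definition diagram :: "nat list \<Rightarrow> (nat \<times> nat) set" where
  "diagram lam = {(x, y). y < length lam \<and> x < lam ! y}"

text \<open>Empty columns are invisible in the set of boxes and therefore have to be excluded.\<close>

definition SST :: "nat \<Rightarrow> nat list \<Rightarrow> tableau set" where
  "SST m lam = {T. [] \<notin> set T \<and> boxes T = diagram lam
     \<and> (\<forall>(x, y)\<in>boxes T. T ! x ! y \<in> {1..m})
     \<and> (\<forall>x y. (x, y) \<in> boxes T \<longrightarrow> (Suc x, y) \<in> boxes T \<longrightarrow> T ! x ! y \<le> T ! Suc x ! y)
     \<and> (\<forall>x y. (x, y) \<in> boxes T \<longrightarrow> (x, Suc y) \<in> boxes T \<longrightarrow> T ! x ! y < T ! x ! Suc y)}"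

definition entry_count :: "tableau \<Rightarrow> nat \<Rightarrow> nat" where
  "entry_count T m = count_list (concat T) m"


text \<open>
  Vectors with respect to the basis \<open>\<epsilon>\<^sub>1, \<dots>, \<epsilon>\<^sub>n\<close> are given by their coordinate functions on
  \<open>{1..n}\<close>, extended by 0.  The vector attached to a letter \<open>m > n\<close> is \<open>- \<epsilon>\<^bsub>2n+1-m\<^esub>\<close>.
\<close>

definition eps_hat :: "nat \<Rightarrow> nat \<Rightarrow> nat \<Rightarrow> real" where
  "eps_hat n m = (if m \<le> n then (\<lambda>i. of_bool (i = m)) else (\<lambda>i. - of_bool (i = 2 * n + 1 - m)))"

definition inv_col_word :: "tableau \<Rightarrow> nat list" where
  "inv_col_word T = concat (rev T)"

text \<open>
  Here \<open>j\<close> is the number of completed steps of the path at time \<open>t\<close>; the letters of \<open>w\<close> are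
  indexed from 0.  The familiar description on each piece is \<open>pi_word_piece\<close> below.
\<close>

definition pi_word :: "nat \<Rightarrow> nat list \<Rightarrow> real \<Rightarrow> nat \<Rightarrow> real" where
  "pi_word n w t =
     (let N = length w; j = min (nat \<lfloor>real N * t\<rfloor>) (N - 1)
      in (\<lambda>i. (\<Sum>k<j. eps_hat n (w ! k) i) + (real N * t - real j) * eps_hat n (w ! j) i))"

definition pi_hat :: "nat \<Rightarrow> tableau \<Rightarrow> real \<Rightarrow> nat \<Rightarrow> real" where
  "pi_hat n T = pi_word n (inv_col_word T)"

lemma pi_word_Nil: "pi_word n [] t = (\<lambda>i. 0)"
  by (simp add: pi_word_def)

lemma pi_word_piece:
  assumes j: "j \<in> {1..length w}"
    and t: "(real j - 1) / real (length w) \<le> t" "t \<le> real j / real (length w)"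
  shows "pi_word n w t i =
    (\<Sum>k=1..j - 1. eps_hat n (w ! (k - 1)) i)
      + (real (length w) * t - (real j - 1)) * eps_hat n (w ! (j - 1)) i"
proof -
  let ?N = "length w"
  have N: "0 < real ?N" using j by auto
  have lo: "real j - 1 \<le> real ?N * t" and hi: "real ?N * t \<le> real j"
    using t N by (simp_all add: field_simps)
  have S: "(\<Sum>k=1..m. eps_hat n (w ! (k - 1)) i) = (\<Sum>k<m. eps_hat n (w ! k) i)" for m
    by (induction m) simp_all
  show ?thesis
  proof (cases "real ?N * t = real j \<and> j < ?N")
    case True
    then have eq: "min (nat \<lfloor>real ?N * t\<rfloor>) (?N - 1) = j" by auto
    obtain m where m: "j = Suc m" using j by (cases j) auto
    show ?thesis
      unfolding pi_word_def Let_def eq S using True m by simp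
  next
    case False
    have eq: "min (nat \<lfloor>real ?N * t\<rfloor>) (?N - 1) = j - 1"
    proof (cases "real ?N * t = real j")
      case True
      then have "j = ?N" using False j by auto
      moreover have "nat \<lfloor>real ?N * t\<rfloor> = j" using True by simp
      ultimately show ?thesis by simp
    next
      case False
      then have "real ?N * t < real j" using hi by simp
      then have "\<lfloor>real ?N * t\<rfloor> = int j - 1"
        using lo by (intro floor_unique) auto
      then show ?thesis using j by auto
    qed
    show ?thesis
      unfolding pi_word_def Let_def eq S using j by (simp add: of_nat_diff)
  qed
qed

definition dominant_chamber :: "nat \<Rightarrow> (nat \<Rightarrow> real) set" where
  "dominant_chamber n = {x. (\<forall>i\<in>{1..<n}. x (Suc i) \<le> x i) \<and> 0 \<le> x n}"

definition g_dominant :: "nat \<Rightarrow> tableau \<Rightarrow> bool" where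
  "g_dominant n T \<longleftrightarrow> pi_hat n T ` {0..1} \<subseteq> dominant_chamber n"

definition SST_gdom :: "nat \<Rightarrow> nat list \<Rightarrow> tableau set" where
  "SST_gdom n lam = {T \<in> SST (2 * n) lam. g_dominant n T}"

definition wt_g :: "nat \<Rightarrow> tableau \<Rightarrow> nat \<Rightarrow> real" where
  "wt_g n T = pi_hat n T 1"

lemma wt_g_eq:
  assumes T: "set (concat T) \<subseteq> {1..2 * n}" and i: "i \<in> {1..n}"
  shows "wt_g n T i = real (entry_count T i) - real (entry_count T (2 * n + 1 - i))"
proof -
  define w where "w = inv_col_word T"
  have w: "set w \<subseteq> {1..2 * n}" using T by (auto simp: w_def inv_col_word_def)
  have cnt: "count_list w m = entry_count T m" for m
    unfolding w_def inv_col_word_def entry_count_def by (induction T) auto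
  have "pi_word n w 1 i = sum_list (map (\<lambda>m. eps_hat n m i) w)"
  proof (cases "w = []")
    case False
    then obtain N where N: "length w = Suc N" by (cases w) auto
    have "pi_word n w 1 i = (\<Sum>k<N. eps_hat n (w ! k) i) + eps_hat n (w ! N) i"
      by (simp add: pi_word_def N nat_add_distrib)
    also have "\<dots> = (\<Sum>k<length w. eps_hat n (w ! k) i)" by (simp add: N)
    finally show ?thesis by (simp add: sum_list_sum_nth atLeast0LessThan)
  qed (simp add: pi_word_Nil)
  also have "\<dots> = real (count_list w i) - real (count_list w (2 * n + 1 - i))"
    using w by (induction w) (use i in \<open>auto simp: eps_hat_def\<close>)
  finally show ?thesis by (simp add: wt_g_def pi_hat_def cnt flip: w_def)
qed


function rem :: "nat list \<Rightarrow> nat set" where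
  "rem S =
     (if length S \<le> 1 then {}
      else if even (S ! (length S - 1))
              \<and> int (S ! (length S - 2)) = int (S ! (length S - 1)) - 1
              \<and> int (S ! (length S - 1))
                  < 2 * int (length S) - int (card (rem (butlast (butlast S)))) - 1
      then rem (butlast (butlast S)) \<union> {S ! (length S - 2), S ! (length S - 1)}
      else rem (butlast S))"
  by pat_completeness auto
termination
  by (relation "measure length") auto

declare rem.simps [simp del]

definition red :: "nat list \<Rightarrow> nat list" where
  "red S = filter (\<lambda>x. x \<notin> rem S) S"

fun col_insert :: "nat \<Rightarrow> tableau \<Rightarrow> tableau" where
  "col_insert m [] = [[m]]"
| "col_insert m (c # S) =
     (if \<forall>x\<in>set c. x < m then (c @ [m]) # S
      else let p = Min {x \<in> set c. m \<le> x}
           in map (\<lambda>x. if x = p then m else x) c # col_insert p S)"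

text \<open>The topmost entry of the column is inserted first.\<close>

definition col_star :: "nat list \<Rightarrow> tableau \<Rightarrow> tableau" where
  "col_star C S = fold col_insert C S"

fun suc :: "tableau \<Rightarrow> tableau" where
  "suc [] = []"
| "suc (c # S) = col_star (red c) S"

definition P_AII :: "tableau \<Rightarrow> tableau" where
  "P_AII S = (suc ^^ (LEAST N. (suc ^^ Suc N) S = (suc ^^ N) S)) S"

text \<open>The choice of the exponent in \<^const>\<open>P_AII\<close> is immaterial.\<close>

lemma P_AII_eq:
  assumes "(suc ^^ Suc N) S = (suc ^^ N) S"
  shows "P_AII S = (suc ^^ N) S"
proof -
  define M where "M = (LEAST N. (suc ^^ Suc N) S = (suc ^^ N) S)"
  have M: "(suc ^^ Suc M) S = (suc ^^ M) S"
    unfolding M_def by (rule LeastI[of _ N]) (rule assms)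
  have "M \<le> N" unfolding M_def by (rule Least_le) (rule assms)
  moreover have "(suc ^^ (k + M)) S = (suc ^^ M) S" for k
    by (induction k) (use M in simp_all)
  ultimately have "(suc ^^ N) S = (suc ^^ M) S" by (metis le_add_diff_inverse2)
  then show ?thesis by (simp add: P_AII_def M_def)
qed


definition a_seq :: "nat \<Rightarrow> nat" where
  "a_seq k = 2 * k - of_bool (even k)"

definition b_seq :: "nat \<Rightarrow> nat" where
  "b_seq k = 2 * k - of_bool (odd k)"

text \<open>
  A tableau has at most \<open>n\<close> rows iff its columns have length at most \<open>n\<close>; rows are numbered from 1
  here, hence the shift in the index.
\<close>

definition rows_const :: "nat \<Rightarrow> (nat \<Rightarrow> nat) \<Rightarrow> tableau \<Rightarrow> bool" where
  "rows_const n f T \<longleftrightarrow>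
     (\<forall>c\<in>set T. length c \<le> n \<and> (\<forall>k\<in>{1..length c}. c ! (k - 1) = f k))"

definition SST_khw :: "nat \<Rightarrow> nat list \<Rightarrow> tableau set" where
  "SST_khw n lam = {S \<in> SST (2 * n) lam. rows_const n a_seq (P_AII S)}"

definition SST_klw :: "nat \<Rightarrow> nat list \<Rightarrow> tableau set" where
  "SST_klw n lam = {S \<in> SST (2 * n) lam. rows_const n b_seq (P_AII S)}"

text \<open>
  With this sign convention highest weight tableaux have dominant weight, whereas lowest weight
  tableaux have antidominant weight: the tableau with a single box is of highest weight if its entry
  is 2, with weight \<open>\<epsilon>\<^sub>1\<close>, and of lowest weight if its entry is 1, with weight \<open>- \<epsilon>\<^sub>1\<close>.
\<close>

definition wt_k :: "nat \<Rightarrow> tableau \<Rightarrow> nat \<Rightarrow> real" where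
  "wt_k n S = (\<lambda>i. if i \<in> {1..n} then real (entry_count S (a_seq i)) - real (entry_count S (b_seq i)) else 0)"

end

theory Submission
  imports Defs "HOL-Combinatorics.Permutations" "HOL-Library.Poly_Mapping" "Jordan_Normal_Form.Determinant"
begin

text \<open>
  It suffices to count: for every dominant weight the three sets contain equally many tableaux of that
  weight.  A tableau with \<open>r\<close> columns is treated as an array of \<open>r\<close> sets of letters.  Moving letters
  between adjacent columns gives a crystal of type \<open>A\<close> on arrays, with the semistandard arrays as its
  highest weight elements; removing pairs \<open>{2m-1, 2m}\<close> from the first column extends it to a crystal
  of type \<open>C\<^sub>r\<close> (a doubling of letters embeds it into a crystal of 0/1 matrices, whose row and column
  moves commute).  Each step of \<^const>\<open>suc\<close> is a composition of crystal moves, and \<^const>\<open>P_AII\<close>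
  leads to the unique highest weight element of the component, a symplectic tableau in the sense of
  King.  Hence the number of semistandard tableaux of a given shape over a highest weight element
  depends only on the shape of the latter, and both kinds of constant-row tableaux give the same count.

  To identify it with the number of dominant tableaux, sum a function antisymmetric under the Weyl group
  over all semistandard tableaux.  Reflecting a tableau at the first place where its path leaves the
  chamber shows that only dominant tableaux contribute.  Swapping tails of columns extends the
  sum to all arrays, where letters may be permuted freely, so that the two weights can be exchanged.
  Grouping by the image under \<^const>\<open>P_AII\<close> leaves sums over King tableaux of fixed shape, and by the
  orthogonality expressed by the dual Cauchy identity for symplectic groups (a determinant of Chebyshev
  polynomials) only the constant-row tableau of the given weight survives.
\<close>

text \<open>The algebra behind the crystals is skew Howe duality: arrays index a basis of the
  exterior algebra of C^(2n) tensor C^r, on which Sp(2n) and Sp(2r) act and commute. Semistandard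
  means highest for GL(r), semistandard and symplectic means highest for Sp(2r). This is why the
  weight for k, a weight of Sp(2n), is constant along the moves that make up \<open>suc\<close>, and
  why the component over a highest element is determined by the column heights.

  The obstacle is the order of the letters. Paths use i and its bar 2n+1-i, symplectic tableaux the
  neighbours 2i-1 and 2i, and renaming letters destroys semistandardness. So both counts are written
  as signed sums over arbitrary arrays, where renaming is harmless. In such a sum a factor
  \<open>Dl\<close> in the column heights singles out one shape; it changes sign when tails are
  swapped, which cancels the arrays that are not semistandard. The bijections obtained are not
  explicit, since elements of equal weight are matched arbitrarily.\<close>

section \<open>Sign words and the signature rule\<close>

text \<open>In a word of signs, a plus is matched with a later minus; \<open>dn\<close> counts the unmatched minus
  signs and \<open>up\<close> the unmatched plus signs.\<close>

fun dn :: "int list \<Rightarrow> int" where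
  "dn [] = 0"
| "dn (x # xs) = max 0 (dn xs - x)"

definition up :: "int list \<Rightarrow> int" where
  "up xs = sum_list xs + dn xs"

lemma dn_nonneg: "0 \<le> dn xs"
  by (cases xs) auto

lemma dn_append: "dn (xs @ ys) = max (dn xs) (dn ys - sum_list xs)"
  by (induction xs) (use dn_nonneg in auto)

lemma up_Nil [simp]: "up [] = 0"
  by (simp add: up_def)

lemma up_append: "up (xs @ ys) = max (up ys) (up xs + sum_list ys)"
  by (simp add: up_def dn_append)

lemma up_nonneg: "0 \<le> up xs"
  unfolding up_def by (induction xs) auto

lemma up_snoc: "up (xs @ [x]) = max 0 (up xs + x)"
  using up_nonneg[of xs] by (auto simp add: up_def dn_append max_def)

lemma dn_append_0: "dn (xs @ ys) = 0 \<Longrightarrow> dn xs = 0"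
  using dn_nonneg[of xs] by (simp add: dn_append)

lemma up_append_0: "up (xs @ ys) = 0 \<Longrightarrow> up ys = 0"
  using up_nonneg[of ys] by (simp add: up_append)

text \<open>The signature rule, stated without the sign at \<open>q\<close>: a minus there is the
  last unmatched minus, a plus there the first unmatched plus. One condition thus serves an operator
  and its inverse.\<close>

definition ctx :: "(nat \<Rightarrow> int) \<Rightarrow> nat \<Rightarrow> nat \<Rightarrow> bool" where
  "ctx f N q \<longleftrightarrow> q < N \<and> up (map f [0..<q]) = 0 \<and> dn (map f [Suc q..<N]) = 0"

lemma ctx_cong:
  assumes "\<And>x. x < N \<Longrightarrow> x \<noteq> q \<Longrightarrow> f x = g x"
  shows "ctx f N q = ctx g N q"
proof (cases "q < N")
  case True
  have "map f [0..<q] = map g [0..<q]" "map f [Suc q..<N] = map g [Suc q..<N]"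
    using assms True by auto
  then show ?thesis by (simp only: ctx_def)
qed (simp add: ctx_def)

lemma upt_split2: "a \<le> k \<Longrightarrow> Suc k < b \<Longrightarrow> [a..<b] = [a..<k] @ [k, Suc k] @ [Suc (Suc k)..<b]"
proof -
  assume "a \<le> k" "Suc k < b"
  then have "[a..<b] = [a..<k] @ [k..<b]" by (metis Suc_lessD less_imp_le_nat upt_add_eq_append le_add_diff_inverse)
  also have "[k..<b] = k # Suc k # [Suc (Suc k)..<b]" using \<open>Suc k < b\<close>
    by (simp add: upt_conv_Cons)
  finally show ?thesis by simp
qed

text \<open>\<open>dn\<close> and the sum of a concatenation depend only on those of its parts, so
  an adjacent pair may be exchanged for an equivalent one. The last premise says that the interval
  does not cut the pair.\<close>

lemma pair_dn_up_cong:
  assumes "\<And>x. x \<noteq> k \<Longrightarrow> x \<noteq> Suc k \<Longrightarrow> f x = g x" "f k + f (Suc k) = g k + g (Suc k)"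
    "dn [f k, f (Suc k)] = dn [g k, g (Suc k)]" "Suc k < a \<or> a \<le> k \<and> Suc k < b \<or> b \<le> k"
  shows "dn (map f [a..<b]) = dn (map g [a..<b]) \<and> sum_list (map f [a..<b]) = sum_list (map g [a..<b])"
proof (cases "a \<le> k \<and> Suc k < b")
  case True
  have m: "map f [a..<k] = map g [a..<k]" "map f [Suc (Suc k)..<b] = map g [Suc (Suc k)..<b]"
    using assms(1) by auto
  have d: "dn ([f k, f (Suc k)] @ ys) = dn ([g k, g (Suc k)] @ ys)" for ys
    unfolding dn_append assms(3) using assms(2) by simp
  have s: "[a..<b] = [a..<k] @ [k, Suc k] @ [Suc (Suc k)..<b]"
    using True by (intro upt_split2) auto
  have "dn (map f [a..<b]) = dn (map f [a..<k] @ ([f k, f (Suc k)] @ map f [Suc (Suc k)..<b]))"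
    unfolding s by simp
  also have "\<dots> = dn (map g [a..<k] @ ([g k, g (Suc k)] @ map g [Suc (Suc k)..<b]))"
    unfolding dn_append[of "map f [a..<k]"] dn_append[of "map g [a..<k]"] d m by simp
  also have "\<dots> = dn (map g [a..<b])" unfolding s by simp
  finally have 1: "dn (map f [a..<b]) = dn (map g [a..<b])" .
  have "sum_list (map f [a..<b]) = sum_list (map f [a..<k]) + (f k + f (Suc k)) + sum_list (map f [Suc (Suc k)..<b])"
    unfolding s by simp
  also have "\<dots> = sum_list (map g [a..<b])" unfolding assms(2) m unfolding s by simp
  finally show ?thesis using 1 by simp
next
  case False
  then have "map f [a..<b] = map g [a..<b]" using assms(4)
    by (intro map_cong[OF refl] assms(1)) auto
  then show ?thesis by (simp only: simp_thms)
qed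

lemma ctx_pair:
  assumes "\<And>x. x \<noteq> k \<Longrightarrow> x \<noteq> Suc k \<Longrightarrow> f x = g x" "f k + f (Suc k) = g k + g (Suc k)"
    "dn [f k, f (Suc k)] = dn [g k, g (Suc k)]" "q \<noteq> k" "q \<noteq> Suc k" "Suc k < N" "ctx f N q"
  shows "ctx g N q"
proof -
  have "dn (map f [0..<q]) = dn (map g [0..<q]) \<and> sum_list (map f [0..<q]) = sum_list (map g [0..<q])"
    by (rule pair_dn_up_cong[OF assms(1-3)]) (use assms(4,5) in auto)
  moreover have "dn (map f [Suc q..<N]) = dn (map g [Suc q..<N]) \<and> sum_list (map f [Suc q..<N]) = sum_list (map g [Suc q..<N])"
    by (rule pair_dn_up_cong[OF assms(1-3)]) (use assms(4-6) in auto)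
  ultimately show ?thesis using assms(7) by (simp add: ctx_def up_def)
qed

lemma ctx_Suc:
  assumes "ctx f N q" "Suc q < N"
  shows "0 \<le> f (Suc q)"
  using assms dn_nonneg[of "map f [Suc (Suc q)..<N]"] by (auto simp: ctx_def upt_conv_Cons max_def split: if_splits)

lemma ctx_pred:
  assumes "ctx f N (Suc q)"
  shows "f q \<le> 0"
  using assms up_nonneg[of "map f [0..<q]"] by (auto simp: ctx_def up_snoc max_def split: if_splits)

text \<open>A neutral letter commutes with its neighbour, so the active position may pass over
  it.\<close>

lemma ctx_shift_up:
  assumes "ctx f N q" "Suc q < N" "f (Suc q) = 0" "g q = 0"
    "\<And>x. x \<noteq> q \<Longrightarrow> x \<noteq> Suc q \<Longrightarrow> f x = g x"
  shows "ctx g N (Suc q)"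
proof -
  have "map f [0..<q] = map g [0..<q]" "map f [Suc (Suc q)..<N] = map g [Suc (Suc q)..<N]"
    by (auto intro!: assms(5))
  note m = this[symmetric]
  show ?thesis using assms(1-4) dn_nonneg[of "map g [Suc (Suc q)..<N]"]
    by (auto simp: ctx_def up_snoc upt_conv_Cons m)
qed

lemma ctx_shift_down:
  assumes "ctx f N (Suc q)" "f q = 0" "g (Suc q) = 0"
    "\<And>x. x \<noteq> q \<Longrightarrow> x \<noteq> Suc q \<Longrightarrow> f x = g x"
  shows "ctx g N q"
proof -
  have "map f [0..<q] = map g [0..<q]" "map f [Suc (Suc q)..<N] = map g [Suc (Suc q)..<N]"
    by (auto intro!: assms(4))
  note m = this[symmetric]
  show ?thesis using assms(1-3) up_nonneg[of "map g [0..<q]"]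
    by (auto simp: ctx_def up_snoc upt_conv_Cons m)
qed

definition unm :: "(nat \<Rightarrow> int) \<Rightarrow> nat \<Rightarrow> nat set" where
  "unm f N = {p. p < N \<and> f p = - 1 \<and> up (map f [0..<p]) = 0}"

lemma finite_unm: "finite (unm f N)"
  by (rule finite_subset[of _ "{..<N}"]) (auto simp: unm_def)

lemma up_upt_Suc: "up (map f [0..<Suc p]) = max 0 (up (map f [0..<p]) + f p)"
  by (simp add: up_snoc)

lemma unm_Suc: "unm f (Suc p) = (if f p = - 1 \<and> up (map f [0..<p]) = 0 then insert p (unm f p) else unm f p)"
  by (auto simp: unm_def less_Suc_eq)

lemma card_unm: "(\<And>x. - 1 \<le> f x) \<Longrightarrow> int (card (unm f N)) = dn (map f [0..<N])"
proof -
  assume f: "\<And>x. - 1 \<le> f x"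
  have "up (map f [0..<N]) = sum_list (map f [0..<N]) + int (card (unm f N))"
  proof (induction N)
    case 0
    show ?case by (simp add: unm_def)
  next
    case (Suc p)
    have "p \<notin> unm f p" by (simp add: unm_def)
    then have "int (card (unm f (Suc p))) = int (card (unm f p)) + of_bool (f p = - 1 \<and> up (map f [0..<p]) = 0)"
      by (simp add: unm_Suc finite_unm)
    moreover have "max 0 (up (map f [0..<p]) + f p) = up (map f [0..<p]) + f p + of_bool (f p = - 1 \<and> up (map f [0..<p]) = 0)"
      using up_nonneg[of "map f [0..<p]"] f[of p] by auto
    ultimately show ?case unfolding up_upt_Suc using Suc.IH by simp
  qed
  then show ?thesis by (simp add: up_def)
qed

lemma dn_upt_0_iff: "(dn (map f [0..<N]) = 0) \<longleftrightarrow> (\<forall>k\<le>N. 0 \<le> sum_list (map f [0..<k]))"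
proof (induction N)
  case (Suc N)
  have "dn (map f [0..<Suc N]) = 0 \<longleftrightarrow> dn (map f [0..<N]) = 0 \<and> 0 \<le> sum_list (map f [0..<Suc N])"
    using dn_nonneg[of "map f [0..<N]"] Suc.IH[THEN iffD1, rule_format, of N]
    by (auto simp: dn_append max_def)
  then show ?case unfolding Suc.IH by (auto simp: le_Suc_eq)
qed simp

text \<open>Flipping the unmatched minus signs from right to left: at each moment the next one is the
  position on which the crystal operator acts.\<close>

lemma ctx_unm:
  assumes f: "\<And>x. - 1 \<le> f x" and q: "q \<in> unm f N"
  shows "ctx (\<lambda>x. if x \<in> unm f N \<and> q < x then 1 else f x) N q"
proof -
  let ?g = "\<lambda>x. if x \<in> unm f N \<and> q < x then 1 else f x"
  have "map ?g [0..<q] = map f [0..<q]" by auto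
  then have 1: "up (map ?g [0..<q]) = 0" using q unfolding unm_def by (simp only: mem_Collect_eq)
  have s: "up (map f [0..<b]) \<le> sum_list (map ?g [Suc q..<b])" if "Suc q \<le> b" "b \<le> N" for b
    using that
  proof (induction b rule: dec_induct)
    case base
    show ?case using q by (simp add: unm_def up_snoc)
  next
    case (step b)
    have e: "sum_list (map ?g [Suc q..<Suc b]) = sum_list (map ?g [Suc q..<b]) + ?g b" using step.hyps by simp
    show ?case
    proof (cases "b \<in> unm f N")
      case True
      then show ?thesis unfolding e up_upt_Suc using step by (auto simp: unm_def)
    next
      case False
      then have "max 0 (up (map f [0..<b]) + f b) = up (map f [0..<b]) + f b"
        using f[of b] up_nonneg[of "map f [0..<b]"] step.prems by (auto simp: unm_def)
      then show ?thesis unfolding e up_upt_Suc using step False by simp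
    qed
  qed
  have "dn (map ?g [Suc q..<b]) = 0" if "Suc q \<le> b" "b \<le> N" for b
    using that
  proof (induction b rule: dec_induct)
    case (step b)
    have "0 \<le> sum_list (map ?g [Suc q..<Suc b])"
      using s[of "Suc b"] step up_nonneg[of "map f [0..<Suc b]"] by linarith
    moreover have "0 \<le> sum_list (map ?g [Suc q..<b])"
      using s[of b] step up_nonneg[of "map f [0..<b]"] by linarith
    ultimately show ?case using step by (simp add: dn_append)
  qed simp
  moreover have "q < N" using q by (simp add: unm_def)
  ultimately show ?thesis using 1 by (simp add: ctx_def)
qed

lemma ctx_exists_neg:
  assumes f: "\<And>x. - 1 \<le> f x" and dn: "0 < dn (map f [0..<N])"
  shows "\<exists>q. f q = - 1 \<and> ctx f N q"
proof -
  have "unm f N \<noteq> {}" using card_unm[of f N, OF f] dn by auto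
  then have q: "Max (unm f N) \<in> unm f N" using finite_unm by (rule Max_in[rotated])
  have "\<not> Max (unm f N) < x" if "x \<in> unm f N" for x using Max_ge[OF finite_unm that] by simp
  then have "(\<lambda>x. if x \<in> unm f N \<and> Max (unm f N) < x then 1 else f x) = f" by (intro ext) auto
  then have "ctx f N (Max (unm f N))" using ctx_unm[of f, OF f q] by simp
  then show ?thesis using q by (auto simp: unm_def)
qed

lemma up_rev: "up xs = dn (map uminus (rev xs))"
  by (induction xs rule: rev_induct) (simp_all add: up_snoc)

lemma map_rev_upt:
  assumes "a \<le> b" "b \<le> N"
  shows "map (\<lambda>x. - f (N - Suc x)) [N - b..<N - a] = map uminus (rev (map f [a..<b]))"
  using assms by (intro nth_equalityI) (auto simp: rev_nth intro!: arg_cong[of _ _ f])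

text \<open>Reversing a word and changing its signs exchanges \<open>up\<close> and
  \<open>dn\<close>, so this is the mirror image of \<open>ctx_exists_neg\<close>.\<close>

lemma ctx_exists_pos:
  assumes f: "\<And>x. f x \<le> 1" and up: "0 < up (map f [0..<N])"
  shows "\<exists>q. f q = 1 \<and> ctx f N q"
proof -
  let ?g = "\<lambda>x. - f (N - Suc x)"
  have "0 < dn (map ?g [0..<N])" using up map_rev_upt[of 0 N N f] by (simp add: up_rev)
  then obtain q where q: "?g q = - 1" "ctx ?g N q" using ctx_exists_neg[of ?g N] f by auto
  then have N: "q < N" by (simp add: ctx_def)
  define p where "p = N - Suc q"
  have p: "p < N" "q = N - Suc p" "Suc q = N - p" using N by (auto simp: p_def)
  have "up (map f [0..<p]) = dn (map ?g [Suc q..<N])" using map_rev_upt[of 0 p N f] p by (simp add: up_rev)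
  moreover have "dn (map f [Suc p..<N]) = up (map ?g [0..<q])"
    using map_rev_upt[of "Suc p" N N f] p by (simp add: up_rev rev_map[symmetric] comp_def)
  ultimately have "ctx f N p" using q(2) p(1) by (simp add: ctx_def)
  then show ?thesis using q(1) p_def by auto
qed

text \<open>The signs strictly between \<open>q\<close> and \<open>q'\<close> have sum at most
  \<open>- max 0 (f q)\<close>, since no plus is unmatched before \<open>q'\<close>, and at least
  \<open>max 0 (- f q')\<close>, since no minus is unmatched after \<open>q\<close>. Equal nonzero
  signs at both places contradict this.\<close>

lemma ctx_unique_aux:
  assumes "ctx f N q" "ctx f N q'" "q < q'"
  shows "f q = 1 \<and> f q' = 1 \<Longrightarrow> False" "f q = - 1 \<and> f q' = - 1 \<Longrightarrow> False"
proof -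
  have s: "[0..<q'] = [0..<q] @ q # [Suc q..<q']"
    using assms(3) by (metis less_imp_le_nat upt_add_eq_append upt_conv_Cons le_add_diff_inverse add_0 bot_nat_0.extremum)
  have t: "[Suc q..<N] = [Suc q..<q'] @ q' # [Suc q'..<N]"
    using assms by (metis Suc_leI ctx_def le_add_diff_inverse less_imp_le_nat upt_add_eq_append upt_conv_Cons)
  have "up ((map f [0..<q] @ [f q]) @ map f [Suc q..<q']) = 0"
    using assms(2) s by (simp add: ctx_def)
  then have 1: "max 0 (up (map f [0..<q]) + f q) + sum_list (map f [Suc q..<q']) \<le> 0"
    unfolding up_append[of "map f [0..<q] @ [f q]"] up_snoc by linarith
  have "dn (map f [Suc q..<q'] @ f q' # map f [Suc q'..<N]) = 0"
    using assms(1) t by (simp add: ctx_def)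
  then have "dn (f q' # map f [Suc q'..<N]) \<le> sum_list (map f [Suc q..<q'])"
    unfolding dn_append by linarith
  then have 2: "max 0 (- f q') \<le> sum_list (map f [Suc q..<q'])"
    using assms(2) by (simp add: ctx_def)
  show "f q = 1 \<and> f q' = 1 \<Longrightarrow> False" using 1 2 assms(1) by (auto simp: ctx_def)
  show "f q = - 1 \<and> f q' = - 1 \<Longrightarrow> False" using 1 2 assms(1) by (auto simp: ctx_def)
qed

lemma ctx_unique:
  assumes "ctx f N q" "ctx f N q'" "f q = f q'" "f q = 1 \<or> f q = - 1"
  shows "q = q'"
  using assms ctx_unique_aux[of f N] by (metis nat_neq_iff)

section \<open>Commuting row and column moves on 0/1 matrices\<close>

definition sg :: "bool \<Rightarrow> bool \<Rightarrow> int" where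
  "sg a b = of_bool a - of_bool b"

type_synonym bmat = "nat \<Rightarrow> nat \<Rightarrow> bool"

definition rs :: "bmat \<Rightarrow> nat \<Rightarrow> nat \<Rightarrow> int" where
  "rs V i k = sg (V i k) (V (Suc i) k)"

text \<open>The entries are compared in the opposite order to \<open>rs\<close>; this is what makes
  \<open>dual\<close> exchange the two kinds of signs.\<close>

definition cs :: "bmat \<Rightarrow> nat \<Rightarrow> nat \<Rightarrow> int" where
  "cs V k t = sg (V t (Suc k)) (V t k)"

text \<open>Written as an exchange of two entries, so that the move is its own inverse and covers
  raising and lowering alike.\<close>

definition rmv :: "nat \<Rightarrow> nat \<Rightarrow> bmat \<Rightarrow> bmat" where
  "rmv i q V = (\<lambda>a b. if b = q then (if a = i then V (Suc i) q else if a = Suc i then V i q else V a b) else V a b)"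

definition cmv :: "nat \<Rightarrow> nat \<Rightarrow> bmat \<Rightarrow> bmat" where
  "cmv k t V = (\<lambda>a b. if a = t then (if b = k then V t (Suc k) else if b = Suc k then V t k else V a b) else V a b)"

definition rowstep :: "nat \<Rightarrow> nat \<Rightarrow> nat \<Rightarrow> bmat \<Rightarrow> bmat \<Rightarrow> bool" where
  "rowstep R K i V W \<longleftrightarrow> Suc i < R \<and> (\<exists>q. ctx (rs V i) K q \<and> \<not> V i q \<and> V (Suc i) q \<and> W = rmv i q V)"

definition colstep :: "nat \<Rightarrow> nat \<Rightarrow> nat \<Rightarrow> bmat \<Rightarrow> bmat \<Rightarrow> bool" where
  "colstep R K k V W \<longleftrightarrow> Suc k < K \<and> (\<exists>t. ctx (cs V k) R t \<and> V t (Suc k) \<and> \<not> V t k \<and> W = cmv k t V)"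

lemma rmv_rmv [simp]: "rmv i q (rmv i q V) = V"
  by (auto simp: rmv_def fun_eq_iff)

lemma cmv_cmv [simp]: "cmv k t (cmv k t V) = V"
  by (auto simp: cmv_def fun_eq_iff)

lemma ctx_rs_rmv: "ctx (rs (rmv i q V) i) K q = ctx (rs V i) K q"
  by (rule ctx_cong) (auto simp: rs_def rmv_def)

lemma ctx_cs_cmv: "ctx (cs (cmv k t V) k) R t = ctx (cs V k) R t"
  by (rule ctx_cong) (auto simp: cs_def cmv_def)

lemma rs_cmv_sum: "rs (cmv k t V) i k + rs (cmv k t V) i (Suc k) = rs V i k + rs V i (Suc k)"
  by (auto simp: rs_def cmv_def sg_def)

text \<open>Only \<open>t = i\<close> and \<open>t = Suc i\<close> matter. There the context of
  \<open>t\<close> restricts the sign of the other row of the 2x2 block, which excludes the blocks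
  in which the matching would change.\<close>

lemma rs_cmv_dn:
  assumes "ctx (cs V k) R t" "V t k \<noteq> V t (Suc k)" "Suc i < R"
  shows "dn [rs (cmv k t V) i k, rs (cmv k t V) i (Suc k)] = dn [rs V i k, rs V i (Suc k)]"
proof -
  consider "t = i" | "t = Suc i" | "t \<noteq> i" "t \<noteq> Suc i" by blast
  then show ?thesis
  proof cases
    case 1
    then have "0 \<le> cs V k (Suc i)" using ctx_Suc assms by blast
    then show ?thesis using assms(2) 1
      by (cases "V i k"; cases "V i (Suc k)"; cases "V (Suc i) k"; cases "V (Suc i) (Suc k)")
        (auto simp: rs_def cs_def cmv_def sg_def)
  next
    case 2
    then have "cs V k i \<le> 0" using ctx_pred assms by blast
    then show ?thesis using assms(2) 2
      by (cases "V i k"; cases "V i (Suc k)"; cases "V (Suc i) k"; cases "V (Suc i) (Suc k)")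
        (auto simp: rs_def cs_def cmv_def sg_def)
  qed (simp add: rs_def cmv_def)
qed

text \<open>Transposing and complementing a matrix exchanges the two kinds of moves.\<close>

definition dual :: "bmat \<Rightarrow> bmat" where
  "dual V = (\<lambda>a b. \<not> V b a)"

lemma dual_simps: "rs (dual V) k = cs V k" "cs (dual V) i = rs V i" "cmv i q (dual V) = dual (rmv i q V)"
  by (auto simp: rs_def cs_def sg_def dual_def cmv_def rmv_def fun_eq_iff)

lemma ctx_rs_cmv:
  assumes "ctx (cs V k) R t" "V t k \<noteq> V t (Suc k)" "Suc i < R" "Suc k < K"
    "q \<noteq> k \<and> q \<noteq> Suc k \<or> t \<noteq> i \<and> t \<noteq> Suc i"
  shows "ctx (rs (cmv k t V) i) K q = ctx (rs V i) K q"
proof (cases "t \<noteq> i \<and> t \<noteq> Suc i")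
  case True
  then show ?thesis by (intro ctx_cong) (simp add: rs_def cmv_def)
next
  case False
  then have q: "q \<noteq> k" "q \<noteq> Suc k" using assms(5) by auto
  have "ctx (rs V i) K q" if "ctx (rs (cmv k t V) i) K q"
    by (rule ctx_pair[OF _ rs_cmv_sum rs_cmv_dn[OF assms(1-3)] q assms(4) that])
      (simp add: rs_def cmv_def)
  moreover have "ctx (rs (cmv k t V) i) K q" if "ctx (rs V i) K q"
    by (rule ctx_pair[OF _ rs_cmv_sum[symmetric] rs_cmv_dn[OF assms(1-3), symmetric] q assms(4) that])
      (simp add: rs_def cmv_def)
  ultimately show ?thesis by blast
qed

lemma ctx_cs_rmv:
  assumes "ctx (rs V i) K q" "V i q \<noteq> V (Suc i) q" "Suc i < R" "Suc k < K"
    "q \<noteq> k \<and> q \<noteq> Suc k \<or> t \<noteq> i \<and> t \<noteq> Suc i"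
  shows "ctx (cs (rmv i q V) k) R t = ctx (cs V k) R t"
  using ctx_rs_cmv[of "dual V" i K q k R t] assms by (auto simp: dual_simps) (auto simp: dual_def)

lemma cmv_rmv_commute:
  "q \<noteq> k \<and> q \<noteq> Suc k \<or> t \<noteq> i \<and> t \<noteq> Suc i \<Longrightarrow> cmv k t (rmv i q V) = rmv i q (cmv k t V)"
  by (auto simp: cmv_def rmv_def fun_eq_iff)

lemma cmv_entries:
  "q \<noteq> k \<and> q \<noteq> Suc k \<or> t \<noteq> i \<and> t \<noteq> Suc i \<Longrightarrow> cmv k t V i q = V i q \<and> cmv k t V (Suc i) q = V (Suc i) q"
  "q \<noteq> k \<and> q \<noteq> Suc k \<or> t \<noteq> i \<and> t \<noteq> Suc i \<Longrightarrow> rmv i q V t k = V t k \<and> rmv i q V t (Suc k) = V t (Suc k)"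
  by (auto simp: cmv_def rmv_def)

lemma ctx_shift:
  assumes "ctx f N a" "b = Suc a \<and> b < N \<or> a = Suc b" "f b = 0" "g a = 0"
    "\<And>x. x \<noteq> a \<Longrightarrow> x \<noteq> b \<Longrightarrow> f x = g x"
  shows "ctx g N b"
  using assms ctx_shift_up[of f N a g] ctx_shift_down[of f N b g] by (elim disjE) simp_all

lemma ctx_opposite_zero:
  assumes "Suc a < N" "ctx f N b" "b = a \<or> b = Suc a"
  shows "b = a \<Longrightarrow> 0 \<le> f (Suc a)" "b = Suc a \<Longrightarrow> f a \<le> 0"
  using assms ctx_Suc ctx_pred by auto

text \<open>The letters next to an active position cannot have the sign that would move it
  (\<open>ctx_Suc\<close>, \<open>ctx_pred\<close>); when both moves meet in one 2x2 block this
  leaves few fillings.\<close>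

lemma block_corner:
  assumes "Suc k < K" "Suc i < R" "ctx (rs V i) K q" "ctx (cs V k) R t"
    "q = k \<or> q = Suc k" "t = i \<or> t = Suc i"
  shows "q = k \<Longrightarrow> V (Suc i) (Suc k) \<Longrightarrow> V i (Suc k)" "q = Suc k \<Longrightarrow> V i k \<Longrightarrow> V (Suc i) k"
    "t = i \<Longrightarrow> V (Suc i) k \<Longrightarrow> V (Suc i) (Suc k)" "t = Suc i \<Longrightarrow> V i (Suc k) \<Longrightarrow> V i k"
  using ctx_opposite_zero[OF assms(1,3,5)] ctx_opposite_zero[OF assms(2,4,6)]
  by (cases "V i k"; cases "V (Suc i) k"; cases "V i (Suc k)"; cases "V (Suc i) (Suc k)"; simp add: rs_def cs_def sg_def)+

text \<open>Inside the two by two block both moves change position, but only in configurations where the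
  two sign words are shifted by one neutral letter.\<close>

lemma block_shift:
  assumes b: "Suc k < K" "Suc i < R" and r: "ctx (rs V i) K q" and c: "ctx (cs V k) R t"
    and q: "q = k \<and> q' = Suc k \<or> q = Suc k \<and> q' = k" and t: "t = i \<and> t' = Suc i \<or> t = Suc i \<and> t' = i"
    and z: "V i q' = V (Suc i) q'" "V t' k = V t' (Suc k)"
    and zr: "V t q' \<noteq> V t q" "V t' q \<noteq> V t q"
  shows "ctx (rs (cmv k t V) i) K q'" "ctx (cs (rmv i q V) k) R t'"
    "cmv k t' (rmv i q V) = rmv i q' (cmv k t V)"
proof -
  show "ctx (rs (cmv k t V) i) K q'"
    by (rule ctx_shift[OF r]) (use b q t z zr in \<open>auto simp: rs_def cmv_def sg_def\<close>)
  show "ctx (cs (rmv i q V) k) R t'"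
    by (rule ctx_shift[OF c]) (use b q t z zr in \<open>auto simp: cs_def rmv_def sg_def\<close>)
  show "cmv k t' (rmv i q V) = rmv i q' (cmv k t V)"
    using q t z zr
    by (elim disjE conjE; intro ext; hypsubst; cases "V i k"; cases "V (Suc i) k"; cases "V i (Suc k)"; cases "V (Suc i) (Suc k)")
      (simp_all add: cmv_def rmv_def)
qed

text \<open>The hypotheses only say that the exchanged entries differ, not which of them is present.
  So raising and lowering are treated at once in both directions, and the four commutation rules are
  instances.\<close>

lemma moves_commute:
  assumes q: "Suc i < R" "ctx (rs V i) K q" "V (Suc i) q \<longleftrightarrow> \<not> V i q"
    and t: "Suc k < K" "ctx (cs V k) R t" "V t (Suc k) \<longleftrightarrow> \<not> V t k"
  shows "\<exists>q' t'. ctx (rs (cmv k t V) i) K q' \<and> cmv k t V i q' = V i q \<and> cmv k t V (Suc i) q' = V (Suc i) q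
    \<and> ctx (cs (rmv i q V) k) R t' \<and> rmv i q V t' k = V t k \<and> rmv i q V t' (Suc k) = V t (Suc k)
    \<and> cmv k t' (rmv i q V) = rmv i q' (cmv k t V)"
proof (cases "q \<noteq> k \<and> q \<noteq> Suc k \<or> t \<noteq> i \<and> t \<noteq> Suc i")
  case True
  then show ?thesis
    using q t cmv_entries[OF True, of V] ctx_rs_cmv[OF t(2) _ q(1) t(1) True] ctx_cs_rmv[OF q(2) _ q(1) t(1) True]
      cmv_rmv_commute[OF True, of V] by (intro exI[of _ q] exI[of _ t]) simp
next
  case False
  then have qt: "q = k \<or> q = Suc k" "t = i \<or> t = Suc i" by auto
  note bc = block_corner[OF t(1) q(1) q(2) t(2) qt]
  \<comment> \<open>Both moves lie in the same 2x2 block; after one of them the other acts in the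
    opposite column or row.\<close>
  define q' where "q' = (if q = k then Suc k else k)"
  define t' where "t' = (if t = i then Suc i else i)"
  have qt': "q = k \<and> q' = Suc k \<or> q = Suc k \<and> q' = k" "t = i \<and> t' = Suc i \<or> t = Suc i \<and> t' = i"
    using qt by (auto simp: q'_def t'_def)
  have z: "V i q' = V (Suc i) q'" "V t' k = V t' (Suc k)" "V t q' \<noteq> V t q" "V t' q \<noteq> V t q"
    using qt' bc q(3) t(3) by auto
  note bs = block_shift[OF t(1) q(1) q(2) t(2) qt' z]
  have "cmv k t V i q' = V i q" "cmv k t V (Suc i) q' = V (Suc i) q" "rmv i q V t' k = V t k" "rmv i q V t' (Suc k) = V t (Suc k)"
    using qt' z q(3) t(3) by (elim disjE conjE; auto simp: cmv_def rmv_def)+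
  then show ?thesis using bs by blast
qed

text \<open>An exchange keeps \<open>ctx\<close>, so a step read backwards has the same form with
  the two entries interchanged; in this form it fits \<open>moves_commute\<close>.\<close>

lemma rowstep_back_iff: "rowstep R K i W V \<longleftrightarrow> Suc i < R \<and> (\<exists>q. ctx (rs V i) K q \<and> V i q \<and> \<not> V (Suc i) q \<and> W = rmv i q V)"
proof -
  have "(\<not> rmv i q V i q) = (\<not> V (Suc i) q)" "rmv i q V (Suc i) q = V i q" for q V by (simp_all add: rmv_def)
  then show ?thesis unfolding rowstep_def by (metis ctx_rs_rmv rmv_rmv)
qed

lemma colstep_back_iff: "colstep R K k W V \<longleftrightarrow> Suc k < K \<and> (\<exists>t. ctx (cs V k) R t \<and> V t k \<and> \<not> V t (Suc k) \<and> W = cmv k t V)"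
proof -
  have "(\<not> cmv k t V t k) = (\<not> V t (Suc k))" "cmv k t V t (Suc k) = V t k" for t V by (simp_all add: cmv_def)
  then show ?thesis unfolding colstep_def by (metis ctx_cs_cmv cmv_cmv)
qed

lemma row_col_commute: "rowstep R K i V W \<Longrightarrow> colstep R K k V V2 \<Longrightarrow> \<exists>W2. rowstep R K i V2 W2 \<and> colstep R K k W W2"
  and row_col_commute_inv_col: "rowstep R K i V W \<Longrightarrow> colstep R K k V2 V \<Longrightarrow> \<exists>W2. rowstep R K i V2 W2 \<and> colstep R K k W2 W"
  and row_col_commute_inv_row: "rowstep R K i W V \<Longrightarrow> colstep R K k V V2 \<Longrightarrow> \<exists>W2. rowstep R K i W2 V2 \<and> colstep R K k W W2"
  and row_col_commute_inv_both: "rowstep R K i W V \<Longrightarrow> colstep R K k V2 V \<Longrightarrow> \<exists>W2. rowstep R K i W2 V2 \<and> colstep R K k W2 W"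
proof -
  show "\<exists>W2. rowstep R K i V2 W2 \<and> colstep R K k W W2" if "rowstep R K i V W" "colstep R K k V V2"
    using that moves_commute[of i R V K _ k] unfolding rowstep_def colstep_def by metis
  show "\<exists>W2. rowstep R K i V2 W2 \<and> colstep R K k W2 W" if "rowstep R K i V W" "colstep R K k V2 V"
    using that moves_commute[of i R V K _ k] unfolding rowstep_def colstep_back_iff by metis
  show "\<exists>W2. rowstep R K i W2 V2 \<and> colstep R K k W W2" if "rowstep R K i W V" "colstep R K k V V2"
    using that moves_commute[of i R V K _ k] unfolding rowstep_back_iff colstep_def by metis
  show "\<exists>W2. rowstep R K i W2 V2 \<and> colstep R K k W2 W" if "rowstep R K i W V" "colstep R K k V2 V"
    using that moves_commute[of i R V K _ k] unfolding rowstep_back_iff colstep_back_iff by metis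
qed

lemma rs_neg_iff: "rs V i q = - 1 \<longleftrightarrow> \<not> V i q \<and> V (Suc i) q"
  and cs_pos_iff: "cs V k t = 1 \<longleftrightarrow> V t (Suc k) \<and> \<not> V t k"
  by (auto simp: rs_def cs_def sg_def of_bool_def)

lemma rowstep_det: "rowstep R K i V W \<Longrightarrow> rowstep R K i V W' \<Longrightarrow> W = W'"
  unfolding rowstep_def by (metis ctx_unique rs_neg_iff)

lemma colstep_inj:
  assumes "colstep R K k V W" "colstep R K k V' W"
  shows "V = V'"
proof -
  obtain t where t: "ctx (cs V k) R t" "V t (Suc k)" "\<not> V t k" "W = cmv k t V"
    using assms by (auto simp: colstep_def)
  obtain t' where t': "ctx (cs V' k) R t'" "V' t' (Suc k)" "\<not> V' t' k" "W = cmv k t' V'"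
    using assms by (auto simp: colstep_def)
  have "ctx (cs W k) R t" "ctx (cs W k) R t'"
    using t(1) t'(1) by (metis t(4) ctx_cs_cmv, metis t'(4) ctx_cs_cmv)
  moreover have "cs W k t = - 1" using t by (simp add: cs_def cmv_def sg_def)
  moreover have "cs W k t' = - 1" using t' by (simp add: cs_def cmv_def sg_def)
  ultimately have "t = t'" using ctx_unique by metis
  then show ?thesis using t(4) t'(4) by (metis cmv_cmv)
qed

section \<open>Highest weight matrices and their uniqueness\<close>

definition row_high :: "nat \<Rightarrow> nat \<Rightarrow> bmat \<Rightarrow> bool" where
  "row_high R K V \<longleftrightarrow> (\<forall>i W. \<not> rowstep R K i V W)"

definition col_high :: "nat \<Rightarrow> nat \<Rightarrow> bmat \<Rightarrow> bool" where
  "col_high R K V \<longleftrightarrow> (\<forall>k W. \<not> colstep R K k V W)"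

definition mat_bd :: "nat \<Rightarrow> nat \<Rightarrow> bmat \<Rightarrow> bool" where
  "mat_bd R K V \<longleftrightarrow> (\<forall>i k. V i k \<longrightarrow> i < R \<and> k < K)"

definition rowconn :: "nat \<Rightarrow> nat \<Rightarrow> bmat \<Rightarrow> bmat \<Rightarrow> bool" where
  "rowconn R K = (\<lambda>V W. \<exists>i. rowstep R K i V W \<or> rowstep R K i W V)\<^sup>*\<^sup>*"

definition colconn :: "nat \<Rightarrow> nat \<Rightarrow> bmat \<Rightarrow> bmat \<Rightarrow> bool" where
  "colconn R K = (\<lambda>V W. \<exists>k. colstep R K k V W \<or> colstep R K k W V)\<^sup>*\<^sup>*"

definition rowsum :: "nat \<Rightarrow> bmat \<Rightarrow> nat \<Rightarrow> nat" where
  "rowsum K V i = (\<Sum>k<K. of_bool (V i k))"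

definition colsum :: "nat \<Rightarrow> bmat \<Rightarrow> nat \<Rightarrow> nat" where
  "colsum R V k = (\<Sum>i<R. of_bool (V i k))"

lemma sum_transpose_Suc:
  fixes f :: "nat \<Rightarrow> nat"
  assumes "Suc k < K"
  shows "(\<Sum>x<K. f (if x = k then Suc k else if x = Suc k then k else x)) = (\<Sum>x<K. f x)"
proof -
  have "transpose k (Suc k) permutes {..<K}" using assms by (intro permutes_swap_id) auto
  from sum.permute[OF this, of f] show ?thesis
    by (simp add: comp_def transpose_def)
qed

lemma rowsum_colstep: "colstep R K k V W \<Longrightarrow> rowsum K W = rowsum K V"
proof
  fix i assume "colstep R K k V W"
  then obtain t where t: "Suc k < K" "W = cmv k t V" by (auto simp: colstep_def)
  show "rowsum K W i = rowsum K V i"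
  proof (cases "i = t")
    case True
    have "rowsum K W i = (\<Sum>x<K. of_bool (V i (if x = k then Suc k else if x = Suc k then k else x)))"
      unfolding rowsum_def t(2) using True by (intro sum.cong) (auto simp: cmv_def)
    then show ?thesis using sum_transpose_Suc[OF t(1), of "\<lambda>x. of_bool (V i x)"] unfolding rowsum_def by (rule trans)
  qed (simp add: rowsum_def t(2) cmv_def)
qed

lemma colsum_rowstep: "rowstep R K i V W \<Longrightarrow> colsum R W = colsum R V"
proof
  fix k assume "rowstep R K i V W"
  then obtain q where q: "Suc i < R" "W = rmv i q V" by (auto simp: rowstep_def)
  show "colsum R W k = colsum R V k"
  proof (cases "k = q")
    case True
    have "colsum R W k = (\<Sum>x<R. of_bool (V (if x = i then Suc i else if x = Suc i then i else x) k))"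
      unfolding colsum_def q(2) using True by (intro sum.cong) (auto simp: rmv_def)
    then show ?thesis using sum_transpose_Suc[OF q(1), of "\<lambda>x. of_bool (V x k)"] unfolding colsum_def by (rule trans)
  qed (simp add: colsum_def q(2) rmv_def)
qed

lemma rowsum_colconn: "colconn R K V W \<Longrightarrow> rowsum K W = rowsum K V"
  unfolding colconn_def by (induction rule: rtranclp_induct) (auto simp: rowsum_colstep)

lemma colsum_rowconn: "rowconn R K V W \<Longrightarrow> colsum R W = colsum R V"
  unfolding rowconn_def by (induction rule: rtranclp_induct) (auto simp: colsum_rowstep)

lemma mat_bd_colstep: "colstep R K k V W \<Longrightarrow> mat_bd R K V \<Longrightarrow> mat_bd R K W"
  unfolding colstep_def ctx_def mat_bd_def cmv_def by (elim conjE exE) (auto split: if_splits dest: Suc_lessD)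

lemma mat_bd_rowstep:
  assumes "rowstep R K i V W \<or> rowstep R K i W V" "mat_bd R K V"
  shows "mat_bd R K W"
proof -
  have "mat_bd R K (rmv i q V)" if "mat_bd R K V" "q < K" "Suc i < R" for q and V
    using that by (auto simp: mat_bd_def rmv_def)
  then show ?thesis using assms unfolding rowstep_def ctx_def by (metis rmv_rmv)
qed

lemma mat_bd_rowconn: "rowconn R K V W \<Longrightarrow> mat_bd R K V \<Longrightarrow> mat_bd R K W"
  unfolding rowconn_def by (induction rule: rtranclp_induct) (auto dest: mat_bd_rowstep[rotated])

lemma rs_ge: "- 1 \<le> rs V i k" and cs_le: "cs V k t \<le> 1"
  by (auto simp: rs_def cs_def sg_def)

lemma row_high_dn:
  assumes "row_high R K V" "Suc i < R"
  shows "dn (map (rs V i) [0..<K]) = 0"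
proof (rule ccontr)
  assume "\<not> ?thesis"
  then have "0 < dn (map (rs V i) [0..<K])" using dn_nonneg[of "map (rs V i) [0..<K]"] by linarith
  then obtain q where "rs V i q = - 1" "ctx (rs V i) K q" using ctx_exists_neg rs_ge by blast
  then have "rowstep R K i V (rmv i q V)" using assms(2) unfolding rowstep_def rs_neg_iff by blast
  then show False using assms(1) by (auto simp: row_high_def)
qed

lemma col_high_up:
  assumes "col_high R K V" "Suc k < K"
  shows "up (map (cs V k) [0..<R]) = 0"
proof (rule ccontr)
  assume "\<not> ?thesis"
  then have "0 < up (map (cs V k) [0..<R])" using up_nonneg[of "map (cs V k) [0..<R]"] by linarith
  then obtain q where "cs V k q = 1" "ctx (cs V k) R q" using ctx_exists_pos cs_le by blast
  then have "colstep R K k V (cmv k q V)" using assms(2) unfolding colstep_def cs_pos_iff by blast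
  then show False using assms(1) by (auto simp: col_high_def)
qed

lemma upt_append_split: "a \<le> b \<Longrightarrow> b \<le> c \<Longrightarrow> [a..<c] = [a..<b] @ [b..<c]"
  by (metis le_add_diff_inverse upt_add_eq_append)

lemma dn_0_prefix:
  assumes "dn (map f [0..<K]) = 0" "k \<le> K"
  shows "0 \<le> (\<Sum>x<k. f x)"
proof -
  have "dn (map f [0..<k]) = 0"
    using dn_append_0[of "map f [0..<k]" "map f [k..<K]"] assms upt_append_split[of 0 k K] by simp
  then have "0 \<le> sum_list (map f [0..<k])" using up_nonneg[of "map f [0..<k]"] by (simp add: up_def)
  then show ?thesis by (simp add: interv_sum_list_conv_sum_set_nat atLeast0LessThan)
qed

lemma up_0_suffix:
  assumes "up (map f [0..<K]) = 0" "k \<le> K"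
  shows "(\<Sum>x=k..<K. f x) \<le> 0"
proof -
  have "up (map f [k..<K]) = 0"
    using up_append_0[of "map f [0..<k]" "map f [k..<K]"] assms upt_append_split[of 0 k K] by simp
  then have "sum_list (map f [k..<K]) \<le> 0" using dn_nonneg[of "map f [k..<K]"] by (simp add: up_def)
  then show ?thesis by (simp add: interv_sum_list_conv_sum_set_nat)
qed

text \<open>Without unmatched plus in \<open>cs\<close>, a column has from any row downwards at most
  as many entries as its left neighbour, so by induction everything to the left is filled. The
  prefix sum of \<open>rs\<close> up to \<open>k\<close>, which is nonnegative, then reduces to its
  last term. Such a matrix is a Young diagram.\<close>

lemma doubly_high_closed:
  assumes "row_high R K V" "col_high R K V" "mat_bd R K V" "V i k" "i' \<le> i" "k' \<le> k"
  shows "V i' k'"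
  using assms(4-6)
proof (induction k arbitrary: i i' k' rule: less_induct)
  case (less k s)
  have sk: "s < R" "k < K" using less.prems(1) assms(3) by (auto simp: mat_bd_def)
  have left: "V a b" if "a \<le> s" "b < k" for a b
  proof -
    from that(2) obtain l where l: "k = Suc l" by (cases k) auto
    have "(\<Sum>x=s..<R. cs V l x) \<le> 0"
      using up_0_suffix[OF col_high_up[OF assms(2)]] l sk by auto
    then have "(\<Sum>x=s..<R. of_bool (V x k)) \<le> (\<Sum>x=s..<R. of_bool (V x l) :: int)"
      by (simp add: cs_def sg_def sum_subtractf l)
    moreover have "(0::int) < (\<Sum>x=s..<R. of_bool (V x k))"
      using sk less.prems(1) by (intro sum_pos2[of _ s]) auto
    ultimately have "(\<Sum>x=s..<R. of_bool (V x l) :: int) \<noteq> 0" by linarith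
    then obtain x where "x \<in> {s..<R}" "of_bool (V x l) \<noteq> (0::int)" by (rule sum.not_neutral_contains_not_neutral)
    then have "V x l" "s \<le> x" by auto
    then show ?thesis using less.IH[of l x a b] that l by auto
  qed
  have "V a k" if "a \<le> s" for a
    using that
  proof (induction a rule: inc_induct)
    case (step a)
    have "0 \<le> (\<Sum>x<Suc k. rs V a x)"
      by (rule dn_0_prefix[OF row_high_dn[OF assms(1)]]) (use step sk in auto)
    moreover have "(\<Sum>x<k. rs V a x) = 0"
      by (rule sum.neutral) (use left step in \<open>auto simp: rs_def sg_def\<close>)
    ultimately show ?case using step by (auto simp: rs_def sg_def split: if_splits)
  qed (use less.prems in simp)
  then show ?case using left less.prems by (cases "k' = k") auto
qed

lemma card_initial:
  assumes fin: "finite {j. P j}" and down: "\<And>i j. P j \<Longrightarrow> i \<le> j \<Longrightarrow> P i"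
  shows "k < card {j. P j} \<longleftrightarrow> P (k::nat)"
proof
  assume "P k"
  then have "{..k} \<subseteq> {j. P j}" using down by auto
  then have "card {..k} \<le> card {j. P j}" using fin by (rule card_mono[rotated])
  then show "k < card {j. P j}" by simp
next
  assume a: "k < card {j. P j}"
  show "P k"
  proof (rule ccontr)
    assume "\<not> P k"
    then have "{j. P j} \<subseteq> {..<k}" using down by (auto simp: not_less[symmetric])
    then have "card {j. P j} \<le> card {..<k}" by (intro card_mono) auto
    then show False using a by simp
  qed
qed

lemma initial_segment_card:
  assumes "\<And>x y. P x \<Longrightarrow> y \<le> x \<Longrightarrow> P y" "\<And>x. P x \<Longrightarrow> x < (K::nat)"
  shows "P x \<longleftrightarrow> x < (\<Sum>x<K. of_bool (P x))"
proof -
  have "{x. x < K \<and> P x} = {x. P x}" using assms(2) by auto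
  then have s: "(\<Sum>x<K. of_bool (P x)) = card {x. P x}"
    by (simp add: of_bool_def sum.If_cases lessThan_def Collect_conj_eq)
  have "finite {x. P x}" by (rule finite_subset[of _ "{..<K}"]) (use assms(2) in auto)
  then show ?thesis unfolding s using card_initial[of P x] assms(1) by blast
qed

text \<open>By \<open>doubly_high_closed\<close> these are Young diagrams, which either the row
  lengths or the column lengths recover.\<close>

lemma doubly_high_unique:
  assumes "row_high R K V" "col_high R K V" "mat_bd R K V"
    "row_high R K W" "col_high R K W" "mat_bd R K W"
    "rowsum K V = rowsum K W \<or> colsum R V = colsum R W"
  shows "V = W"
proof -
  have r: "V i k \<longleftrightarrow> k < rowsum K V i" "V i k \<longleftrightarrow> i < colsum R V k"
    if "row_high R K V" "col_high R K V" "mat_bd R K V" for V i k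
  proof -
    show "V i k \<longleftrightarrow> k < rowsum K V i" unfolding rowsum_def
      by (rule initial_segment_card) (use doubly_high_closed[OF that] that(3) in \<open>unfold mat_bd_def, blast+\<close>)
    show "V i k \<longleftrightarrow> i < colsum R V k" unfolding colsum_def
      by (rule initial_segment_card[of "\<lambda>i. V i k"])
        (use doubly_high_closed[OF that] that(3) in \<open>unfold mat_bd_def, blast+\<close>)
  qed
  show ?thesis
  proof (intro ext)
    fix i k
    from assms(7) show "V i k = W i k"
    proof
      assume "rowsum K V = rowsum K W"
      then show ?thesis using r(1)[OF assms(1-3), of i k] r(1)[OF assms(4-6), of i k] by presburger
    next
      assume "colsum R V = colsum R W"
      then show ?thesis using r(2)[OF assms(1-3), of i k] r(2)[OF assms(4-6), of i k] by presburger
    qed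
  qed
qed

text \<open>A column step carries one entry to a smaller column index, so this is a termination
  measure.\<close>

definition mat_weight :: "nat \<Rightarrow> nat \<Rightarrow> bmat \<Rightarrow> nat" where
  "mat_weight R K V = sum snd {(i, k). i < R \<and> k < K \<and> V i k}"

lemma mat_weight_colstep:
  assumes "colstep R K k V W"
  shows "mat_weight R K W < mat_weight R K V"
proof -
  obtain t where t: "Suc k < K" "t < R" "V t (Suc k)" "\<not> V t k" "W = cmv k t V"
    using assms by (auto simp: colstep_def ctx_def)
  define S where "S = {(i, k). i < R \<and> k < K \<and> V i k} - {(t, Suc k)}"
  have fin: "finite S" unfolding S_def by (rule finite_subset[of _ "{..<R} \<times> {..<K}"]) auto
  have 1: "{(i, k). i < R \<and> k < K \<and> V i k} = insert (t, Suc k) S" "(t, Suc k) \<notin> S"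
    using t by (auto simp: S_def)
  have 2: "{(i, k). i < R \<and> k < K \<and> W i k} = insert (t, k) S" "(t, k) \<notin> S"
    using t by (auto simp: S_def cmv_def split: if_splits)
  show ?thesis unfolding mat_weight_def 1(1) 2(1) using fin 1(2) 2(2) by simp
qed

lemma rowconn_sym: "rowconn R K V W \<Longrightarrow> rowconn R K W V"
  unfolding rowconn_def by (rule sympD[OF symp_rtranclp]) (auto intro: sympI)

lemma colconn_sym: "colconn R K V W \<Longrightarrow> colconn R K W V"
  unfolding colconn_def by (rule sympD[OF symp_rtranclp]) (auto intro: sympI)

lemma colconn_trans: "colconn R K V W \<Longrightarrow> colconn R K W X \<Longrightarrow> colconn R K V X"
  unfolding colconn_def by (rule rtranclp_trans)

lemma rowconn_trans: "rowconn R K V W \<Longrightarrow> rowconn R K W X \<Longrightarrow> rowconn R K V X"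
  unfolding rowconn_def by (rule rtranclp_trans)

lemma rowconn_step: "rowstep R K i V W \<Longrightarrow> rowconn R K V W"
  unfolding rowconn_def by blast

lemma colstep_along_rowconn:
  assumes "rowconn R K V W" "colstep R K k V V2"
  shows "\<exists>W2. colstep R K k W W2 \<and> rowconn R K V2 W2"
  using assms unfolding rowconn_def
proof (induction rule: rtranclp_induct)
  case (step X Y)
  then obtain X2 where X2: "colstep R K k X X2" "rowconn R K V2 X2" unfolding rowconn_def by blast
  obtain i where "rowstep R K i X Y \<or> rowstep R K i Y X" using step by blast
  then obtain Y2 where "colstep R K k Y Y2" "rowstep R K i X2 Y2 \<or> rowstep R K i Y2 X2"
    using row_col_commute row_col_commute_inv_row X2(1) by metis
  moreover from this(2) have "rowconn R K V2 Y2"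
    using X2(2) unfolding rowconn_def by (elim rtranclp.rtrancl_into_rtrancl) blast
  ultimately show ?case unfolding rowconn_def by blast
qed blast

lemma rowstep_along_colconn:
  assumes "colconn R K V W" "rowstep R K i V V2"
  shows "\<exists>W2. rowstep R K i W W2 \<and> colconn R K V2 W2"
  using assms unfolding colconn_def
proof (induction rule: rtranclp_induct)
  case (step X Y)
  then obtain X2 where X2: "rowstep R K i X X2" "colconn R K V2 X2" unfolding colconn_def by blast
  obtain k where "colstep R K k X Y \<or> colstep R K k Y X" using step by blast
  then obtain Y2 where "rowstep R K i Y Y2" "colstep R K k X2 Y2 \<or> colstep R K k Y2 X2"
    using row_col_commute row_col_commute_inv_col X2(1) by metis
  moreover from this(2) have "colconn R K V2 Y2"
    using X2(2) unfolding colconn_def by (elim rtranclp.rtrancl_into_rtrancl) blast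
  ultimately show ?case unfolding colconn_def by blast
qed blast

lemma row_high_colconn: "colconn R K V W \<Longrightarrow> row_high R K V \<Longrightarrow> row_high R K W"
  using rowstep_along_colconn colconn_sym unfolding row_high_def by blast

lemma col_high_rowconn: "rowconn R K V W \<Longrightarrow> col_high R K V \<Longrightarrow> col_high R K W"
  using colstep_along_rowconn rowconn_sym unfolding col_high_def by blast

text \<open>Column steps commute with row moves, so \<open>V\<close> and \<open>W\<close> can be
  pushed along the same column steps until both are highest for columns too. There the column sums,
  constant under row moves, determine the matrix; column steps are injective, which leads
  back.\<close>

theorem row_high_rowconn_unique:
  assumes "rowconn R K V W" "row_high R K V" "row_high R K W" "mat_bd R K V"
  shows "V = W"
  using assms
proof (induction "mat_weight R K V" arbitrary: V W rule: less_induct)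
  case less
  show ?case
  proof (cases "col_high R K V")
    case True
    then show ?thesis
      using doubly_high_unique less.prems col_high_rowconn mat_bd_rowconn colsum_rowconn by metis
  next
    case False
    then obtain k V2 where V2: "colstep R K k V V2" by (auto simp: col_high_def)
    then obtain W2 where W2: "colstep R K k W W2" "rowconn R K V2 W2"
      using colstep_along_rowconn less.prems(1) by blast
    have "colconn R K V V2" "colconn R K W W2" using V2 W2(1) unfolding colconn_def by blast+
    then have "V2 = W2"
      using less.hyps[OF mat_weight_colstep[OF V2] W2(2)] less.prems(2-4) row_high_colconn mat_bd_colstep[OF V2] by blast
    then show ?thesis using colstep_inj V2 W2(1) by blast
  qed
qed

lemma colconn_to_col_high: "\<exists>W. colconn R K V W \<and> col_high R K W \<and> (mat_bd R K V \<longrightarrow> mat_bd R K W)"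
proof (induction "mat_weight R K V" arbitrary: V rule: less_induct)
  case less
  show ?case
  proof (cases "col_high R K V")
    case True
    then show ?thesis unfolding colconn_def by blast
  next
    case False
    then obtain k V2 where V2: "colstep R K k V V2" by (auto simp: col_high_def)
    then have "colconn R K V V2" unfolding colconn_def by blast
    then show ?thesis using less[OF mat_weight_colstep[OF V2]] mat_bd_colstep[OF V2] colconn_trans by blast
  qed
qed

text \<open>Column moves keep row sums and the property of being highest for rows. Raised as far as
  possible, both matrices become Young diagrams with the same row lengths.\<close>

theorem row_high_colconn_if_rowsum_eq:
  assumes "row_high R K V" "row_high R K W" "mat_bd R K V" "mat_bd R K W" "rowsum K V = rowsum K W"
  shows "colconn R K V W"
proof -
  obtain V2 where V2: "colconn R K V V2" "col_high R K V2" "mat_bd R K V2"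
    using colconn_to_col_high assms by blast
  obtain W2 where W2: "colconn R K W W2" "col_high R K W2" "mat_bd R K W2"
    using colconn_to_col_high assms by blast
  have "V2 = W2"
    using doubly_high_unique row_high_colconn rowsum_colconn V2 W2 assms by metis
  then show ?thesis using V2(1) W2(1) colconn_sym colconn_trans by blast
qed

section \<open>Crystals of type C on words, embedded into matrices\<close>

text \<open>Words over the letters \<open>0, \<dots>, 2r - 1\<close> of type \<open>C\<^sub>r\<close>, where \<open>2r - 1 - t\<close> is the bar of \<open>t\<close>.\<close>

definition csg :: "nat \<Rightarrow> nat \<Rightarrow> nat \<Rightarrow> int" where
  "csg r i t = (if t = i \<or> t = 2 * r - 2 - i then 1
     else if t = Suc i \<or> t = Suc (2 * r - 2 - i) then - 1 else 0)"

definition wsg :: "nat \<Rightarrow> nat \<Rightarrow> nat list \<Rightarrow> nat \<Rightarrow> int" where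
  "wsg r i w p = (if p < length w then csg r i (w ! p) else 0)"

definition cstep :: "nat \<Rightarrow> nat \<Rightarrow> nat list \<Rightarrow> nat list \<Rightarrow> bool" where
  "cstep r i w x \<longleftrightarrow> i < r \<and> (\<exists>p. ctx (wsg r i w) (length w) p \<and> wsg r i w p = - 1 \<and> x = w[p := w ! p - 1])"

text \<open>A letter \<open>x\<close> becomes two columns, \<open>{x}\<close> and the complement of the bar of \<open>x\<close>; beyond the end of the word
  there is padding by an empty and a full column.\<close>

definition vmat :: "nat \<Rightarrow> nat \<Rightarrow> nat list \<Rightarrow> bmat" where
  "vmat r L w = (\<lambda>i k. i < 2 * r \<and> k < 2 * L \<and>
     (if k div 2 < length w then (if even k then i = w ! (k div 2) else i + w ! (k div 2) \<noteq> 2 * r - 1)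
      else odd k))"

lemma mat_bd_vmat: "mat_bd (2 * r) (2 * L) (vmat r L w)"
  by (auto simp: mat_bd_def vmat_def)

lemma dn_sum_pairing:
  fixes f g :: "nat \<Rightarrow> int"
  assumes "\<And>p. p < b \<Longrightarrow> f (2 * p) + f (Suc (2 * p)) = c * g p"
    "\<And>p. p < b \<Longrightarrow> dn [f (2 * p), f (Suc (2 * p))] = c * dn [g p]" "0 \<le> c"
  shows "dn (map f [2 * a..<2 * b]) = c * dn (map g [a..<b])
    \<and> sum_list (map f [2 * a..<2 * b]) = c * sum_list (map g [a..<b])"
  using assms(1,2)
proof (induction b)
  case (Suc b)
  show ?case
  proof (cases "a \<le> b")
    case True
    have s: "[2 * a..<2 * Suc b] = [2 * a..<2 * b] @ [2 * b, Suc (2 * b)]"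
      using True by simp
    have IH: "dn (map f [2 * a..<2 * b]) = c * dn (map g [a..<b])"
      "sum_list (map f [2 * a..<2 * b]) = c * sum_list (map g [a..<b])"
      using Suc by auto
    have "dn (map f [2 * a..<2 * Suc b]) = max (dn (map f [2 * a..<2 * b]))
      (dn [f (2 * b), f (Suc (2 * b))] - sum_list (map f [2 * a..<2 * b]))"
      unfolding s map_append dn_append by simp
    also have "\<dots> = max (c * dn (map g [a..<b])) (c * (dn [g b] - sum_list (map g [a..<b])))"
      using Suc.prems(2)[of b] IH by (simp only: lessI right_diff_distrib)
    also have "\<dots> = c * max (dn (map g [a..<b])) (dn [g b] - sum_list (map g [a..<b]))"
      using assms(3) by (simp add: max_mult_distrib_left)
    also have "\<dots> = c * dn (map g [a..<Suc b])"
      using True by (simp add: dn_append)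
    finally have "dn (map f [2 * a..<2 * Suc b]) = c * dn (map g [a..<Suc b])" .
    moreover have "sum_list (map f [2 * a..<2 * Suc b]) = c * sum_list (map g [a..<Suc b])"
      unfolding s using IH(2) Suc.prems(1)[of b] True by (simp add: distrib_left)
    ultimately show ?thesis by blast
  qed simp
qed simp

lemma dn_wsg_extend:
  assumes "length w \<le> L" "a \<le> length w"
  shows "dn (map (wsg r i w) [a..<L]) = dn (map (wsg r i w) [a..<length w])"
proof -
  have s: "[a..<L] = [a..<length w] @ [length w..<L]" using assms by (intro upt_append_split) auto
  have "map (wsg r i w) [length w..<L] = replicate (L - length w) 0"
    by (intro nth_equalityI) (auto simp: wsg_def)
  moreover have "dn (replicate m 0) = 0" for m by (induction m) auto
  ultimately have "dn (map (wsg r i w) [a..<L]) =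
      max (dn (map (wsg r i w) [a..<length w])) (0 - sum_list (map (wsg r i w) [a..<length w]))"
    unfolding s map_append dn_append by simp
  also have "\<dots> = dn (map (wsg r i w) [a..<length w])"
    using up_nonneg[of "map (wsg r i w) [a..<length w]"] unfolding up_def by linarith
  finally show ?thesis .
qed

lemma ctx_wsg_extend:
  assumes "length w \<le> L" "p < length w"
  shows "ctx (wsg r i w) L p = ctx (wsg r i w) (length w) p"
  using assms dn_wsg_extend[of w L "Suc p" r i] unfolding ctx_def by simp

lemma rs_vmat:
  assumes "i < r" "set w \<subseteq> {..<2 * r}" "length w \<le> L" "p < L" "h = i \<or> h = 2 * r - 2 - i"
  shows "rs (vmat r L w) h (2 * p) = (if p < length w then of_bool (w ! p = h) - of_bool (w ! p = Suc h) else 0)"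
    "rs (vmat r L w) h (Suc (2 * p)) =
      (if p < length w then of_bool (w ! p = 2 * r - 2 - h) - of_bool (w ! p = Suc (2 * r - 2 - h)) else 0)"
proof -
  have h: "Suc h < 2 * r" using assms(1,5) by auto
  have "(w ! p = 2 * r - 2 - h) = (Suc h + w ! p = 2 * r - 1)"
    "(w ! p = Suc (2 * r - 2 - h)) = (h + w ! p = 2 * r - 1)" using h by linarith+
  then show "rs (vmat r L w) h (2 * p) = (if p < length w then of_bool (w ! p = h) - of_bool (w ! p = Suc h) else 0)"
    "rs (vmat r L w) h (Suc (2 * p)) =
      (if p < length w then of_bool (w ! p = 2 * r - 2 - h) - of_bool (w ! p = Suc (2 * r - 2 - h)) else 0)"
    using h assms(4) by (simp_all add: rs_def sg_def vmat_def eq_commute[of "w ! p"])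
qed

text \<open>At the long root \<open>i = r - 1\<close> the rows \<open>i\<close> and
  \<open>2r - 2 - i\<close> coincide, so a letter contributes its sign in both of its
  columns.\<close>

definition cmul :: "nat \<Rightarrow> nat \<Rightarrow> int" where
  "cmul r i = (if Suc i = r then 2 else 1)"

lemma rs_vmat_pair:
  assumes "i < r" "set w \<subseteq> {..<2 * r}" "length w \<le> L" "p < L" "h = i \<or> h = 2 * r - 2 - i"
  shows "rs (vmat r L w) h (2 * p) + rs (vmat r L w) h (Suc (2 * p)) = cmul r i * wsg r i w p"
    "dn [rs (vmat r L w) h (2 * p), rs (vmat r L w) h (Suc (2 * p))] = cmul r i * dn [wsg r i w p]"
proof -
  define j x where "j = 2 * r - 2 - i" and "x = w ! p"
  have j: "2 * r - 2 - j = i" "Suc i = r \<Longrightarrow> j = i" "Suc i \<noteq> r \<Longrightarrow> Suc i < j" using assms(1) by (auto simp: j_def)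
  have g: "wsg r i w p = (if p < length w then if x = i \<or> x = j then 1 else if x = Suc i \<or> x = Suc j then - 1 else 0 else 0)"
    by (simp add: wsg_def csg_def j_def x_def)
  have f: "rs (vmat r L w) h (2 * p) = (if p < length w then of_bool (x = h) - of_bool (x = Suc h) else 0)"
    "rs (vmat r L w) h (Suc (2 * p)) = (if p < length w then of_bool (x = i + j - h) - of_bool (x = Suc (i + j - h)) else 0)"
    using rs_vmat[OF assms] assms(1,5) by (auto simp: j_def x_def)
  have h: "h = i \<or> h = j" using assms(5) by (simp add: j_def)
  have "rs (vmat r L w) h (2 * p) + rs (vmat r L w) h (Suc (2 * p)) = cmul r i * wsg r i w p \<and>
    dn [rs (vmat r L w) h (2 * p), rs (vmat r L w) h (Suc (2 * p))] = cmul r i * dn [wsg r i w p]"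
  proof (cases "Suc i = r")
    case True
    then show ?thesis unfolding f g cmul_def using h j(2)[OF True] by auto
  next
    case False
    consider "x = i" | "x = Suc i" | "x = j" | "x = Suc j" | "x \<notin> {i, Suc i, j, Suc j}" by blast
    then show ?thesis unfolding f g cmul_def using h j(3)[OF False] False by cases auto
  qed
  then show "rs (vmat r L w) h (2 * p) + rs (vmat r L w) h (Suc (2 * p)) = cmul r i * wsg r i w p"
    "dn [rs (vmat r L w) h (2 * p), rs (vmat r L w) h (Suc (2 * p))] = cmul r i * dn [wsg r i w p]" by blast+
qed

lemma dn_rs_vmat:
  assumes "i < r" "set w \<subseteq> {..<2 * r}" "length w \<le> L" "h = i \<or> h = 2 * r - 2 - i" "b \<le> L"
  shows "dn (map (rs (vmat r L w) h) [2 * a..<2 * b]) = cmul r i * dn (map (wsg r i w) [a..<b])"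
    "sum_list (map (rs (vmat r L w) h) [2 * a..<2 * b]) = cmul r i * sum_list (map (wsg r i w) [a..<b])"
  using dn_sum_pairing[of b "rs (vmat r L w) h" "cmul r i" "wsg r i w" a]
    rs_vmat_pair[OF assms(1-3) _ assms(4)] assms(5) by (simp_all add: cmul_def)

lemma ctx_vmat:
  assumes "i < r" "set w \<subseteq> {..<2 * r}" "length w \<le> L" "h = i \<or> h = 2 * r - 2 - i"
    "ctx (wsg r i w) L p"
  shows "up (map (rs (vmat r L w) h) [0..<2 * p]) = 0"
    "dn (map (rs (vmat r L w) h) [Suc (Suc (2 * p))..<2 * L]) = 0"
proof -
  have p: "p < L" "up (map (wsg r i w) [0..<p]) = 0" "dn (map (wsg r i w) [Suc p..<L]) = 0"
    using assms(5) by (auto simp: ctx_def)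
  have "up (map (rs (vmat r L w) h) [2 * 0..<2 * p]) = cmul r i * up (map (wsg r i w) [0..<p])"
    unfolding up_def using dn_rs_vmat[OF assms(1-4), of p 0] p(1) by (simp add: distrib_left)
  then show "up (map (rs (vmat r L w) h) [0..<2 * p]) = 0" using p(2) by simp
  have "dn (map (rs (vmat r L w) h) [2 * Suc p..<2 * L]) = cmul r i * dn (map (wsg r i w) [Suc p..<L])"
    using dn_rs_vmat(1)[OF assms(1-4), of L "Suc p"] by simp
  then show "dn (map (rs (vmat r L w) h) [Suc (Suc (2 * p))..<2 * L]) = 0" using p(3) by simp
qed

lemma vmat_update:
  assumes "p < length w" "t = w ! p" "0 < t"
  shows "vmat r L (w[p := t - 1]) = (\<lambda>a b. if b = 2 * p then a < 2 * r \<and> b < 2 * L \<and> Suc a = t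
    else if b = Suc (2 * p) then a < 2 * r \<and> b < 2 * L \<and> a + t \<noteq> 2 * r else vmat r L w a b)"
proof (intro ext)
  fix a b
  have "b div 2 = p \<longleftrightarrow> b = 2 * p \<or> b = Suc (2 * p)" by presburger
  then show "vmat r L (w[p := t - 1]) a b = (if b = 2 * p then a < 2 * r \<and> b < 2 * L \<and> Suc a = t
    else if b = Suc (2 * p) then a < 2 * r \<and> b < 2 * L \<and> a + t \<noteq> 2 * r else vmat r L w a b)"
    using assms by (auto simp: vmat_def nth_list_update)
qed

text \<open>Virtualization of type C_r in type A_{2r-1}: a letter and the complement of its bar
  change together, so the operator at node \<open>i\<close> is the product of those at
  \<open>i\<close> and \<open>2r - 2 - i\<close>.\<close>

lemma vmat_cstep:
  assumes st: "cstep r i w x" and w: "set w \<subseteq> {..<2 * r}" "length w \<le> L"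
  shows "\<exists>Y. rowstep (2 * r) (2 * L) i (vmat r L w) Y \<and> rowstep (2 * r) (2 * L) (2 * r - 2 - i) Y (vmat r L x)"
proof -
  let ?V = "vmat r L w" and ?j = "2 * r - 2 - i"
  obtain p where p: "i < r" "ctx (wsg r i w) (length w) p" "wsg r i w p = - 1" "x = w[p := w ! p - 1]"
    using st by (auto simp: cstep_def)
  have pl: "p < length w" "p < L" using p(2) w(2) by (auto simp: ctx_def)
  have c: "ctx (wsg r i w) L p" using p(2) ctx_wsg_extend[OF w(2) pl(1)] by simp
  define t where "t = w ! p"
  have t: "t = Suc i \<or> t = Suc ?j" "t \<noteq> i" "t \<noteq> ?j"
    using p(3) pl by (auto simp: wsg_def csg_def t_def split: if_splits)
  note cv = ctx_vmat[OF p(1) w _ c]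
  note rv = rs_vmat[OF p(1) w pl(2)]
  have ve: "?V a (2 * p) \<longleftrightarrow> a < 2 * r \<and> a = t" "?V a (Suc (2 * p)) \<longleftrightarrow> a < 2 * r \<and> a + t \<noteq> 2 * r - 1" for a
    using pl by (simp_all add: vmat_def t_def)
  have xe: "vmat r L x a b = (if b = 2 * p then a < 2 * r \<and> Suc a = t
    else if b = Suc (2 * p) then a < 2 * r \<and> a + t \<noteq> 2 * r else ?V a b)" for a b
    using vmat_update[OF pl(1) t_def, of r L] t(1) pl(2) unfolding p(4) t_def[symmetric] by auto
  show ?thesis
  proof (cases "Suc i = r")
    case True
    \<comment> \<open>Both factors now act on the same pair of rows. The complement column stands to
      the right, so its minus is the last unmatched one and moves first.\<close>
    then have j: "?j = i" "t = Suc i" using t by auto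
    have cc: "up (map (rs ?V i) [0..<2 * p]) = 0" "dn (map (rs ?V i) [Suc (Suc (2 * p))..<2 * L]) = 0"
      using cv[of i] by auto
    have r1: "rs ?V i (2 * p) = - 1" "rs ?V i (Suc (2 * p)) = - 1"
      using rv[of i] pl t(2) j unfolding t_def by auto
    have 1: "ctx (rs ?V i) (2 * L) (Suc (2 * p))"
      using cc r1 pl by (simp add: ctx_def up_snoc)
    define Y where "Y = rmv i (Suc (2 * p)) ?V"
    have s1: "rowstep (2 * r) (2 * L) i ?V Y"
      unfolding rowstep_def Y_def using 1 r1(2) True rs_neg_iff by auto
    have rY: "rs Y i x = (if x = Suc (2 * p) then 1 else rs ?V i x)" for x
      using r1(2) unfolding rs_neg_iff by (auto simp: Y_def rmv_def rs_def sg_def)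
    have m: "map (rs Y i) [0..<2 * p] = map (rs ?V i) [0..<2 * p]"
      "map (rs Y i) [Suc (Suc (2 * p))..<2 * L] = map (rs ?V i) [Suc (Suc (2 * p))..<2 * L]"
      using rY by auto
    have "[Suc (2 * p)..<2 * L] = Suc (2 * p) # [Suc (Suc (2 * p))..<2 * L]"
      using pl by (intro upt_conv_Cons) auto
    moreover have "dn (map (rs Y i) [Suc (Suc (2 * p))..<2 * L]) = 0" unfolding m(2) by (rule cc(2))
    ultimately have "dn (map (rs Y i) [Suc (2 * p)..<2 * L]) = 0"
      using rY[of "Suc (2 * p)"] by simp
    then have 2: "ctx (rs Y i) (2 * L) (2 * p)"
      unfolding ctx_def m(1) using cc(1) pl by simp
    have "rs Y i (2 * p) = - 1" using rY r1 by simp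
    then have s2: "rowstep (2 * r) (2 * L) ?j Y (rmv i (2 * p) Y)"
      unfolding rowstep_def j(1) using 2 True rs_neg_iff by auto
    have "rmv i (2 * p) Y = vmat r L x"
    proof (intro ext)
      fix a b
      show "rmv i (2 * p) Y a b = vmat r L x a b"
        unfolding xe using ve True j(2) p(1)
        by (cases "b = 2 * p"; cases "b = Suc (2 * p)"; cases "a = i"; cases "a = Suc i") (simp_all add: Y_def rmv_def, linarith+)
    qed
    then show ?thesis using s1 s2 by metis
  next
    case False
    then have ij: "Suc (Suc i) \<le> ?j" "Suc ?j < 2 * r" using p(1) by auto
    \<comment> \<open>The letter \<open>Suc i\<close> has its sign for row \<open>i\<close> in the
      singleton column and its sign for row \<open>?j\<close> in the complement column; for the
      letter \<open>Suc ?j\<close> it is the other way round.\<close>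
    define q where "q = (if t = Suc i then 2 * p else Suc (2 * p))"
    define q' where "q' = (if t = Suc i then Suc (2 * p) else 2 * p)"
    have r1: "rs ?V i (2 * p) = (if t = Suc i then - 1 else 0)" "rs ?V i (Suc (2 * p)) = (if t = Suc i then 0 else - 1)"
      "rs ?V ?j (2 * p) = (if t = Suc i then 0 else - 1)" "rs ?V ?j (Suc (2 * p)) = (if t = Suc i then - 1 else 0)"
      using rv[of i] rv[of ?j] pl t ij p(1) unfolding t_def[symmetric] by auto
    have sp: "[Suc (2 * p)..<2 * L] = Suc (2 * p) # [Suc (Suc (2 * p))..<2 * L]"
      using pl by (intro upt_conv_Cons) auto
    have c1: "ctx (rs ?V i) (2 * L) q"
      using cv[of i] r1(1,2) pl sp unfolding ctx_def q_def by (simp add: up_snoc del: upt.upt_Suc) (simp add: up_snoc)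
    have c2: "ctx (rs ?V ?j) (2 * L) q'"
      using cv[of ?j] r1(3,4) pl sp unfolding ctx_def q'_def by (simp add: up_snoc del: upt.upt_Suc) (simp add: up_snoc)
    define Y where "Y = rmv i q ?V"
    have s1: "rowstep (2 * r) (2 * L) i ?V Y"
      unfolding rowstep_def Y_def using c1 r1(1,2) ij rs_neg_iff[of ?V i q] p(1) unfolding q_def by (auto split: if_splits)
    have rY: "rs Y ?j = rs ?V ?j"
      using ij by (auto simp: Y_def rmv_def rs_def sg_def fun_eq_iff)
    have s2: "rowstep (2 * r) (2 * L) ?j Y (rmv ?j q' Y)"
      unfolding rowstep_def rY using c2 r1(3,4) ij rs_neg_iff[of Y ?j q'] unfolding rY q'_def by (auto split: if_splits)
    have "rmv ?j q' Y = vmat r L x"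
    proof (intro ext)
      fix a b
      show "rmv ?j q' Y a b = vmat r L x a b"
      proof -
        have rr: "2 * r = Suc (Suc (i + ?j))" using p(1) by auto
        obtain j where j: "?j = j" by blast
        have ve': "?V a (2 * p) \<longleftrightarrow> a < Suc (Suc (i + j)) \<and> a = t"
          "?V a (Suc (2 * p)) \<longleftrightarrow> a < Suc (Suc (i + j)) \<and> a + t \<noteq> Suc (i + j)" for a
          using ve rr unfolding j by simp_all
        have xe': "vmat r L x a b = (if b = 2 * p then a < Suc (Suc (i + j)) \<and> Suc a = t
          else if b = Suc (2 * p) then a < Suc (Suc (i + j)) \<and> a + t \<noteq> Suc (Suc (i + j)) else ?V a b)"
          using xe rr unfolding j by simp
        have ij': "Suc (Suc i) \<le> j" using ij(1) unfolding j .
        consider "b = 2 * p" | "b = Suc (2 * p)" | "b \<noteq> 2 * p" "b \<noteq> Suc (2 * p)" by blast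
        then show ?thesis
        proof cases
          case 1
          from t(1) show ?thesis unfolding xe' j
            by (elim disjE) (use 1 ve' ij' in \<open>auto simp: Y_def q_def q'_def rmv_def j\<close>)
        next
          case 2
          from t(1) show ?thesis unfolding xe' j
            by (elim disjE) (use 2 ve' ij' in \<open>auto simp: Y_def q_def q'_def rmv_def j\<close>)
        next
          case 3
          then show ?thesis unfolding xe' j by (auto simp: Y_def q_def q'_def rmv_def)
        qed
      qed
    qed
    then show ?thesis using s1 s2 by metis
  qed
qed

lemma map_wsg: "map (wsg r i w) [0..<length w] = map (csg r i) w"
  by (intro nth_equalityI) (auto simp: wsg_def)

lemma ctx_neg_dn:
  assumes "ctx f N q" "f q = - 1"
  shows "0 < dn (map f [0..<N])"
proof -
  have q: "q < N" "up (map f [0..<q]) = 0" "dn (map f [Suc q..<N]) = 0" using assms by (auto simp: ctx_def)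
  have s: "[0..<N] = [0..<q] @ q # [Suc q..<N]"
    using q(1) by (metis less_imp_le_nat upt_append_split upt_conv_Cons zero_le)
  have "sum_list (map f [0..<q]) \<le> 0" using q(2) dn_nonneg[of "map f [0..<q]"] unfolding up_def by linarith
  moreover have "dn (map f [0..<N]) \<ge> dn (f q # map f [Suc q..<N]) - sum_list (map f [0..<q])"
    unfolding s by (simp only: map_append list.map dn_append max.cobounded2)
  ultimately show ?thesis using q(3) assms(2) by simp
qed

lemma row_high_iff: "row_high R K V \<longleftrightarrow> (\<forall>i. Suc i < R \<longrightarrow> dn (map (rs V i) [0..<K]) = 0)"
proof
  assume a: "\<forall>i. Suc i < R \<longrightarrow> dn (map (rs V i) [0..<K]) = 0"
  show "row_high R K V" unfolding row_high_def rowstep_def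
  proof (intro allI notI, elim conjE exE)
    fix i W q assume "Suc i < R" "ctx (rs V i) K q" "\<not> V i q" "V (Suc i) q"
    then show False using ctx_neg_dn[of "rs V i" K q] a rs_neg_iff by auto
  qed
qed (use row_high_dn in blast)

lemma ex_cstep_iff: "(\<exists>x. cstep r i w x) \<longleftrightarrow> i < r \<and> 0 < dn (map (csg r i) w)"
proof
  assume "\<exists>x. cstep r i w x"
  then obtain p where "i < r" "ctx (wsg r i w) (length w) p" "wsg r i w p = - 1" by (auto simp: cstep_def)
  then show "i < r \<and> 0 < dn (map (csg r i) w)" using ctx_neg_dn by (metis map_wsg)
next
  assume a: "i < r \<and> 0 < dn (map (csg r i) w)"
  moreover have "- 1 \<le> wsg r i w x" for x by (simp add: wsg_def csg_def)
  ultimately obtain q where "wsg r i w q = - 1" "ctx (wsg r i w) (length w) q"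
    using ctx_exists_neg[of "wsg r i w" "length w"] unfolding map_wsg by blast
  then show "\<exists>x. cstep r i w x" using a unfolding cstep_def by blast
qed

definition whigh :: "nat \<Rightarrow> nat list \<Rightarrow> bool" where
  "whigh r w \<longleftrightarrow> (\<forall>i x. \<not> cstep r i w x)"

lemma whigh_iff: "whigh r w \<longleftrightarrow> (\<forall>i<r. dn (map (csg r i) w) = 0)"
  unfolding whigh_def using ex_cstep_iff[of r _ w] dn_nonneg by (metis dn_nonneg le_less less_irrefl)

lemma dn_rs_vmat_full:
  assumes "i < r" "set w \<subseteq> {..<2 * r}" "length w \<le> L" "h = i \<or> h = 2 * r - 2 - i"
  shows "dn (map (rs (vmat r L w) h) [0..<2 * L]) = cmul r i * dn (map (csg r i) w)"
  using dn_rs_vmat(1)[OF assms, of L 0] dn_wsg_extend[OF assms(3), of 0 r i] by (simp add: map_wsg)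

lemma cmul_pos: "0 < cmul r i"
  by (simp add: cmul_def)

lemma row_high_vmat_iff:
  assumes "set w \<subseteq> {..<2 * r}" "length w \<le> L"
  shows "row_high (2 * r) (2 * L) (vmat r L w) \<longleftrightarrow> whigh r w"
proof
  assume h: "row_high (2 * r) (2 * L) (vmat r L w)"
  show "whigh r w" unfolding whigh_iff
  proof (intro allI impI)
    fix i assume "i < r"
    then have "cmul r i * dn (map (csg r i) w) = 0"
      using h dn_rs_vmat_full[OF _ assms, of i i] unfolding row_high_iff by simp
    then show "dn (map (csg r i) w) = 0" using cmul_pos[of r i] by simp
  qed
next
  assume h: "whigh r w"
  show "row_high (2 * r) (2 * L) (vmat r L w)" unfolding row_high_iff
  proof (intro allI impI)
    fix i assume i: "Suc i < 2 * r"
    define m where "m = (if i < r then i else 2 * r - 2 - i)"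
    have "m < r" "i = m \<or> i = 2 * r - 2 - m" using i by (auto simp: m_def)
    then show "dn (map (rs (vmat r L w) i) [0..<2 * L]) = 0"
      using dn_rs_vmat_full[OF _ assms, of m i] h unfolding whigh_iff by simp
  qed
qed

lemma cstep_length: "cstep r i w x \<Longrightarrow> length x = length w"
  by (auto simp: cstep_def)

lemma cstep_det: "cstep r i w x \<Longrightarrow> cstep r i w y \<Longrightarrow> x = y"
  unfolding cstep_def by (metis ctx_unique)

lemma rowstep_inj:
  assumes "rowstep R K i V W" "rowstep R K i V' W"
  shows "V = V'"
proof -
  obtain q where q: "ctx (rs V i) K q" "\<not> V i q" "V (Suc i) q" "W = rmv i q V"
    using assms by (auto simp: rowstep_def)
  obtain q' where q': "ctx (rs V' i) K q'" "\<not> V' i q'" "V' (Suc i) q'" "W = rmv i q' V'"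
    using assms by (auto simp: rowstep_def)
  have "ctx (rs W i) K q" "ctx (rs W i) K q'"
    using q(1) q'(1) by (metis q(4) ctx_rs_rmv, metis q'(4) ctx_rs_rmv)
  moreover have "rs W i q = 1" using q by (simp add: rs_def rmv_def sg_def)
  moreover have "rs W i q' = 1" using q' by (simp add: rs_def rmv_def sg_def)
  ultimately have "q = q'" using ctx_unique by metis
  then show ?thesis using q(4) q'(4) by (metis rmv_rmv)
qed

lemma vmat_inj:
  assumes "vmat r L w = vmat r L x" "length w = length x" "set w \<subseteq> {..<2 * r}" "length w \<le> L"
  shows "w = x"
proof (intro nth_equalityI)
  fix p assume p: "p < length w"
  have "w ! p < 2 * r" using assms(3) p by (meson lessThan_iff nth_mem subsetD)
  moreover have "vmat r L w (w ! p) (2 * p) \<longleftrightarrow> vmat r L x (w ! p) (2 * p)" using assms(1) by simp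
  ultimately show "w ! p = x ! p" using p assms by (simp add: vmat_def)
qed (fact assms(2))

lemma cstep_inj:
  assumes "cstep r i w y" "cstep r i x y" "set w \<subseteq> {..<2 * r}" "set x \<subseteq> {..<2 * r}"
  shows "w = x"
proof -
  let ?L = "length w"
  have l: "length w = length x" using assms cstep_length by metis
  obtain Y where Y: "rowstep (2 * r) (2 * ?L) i (vmat r ?L w) Y" "rowstep (2 * r) (2 * ?L) (2 * r - 2 - i) Y (vmat r ?L y)"
    using vmat_cstep[OF assms(1,3)] by blast
  obtain Z where Z: "rowstep (2 * r) (2 * ?L) i (vmat r ?L x) Z" "rowstep (2 * r) (2 * ?L) (2 * r - 2 - i) Z (vmat r ?L y)"
    using vmat_cstep[OF assms(2,4)] l by (metis order_refl)
  have "Y = Z" using rowstep_inj Y(2) Z(2) by blast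
  then have "vmat r ?L w = vmat r ?L x" using rowstep_inj Y(1) Z(1) by blast
  then show ?thesis using vmat_inj l assms(3) by blast
qed

text \<open>The range of the letters is part of every step, since \<open>vmat\<close> represents
  only letters below \<open>2 * r\<close>.\<close>

definition wconn :: "nat \<Rightarrow> nat list \<Rightarrow> nat list \<Rightarrow> bool" where
  "wconn r = (\<lambda>w x. \<exists>i. (cstep r i w x \<or> cstep r i x w) \<and> set w \<subseteq> {..<2 * r} \<and> set x \<subseteq> {..<2 * r})\<^sup>*\<^sup>*"

lemma wconn_length: "wconn r w x \<Longrightarrow> length x = length w"
  unfolding wconn_def by (induction rule: rtranclp_induct) (auto dest: cstep_length)

lemma wconn_rowconn:
  assumes "wconn r w x" "length w \<le> L"
  shows "rowconn (2 * r) (2 * L) (vmat r L w) (vmat r L x)"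
  using assms(1) unfolding wconn_def
proof (induction rule: rtranclp_induct)
  case base
  show ?case by (simp add: rowconn_def)
next
  case (step y z)
  have l: "length y \<le> L" "length z \<le> L"
    using step wconn_length[of r w y] assms(2) unfolding wconn_def by (auto dest: cstep_length)
  obtain i where i: "cstep r i y z \<or> cstep r i z y" "set y \<subseteq> {..<2 * r}" "set z \<subseteq> {..<2 * r}"
    using step(2) by blast
  have s: "rowconn (2 * r) (2 * L) (vmat r L a) (vmat r L b)"
    if "cstep r i a b" "set a \<subseteq> {..<2 * r}" "length a \<le> L" for a b
    using vmat_cstep[OF that] rowconn_step rowconn_trans by blast
  show ?case using i s[of y z] s[of z y] l step.IH rowconn_sym rowconn_trans by blast
qed

theorem whigh_unique:
  assumes "wconn r w x" "whigh r w" "whigh r x" "set w \<subseteq> {..<2 * r}" "set x \<subseteq> {..<2 * r}"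
  shows "w = x"
proof -
  have l: "length x = length w" using wconn_length assms(1) by blast
  have "vmat r (length w) w = vmat r (length w) x"
    using row_high_rowconn_unique[OF wconn_rowconn[OF assms(1) order_refl]] row_high_vmat_iff assms(2-5) l mat_bd_vmat
    by (metis order_refl)
  then show ?thesis using vmat_inj l assms(4) by (metis order_refl)
qed

text \<open>The matrices passed through need not come from words. But row steps are deterministic,
  so the transported pair of row steps must be the one that \<open>vmat_cstep\<close> assigns to a
  step of \<open>w'\<close>.\<close>

theorem cstep_along_colconn:
  assumes "colconn (2 * r) (2 * L) (vmat r L w) (vmat r L w')" "cstep r i w x"
    "set w \<subseteq> {..<2 * r}" "length w \<le> L" "set w' \<subseteq> {..<2 * r}" "length w' \<le> L"
  shows "\<exists>x'. cstep r i w' x' \<and> colconn (2 * r) (2 * L) (vmat r L x) (vmat r L x')"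
proof -
  obtain Y where Y: "rowstep (2 * r) (2 * L) i (vmat r L w) Y" "rowstep (2 * r) (2 * L) (2 * r - 2 - i) Y (vmat r L x)"
    using vmat_cstep[OF assms(2-4)] by blast
  obtain Y' where Y': "rowstep (2 * r) (2 * L) i (vmat r L w') Y'" "colconn (2 * r) (2 * L) Y Y'"
    using rowstep_along_colconn[OF assms(1) Y(1)] by blast
  obtain Z' where Z': "rowstep (2 * r) (2 * L) (2 * r - 2 - i) Y' Z'" "colconn (2 * r) (2 * L) (vmat r L x) Z'"
    using rowstep_along_colconn[OF Y'(2) Y(2)] by blast
  have i: "i < r" using assms(2) by (simp add: cstep_def)
  have "0 < dn (map (rs (vmat r L w') i) [0..<2 * L])"
    using Y'(1) ctx_neg_dn rs_neg_iff unfolding rowstep_def by blast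
  then have "0 < dn (map (csg r i) w')"
    using dn_rs_vmat_full[OF i assms(5,6), of i] cmul_pos[of r i] by (simp add: zero_less_mult_iff)
  then obtain x' where x': "cstep r i w' x'" using ex_cstep_iff i by blast
  obtain V where V: "rowstep (2 * r) (2 * L) i (vmat r L w') V" "rowstep (2 * r) (2 * L) (2 * r - 2 - i) V (vmat r L x')"
    using vmat_cstep[OF x' assms(5,6)] by blast
  have "V = Y'" using rowstep_det V(1) Y'(1) by blast
  then have "vmat r L x' = Z'" using rowstep_det V(2) Z'(1) by blast
  then show ?thesis using x' Z'(2) by blast
qed

lemma sum_of_bool_nth_eq: "(\<Sum>p<length w. of_bool (w ! p = t)) = count_list w t"
proof -
  have "(\<Sum>p<length w. of_bool (w ! p = t)) = (\<Sum>x\<leftarrow>w. of_bool (x = t))"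
    by (simp only: sum_list_sum_nth length_map atLeast0LessThan) (rule sum.cong, auto)
  also have "\<dots> = count_list w t" by (induction w) auto
  finally show ?thesis .
qed

lemma sum_double_index: "(\<Sum>k<2 * L. f k) = (\<Sum>p<L. f (2 * p) + f (Suc (2 * p)))" for f :: "nat \<Rightarrow> nat"
  by (induction L) (simp_all add: numeral_2_eq_2 algebra_simps)

text \<open>A pair of columns contributes 1 to each row, corrected by +1 in the row of its letter
  and -1 in the row of the bar. A padding pair, one empty and one full column, contributes just 1.
  So row sums see only the weight, whatever the length of the word.\<close>

lemma rowsum_vmat:
  assumes "i < 2 * r" "set w \<subseteq> {..<2 * r}" "length w \<le> L"
  shows "rowsum (2 * L) (vmat r L w) i + count_list w (2 * r - 1 - i) = L + count_list w i"
proof -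
  have *: "of_bool (vmat r L w i (2 * p)) + of_bool (vmat r L w i (Suc (2 * p))) + (if p < length w then of_bool (w ! p = 2 * r - 1 - i) else 0)
    = (1::nat) + (if p < length w then of_bool (w ! p = i) else 0)" if "p < L" for p
    using that assms(1) by (auto simp: vmat_def)
  have e: "(\<Sum>p<L. if p < length w then of_bool (w ! p = t) else 0) = count_list w t" for t
  proof -
    have "(\<Sum>p<L. if p < length w then of_bool (w ! p = t) else (0::nat)) = (\<Sum>p\<in>{..<L} \<inter> {..<length w}. of_bool (w ! p = t))"
      by (subst sum.inter_restrict) (auto intro: sum.cong)
    also have "{..<L} \<inter> {..<length w} = {..<length w}" using assms(3) by auto
    finally show ?thesis by (simp only: sum_of_bool_nth_eq)
  qed
  have "rowsum (2 * L) (vmat r L w) i + count_list w (2 * r - 1 - i)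
    = (\<Sum>p<L. of_bool (vmat r L w i (2 * p)) + of_bool (vmat r L w i (Suc (2 * p))) + (if p < length w then of_bool (w ! p = 2 * r - 1 - i) else 0))"
    unfolding rowsum_def sum_double_index e[of "2 * r - 1 - i", symmetric] by (simp only: sum.distrib)
  also have "\<dots> = (\<Sum>p<L. 1 + (if p < length w then of_bool (w ! p = i) else 0))"
    using * by (intro sum.cong) auto
  also have "\<dots> = L + count_list w i"
    by (simp only: sum.distrib e) simp
  finally show ?thesis .
qed


lemma inv_rowstep_along_colconn:
  assumes "colconn R K V W" "rowstep R K i V2 V"
  shows "\<exists>W2. rowstep R K i W2 W \<and> colconn R K V2 W2"
  using assms unfolding colconn_def
proof (induction rule: rtranclp_induct)
  case (step X Y)
  then obtain X2 where X2: "rowstep R K i X2 X" "colconn R K V2 X2" unfolding colconn_def by blast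
  obtain k where "colstep R K k X Y \<or> colstep R K k Y X" using step by blast
  then obtain Y2 where "rowstep R K i Y2 Y" "colstep R K k X2 Y2 \<or> colstep R K k Y2 X2"
    using row_col_commute_inv_both row_col_commute_inv_row X2(1) by metis
  moreover from this(2) have "colconn R K V2 Y2"
    using X2(2) unfolding colconn_def by (elim rtranclp.rtrancl_into_rtrancl) blast
  ultimately show ?case unfolding colconn_def by blast
qed blast

lemma ctx_pos_up:
  assumes "ctx f N q" "f q = 1"
  shows "0 < up (map f [0..<N])"
proof -
  have q: "q < N" "up (map f [0..<q]) = 0" "dn (map f [Suc q..<N]) = 0" using assms by (auto simp: ctx_def)
  have s: "[0..<N] = ([0..<q] @ [q]) @ [Suc q..<N]"
    using q(1) by (metis append_Cons append_Nil append_assoc less_imp_le_nat upt_append_split upt_conv_Cons zero_le)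
  have "0 \<le> sum_list (map f [Suc q..<N])" using q(3) up_nonneg[of "map f [Suc q..<N]"] unfolding up_def by linarith
  moreover have "up (map f [0..<N]) \<ge> up (map f [0..<q] @ [f q]) + sum_list (map f [Suc q..<N])"
    unfolding s by (simp only: map_append list.map up_append[of "map f [0..<q] @ [f q]"] max.cobounded2)
  ultimately show ?thesis using q(2) assms(2) by (simp add: up_snoc)
qed

lemma ex_inv_cstep:
  assumes "i < r" "0 < up (map (csg r i) w)" "set w \<subseteq> {..<2 * r}"
  shows "\<exists>x. cstep r i x w \<and> set x \<subseteq> {..<2 * r}"
proof -
  have "wsg r i w x \<le> 1" for x by (simp add: wsg_def csg_def)
  then obtain p where p: "wsg r i w p = 1" "ctx (wsg r i w) (length w) p"
    using ctx_exists_pos[of "wsg r i w" "length w"] assms(2) unfolding map_wsg by blast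
  define x where "x = w[p := Suc (w ! p)]"
  have pl: "p < length w" using p(2) by (simp add: ctx_def)
  have t: "w ! p = i \<or> w ! p = 2 * r - 2 - i" using p(1) pl by (auto simp: wsg_def csg_def split: if_splits)
  have "ctx (wsg r i x) (length x) p"
    using p(2) ctx_cong[of "length w" p "wsg r i x" "wsg r i w"] by (simp add: x_def wsg_def)
  moreover have "wsg r i x p = - 1"
  proof (cases "Suc i = r")
    case True
    then show ?thesis using t pl by (auto simp: wsg_def csg_def x_def)
  next
    case False
    then have "Suc i < 2 * r - 2 - i" using assms(1) by auto
    then show ?thesis using t pl by (auto simp: wsg_def csg_def x_def)
  qed
  moreover have "w = x[p := x ! p - 1]" using pl by (simp add: x_def)
  moreover have "set x \<subseteq> {..<2 * r}"
    using set_update_subset_insert[of w p "Suc (w ! p)"] assms(1,3) t unfolding x_def by auto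
  ultimately show ?thesis using assms(1) unfolding cstep_def by blast
qed

theorem inv_cstep_along_colconn:
  assumes "colconn (2 * r) (2 * L) (vmat r L w) (vmat r L w')" "cstep r i x w"
    "set x \<subseteq> {..<2 * r}" "length w \<le> L" "set w' \<subseteq> {..<2 * r}" "length w' \<le> L"
  shows "\<exists>x'. cstep r i x' w' \<and> set x' \<subseteq> {..<2 * r} \<and> colconn (2 * r) (2 * L) (vmat r L x) (vmat r L x')"
proof -
  have lx: "length x \<le> L" using cstep_length[OF assms(2)] assms(4) by simp
  obtain Y where Y: "rowstep (2 * r) (2 * L) i (vmat r L x) Y" "rowstep (2 * r) (2 * L) (2 * r - 2 - i) Y (vmat r L w)"
    using vmat_cstep[OF assms(2,3) lx] by blast
  obtain Y' where Y': "rowstep (2 * r) (2 * L) (2 * r - 2 - i) Y' (vmat r L w')" "colconn (2 * r) (2 * L) Y Y'"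
    using inv_rowstep_along_colconn[OF assms(1) Y(2)] by blast
  obtain Z' where Z': "rowstep (2 * r) (2 * L) i Z' Y'" "colconn (2 * r) (2 * L) (vmat r L x) Z'"
    using inv_rowstep_along_colconn[OF Y'(2) Y(1)] by blast
  have i: "i < r" using assms(2) by (simp add: cstep_def)
  let ?j = "2 * r - 2 - i"
  obtain q where q: "ctx (rs Y' ?j) (2 * L) q" "\<not> Y' ?j q" "Y' (Suc ?j) q" "vmat r L w' = rmv ?j q Y'"
    using Y'(1) unfolding rowstep_def by blast
  have "ctx (rs (vmat r L w') ?j) (2 * L) q" "rs (vmat r L w') ?j q = 1"
    using q by (simp_all add: ctx_rs_rmv) (simp add: rs_def rmv_def sg_def)
  then have u: "0 < up (map (rs (vmat r L w') ?j) [0..<2 * L])" by (rule ctx_pos_up)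
  have e: "map (wsg r i w') [0..<L] = map (csg r i) w' @ replicate (L - length w') 0"
    using assms(6) by (intro nth_equalityI) (auto simp: wsg_def nth_append)
  have "up (map (rs (vmat r L w') ?j) [0..<2 * L]) = cmul r i * (dn (map (csg r i) w') + sum_list (map (wsg r i w') [0..<L]))"
    using dn_rs_vmat_full[OF i assms(5,6), of ?j] dn_rs_vmat(2)[OF i assms(5,6), of ?j L 0]
    by (simp add: up_def distrib_left add.commute)
  also have "\<dots> = cmul r i * up (map (csg r i) w')" unfolding e by (simp add: up_def add.commute sum_list_replicate)
  finally have "0 < up (map (csg r i) w')" using u cmul_pos[of r i] by (simp add: zero_less_mult_iff)
  then obtain x' where x': "cstep r i x' w'" "set x' \<subseteq> {..<2 * r}" using ex_inv_cstep i assms(5) by blast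
  have lx': "length x' \<le> L" using cstep_length[OF x'(1)] assms(6) by simp
  obtain V where V: "rowstep (2 * r) (2 * L) i (vmat r L x') V" "rowstep (2 * r) (2 * L) ?j V (vmat r L w')"
    using vmat_cstep[OF x' lx'] by blast
  have "V = Y'" using rowstep_inj V(2) Y'(1) by blast
  then have "vmat r L x' = Z'" using rowstep_inj V(1) Z'(1) by blast
  then show ?thesis using x' Z'(2) by blast
qed

section \<open>Arrays as words of type C\<close>

text \<open>Columns are numbered from 0.\<close>

type_synonym array = "nat \<Rightarrow> nat set"

definition arrays :: "nat \<Rightarrow> nat \<Rightarrow> array set" where
  "arrays n r = {M. (\<forall>j<r. M j \<subseteq> {1..2 * n}) \<and> (\<forall>j\<ge>r. M j = {})}"

definition asg :: "array \<Rightarrow> nat \<Rightarrow> nat \<Rightarrow> int" where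
  "asg M j p = of_bool (p \<in> M j) - of_bool (p \<in> M (Suc j))"

text \<open>A minus marks a complete pair, a plus an empty one. The neutral value at 0 lets the
  index start at 0.\<close>

definition zsg :: "array \<Rightarrow> nat \<Rightarrow> int" where
  "zsg M m = (if m = 0 then 0 else 1 - of_bool (2 * m - 1 \<in> M 0) - of_bool (2 * m \<in> M 0))"

text \<open>Block \<open>m\<close> of the word of an array lists the columns without \<open>2m - 1\<close> from right to left, then the columns
  with \<open>2m\<close> from left to right; this makes column moves and pair removals steps of type \<open>C\<^sub>r\<close>.\<close>

definition lettr :: "nat \<Rightarrow> array \<Rightarrow> nat \<Rightarrow> nat \<Rightarrow> bool" where
  "lettr r M m t = (if t < r then 2 * m - 1 \<notin> M (r - 1 - t) else 2 * m \<in> M (t - r))"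

definition blk :: "nat \<Rightarrow> array \<Rightarrow> nat \<Rightarrow> nat list" where
  "blk r M m = filter (lettr r M m) [0..<2 * r]"

definition wrd :: "nat \<Rightarrow> nat \<Rightarrow> array \<Rightarrow> nat list" where
  "wrd n r M = concat (map (blk r M) [1..<Suc n])"

definition glstep :: "nat \<Rightarrow> nat \<Rightarrow> array \<Rightarrow> array \<Rightarrow> bool" where
  "glstep n j M N \<longleftrightarrow> (\<exists>p. ctx (asg M j) (2 * n + 1) p \<and> asg M j p = - 1 \<and>
     N = M(j := insert p (M j), Suc j := M (Suc j) - {p}))"

definition zstep :: "nat \<Rightarrow> array \<Rightarrow> array \<Rightarrow> bool" where
  "zstep n M N \<longleftrightarrow> (\<exists>m. ctx (zsg M) (Suc n) m \<and> zsg M m = - 1 \<and> N = M(0 := M 0 - {2 * m - 1, 2 * m}))"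

text \<open>Equality in the bicyclic monoid, where a sign word reduces to its unmatched minus signs
  followed by its unmatched plus signs. Being a congruence, it allows neutral letters to be dropped
  and blocks to be treated separately.\<close>

definition seq :: "int list \<Rightarrow> int list \<Rightarrow> bool" where
  "seq xs ys \<longleftrightarrow> dn xs = dn ys \<and> sum_list xs = sum_list ys"

lemma seq_refl: "seq xs xs" and seq_sym: "seq xs ys \<Longrightarrow> seq ys xs"
  and seq_trans: "seq xs ys \<Longrightarrow> seq ys zs \<Longrightarrow> seq xs zs"
  by (auto simp: seq_def)

lemma seq_append: "seq xs ys \<Longrightarrow> seq xs' ys' \<Longrightarrow> seq (xs @ xs') (ys @ ys')"
  by (simp add: seq_def dn_append)

lemma seq_dn: "seq xs ys \<Longrightarrow> dn xs = dn ys" and seq_up: "seq xs ys \<Longrightarrow> up xs = up ys"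
  by (simp_all add: seq_def up_def)

lemma seq_neutral:
  assumes "\<And>t. t \<in> set ts \<Longrightarrow> f t = 0"
  shows "seq (map f (filter P ts)) []"
  using assms by (induction ts) (auto simp: seq_def)

lemma cstepI:
  assumes "i < r" "csg r i t = - 1" "up (map (csg r i) a) = 0" "dn (map (csg r i) b) = 0"
  shows "cstep r i (a @ t # b) (a @ (t - 1) # b)"
proof -
  let ?w = "a @ t # b"
  have 1: "map (wsg r i ?w) [0..<length a] = map (csg r i) a"
    by (intro nth_equalityI) (auto simp: wsg_def nth_append)
  have 2: "map (wsg r i ?w) [Suc (length a)..<length ?w] = map (csg r i) b"
    by (intro nth_equalityI) (auto simp: wsg_def nth_append simp del: upt_Suc)
  have "ctx (wsg r i ?w) (length ?w) (length a)"
    unfolding ctx_def 1 2 using assms(3,4) by simp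
  moreover have "wsg r i ?w (length a) = - 1" using assms(2) by (simp add: wsg_def)
  moreover have "a @ (t - 1) # b = ?w[length a := ?w ! length a - 1]" by simp
  ultimately show ?thesis using assms(1) unfolding cstep_def by blast
qed

lemma csg_neutral_upt:
  assumes "\<And>t. a \<le> t \<Longrightarrow> t < b \<Longrightarrow> csg r i t = 0"
  shows "seq (map (csg r i) (filter P [a..<b])) []"
  using assms by (intro seq_neutral) auto

lemma csg_pair_filter:
  assumes "t = i \<or> t = 2 * r - 2 - i" "Suc i < r"
  shows "seq (map (csg r i) (filter P [t, Suc t])) [of_bool (P t) - of_bool (P (Suc t))]"
proof -
  have "Suc i < 2 * r - 2 - i" using assms(2) by auto
  then have "csg r i t = 1" "csg r i (Suc t) = - 1" using assms(1) by (auto simp: csg_def)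
  then show ?thesis by (auto simp: seq_def)
qed

lemma wrd_split:
  assumes "1 \<le> m" "m \<le> n" "\<And>k. k \<noteq> m \<Longrightarrow> 1 \<le> k \<Longrightarrow> blk r N k = blk r M k"
  shows "wrd n r N = concat (map (blk r M) [1..<m]) @ blk r N m @ concat (map (blk r M) [Suc m..<Suc n])"
proof -
  have "[1..<Suc n] = [1..<m] @ m # [Suc m..<Suc n]" using assms(1,2)
    by (metis le_imp_less_Suc less_imp_le_nat upt_append_split upt_conv_Cons)
  moreover have "map (blk r N) [1..<m] = map (blk r M) [1..<m]" "map (blk r N) [Suc m..<Suc n] = map (blk r M) [Suc m..<Suc n]"
    using assms by (intro map_cong refl; auto)+
  ultimately show ?thesis unfolding wrd_def by (simp only: map_append list.map concat_append concat.simps)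
qed

context
  fixes r i j :: nat
  assumes ij: "Suc j < r" "i = r - 2 - j"
begin

lemma node_letters: "Suc i = r - 1 - j" "2 * r - 2 - i = r + j" "Suc i < r" "i < r"
  using ij by auto

lemma csg_node: "csg r i t = (if t = i \<or> t = r + j then 1 else if t = Suc i \<or> t = Suc (r + j) then - 1 else 0)"
  unfolding csg_def node_letters(2) by (rule refl)

lemma letter_signs:
  "of_bool (lettr r M m i) - of_bool (lettr r M m (Suc i)) = asg M j (2 * m - 1)"
  "of_bool (lettr r M m (r + j)) - of_bool (lettr r M m (Suc (r + j))) = asg M j (2 * m)"
proof -
  have "r - 1 - i = Suc j" "r - 1 - Suc i = j" using ij by auto
  then show "of_bool (lettr r M m i) - of_bool (lettr r M m (Suc i)) = asg M j (2 * m - 1)"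
    using node_letters(3) by (simp add: lettr_def asg_def)
  show "of_bool (lettr r M m (r + j)) - of_bool (lettr r M m (Suc (r + j))) = asg M j (2 * m)"
    by (simp add: lettr_def asg_def)
qed

lemma blk_low: "seq (map (csg r i) (filter (lettr r M m) [0..<r])) [asg M j (2 * m - 1)]"
proof -
  have s: "[0..<r] = [0..<i] @ [i, Suc i] @ [Suc (Suc i)..<r]" using node_letters by (intro upt_split2) auto
  have "seq (map (csg r i) (filter (lettr r M m) [0..<r])) ([] @ [asg M j (2 * m - 1)] @ [])"
    unfolding s filter_append map_append
  proof (intro seq_append)
    show "seq (map (csg r i) (filter (lettr r M m) [i, Suc i])) [asg M j (2 * m - 1)]"
      using csg_pair_filter[of i i r "lettr r M m"] node_letters letter_signs by simp
  qed (rule csg_neutral_upt; use node_letters(3) in \<open>auto simp: csg_node\<close>)+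
  then show ?thesis by simp
qed

lemma blk_high: "seq (map (csg r i) (filter (lettr r M m) [r..<2 * r])) [asg M j (2 * m)]"
proof -
  have s: "[r..<2 * r] = [r..<r + j] @ [r + j, Suc (r + j)] @ [Suc (Suc (r + j))..<2 * r]"
    using node_letters ij by (intro upt_split2) auto
  have "seq (map (csg r i) (filter (lettr r M m) [r..<2 * r])) ([] @ [asg M j (2 * m)] @ [])"
    unfolding s filter_append map_append
  proof (intro seq_append)
    show "seq (map (csg r i) (filter (lettr r M m) [r + j, Suc (r + j)])) [asg M j (2 * m)]"
      using csg_pair_filter[of "r + j" i r "lettr r M m"] node_letters letter_signs by simp
  qed (rule csg_neutral_upt; use node_letters(3) in \<open>auto simp: csg_node\<close>)+
  then show ?thesis by simp
qed

text \<open>Listing the columns without \<open>2m - 1\<close> in reverse order gives the same sign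
  as listing those with it in the given order. Hence at node \<open>r - 2 - j\<close> a block reads
  like the letters \<open>2m - 1\<close> and \<open>2m\<close> of columns \<open>j\<close> and
  \<open>Suc j\<close>.\<close>

lemma blk_signs: "seq (map (csg r i) (blk r M m)) [asg M j (2 * m - 1), asg M j (2 * m)]"
proof -
  have "[0..<2 * r] = [0..<r] @ [r..<2 * r]" by (intro upt_append_split) auto
  then show ?thesis
    unfolding blk_def using seq_append[OF blk_low blk_high] by simp
qed

lemma blks_signs:
  assumes "1 \<le> a" "a \<le> b"
  shows "seq (map (csg r i) (concat (map (blk r M) [a..<b]))) (map (asg M j) [2 * a - 1..<2 * b - 1])"
  using assms(2)
proof (induction b rule: dec_induct)
  case (step b)
  have "[2 * a - 1..<2 * Suc b - 1] = [2 * a - 1..<2 * b - 1] @ [2 * b - 1..<2 * Suc b - 1]"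
    using step assms by (intro upt_append_split) auto
  also have "[2 * b - 1..<2 * Suc b - 1] = [2 * b - 1, 2 * b]"
    using step assms by (simp add: upt_rec)
  finally have s: "[2 * a - 1..<2 * Suc b - 1] = [2 * a - 1..<2 * b - 1] @ [2 * b - 1, 2 * b]" .
  show ?case unfolding s using step seq_append[OF step.IH blk_signs[of M b]] by simp
qed (simp add: seq_refl)

lemma wrd_signs:
  assumes "0 \<notin> M j" "0 \<notin> M (Suc j)"
  shows "seq (map (csg r i) (wrd n r M)) (map (asg M j) [0..<2 * n + 1])"
proof -
  have "seq [asg M j 0] []" using assms by (simp add: asg_def seq_def)
  moreover have "seq (map (csg r i) (wrd n r M)) (map (asg M j) [1..<2 * n + 1])"
    unfolding wrd_def using blks_signs[of 1 "Suc n" M] by simp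
  ultimately have "seq ([asg M j 0] @ map (asg M j) [1..<2 * n + 1]) ([] @ map (csg r i) (wrd n r M))"
    using seq_append seq_sym by blast
  moreover have "[0..<2 * n + 1] = 0 # [1..<2 * n + 1]" by (simp add: upt_rec)
  ultimately show ?thesis using seq_sym by simp
qed

lemma glstep_cstep:
  assumes st: "glstep n j M N" and M: "0 \<notin> M j" "0 \<notin> M (Suc j)"
  shows "cstep r i (wrd n r M) (wrd n r N)"
proof -
  obtain p where p: "ctx (asg M j) (2 * n + 1) p" "asg M j p = - 1"
    "N = M(j := insert p (M j), Suc j := M (Suc j) - {p})" using st by (auto simp: glstep_def)
  have pM: "p \<notin> M j" "p \<in> M (Suc j)" using p(2) by (auto simp: asg_def of_bool_def split: if_splits)
  have p0: "p \<noteq> 0" using pM M by metis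
  define m where "m = (p + 1) div 2"
  have m: "1 \<le> m" "m \<le> n" "p = 2 * m - 1 \<or> p = 2 * m"
    using p0 p(1) by (auto simp: m_def ctx_def)
  have other: "blk r N k = blk r M k" if "k \<noteq> m" "1 \<le> k" for k
  proof -
    have "2 * k - 1 \<noteq> p" "2 * k \<noteq> p" using that m by presburger+
    then show ?thesis unfolding blk_def p(3) by (intro filter_cong) (auto simp: lettr_def)
  qed
  let ?A = "concat (map (blk r M) [1..<m])" and ?B = "concat (map (blk r M) [Suc m..<Suc n])"
  note wM = wrd_split[OF m(1,2), of r M M, OF refl]
  have wN: "wrd n r N = ?A @ blk r N m @ ?B" by (rule wrd_split) (use m(1,2) other in auto)
  have A: "seq (map (csg r i) ?A) (map (asg M j) [1..<2 * m - 1])" using blks_signs[of 1 m M] m by simp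
  have B: "seq (map (csg r i) ?B) (map (asg M j) [Suc (2 * m)..<2 * n + 1])"
    using blks_signs[of "Suc m" "Suc n" M] m by simp
  have up: "up (map (asg M j) [1..<p]) = 0"
  proof -
    have s: "[0..<p] = [0] @ [1..<p]" using p0 by (simp add: upt_rec)
    have "up (map (asg M j) [0..<p]) = 0" using p(1) by (simp add: ctx_def)
    then show ?thesis unfolding s map_append by (rule up_append_0)
  qed
  have dn: "dn (map (asg M j) [Suc p..<2 * n + 1]) = 0" using p(1) by (simp add: ctx_def)
  \<comment> \<open>Moving \<open>2m\<close> to the left lowers the letter
    \<open>Suc (r + j)\<close>. Moving \<open>2m - 1\<close> to the left moves its absence to the
    right, which lowers the letter \<open>Suc i\<close>.\<close>
  define t where "t = (if p = 2 * m then Suc (r + j) else Suc i)"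
  have tt: "0 < t" "t < 2 * r" "lettr r M m t" "\<not> lettr r M m (t - 1)" "\<not> lettr r N m t" "lettr r N m (t - 1)"
    using pM m node_letters ij unfolding t_def p(3) by (auto simp: lettr_def)
  have tsg: "csg r i t = - 1" unfolding t_def csg_node using node_letters(3) by auto
  have oth: "lettr r N m s = lettr r M m s" if "s \<noteq> t" "s \<noteq> t - 1" "s < 2 * r" for s
    using that pM m node_letters ij le_add_diff_inverse[of r s] unfolding t_def p(3) by (cases "s < r") (auto simp: lettr_def split: if_splits)
  let ?a = "filter (lettr r M m) [0..<t - 1]" and ?b = "filter (lettr r M m) [Suc t..<2 * r]"
  have st: "[0..<2 * r] = [0..<t - 1] @ [t - 1, t] @ [Suc t..<2 * r]"
    using upt_split2[of 0 "t - 1" "2 * r"] tt by simp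
  have bM: "blk r M m = ?a @ t # ?b" unfolding blk_def st using tt by simp
  have "filter (lettr r N m) [0..<t - 1] = ?a" "filter (lettr r N m) [Suc t..<2 * r] = ?b"
    using oth tt by (intro filter_cong; auto)+
  then have bN: "blk r N m = ?a @ (t - 1) # ?b" unfolding blk_def st using tt by simp
  have ab: "seq (map (csg r i) ?a) (map (asg M j) [2 * m - 1..<p]) \<and> seq (map (csg r i) ?b) (map (asg M j) [Suc p..<Suc (2 * m)])"
  proof (cases "p = 2 * m")
    case True
    have "[0..<t - 1] = [0..<r] @ [r..<r + j]" using True t_def by (simp add: upt_append_split)
    moreover have "seq (map (csg r i) (filter (lettr r M m) [r..<r + j])) []"
      by (rule csg_neutral_upt) (use node_letters(3) in \<open>auto simp: csg_node\<close>)
    ultimately have "seq (map (csg r i) ?a) ([asg M j (2 * m - 1)] @ [])"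
      using seq_append[OF blk_low] by simp
    moreover have "seq (map (csg r i) ?b) []"
      by (rule csg_neutral_upt) (use node_letters(3) True t_def in \<open>auto simp: csg_node\<close>)
    moreover have "[2 * m - 1..<p] = [2 * m - 1]" using True m by (simp add: upt_rec)
    ultimately show ?thesis using True by simp
  next
    case False
    then have pp: "p = 2 * m - 1" "t = Suc i" using m t_def by auto
    have sb: "[Suc t..<2 * r] = [Suc t..<r] @ [r..<2 * r]" using pp node_letters by (intro upt_append_split) auto
    have nb: "seq (map (csg r i) (filter (lettr r M m) [Suc t..<r])) []"
      by (rule csg_neutral_upt) (use node_letters(3) pp(2) in \<open>auto simp: csg_node\<close>)
    have "seq (map (csg r i) ?b) ([] @ [asg M j (2 * m)])"
      unfolding sb filter_append map_append by (rule seq_append[OF nb blk_high])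
    moreover have "seq (map (csg r i) ?a) []"
      by (rule csg_neutral_upt) (use node_letters(3) pp(2) in \<open>auto simp: csg_node\<close>)
    moreover have "[Suc p..<Suc (2 * m)] = [2 * m]" using pp m by (simp add: upt_rec)
    ultimately show ?thesis using pp by simp
  qed
  have "up (map (csg r i) (?A @ ?a)) = 0"
  proof -
    have "[1..<p] = [1..<2 * m - 1] @ [2 * m - 1..<p]" using m by (intro upt_append_split) auto
    then show ?thesis using seq_up[OF seq_append[OF A conjunct1[OF ab]]] up by simp
  qed
  moreover have "dn (map (csg r i) (?b @ ?B)) = 0"
  proof -
    have "[Suc p..<2 * n + 1] = [Suc p..<Suc (2 * m)] @ [Suc (2 * m)..<2 * n + 1]" using m by (intro upt_append_split) auto
    then show ?thesis using seq_dn[OF seq_append[OF conjunct2[OF ab] B]] dn by simp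
  qed
  ultimately have "cstep r i ((?A @ ?a) @ t # (?b @ ?B)) ((?A @ ?a) @ (t - 1) # (?b @ ?B))"
    using tsg node_letters(4) by (intro cstepI)
  then show ?thesis unfolding wM wN bM bN by simp
qed

end

lemma zsg_neg_iff: "zsg M m = - 1 \<longleftrightarrow> m \<noteq> 0 \<and> 2 * m - 1 \<in> M 0 \<and> 2 * m \<in> M 0"
  and zsg_pos_iff: "zsg M m = 1 \<longleftrightarrow> m \<noteq> 0 \<and> 2 * m - 1 \<notin> M 0 \<and> 2 * m \<notin> M 0"
  and asg_neg_iff: "asg M j p = - 1 \<longleftrightarrow> p \<notin> M j \<and> p \<in> M (Suc j)"
  and asg_pos_iff: "asg M j p = 1 \<longleftrightarrow> p \<in> M j \<and> p \<notin> M (Suc j)"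
  by (auto simp: zsg_def asg_def of_bool_def)

lemma ctx_less: "ctx f N q \<Longrightarrow> q < N"
  by (simp add: ctx_def)

lemma csg_last: "0 < r \<Longrightarrow> csg r (r - 1) t = (if t = r - 1 then 1 else if t = r then - 1 else 0)"
  by (auto simp: csg_def)

lemma blk_signs_0:
  assumes "0 < r" "1 \<le> m"
  shows "seq (map (csg r (r - 1)) (blk r M m)) [zsg M m]"
proof -
  obtain s where r: "r = Suc s" using assms by (cases r) auto
  have sp: "[0..<2 * r] = [0..<s] @ [s, Suc s] @ [Suc (Suc s)..<2 * r]" using r by (intro upt_split2) auto
  have "seq (map (csg r (r - 1)) (blk r M m)) ([] @ [zsg M m] @ [])"
    unfolding blk_def sp filter_append map_append
  proof (intro seq_append)
    show "seq (map (csg r (r - 1)) (filter (lettr r M m) [s, Suc s])) [zsg M m]"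
      using assms unfolding r by (auto simp: seq_def csg_def lettr_def zsg_def)
  qed (rule csg_neutral_upt; use r csg_last[OF assms(1)] in auto)+
  then show ?thesis by simp
qed

lemma blks_signs_0:
  assumes "0 < r" "1 \<le> a" "a \<le> b"
  shows "seq (map (csg r (r - 1)) (concat (map (blk r M) [a..<b]))) (map (zsg M) [a..<b])"
  using assms(3)
proof (induction b rule: dec_induct)
  case (step b)
  then show ?case using seq_append[OF step.IH blk_signs_0[OF assms(1), of b M]] assms(2) by simp
qed (simp add: seq_refl)

lemma wrd_signs_0:
  assumes "0 < r"
  shows "seq (map (csg r (r - 1)) (wrd n r M)) (map (zsg M) [0..<Suc n])"
proof -
  have "seq [zsg M 0] []" by (simp add: zsg_def seq_def)
  moreover have "seq (map (csg r (r - 1)) (wrd n r M)) (map (zsg M) [1..<Suc n])"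
    unfolding wrd_def using blks_signs_0[OF assms, of 1 "Suc n" M] by simp
  ultimately have "seq ([zsg M 0] @ map (zsg M) [1..<Suc n]) ([] @ map (csg r (r - 1)) (wrd n r M))"
    using seq_append seq_sym by blast
  moreover have "[0..<Suc n] = 0 # [1..<Suc n]" by (simp add: upt_rec)
  ultimately show ?thesis using seq_sym by simp
qed

text \<open>In block \<open>m\<close>, losing \<open>2m\<close> from column 0 deletes the letter
  \<open>r\<close> and losing \<open>2m - 1\<close> creates the letter \<open>r - 1\<close>:
  together one step at the long root.\<close>

lemma zstep_cstep:
  assumes st: "zstep n M N" and r: "0 < r"
  shows "cstep r (r - 1) (wrd n r M) (wrd n r N)"
proof -
  obtain m where m: "ctx (zsg M) (Suc n) m" "zsg M m = - 1" "N = M(0 := M 0 - {2 * m - 1, 2 * m})"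
    using st by (auto simp: zstep_def)
  have mM: "1 \<le> m" "m \<le> n" "2 * m - 1 \<in> M 0" "2 * m \<in> M 0"
    using ctx_less[OF m(1)] m(2) unfolding zsg_neg_iff by auto
  have other: "blk r N k = blk r M k" if "k \<noteq> m" "1 \<le> k" for k
  proof -
    have "2 * k - 1 \<noteq> 2 * m - 1" "2 * k \<noteq> 2 * m - 1" "2 * k - 1 \<noteq> 2 * m" "2 * k \<noteq> 2 * m"
      using that mM by presburger+
    then show ?thesis unfolding blk_def m(3) by (intro filter_cong) (auto simp: lettr_def)
  qed
  let ?A = "concat (map (blk r M) [1..<m])" and ?B = "concat (map (blk r M) [Suc m..<Suc n])"
  note wM = wrd_split[OF mM(1,2), of r M M, OF refl]
  have wN: "wrd n r N = ?A @ blk r N m @ ?B" by (rule wrd_split) (use mM(1,2) other in auto)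
  have A: "seq (map (csg r (r - 1)) ?A) (map (zsg M) [1..<m])" using blks_signs_0[OF r, of 1 m M] mM by simp
  have B: "seq (map (csg r (r - 1)) ?B) (map (zsg M) [Suc m..<Suc n])"
    using blks_signs_0[OF r, of "Suc m" "Suc n" M] mM by simp
  have up: "up (map (zsg M) [1..<m]) = 0"
  proof -
    have s: "[0..<m] = [0] @ [1..<m]" using mM by (simp add: upt_rec)
    have "up (map (zsg M) [0..<m]) = 0" using m(1) by (simp add: ctx_def)
    then show ?thesis unfolding s map_append by (rule up_append_0)
  qed
  have dn: "dn (map (zsg M) [Suc m..<Suc n]) = 0" using m(1) by (simp add: ctx_def)
  have tt: "lettr r M m r" "\<not> lettr r M m (r - 1)" "\<not> lettr r N m r" "lettr r N m (r - 1)"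
    using mM r unfolding m(3) by (auto simp: lettr_def)
  have oth: "lettr r N m s = lettr r M m s" if "s \<noteq> r" "s \<noteq> r - 1" for s
    using that mM r unfolding m(3) by (auto simp: lettr_def)
  let ?a = "filter (lettr r M m) [0..<r - 1]" and ?b = "filter (lettr r M m) [Suc r..<2 * r]"
  have st: "[0..<2 * r] = [0..<r - 1] @ [r - 1, r] @ [Suc r..<2 * r]"
    using upt_split2[of 0 "r - 1" "2 * r"] r by simp
  have bM: "blk r M m = ?a @ r # ?b" unfolding blk_def st using tt by simp
  have "filter (lettr r N m) [0..<r - 1] = ?a" "filter (lettr r N m) [Suc r..<2 * r] = ?b"
    using oth by (intro filter_cong; auto)+
  then have bN: "blk r N m = ?a @ (r - 1) # ?b" unfolding blk_def st using tt by simp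
  have "seq (map (csg r (r - 1)) ?a) []" "seq (map (csg r (r - 1)) ?b) []"
    by (rule csg_neutral_upt; use r csg_last[OF r] in auto)+
  note a = seq_append[OF A this(1)] and b = seq_append[OF this(2) B]
  have "up (map (csg r (r - 1)) (?A @ ?a)) = 0" using seq_up[OF a] up by simp
  moreover have "dn (map (csg r (r - 1)) (?b @ ?B)) = 0" using seq_dn[OF b] dn by simp
  ultimately have "cstep r (r - 1) ((?A @ ?a) @ r # (?b @ ?B)) ((?A @ ?a) @ (r - 1) # (?b @ ?B))"
    using r csg_last[OF r, of r] by (intro cstepI) auto
  then show ?thesis unfolding wM wN bM bN by simp
qed

section \<open>The type C crystal on arrays\<close>

text \<open>Nodes run against the columns: node \<open>i\<close> moves letters between columns
  \<open>r - 2 - i\<close> and \<open>r - 1 - i\<close>, and the last node, the long root, acts on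
  column 0 alone.\<close>

definition astep :: "nat \<Rightarrow> nat \<Rightarrow> nat \<Rightarrow> array \<Rightarrow> array \<Rightarrow> bool" where
  "astep n r i M N \<longleftrightarrow> i < r \<and> M \<in> arrays n r \<and> (if Suc i = r then zstep n M N else glstep n (r - 2 - i) M N)"

definition alist :: "nat \<Rightarrow> nat \<Rightarrow> nat \<Rightarrow> array \<Rightarrow> int list" where
  "alist n r i M = (if Suc i = r then map (zsg M) [0..<Suc n] else map (asg M (r - 2 - i)) [0..<2 * n + 1])"

lemma arrays_iff: "M \<in> arrays n r \<longleftrightarrow> (\<forall>j q. q \<in> M j \<longrightarrow> j < r \<and> 1 \<le> q \<and> q \<le> 2 * n)"
proof
  assume M: "M \<in> arrays n r"
  show "\<forall>j q. q \<in> M j \<longrightarrow> j < r \<and> 1 \<le> q \<and> q \<le> 2 * n"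
  proof (intro allI impI)
    fix j q assume q: "q \<in> M j"
    then have "j < r" using M unfolding arrays_def by (cases "j < r") auto
    then show "j < r \<and> 1 \<le> q \<and> q \<le> 2 * n" using M q unfolding arrays_def by force
  qed
next
  assume M: "\<forall>j q. q \<in> M j \<longrightarrow> j < r \<and> 1 \<le> q \<and> q \<le> 2 * n"
  then have "M j \<subseteq> {1..2 * n}" for j by auto
  moreover have "M j = {}" if "r \<le> j" for j using M that by (metis equals0I not_le)
  ultimately show "M \<in> arrays n r" unfolding arrays_def by blast
qed

lemma arrays_bd: "M \<in> arrays n r \<Longrightarrow> q \<in> M j \<Longrightarrow> j < r \<and> 1 \<le> q \<and> q \<le> 2 * n"
  unfolding arrays_iff by blast

lemma arrays_0: "M \<in> arrays n r \<Longrightarrow> 0 \<notin> M j"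
  using arrays_bd by fastforce

lemma astep_arrays:
  assumes "astep n r i M N"
  shows "N \<in> arrays n r"
proof (cases "Suc i = r")
  case True
  then show ?thesis using assms unfolding astep_def zstep_def arrays_iff by (auto split: if_splits)
next
  case False
  then obtain p where p: "asg M (r - 2 - i) p = - 1" "N = M(r - 2 - i := insert p (M (r - 2 - i)), Suc (r - 2 - i) := M (Suc (r - 2 - i)) - {p})"
    using assms by (auto simp: astep_def glstep_def)
  have M: "M \<in> arrays n r" "i < r" using assms by (auto simp: astep_def)
  have "p \<in> M (Suc (r - 2 - i))" using p(1) unfolding asg_neg_iff by auto
  then have "1 \<le> p \<and> p \<le> 2 * n" using arrays_bd M by blast
  then show ?thesis using M False unfolding p(2) arrays_iff by (auto split: if_splits)
qed

lemma astep_cstep: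
  assumes "astep n r i M N"
  shows "cstep r i (wrd n r M) (wrd n r N)"
proof (cases "Suc i = r")
  case True
  then have "i = r - 1" "0 < r" by auto
  then show ?thesis using assms zstep_cstep True by (simp add: astep_def)
next
  case False
  then show ?thesis using assms glstep_cstep[of "r - 2 - i" r i n M N] arrays_0 by (auto simp: astep_def)
qed

lemma alist_signs:
  assumes "i < r" "M \<in> arrays n r"
  shows "seq (map (csg r i) (wrd n r M)) (alist n r i M)"
proof (cases "Suc i = r")
  case True
  then have "i = r - 1" "0 < r" by auto
  then show ?thesis using wrd_signs_0 True by (simp add: alist_def)
next
  case False
  then show ?thesis using wrd_signs[of "r - 2 - i" r i M n] assms arrays_0 by (auto simp: alist_def)
qed

lemma asg_bounds: "- 1 \<le> asg M j p" "asg M j p \<le> 1" and zsg_bounds: "- 1 \<le> zsg M p" "zsg M p \<le> 1"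
  by (auto simp: asg_def zsg_def)

lemma ex_astep:
  assumes "i < r" "M \<in> arrays n r" "0 < dn (alist n r i M)"
  shows "\<exists>N. astep n r i M N"
proof (cases "Suc i = r")
  case True
  then obtain m where "zsg M m = - 1" "ctx (zsg M) (Suc n) m"
    using ctx_exists_neg[of "zsg M" "Suc n", OF zsg_bounds(1)] assms(3) unfolding alist_def if_P[OF True] by blast
  then show ?thesis using assms True unfolding astep_def zstep_def by auto
next
  case False
  then obtain m where "asg M (r - 2 - i) m = - 1" "ctx (asg M (r - 2 - i)) (2 * n + 1) m"
    using ctx_exists_neg[of "asg M (r - 2 - i)" "2 * n + 1", OF asg_bounds(1)] assms(3) unfolding alist_def if_not_P[OF False] by blast
  then show ?thesis using assms False unfolding astep_def glstep_def by auto
qed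

lemma ex_inv_astep:
  assumes "i < r" "M \<in> arrays n r" "0 < up (alist n r i M)"
  shows "\<exists>N. astep n r i N M"
proof (cases "Suc i = r")
  case True
  then obtain m where m: "zsg M m = 1" "ctx (zsg M) (Suc n) m"
    using ctx_exists_pos[of "zsg M" "Suc n", OF zsg_bounds(2)] assms(3) unfolding alist_def if_P[OF True] by blast
  have mM: "1 \<le> m" "m \<le> n" "2 * m - 1 \<notin> M 0" "2 * m \<notin> M 0"
    using m(1) ctx_less[OF m(2)] unfolding zsg_pos_iff by auto
  define N where "N = M(0 := M 0 \<union> {2 * m - 1, 2 * m})"
  have "zsg N k = zsg M k" if "k \<noteq> m" for k
  proof -
    have "k = 0 \<or> (2 * k - 1 \<noteq> 2 * m - 1 \<and> 2 * k \<noteq> 2 * m - 1 \<and> 2 * k - 1 \<noteq> 2 * m \<and> 2 * k \<noteq> 2 * m)"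
      using that mM by presburger
    then show ?thesis by (auto simp: N_def zsg_def)
  qed
  then have "ctx (zsg N) (Suc n) m" using m(2) ctx_cong[of "Suc n" m "zsg N" "zsg M"] by simp
  moreover have "zsg N m = - 1" using mM by (simp add: N_def zsg_def)
  moreover have "M = N(0 := N 0 - {2 * m - 1, 2 * m})" using mM by (auto simp: N_def fun_eq_iff)
  moreover have "N \<in> arrays n r" using assms(1,2) mM unfolding N_def arrays_iff by (auto split: if_splits)
  ultimately show ?thesis using assms True unfolding astep_def zstep_def by auto
next
  case False
  let ?j = "r - 2 - i"
  obtain p where p: "asg M ?j p = 1" "ctx (asg M ?j) (2 * n + 1) p"
    using ctx_exists_pos[of "asg M (r - 2 - i)" "2 * n + 1", OF asg_bounds(2)] assms(3) unfolding alist_def if_not_P[OF False] by blast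
  have pM: "p \<in> M ?j" "p \<notin> M (Suc ?j)" using p(1) unfolding asg_pos_iff by auto
  define N where "N = M(?j := M ?j - {p}, Suc ?j := insert p (M (Suc ?j)))"
  have "ctx (asg N ?j) (2 * n + 1) p"
    using p(2) ctx_cong[of "2 * n + 1" p "asg N ?j" "asg M ?j"] by (simp add: asg_def N_def)
  moreover have "asg N ?j p = - 1" using pM by (simp add: N_def asg_def)
  moreover have "M = N(?j := insert p (N ?j), Suc ?j := N (Suc ?j) - {p})" using pM by (auto simp: N_def fun_eq_iff)
  moreover have "N \<in> arrays n r" using assms(1,2) False arrays_bd[OF assms(2) pM(1)] unfolding N_def arrays_iff by (auto split: if_splits)
  ultimately show ?thesis using assms False unfolding astep_def glstep_def by metis
qed

lemma set_wrd: "set (wrd n r M) \<subseteq> {..<2 * r}"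
  by (auto simp: wrd_def blk_def)

lemma length_wrd: "length (wrd n r M) \<le> 2 * r * n"
proof -
  have l: "length (blk r M m) \<le> 2 * r" for m unfolding blk_def using length_filter_le[of _ "[0..<2 * r]"] by simp
  have "length (concat (map (blk r M) [1..<Suc k])) \<le> 2 * r * k" for k
    by (induction k) (use l in \<open>auto simp: add_le_mono algebra_simps\<close>)
  then show ?thesis by (simp add: wrd_def)
qed

definition letter_count :: "nat \<Rightarrow> array \<Rightarrow> nat \<Rightarrow> nat" where
  "letter_count r M q = (\<Sum>j<r. of_bool (q \<in> M j))"

definition ew :: "nat \<Rightarrow> array \<Rightarrow> nat \<Rightarrow> int" where
  "ew r M m = int (letter_count r M (2 * m)) - int (letter_count r M (2 * m - 1))"

lemma length_filter_sum: "length (filter P [0..<k]) = (\<Sum>t<k. of_bool (P t))"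
  by (induction k) auto

lemma sum_lessThan_add: "(\<Sum>t<a + b. f t) = (\<Sum>t<a. f t) + (\<Sum>t<b. f (a + t))" for f :: "nat \<Rightarrow> nat"
  by (induction b) (simp_all add: add.assoc)

lemma length_blk: "int (length (blk r M m)) = int r + ew r M m"
proof -
  have "length (blk r M m) = (\<Sum>t<r. of_bool (lettr r M m t)) + (\<Sum>t<r. of_bool (lettr r M m (r + t)))"
    unfolding blk_def length_filter_sum mult_2 sum_lessThan_add ..
  also have "(\<Sum>t<r. of_bool (lettr r M m (r + t))) = letter_count r M (2 * m)"
    by (simp only: letter_count_def lettr_def not_add_less1 if_False add_diff_cancel_left')
  also have "(\<Sum>t<r. of_bool (lettr r M m t)) = (\<Sum>t<r. (\<lambda>j. of_bool (2 * m - 1 \<notin> M j)) (r - Suc t))"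
    by (intro sum.cong) (auto simp: lettr_def)
  also have "\<dots> = (\<Sum>j<r. of_bool (2 * m - 1 \<notin> M j))" by (rule sum.nat_diff_reindex)
  finally have "length (blk r M m) = (\<Sum>j<r. of_bool (2 * m - 1 \<notin> M j)) + letter_count r M (2 * m)" .
  moreover have "(\<Sum>j<r. of_bool (2 * m - 1 \<notin> M j)) + letter_count r M (2 * m - 1) = r"
    unfolding letter_count_def sum.distrib[symmetric] by (simp add: of_bool_def if_distrib cong: if_cong)
  ultimately show ?thesis unfolding ew_def by linarith
qed

text \<open>A word does not show where its blocks end. By \<open>length_blk\<close> the block
  lengths are given by \<open>ew\<close>, which no move changes.\<close>

lemma wrd_inj:
  assumes "M \<in> arrays n r" "N \<in> arrays n r" "wrd n r M = wrd n r N" "ew r M = ew r N"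
  shows "M = N"
proof -
  have l: "length (blk r M m) = length (blk r N m)" for m
    using length_blk[of r M m] length_blk[of r N m] assms(4) by simp
  have "map (blk r M) [1..<Suc n] = map (blk r N) [1..<Suc n]"
    by (rule concat_injective) (use assms(3) l in \<open>auto simp: wrd_def zip_map1 zip_map2 zip_same_conv_map\<close>)
  then have b: "blk r M m = blk r N m" if "1 \<le> m" "m \<le> n" for m using that by auto
  have e: "lettr r M m t = lettr r N m t" if "1 \<le> m" "m \<le> n" "t < 2 * r" for m t
  proof -
    have "t \<in> set (blk r M m) \<longleftrightarrow> t \<in> set (blk r N m)" using b that by simp
    then show ?thesis using that by (simp add: blk_def)
  qed
  have "q \<in> M j \<longleftrightarrow> q \<in> N j" for q j
  proof (cases "j < r \<and> 1 \<le> q \<and> q \<le> 2 * n")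
    case True
    define m where "m = (q + 1) div 2"
    have m: "1 \<le> m" "m \<le> n" "q = 2 * m - 1 \<or> q = 2 * m" using True by (auto simp: m_def)
    show ?thesis
    proof (cases "q = 2 * m")
      case q: True
      then show ?thesis using e[OF m(1,2), of "r + j"] True by (simp add: lettr_def)
    next
      case q: False
      have "r - 1 - j < 2 * r" "r - 1 - j < r" "r - 1 - (r - 1 - j) = j" using True by auto
      then show ?thesis using e[OF m(1,2), of "r - 1 - j"] q m(3) by (simp add: lettr_def del: diff_diff_left)
    qed
  next
    case False
    then show ?thesis using arrays_bd assms(1,2) by blast
  qed
  then show ?thesis by auto
qed

lemma letter_count_glstep:
  assumes "glstep n j M N" "Suc j < r"
  shows "letter_count r N q = letter_count r M q"
proof -
  obtain p where p: "asg M j p = - 1" "N = M(j := insert p (M j), Suc j := M (Suc j) - {p})"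
    using assms by (auto simp: glstep_def)
  have pM: "p \<notin> M j" "p \<in> M (Suc j)" using p(1) unfolding asg_neg_iff by auto
  show ?thesis
  proof (cases "q = p")
    case True
    have "letter_count r N q = (\<Sum>x<r. (\<lambda>x. of_bool (p \<in> M x)) (if x = j then Suc j else if x = Suc j then j else x))"
      unfolding letter_count_def p(2) using True pM by (intro sum.cong) auto
    also have "\<dots> = letter_count r M q"
      unfolding letter_count_def True by (rule sum_transpose_Suc[OF assms(2)])
    finally show ?thesis .
  next
    case False
    then show ?thesis unfolding letter_count_def p(2) by (intro sum.cong) auto
  qed
qed

lemma letter_count_head: "0 < r \<Longrightarrow> letter_count r M q = of_bool (q \<in> M 0) + (\<Sum>j\<in>{1..<r}. of_bool (q \<in> M j))"
  unfolding letter_count_def lessThan_atLeast0 by (simp only: sum.atLeast_Suc_lessThan One_nat_def)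

lemma ew_astep:
  assumes "astep n r i M N"
  shows "ew r N = ew r M"
proof (cases "Suc i = r")
  case True
  then obtain m where m: "zsg M m = - 1" "N = M(0 := M 0 - {2 * m - 1, 2 * m})" and r: "0 < r"
    using assms by (auto simp: astep_def zstep_def)
  have mM: "1 \<le> m" "2 * m - 1 \<in> M 0" "2 * m \<in> M 0" using m(1) unfolding zsg_neg_iff by auto
  have s: "(\<Sum>j\<in>{1..<r}. of_bool (q \<in> N j)) = (\<Sum>j\<in>{1..<r}. of_bool (q \<in> M j) :: nat)" for q
    unfolding m(2) by (intro sum.cong) auto
  show ?thesis
  proof
    fix k
    show "ew r N k = ew r M k"
    proof (cases "k = m")
      case True
      then show ?thesis using mM unfolding ew_def letter_count_head[OF r] s by (simp add: m(2))
    next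
      case False
      then have "k = 0 \<or> (2 * k - 1 \<noteq> 2 * m - 1 \<and> 2 * k \<noteq> 2 * m - 1 \<and> 2 * k - 1 \<noteq> 2 * m \<and> 2 * k \<noteq> 2 * m)"
        using mM by presburger
      then show ?thesis unfolding ew_def letter_count_head[OF r] s by (auto simp: m(2))
    qed
  qed
next
  case False
  then have "letter_count r N q = letter_count r M q" for q
    using letter_count_glstep[of n "r - 2 - i" M N r q] assms by (auto simp: astep_def)
  then show ?thesis by (simp add: ew_def fun_eq_iff)
qed

definition ahigh :: "nat \<Rightarrow> nat \<Rightarrow> array \<Rightarrow> bool" where
  "ahigh n r M \<longleftrightarrow> (\<forall>i N. \<not> astep n r i M N)"

definition aconn :: "nat \<Rightarrow> nat \<Rightarrow> array \<Rightarrow> array \<Rightarrow> bool" where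
  "aconn n r = (\<lambda>M N. \<exists>i. astep n r i M N \<or> astep n r i N M)\<^sup>*\<^sup>*"

lemma aconn_sym: "aconn n r M N \<Longrightarrow> aconn n r N M"
  unfolding aconn_def by (rule sympD[OF symp_rtranclp]) (auto intro: sympI)

lemma aconn_trans: "aconn n r M N \<Longrightarrow> aconn n r N X \<Longrightarrow> aconn n r M X"
  unfolding aconn_def by (rule rtranclp_trans)

lemma aconn_step: "astep n r i M N \<Longrightarrow> aconn n r M N"
  unfolding aconn_def by blast

lemma aconn_ew: "aconn n r M N \<Longrightarrow> ew r N = ew r M"
  unfolding aconn_def by (induction rule: rtranclp_induct) (auto simp: ew_astep)

lemma aconn_arrays: "aconn n r M N \<Longrightarrow> M \<in> arrays n r \<Longrightarrow> N \<in> arrays n r"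
  unfolding aconn_def by (induction rule: rtranclp_induct) (auto simp: astep_arrays, auto simp: astep_def)

lemma aconn_wconn: "aconn n r M N \<Longrightarrow> wconn r (wrd n r M) (wrd n r N)"
  unfolding aconn_def
proof (induction rule: rtranclp_induct)
  case (step X Y)
  then obtain i where "cstep r i (wrd n r X) (wrd n r Y) \<or> cstep r i (wrd n r Y) (wrd n r X)"
    using astep_cstep by blast
  then show ?case using step.IH set_wrd unfolding wconn_def
    by (elim rtranclp.rtrancl_into_rtrancl) blast
qed (simp add: wconn_def)

lemma dn_alist: "i < r \<Longrightarrow> M \<in> arrays n r \<Longrightarrow> dn (map (csg r i) (wrd n r M)) = dn (alist n r i M)"
  by (rule seq_dn[OF alist_signs])

lemma up_alist: "i < r \<Longrightarrow> M \<in> arrays n r \<Longrightarrow> up (map (csg r i) (wrd n r M)) = up (alist n r i M)"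
  by (rule seq_up[OF alist_signs])

lemma ex_astep_iff:
  assumes "M \<in> arrays n r"
  shows "(\<exists>N. astep n r i M N) \<longleftrightarrow> (\<exists>x. cstep r i (wrd n r M) x)"
  using astep_cstep ex_cstep_iff dn_alist[OF _ assms] ex_astep[OF _ assms] by metis

lemma ahigh_whigh: "M \<in> arrays n r \<Longrightarrow> ahigh n r M \<longleftrightarrow> whigh r (wrd n r M)"
  unfolding ahigh_def whigh_def using ex_astep_iff by metis

theorem ahigh_unique:
  assumes "aconn n r M N" "ahigh n r M" "ahigh n r N" "M \<in> arrays n r"
  shows "M = N"
proof -
  have N: "N \<in> arrays n r" using aconn_arrays assms by blast
  have "wrd n r M = wrd n r N"
    using whigh_unique[OF aconn_wconn[OF assms(1)]] ahigh_whigh assms N set_wrd by metis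
  then show ?thesis using wrd_inj[OF assms(4) N] aconn_ew[OF assms(1)] by simp
qed

section \<open>Isomorphic components and fibres\<close>

text \<open>By \<open>length_wrd\<close> every word has length at most \<open>2 * r * n\<close>, so
  one padded width serves all arrays.\<close>

definition avmat :: "nat \<Rightarrow> nat \<Rightarrow> array \<Rightarrow> bmat" where
  "avmat n r M = vmat r (2 * r * n) (wrd n r M)"

text \<open>Column moves of the matrices commute with all crystal operators, so related arrays can
  copy each other's steps: they sit at the same place of isomorphic components.\<close>

definition aiso :: "nat \<Rightarrow> nat \<Rightarrow> array \<Rightarrow> array \<Rightarrow> bool" where
  "aiso n r M N \<longleftrightarrow> colconn (2 * r) (2 * (2 * r * n)) (avmat n r M) (avmat n r N)"

lemma aiso_sym: "aiso n r M N \<Longrightarrow> aiso n r N M"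
  unfolding aiso_def by (rule colconn_sym)

lemma aiso_trans: "aiso n r M N \<Longrightarrow> aiso n r N X \<Longrightarrow> aiso n r M X"
  unfolding aiso_def by (rule colconn_trans)

lemma astep_along_aiso:
  assumes "aiso n r M M'" "astep n r i M N" "M' \<in> arrays n r"
  shows "\<exists>N'. astep n r i M' N' \<and> aiso n r N N'"
proof -
  obtain x' where x': "cstep r i (wrd n r M') x'"
    "colconn (2 * r) (2 * (2 * r * n)) (vmat r (2 * r * n) (wrd n r N)) (vmat r (2 * r * n) x')"
    using cstep_along_colconn[OF _ astep_cstep[OF assms(2)] set_wrd length_wrd set_wrd length_wrd] assms(1)
    unfolding aiso_def avmat_def by blast
  then obtain N' where N': "astep n r i M' N'" using ex_astep_iff assms(3) by blast
  then have "wrd n r N' = x'" using cstep_det astep_cstep x'(1) by blast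
  then show ?thesis using N' x'(2) unfolding aiso_def avmat_def by blast
qed

lemma inv_astep_along_aiso:
  assumes "aiso n r N N'" "astep n r i M N" "N' \<in> arrays n r"
  shows "\<exists>M'. astep n r i M' N' \<and> aiso n r M M'"
proof -
  obtain x' where x': "cstep r i x' (wrd n r N')" "set x' \<subseteq> {..<2 * r}"
    "colconn (2 * r) (2 * (2 * r * n)) (vmat r (2 * r * n) (wrd n r M)) (vmat r (2 * r * n) x')"
    using inv_cstep_along_colconn[OF _ astep_cstep[OF assms(2)] set_wrd length_wrd set_wrd length_wrd] assms(1)
    unfolding aiso_def avmat_def by blast
  have i: "i < r" using assms(2) by (simp add: astep_def)
  obtain p where p: "ctx (wsg r i x') (length x') p" "wsg r i x' p = - 1" "wrd n r N' = x'[p := x' ! p - 1]"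
    using x'(1) by (auto simp: cstep_def)
  have pl: "p < length x'" using p(1) by (simp add: ctx_def)
  have "ctx (wsg r i (wrd n r N')) (length (wrd n r N')) p"
    using p(1) ctx_cong[of "length x'" p "wsg r i (wrd n r N')" "wsg r i x'"] unfolding p(3) by (simp add: wsg_def)
  moreover have "wsg r i (wrd n r N') p = 1"
    using p(2) pl i unfolding p(3) by (auto simp: wsg_def csg_def split: if_splits)
  ultimately have "0 < up (map (csg r i) (wrd n r N'))" using ctx_pos_up by (metis map_wsg)
  then obtain M' where M': "astep n r i M' N'" using ex_inv_astep[OF i assms(3)] up_alist[OF i assms(3)] by auto
  then have "wrd n r M' = x'" using cstep_inj astep_cstep x'(1,2) set_wrd by blast
  then show ?thesis using M' x'(3) unfolding aiso_def avmat_def by blast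
qed

lemma astep_inj: "astep n r i M X \<Longrightarrow> astep n r i N X \<Longrightarrow> M = N"
proof -
  assume a: "astep n r i M X" "astep n r i N X"
  then have "wrd n r M = wrd n r N" using cstep_inj astep_cstep set_wrd by blast
  moreover have "M \<in> arrays n r" "N \<in> arrays n r" using a by (simp_all add: astep_def)
  moreover have "ew r M = ew r N" using a ew_astep by metis
  ultimately show "M = N" using wrd_inj by blast
qed

text \<open>The nodes are recorded, so that a path can be copied in an isomorphic component and
  retraced from its end.\<close>

fun apath :: "nat \<Rightarrow> nat \<Rightarrow> nat list \<Rightarrow> array \<Rightarrow> array \<Rightarrow> bool" where
  "apath n r [] M N \<longleftrightarrow> M = N"
| "apath n r (i # is) M N \<longleftrightarrow> (\<exists>X. astep n r i M X \<and> apath n r is X N)"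

lemma apath_inj: "apath n r is M X \<Longrightarrow> apath n r is N X \<Longrightarrow> M = N"
proof (induction "is" arbitrary: M N)
  case (Cons i "is")
  obtain A B where "astep n r i M A" "apath n r is A X" "astep n r i N B" "apath n r is B X"
    using Cons.prems by auto
  then show ?case using Cons.IH[of A B] astep_inj by blast
qed simp

lemma apath_aconn: "apath n r is M N \<Longrightarrow> aconn n r M N"
proof (induction "is" arbitrary: M)
  case Nil
  then show ?case by (simp add: aconn_def)
next
  case (Cons i "is")
  then obtain A where "astep n r i M A" "apath n r is A N" by auto
  then show ?case using Cons.IH aconn_step aconn_trans by blast
qed

lemma apath_along_aiso:
  assumes "apath n r is M N" "aiso n r M M'" "M' \<in> arrays n r"
  shows "\<exists>N'. apath n r is M' N' \<and> aiso n r N N'"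
  using assms
proof (induction "is" arbitrary: M M')
  case (Cons i "is")
  then obtain A where A: "astep n r i M A" "apath n r is A N" by auto
  then obtain A' where "astep n r i M' A'" "aiso n r A A'" using astep_along_aiso Cons.prems by blast
  then show ?case using Cons.IH[OF A(2)] astep_arrays by fastforce
qed auto

lemma inv_apath_along_aiso:
  assumes "apath n r is M N" "aiso n r N N'" "N' \<in> arrays n r"
  shows "\<exists>M'. apath n r is M' N' \<and> aiso n r M M' \<and> M' \<in> arrays n r"
  using assms
proof (induction "is" arbitrary: M)
  case (Cons i "is")
  then obtain A where A: "astep n r i M A" "apath n r is A N" by auto
  then obtain A' where A': "apath n r is A' N'" "aiso n r A A'" "A' \<in> arrays n r" using Cons by blast
  then obtain M' where "astep n r i M' A'" "aiso n r M M'" using inv_astep_along_aiso A by blast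
  moreover from this(1) have "M' \<in> arrays n r" by (simp add: astep_def)
  ultimately show ?case using A'(1) by auto
qed auto

lemma count_list_wrd:
  assumes "t < 2 * r"
  shows "count_list (wrd n r M) t = (\<Sum>m\<in>{1..n}. of_bool (lettr r M m t))"
proof -
  have b: "count_list (filter P [0..<k]) t = of_bool (P t \<and> t < k)" for P k
    by (induction k) auto
  have "count_list (concat (map (blk r M) [1..<Suc k])) t = (\<Sum>m\<in>{1..k}. of_bool (lettr r M m t))" for k
    by (induction k) (use assms b in \<open>auto simp: blk_def\<close>)
  then show ?thesis by (simp only: wrd_def)
qed

lemma card_column:
  assumes "M \<in> arrays n r"
  shows "card (M j) = (\<Sum>m\<in>{1..n}. of_bool (2 * m - 1 \<in> M j)) + (\<Sum>m\<in>{1..n}. of_bool (2 * m \<in> M j))"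
proof -
  have c: "card {q \<in> M j. q \<le> 2 * k} = (\<Sum>m\<in>{1..k}. of_bool (2 * m - 1 \<in> M j)) + (\<Sum>m\<in>{1..k}. of_bool (2 * m \<in> M j))" for k
  proof (induction k)
    case 0
    have "{q \<in> M j. q \<le> 2 * 0} = {}" using arrays_0[OF assms, of j] by auto
    then show ?case by simp
  next
    case (Suc k)
    have "{q \<in> M j. q \<le> 2 * Suc k} = {q \<in> M j. q \<le> 2 * k} \<union> ({2 * Suc k - 1} \<inter> M j) \<union> ({2 * Suc k} \<inter> M j)"
      by auto
    also have "card \<dots> = card {q \<in> M j. q \<le> 2 * k} + card ({2 * Suc k - 1} \<inter> M j) + card ({2 * Suc k} \<inter> M j)"
      by (subst card_Un_disjoint; (subst card_Un_disjoint)?) auto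
    also have "card ({x} \<inter> M j) = of_bool (x \<in> M j)" for x by auto
    finally show ?case using Suc by simp
  qed
  have "{q \<in> M j. q \<le> 2 * n} = M j" using arrays_bd[OF assms] by auto
  then show ?thesis using c[of n] by simp
qed

text \<open>The type C weight of an array consists of the differences between \<open>n\<close> and
  its column heights. Through this, equal heights become equal row sums.\<close>

lemma rowsum_avmat:
  assumes "M \<in> arrays n r" "t < r"
  shows "rowsum (2 * (2 * r * n)) (avmat n r M) t + card (M (r - 1 - t)) = 2 * r * n + n"
    "rowsum (2 * (2 * r * n)) (avmat n r M) (r + t) + n = 2 * r * n + card (M t)"
proof -
  have odd: "count_list (wrd n r M) s + (\<Sum>m\<in>{1..n}. of_bool (2 * m - 1 \<in> M (r - 1 - s))) = n" if "s < r" for s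
  proof -
    have "count_list (wrd n r M) s = (\<Sum>m\<in>{1..n}. of_bool (2 * m - 1 \<notin> M (r - 1 - s)))"
      using that by (simp only: count_list_wrd lettr_def if_True)
    then have "count_list (wrd n r M) s + (\<Sum>m\<in>{1..n}. of_bool (2 * m - 1 \<in> M (r - 1 - s))) = (\<Sum>m\<in>{1..n}. 1)"
      by (simp only: sum.distrib[symmetric]) (rule sum.cong, auto)
    then show ?thesis by simp
  qed
  have even: "count_list (wrd n r M) (r + s) = (\<Sum>m\<in>{1..n}. of_bool (2 * m \<in> M s))" if "s < r" for s
    using that count_list_wrd[of "r + s" r n M] by (simp only: lettr_def not_add_less1 if_False add_diff_cancel_left' mult_2 nat_add_left_cancel_less)
  have e1: "2 * r - 1 - t = r + (r - 1 - t)" "r - 1 - t < r" using assms(2) by auto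
  have e2: "2 * r - 1 - (r + t) = r - 1 - t" "r - 1 - (r - 1 - t) = t" using assms(2) by auto
  show "rowsum (2 * (2 * r * n)) (avmat n r M) t + card (M (r - 1 - t)) = 2 * r * n + n"
    using rowsum_vmat[OF _ set_wrd length_wrd, of t r n M] assms(2) odd[OF assms(2)] even[OF e1(2)]
      card_column[OF assms(1), of "r - 1 - t"] unfolding avmat_def e1(1) by linarith
  show "rowsum (2 * (2 * r * n)) (avmat n r M) (r + t) + n = 2 * r * n + card (M t)"
    using rowsum_vmat[OF _ set_wrd length_wrd, of "r + t" r n M] assms(2) odd[OF e1(2)] even[OF assms(2)]
      card_column[OF assms(1), of t] unfolding avmat_def e2 by linarith
qed

lemma rowsum_avmat_outside: "\<not> i < 2 * r \<Longrightarrow> rowsum K (avmat n r M) i = 0"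
  by (simp add: rowsum_def avmat_def vmat_def)

lemma aiso_card:
  assumes "aiso n r M N" "M \<in> arrays n r" "N \<in> arrays n r"
  shows "card (M j) = card (N j)"
proof (cases "j < r")
  case True
  then show ?thesis using rowsum_avmat(2)[OF assms(2) True] rowsum_avmat(2)[OF assms(3) True]
      rowsum_colconn[OF assms(1)[unfolded aiso_def]] by simp
next
  case False
  then show ?thesis using assms(2,3) by (simp add: arrays_def)
qed

lemma aiso_if_card_eq:
  assumes "ahigh n r M" "ahigh n r N" "M \<in> arrays n r" "N \<in> arrays n r" "\<And>j. card (M j) = card (N j)"
  shows "aiso n r M N"
proof -
  have "rowsum (2 * (2 * r * n)) (avmat n r M) i = rowsum (2 * (2 * r * n)) (avmat n r N) i" for i
  proof (cases "i < 2 * r")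
    case True
    show ?thesis
    proof (cases "i < r")
      case i: True
      then show ?thesis using rowsum_avmat(1)[OF assms(3) i] rowsum_avmat(1)[OF assms(4) i] assms(5)[of "r - 1 - i"] by simp
    next
      case i: False
      then have "i - r < r" "r + (i - r) = i" using True by auto
      then show ?thesis using rowsum_avmat(2)[OF assms(3), of "i - r"] rowsum_avmat(2)[OF assms(4), of "i - r"] assms(5)[of "i - r"] by simp
    qed
  qed (simp add: rowsum_avmat_outside)
  then have "rowsum (2 * (2 * r * n)) (avmat n r M) = rowsum (2 * (2 * r * n)) (avmat n r N)" by (rule ext)
  moreover have "row_high (2 * r) (2 * (2 * r * n)) (avmat n r M)" "row_high (2 * r) (2 * (2 * r * n)) (avmat n r N)"
    using row_high_vmat_iff[OF set_wrd length_wrd] ahigh_whigh assms(1-4) unfolding avmat_def by blast+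
  ultimately show ?thesis
    unfolding aiso_def using row_high_colconn_if_rowsum_eq mat_bd_vmat unfolding avmat_def by blast
qed

definition glhigh :: "nat \<Rightarrow> nat \<Rightarrow> array \<Rightarrow> bool" where
  "glhigh n r M \<longleftrightarrow> (\<forall>i N. Suc i < r \<longrightarrow> \<not> astep n r i M N)"

lemma glhigh_aiso: "aiso n r M M' \<Longrightarrow> M \<in> arrays n r \<Longrightarrow> M' \<in> arrays n r \<Longrightarrow> glhigh n r M \<Longrightarrow> glhigh n r M'"
  unfolding glhigh_def using astep_along_aiso aiso_sym by metis

lemma ahigh_aiso: "aiso n r M M' \<Longrightarrow> M \<in> arrays n r \<Longrightarrow> M' \<in> arrays n r \<Longrightarrow> ahigh n r M \<Longrightarrow> ahigh n r M'"
  unfolding ahigh_def using astep_along_aiso aiso_sym by metis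

text \<open>For highest \<open>U\<close> its size is the multiplicity in the branching from Sp(2r)
  to GL(r) for the component of \<open>U\<close>.\<close>

definition fibre :: "nat \<Rightarrow> nat \<Rightarrow> (nat \<Rightarrow> nat) \<Rightarrow> array \<Rightarrow> array set" where
  "fibre n r k U = {M \<in> arrays n r. glhigh n r M \<and> (\<forall>j. card (M j) = k j) \<and> (\<exists>is. apath n r is M U)}"


lemma finite_arrays: "finite (arrays n r)"
proof -
  have "arrays n r \<subseteq> (\<lambda>f j. if j < r then f j else {}) ` (PiE {..<r} (\<lambda>_. Pow {1..2 * n}))"
  proof
    fix M assume M: "M \<in> arrays n r"
    have "M = (\<lambda>j. if j < r then restrict M {..<r} j else {})"
      using M by (auto simp: arrays_def fun_eq_iff)
    moreover have "restrict M {..<r} \<in> PiE {..<r} (\<lambda>_. Pow {1..2 * n})"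
      using M by (auto simp: arrays_def)
    ultimately show "M \<in> (\<lambda>f j. if j < r then f j else {}) ` (PiE {..<r} (\<lambda>_. Pow {1..2 * n}))" by blast
  qed
  then show ?thesis by (rule finite_subset) (auto intro!: finite_imageI finite_PiE)
qed

text \<open>A path from \<open>M\<close> to \<open>U\<close> is copied backwards from
  \<open>U'\<close>, which gives the image of \<open>M\<close>. If \<open>M\<close> and
  \<open>N\<close> have the same image they are isomorphic, so the path of \<open>M\<close> can be
  copied from \<open>N\<close>; it ends in a highest element of the component of \<open>U\<close>,
  hence in \<open>U\<close>, and paths with given nodes are injective.\<close>

lemma card_fibre_le:
  assumes U: "U \<in> arrays n r" "ahigh n r U" and U': "U' \<in> arrays n r" "ahigh n r U'"
    and c: "\<And>j. card (U j) = card (U' j)"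
  shows "card (fibre n r k U) \<le> card (fibre n r k U')"
proof -
  have iso: "aiso n r U U'" using aiso_if_card_eq U U' c by blast
  have ex: "\<exists>M' is. apath n r is M U \<and> apath n r is M' U' \<and> aiso n r M M' \<and> M' \<in> fibre n r k U'"
    if M: "M \<in> fibre n r k U" for M
  proof -
    obtain "is" where i: "apath n r is M U" using M by (auto simp: fibre_def)
    then obtain M' where M': "apath n r is M' U'" "aiso n r M M'" "M' \<in> arrays n r"
      using inv_apath_along_aiso iso U'(1) by blast
    have "M' \<in> fibre n r k U'"
      using M M' glhigh_aiso[OF M'(2)] aiso_card[OF M'(2)] unfolding fibre_def by auto
    then show ?thesis using i M' by blast
  qed
  define f where "f M = (SOME M'. \<exists>is. apath n r is M U \<and> apath n r is M' U' \<and> aiso n r M M' \<and> M' \<in> fibre n r k U')" for M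
  have f: "\<exists>is. apath n r is M U \<and> apath n r is (f M) U' \<and> aiso n r M (f M) \<and> f M \<in> fibre n r k U'"
    if "M \<in> fibre n r k U" for M
    unfolding f_def using someI_ex[OF ex[OF that]] .
  have "inj_on f (fibre n r k U)"
  proof (rule inj_onI)
    fix M N assume M: "M \<in> fibre n r k U" and N: "N \<in> fibre n r k U" and e: "f M = f N"
    have arr: "M \<in> arrays n r" "N \<in> arrays n r" using M N by (auto simp: fibre_def)
    have "aiso n r M N" using f[OF M] f[OF N] e aiso_sym aiso_trans by metis
    moreover obtain "is" where i: "apath n r is M U" using M by (auto simp: fibre_def)
    ultimately obtain V where V: "apath n r is N V" "aiso n r U V" using apath_along_aiso arr(2) by blast
    have VA: "V \<in> arrays n r" using V(1) apath_aconn aconn_arrays arr(2) by blast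
    have "aconn n r V U" using apath_aconn[OF V(1)] N apath_aconn aconn_sym aconn_trans unfolding fibre_def by blast
    then have "V = U" using ahigh_unique ahigh_aiso[OF V(2) U(1) VA U(2)] U(2) VA by blast
    then show "M = N" using apath_inj i V(1) by blast
  qed
  moreover have "f ` fibre n r k U \<subseteq> fibre n r k U'" using f by blast
  moreover have "finite (fibre n r k U')" by (rule finite_subset[OF _ finite_arrays]) (auto simp: fibre_def)
  ultimately show ?thesis using card_inj_on_le by blast
qed

theorem card_fibre_eq:
  assumes "U \<in> arrays n r" "ahigh n r U" "U' \<in> arrays n r" "ahigh n r U'" "\<And>j. card (U j) = card (U' j)"
  shows "card (fibre n r k U) = card (fibre n r k U')"
  using card_fibre_le[OF assms] card_fibre_le[OF assms(3,4,1,2), of k] assms(5) by (intro antisym) auto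

section \<open>Tail swaps and tail flips\<close>

definition cnt :: "array \<Rightarrow> nat \<Rightarrow> nat \<Rightarrow> nat" where
  "cnt M j p = card {q \<in> M j. q \<le> p}"

text \<open>Stated by counts, so that it reads as the ballot condition for the signs
  \<open>asg\<close>; \<open>sst_tab_iff\<close> translates it into rows and columns.\<close>

definition sst :: "array \<Rightarrow> bool" where
  "sst M \<longleftrightarrow> (\<forall>j p. cnt M (Suc j) p \<le> cnt M j p)"

text \<open>King's condition that the entries of row i are at least 2i - 1, expressed by counts in
  the first column. For \<open>m = n\<close> it bounds the height by \<open>n\<close>.\<close>

definition king :: "nat \<Rightarrow> array \<Rightarrow> bool" where
  "king n M \<longleftrightarrow> (\<forall>m\<le>n. cnt M 0 (2 * m) \<le> m)"

definition tswap :: "nat \<Rightarrow> nat \<Rightarrow> array \<Rightarrow> array" where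
  "tswap j p M = M(j := {q \<in> M j. q \<le> p} \<union> {q \<in> M (Suc j). p < q},
     Suc j := {q \<in> M (Suc j). q \<le> p} \<union> {q \<in> M j. p < q})"

definition mate :: "nat \<Rightarrow> nat" where
  "mate q = (if even q then q - 1 else q + 1)"

text \<open>Beyond \<open>2 * m\<close>, complete pairs become empty and empty ones complete, while
  a pair with a single letter stays. So \<open>ew\<close> is kept and the height of column 0 is
  reflected.\<close>

definition tflip :: "nat \<Rightarrow> nat \<Rightarrow> array \<Rightarrow> array" where
  "tflip n m M = M(0 := {q \<in> M 0. q \<le> 2 * m} \<union> {q \<in> {2 * m + 1..2 * n}. mate q \<notin> M 0})"

lemma cnt_Suc: "cnt M j (Suc p) = cnt M j p + of_bool (Suc p \<in> M j)"
proof -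
  have "{q \<in> M j. q \<le> Suc p} = (if Suc p \<in> M j then insert (Suc p) {q \<in> M j. q \<le> p} else {q \<in> M j. q \<le> p})"
    by (auto simp: le_Suc_eq)
  then show ?thesis by (simp add: cnt_def)
qed

lemma cnt_0: "M \<in> arrays n r \<Longrightarrow> cnt M j 0 = 0"
proof -
  assume "M \<in> arrays n r"
  then have "0 \<notin> M j" by (rule arrays_0)
  then have "{q \<in> M j. q \<le> 0} = {}" by auto
  then show ?thesis by (simp add: cnt_def)
qed

lemma cnt_mono: "p \<le> q \<Longrightarrow> cnt M j p \<le> cnt M j q"
  by (rule lift_Suc_mono_le[of "cnt M j"]) (simp_all add: cnt_Suc)

lemma cnt_pos_nonempty: "0 < cnt M j p \<Longrightarrow> M j \<noteq> {}"
  by (auto simp: cnt_def)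

lemma sum_involution_cancel:
  fixes F :: "'a \<Rightarrow> int"
  assumes "finite A" "\<And>x. x \<in> A \<Longrightarrow> t x \<in> A" "\<And>x. x \<in> A \<Longrightarrow> t (t x) = x" "\<And>x. x \<in> A \<Longrightarrow> F (t x) = - F x"
  shows "sum F A = 0"
proof -
  have "sum F A = (\<Sum>x\<in>A. F (t x))"
    by (rule sum.reindex_bij_witness[of _ t t]) (use assms in auto)
  also have "\<dots> = - sum F A" using assms(4) by (simp add: sum_negf)
  finally show ?thesis by simp
qed

lemma tswap_tswap: "tswap j p (tswap j p M) = M"
  by (auto simp: tswap_def fun_eq_iff)

lemma mate_mate: "1 \<le> q \<Longrightarrow> mate (mate q) = q"
  by (auto simp: mate_def)

lemma mate_range: "2 * m + 1 \<le> q \<Longrightarrow> q \<le> 2 * n \<Longrightarrow> 2 * m + 1 \<le> mate q \<and> mate q \<le> 2 * n"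
  unfolding mate_def by (cases "even q") (simp, presburger)+

lemma tflip_tflip:
  assumes "M 0 \<subseteq> {1..2 * n}"
  shows "tflip n m (tflip n m M) = M"
proof -
  have "q \<in> tflip n m (tflip n m M) 0 \<longleftrightarrow> q \<in> M 0" for q
  proof (cases "2 * m + 1 \<le> q \<and> q \<le> 2 * n")
    case True
    then have "2 * m + 1 \<le> mate q" "mate q \<le> 2 * n" "mate (mate q) = q"
      using mate_range[of m q n] mate_mate[of q] by auto
    then show ?thesis using True by (auto simp: tflip_def)
  next
    case False
    then show ?thesis using assms by (auto simp: tflip_def)
  qed
  then have "tflip n m (tflip n m M) 0 = M 0" by blast
  moreover have "tflip n m (tflip n m M) j = M j" if "j \<noteq> 0" for j using that by (simp add: tflip_def)
  ultimately show ?thesis by (intro ext) metis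
qed

lemma cnt_tswap: "q \<le> p \<Longrightarrow> cnt (tswap j p M) k q = cnt M k q"
  unfolding cnt_def tswap_def by (intro arg_cong[of _ _ card]) auto

lemma cnt_tflip: "q \<le> 2 * m \<Longrightarrow> cnt (tflip n m M) k q = cnt M k q"
  unfolding cnt_def tflip_def by (intro arg_cong[of _ _ card]) auto

lemma tswap_arrays: "M \<in> arrays n r \<Longrightarrow> Suc j < r \<Longrightarrow> tswap j p M \<in> arrays n r"
  unfolding arrays_iff tswap_def by (auto split: if_splits)

lemma tflip_arrays: "M \<in> arrays n r \<Longrightarrow> 0 < r \<Longrightarrow> m \<le> n \<Longrightarrow> tflip n m M \<in> arrays n r"
  unfolding arrays_iff tflip_def by (auto split: if_splits)

text \<open>Reading the letters in increasing order, the first place where an array stops being semistandard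
  (or, if \<open>b\<close> holds, symplectic) is left unchanged by the move that alters all later letters.\<close>

theorem sum_arrays_tail_reflection:
  fixes F :: "array \<Rightarrow> int" and b :: bool
  assumes sw: "\<And>M j p. M \<in> arrays n r \<Longrightarrow> Suc j < r \<Longrightarrow> cnt M (Suc j) p = Suc (cnt M j p) \<Longrightarrow> F (tswap j p M) = - F M"
    and fl: "\<And>M m. b \<Longrightarrow> M \<in> arrays n r \<Longrightarrow> 0 < r \<Longrightarrow> m \<le> n \<Longrightarrow> cnt M 0 (2 * m) = Suc m \<Longrightarrow> F (tflip n m M) = - F M"
  shows "(\<Sum>M\<in>arrays n r. F M) = (\<Sum>M\<in>{M \<in> arrays n r. sst M \<and> (b \<longrightarrow> king n M)}. F M)"
proof -
  define sb where "sb M p j \<longleftrightarrow> cnt M j p < cnt M (Suc j) p" for M p j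
  define fb where "fb M p \<longleftrightarrow> b \<and> even p \<and> p \<le> 2 * n \<and> p div 2 < cnt M 0 p" for M p
  define bad where "bad M p \<longleftrightarrow> (\<exists>j. sb M p j) \<or> fb M p" for M p
  define A where "A = {M \<in> arrays n r. \<exists>p. bad M p}"
  define pp where "pp M = (LEAST p. bad M p)" for M
  define jj where "jj M = (LEAST j. sb M (pp M) j)" for M
  define t where "t M = (if \<exists>j. sb M (pp M) j then tswap (jj M) (pp M) M else tflip n (pp M div 2) M)" for M
  have good: "{M \<in> arrays n r. sst M \<and> (b \<longrightarrow> king n M)} = arrays n r - A"
  proof -
    have "(sst M \<and> (b \<longrightarrow> king n M)) \<longleftrightarrow> \<not> (\<exists>p. bad M p)" for M
    proof -
      have "(\<exists>p. fb M p) \<longleftrightarrow> b \<and> \<not> king n M"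
      proof
        assume "b \<and> \<not> king n M"
        then obtain m where "m \<le> n" "m < cnt M 0 (2 * m)" "b" by (auto simp: king_def not_le)
        then have "fb M (2 * m)" by (simp add: fb_def)
        then show "\<exists>p. fb M p" ..
      next
        assume "\<exists>p. fb M p"
        then obtain p where p: "b" "even p" "p \<le> 2 * n" "p div 2 < cnt M 0 p" by (auto simp: fb_def)
        then have "p div 2 \<le> n" "p div 2 < cnt M 0 (2 * (p div 2))" by auto
        then show "b \<and> \<not> king n M" using p(1) unfolding king_def by (meson not_le)
      qed
      moreover have "(\<exists>p j. sb M p j) \<longleftrightarrow> \<not> sst M" by (auto simp: sb_def sst_def not_le)
      ultimately show ?thesis unfolding bad_def by blast
    qed
    then show ?thesis by (auto simp: A_def)
  qed
  have main: "t M \<in> A \<and> t (t M) = M \<and> F (t M) = - F M" if MA: "M \<in> A" for M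
  proof -
    have M: "M \<in> arrays n r" using MA by (simp add: A_def)
    let ?p = "pp M"
    have bp: "bad M ?p" unfolding pp_def using MA by (auto simp: A_def intro: LeastI_ex)
    have nb: "\<not> bad M q" if "q < ?p" for q using that unfolding pp_def by (rule not_less_Least)
    have transfer: "pp N = ?p \<and> (\<forall>j. sb N ?p j \<longleftrightarrow> sb M ?p j) \<and> bad N ?p"
      if "\<And>k q. q \<le> ?p \<Longrightarrow> cnt N k q = cnt M k q" for N
    proof -
      have e: "sb N q j \<longleftrightarrow> sb M q j" "fb N q \<longleftrightarrow> fb M q" if "q \<le> ?p" for q j
        using \<open>\<And>k q. q \<le> ?p \<Longrightarrow> cnt N k q = cnt M k q\<close> that by (simp_all add: sb_def fb_def)
      then have "bad N q \<longleftrightarrow> bad M q" if "q \<le> ?p" for q using that by (simp add: bad_def)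
      then have "bad N ?p" "\<And>q. q < ?p \<Longrightarrow> \<not> bad N q" using bp nb by auto
      then have "pp N = ?p" unfolding pp_def[of N] by (metis Least_equality not_le)
      then show ?thesis using e \<open>bad N ?p\<close> by simp
    qed
    have p0: "?p \<noteq> 0"
    proof
      assume "?p = 0"
      then show False using bp cnt_0[OF M] unfolding bad_def sb_def fb_def by simp
    qed
    then obtain p' where p': "?p = Suc p'" by (cases ?p) auto
    show ?thesis
    proof (cases "\<exists>j. sb M ?p j")
      case True
      let ?j = "jj M"
      have sj: "sb M ?p ?j" unfolding jj_def using True by (rule LeastI_ex)
      \<comment> \<open>The condition still held at \<open>p'\<close> and each count grows by at
        most one, so the excess is exactly one.\<close>
      have "cnt M (Suc ?j) p' \<le> cnt M ?j p'" using nb[of p'] p' unfolding bad_def sb_def by (simp add: not_less)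
      then have c: "cnt M (Suc ?j) ?p = Suc (cnt M ?j ?p)"
        using sj unfolding sb_def p' cnt_Suc
        by (cases "Suc p' \<in> M ?j"; cases "Suc p' \<in> M (Suc ?j)") simp_all
      then have "M (Suc ?j) \<noteq> {}" using cnt_pos_nonempty[of M "Suc ?j" ?p] by simp
      then have jr: "Suc ?j < r" using M by (auto simp: arrays_def not_less)
      have tM: "t M = tswap ?j ?p M" using True by (simp add: t_def)
      note tr = transfer[of "t M", unfolded tM, OF cnt_tswap]
      have "sb (t M) (pp (t M)) = sb M ?p" unfolding tM using tr by auto
      then have "jj (t M) = ?j" unfolding jj_def[of "t M"] by (simp add: jj_def[of M])
      moreover have ex: "\<exists>j. sb (t M) (pp (t M)) j" unfolding tM using tr sj by auto
      moreover have "pp (t M) = ?p" unfolding tM using tr by blast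
      ultimately have "t (t M) = tswap ?j ?p (t M)" using t_def[of "t M"] unfolding if_P[OF ex] by simp
      then show ?thesis using tswap_tswap tswap_arrays[OF M jr] sw[OF M jr c] tr unfolding tM A_def by auto
    next
      case False
      let ?m = "?p div 2"
      have f: "b" "even ?p" "?p \<le> 2 * n" "?m < cnt M 0 ?p" using bp False by (auto simp: bad_def fb_def)
      obtain k where k: "?p = Suc (Suc k)" "even k" using f(2) p0 p' by (metis even_Suc not0_implies_Suc odd_Suc_minus_one one_is_add plus_1_eq_Suc zero_neq_one even_zero)
      have "\<not> fb M k" using nb[of k] k(1) unfolding bad_def by simp
      \<comment> \<open>From \<open>k\<close> to \<open>k + 2\<close> the count grows by at most 2
        and the bound by 1, so the bound is exceeded by exactly one.\<close>
      then have "cnt M 0 k \<le> k div 2" using f k by (simp add: fb_def)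
      then have c: "cnt M 0 (2 * ?m) = Suc ?m"
        using f k unfolding k(1)
        by (cases "Suc k \<in> M 0"; cases "Suc (Suc k) \<in> M 0") (simp_all add: cnt_Suc)
      have "M 0 \<noteq> {}" using cnt_pos_nonempty[of M 0 ?p] f(4) by simp
      then have r0: "0 < r" using M by (auto simp: arrays_def)
      have m: "?m \<le> n" using f(3) by simp
      have tM: "t M = tflip n ?m M" using False by (simp add: t_def)
      have "2 * ?m = ?p" using f(2) by simp
      then have "\<And>k q. q \<le> ?p \<Longrightarrow> cnt (t M) k q = cnt M k q" unfolding tM by (metis cnt_tflip)
      note tr = transfer[of "t M", OF this]
      then have "t (t M) = tflip n ?m (t M)" using False unfolding t_def[of "t M"] by auto
      moreover have "M 0 \<subseteq> {1..2 * n}" using M r0 by (auto simp: arrays_def)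
      ultimately show ?thesis using tflip_tflip tflip_arrays[OF M r0 m] fl[OF f(1) M r0 m c] tr unfolding tM A_def by auto
    qed
  qed
  have "sum F A = 0"
    by (rule sum_involution_cancel[of A t]) (use main finite_arrays in \<open>auto simp: A_def\<close>)
  then show ?thesis unfolding good using finite_arrays[of n r] by (subst sum_diff) (auto simp: A_def)
qed

section \<open>Reversing runs\<close>

primrec run_start :: "(nat \<Rightarrow> bool) \<Rightarrow> nat \<Rightarrow> nat" where
  "run_start L 0 = 0"
| "run_start L (Suc j) = (if L j then run_start L j else Suc j)"

definition run_end :: "(nat \<Rightarrow> bool) \<Rightarrow> nat \<Rightarrow> nat" where
  "run_end L j = (LEAST e. j \<le> e \<and> \<not> L e)"

text \<open>\<open>L t\<close> links \<open>t\<close> with \<open>Suc t\<close>. A run is a maximal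
  chain of links, and it is turned round as a whole.\<close>

definition run_rev :: "(nat \<Rightarrow> bool) \<Rightarrow> nat \<Rightarrow> nat" where
  "run_rev L j = run_start L j + run_end L j - j"

lemma run_start_le: "run_start L j \<le> j"
  by (induction j) auto

lemma run_start_linked: "run_start L j \<le> t \<Longrightarrow> t < j \<Longrightarrow> L t"
  by (induction j) (auto simp: less_Suc_eq split: if_splits)

context
  fixes L :: "nat \<Rightarrow> bool" and C :: nat
  assumes bd: "\<And>t. L t \<Longrightarrow> Suc t < C"
begin

lemma run_end: "j \<le> run_end L j" "\<not> L (run_end L j)" "j \<le> t \<Longrightarrow> t < run_end L j \<Longrightarrow> L t"
proof -
  have "\<exists>e. j \<le> e \<and> \<not> L e" using bd by (metis Suc_lessD le_add1 le_add2 not_less)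
  then have "j \<le> run_end L j \<and> \<not> L (run_end L j)" unfolding run_end_def by (rule LeastI_ex)
  then show "j \<le> run_end L j" "\<not> L (run_end L j)" by auto
  show "j \<le> t \<Longrightarrow> t < run_end L j \<Longrightarrow> L t"
    unfolding run_end_def using not_less_Least by blast
qed

lemma run_end_linked: "L j \<Longrightarrow> run_end L (Suc j) = run_end L j"
  unfolding run_end_def by (rule arg_cong[where f = Least]) (auto simp: fun_eq_iff Suc_le_eq le_less)

lemma run_constant:
  assumes "\<And>t. a \<le> t \<Longrightarrow> t < b \<Longrightarrow> L t" "a \<le> b"
  shows "run_start L b = run_start L a \<and> run_end L b = run_end L a"
  using assms(2,1) by (induction b rule: dec_induct) (auto simp: run_end_linked)

lemma run_constant':
  assumes "run_start L j \<le> t" "t \<le> run_end L j"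
  shows "run_start L t = run_start L j" "run_end L t = run_end L j"
proof -
  have "run_start L t = run_start L j \<and> run_end L t = run_end L j"
  proof (cases "t \<le> j")
    case True
    have "L s" if "t \<le> s" "s < j" for s
      using that assms(1) run_start_linked[of L j s] by linarith
    then show ?thesis using run_constant[of t j] True by simp
  next
    case False
    have "L s" if "j \<le> s" "s < t" for s
      using that assms(2) run_end(3)[of j s] by linarith
    then show ?thesis using run_constant[of j t] False by simp
  qed
  then show "run_start L t = run_start L j" "run_end L t = run_end L j" by auto
qed

lemma run_rev_range: "run_start L j \<le> run_rev L j" "run_rev L j \<le> run_end L j"
  using run_start_le[of L j] run_end(1)[of j] by (auto simp: run_rev_def)

lemma run_rev_run_rev: "run_rev L (run_rev L j) = j"
  unfolding run_rev_def[of L "run_rev L j"] run_constant'[OF run_rev_range]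
  using run_start_le[of L j] run_end(1)[of j] by (auto simp: run_rev_def)

lemma run_rev_Suc:
  assumes "L j"
  shows "run_rev L j = Suc (run_rev L (Suc j))" "L (run_rev L (Suc j))"
proof -
  have e: "run_start L (Suc j) = run_start L j" "run_end L (Suc j) = run_end L j"
    using assms run_end_linked by auto
  have "j \<noteq> run_end L j" using assms run_end(2) by metis
  then have "Suc j \<le> run_end L j" using run_end(1)[of j] by simp
  then show 1: "run_rev L j = Suc (run_rev L (Suc j))" using run_start_le[of L j] e by (simp add: run_rev_def)
  have "run_start L j \<le> run_rev L (Suc j)" using run_rev_range(1)[of "Suc j"] e by simp
  moreover have "run_rev L (Suc j) < run_end L j" using 1 run_rev_range(2)[of j] by simp
  ultimately show "L (run_rev L (Suc j))"
    using run_start_linked[of L j] run_end(3)[of j] by (meson not_le)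
qed

lemma run_rev_less: "j < C \<Longrightarrow> run_rev L j < C"
proof -
  assume j: "j < C"
  have "run_end L j < C"
  proof (cases "run_end L j = j")
    case False
    then obtain e where e: "run_end L j = Suc e" "j \<le> e" using run_end(1)[of j] by (cases "run_end L j") auto
    then show ?thesis using run_end(3)[of j e] bd by simp
  qed (use j in simp)
  then show ?thesis using run_rev_range(2)[of j] by simp
qed

lemma run_rev_invariant:
  assumes "\<And>t. L t \<Longrightarrow> P (Suc t) = P t"
  shows "P (run_rev L j) = P j"
proof -
  have "P b = P a" if "a \<le> b" "\<And>t. a \<le> t \<Longrightarrow> t < b \<Longrightarrow> L t" for a b
    using that by (induction b rule: dec_induct) (use assms in auto)
  moreover have "L s" if "run_start L j \<le> s" "s < run_end L j" for s
    using that run_start_linked[of L j s] run_end(3)[of j s] by (cases "s < j") auto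
  ultimately have c: "P t = P (run_start L j)" if "run_start L j \<le> t" "t \<le> run_end L j" for t
    using that by (meson order_less_le_trans)
  show ?thesis
    by (rule trans[OF c[OF run_rev_range] c[OF run_start_le run_end(1), symmetric]])
qed

end

section \<open>Reflection of a pair of consecutive letters\<close>

definition free :: "array \<Rightarrow> nat \<Rightarrow> nat \<Rightarrow> bool" where
  "free M x j \<longleftrightarrow> (x \<in> M j) \<noteq> (Suc x \<in> M j)"

text \<open>Equally many letters below \<open>x\<close> put the two free boxes into the same row, so
  a run consists of neighbouring free boxes of one row.\<close>

definition lnk :: "array \<Rightarrow> nat \<Rightarrow> nat \<Rightarrow> nat \<Rightarrow> bool" where
  "lnk M x C t \<longleftrightarrow> Suc t < C \<and> free M x t \<and> free M x (Suc t) \<and> cnt M t (x - 1) = cnt M (Suc t) (x - 1)"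

text \<open>The Bender-Knuth involution on the columns below \<open>C\<close>: in the free boxes of
  a row, a letters \<open>x\<close> and b letters \<open>Suc x\<close> become b letters
  \<open>x\<close> and a letters \<open>Suc x\<close>, by reversing the run and exchanging the two
  letters. The columns from \<open>C\<close> on are the part of the path already read.\<close>

definition refl_pair :: "nat \<Rightarrow> nat \<Rightarrow> array \<Rightarrow> array" where
  "refl_pair x C M j = (if j < C \<and> free M x j
     then (M j - {x, Suc x}) \<union> (if x \<in> M (run_rev (lnk M x C) j) then {Suc x} else {x}) else M j)"

lemma lnk_bd: "lnk M x C t \<Longrightarrow> Suc t < C"
  by (simp add: lnk_def)

lemma free_run_rev: "free M x (run_rev (lnk M x C) j) = free M x j"
  by (rule run_rev_invariant[of _ C]) (auto simp: lnk_def)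

lemma refl_pair_other: "q \<noteq> x \<Longrightarrow> q \<noteq> Suc x \<Longrightarrow> q \<in> refl_pair x C M j \<longleftrightarrow> q \<in> M j"
  by (auto simp: refl_pair_def)

lemma refl_pair_x:
  "x \<in> refl_pair x C M j \<longleftrightarrow> (if j < C \<and> free M x j then x \<notin> M (run_rev (lnk M x C) j) else x \<in> M j)"
  "Suc x \<in> refl_pair x C M j \<longleftrightarrow> (if j < C \<and> free M x j then x \<in> M (run_rev (lnk M x C) j) else Suc x \<in> M j)"
  by (auto simp: refl_pair_def)

lemma free_refl_pair: "free (refl_pair x C M) x j = free M x j"
  by (auto simp: free_def refl_pair_x)

lemma refl_pair_ge: "C \<le> j \<Longrightarrow> refl_pair x C M j = M j"
  by (simp add: refl_pair_def)

lemma cnt_split_pair: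
  assumes "1 \<le> x"
  shows "p < x \<Longrightarrow> cnt M j p = card {q \<in> M j. q \<le> p \<and> q \<noteq> x \<and> q \<noteq> Suc x}"
    "x < p \<Longrightarrow> cnt M j p = card {q \<in> M j. q \<le> p \<and> q \<noteq> x \<and> q \<noteq> Suc x} + of_bool (x \<in> M j) + of_bool (Suc x \<in> M j)"
proof -
  show "cnt M j p = card {q \<in> M j. q \<le> p \<and> q \<noteq> x \<and> q \<noteq> Suc x}" if "p < x"
    unfolding cnt_def by (rule arg_cong[of _ _ card]) (use that in auto)
  assume p: "x < p"
  have "{q \<in> M j. q \<le> p} = {q \<in> M j. q \<le> p \<and> q \<noteq> x \<and> q \<noteq> Suc x} \<union> ({x} \<inter> M j) \<union> ({Suc x} \<inter> M j)"
    using p by auto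
  then have "cnt M j p = card ({q \<in> M j. q \<le> p \<and> q \<noteq> x \<and> q \<noteq> Suc x} \<union> ({x} \<inter> M j) \<union> ({Suc x} \<inter> M j))"
    by (simp add: cnt_def)
  also have "\<dots> = card {q \<in> M j. q \<le> p \<and> q \<noteq> x \<and> q \<noteq> Suc x} + card ({x} \<inter> M j) + card ({Suc x} \<inter> M j)"
    by (subst card_Un_disjoint; (subst card_Un_disjoint)?) auto
  finally show "cnt M j p = card {q \<in> M j. q \<le> p \<and> q \<noteq> x \<and> q \<noteq> Suc x} + of_bool (x \<in> M j) + of_bool (Suc x \<in> M j)"
    by (cases "x \<in> M j"; cases "Suc x \<in> M j") simp_all
qed

lemma of_bool_free: "free M x j \<Longrightarrow> of_bool (x \<in> M j) + of_bool (Suc x \<in> M j) = (1::nat)"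
  by (auto simp: free_def)

lemma cnt_refl_pair:
  assumes "1 \<le> x" "p \<noteq> x"
  shows "cnt (refl_pair x C M) j p = cnt M j p"
proof -
  have s: "{q \<in> refl_pair x C M j. q \<le> p \<and> q \<noteq> x \<and> q \<noteq> Suc x} = {q \<in> M j. q \<le> p \<and> q \<noteq> x \<and> q \<noteq> Suc x}"
    using refl_pair_other by blast
  have f: "of_bool (x \<in> refl_pair x C M j) + of_bool (Suc x \<in> refl_pair x C M j)
    = (of_bool (x \<in> M j) + of_bool (Suc x \<in> M j) :: nat)"
  proof (cases "free M x j")
    case True
    then show ?thesis using of_bool_free[of M x j] of_bool_free[of "refl_pair x C M" x j] free_refl_pair by metis
  next
    case False
    then show ?thesis by (simp add: refl_pair_def)
  qed
  show ?thesis
  proof (cases "p < x")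
    case True
    then show ?thesis using cnt_split_pair(1)[OF assms(1) True] s by simp
  next
    case False
    then show ?thesis using cnt_split_pair(2)[OF assms(1), of p] assms(2) s f by (simp add: add.assoc)
  qed
qed

lemma lnk_refl_pair: "1 \<le> x \<Longrightarrow> lnk (refl_pair x C M) x C = lnk M x C"
  by (auto simp: lnk_def free_refl_pair cnt_refl_pair fun_eq_iff)

lemma refl_pair_refl_pair:
  assumes "1 \<le> x"
  shows "refl_pair x C (refl_pair x C M) = M"
proof -
  have "q \<in> refl_pair x C (refl_pair x C M) j \<longleftrightarrow> q \<in> M j" for q j
  proof -
    have j: "run_rev (lnk M x C) (run_rev (lnk M x C) j) = j"
      by (rule run_rev_run_rev[of _ C]) (simp add: lnk_def)
    have l: "j < C \<Longrightarrow> run_rev (lnk M x C) j < C"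
      by (rule run_rev_less) (simp_all add: lnk_def)
    consider "q = x" | "q = Suc x" | "q \<noteq> x" "q \<noteq> Suc x" by blast
    then show ?thesis
    proof cases
      case 1
      then show ?thesis using j l
        by (auto simp: refl_pair_x lnk_refl_pair[OF assms] free_refl_pair free_run_rev)
    next
      case 2
      then show ?thesis using j l
        by (auto simp: refl_pair_x lnk_refl_pair[OF assms] free_refl_pair free_run_rev) (auto simp: free_def)
    qed (simp add: refl_pair_other)
  qed
  then show ?thesis by (intro ext Set.set_eqI)
qed

text \<open>A reflection at \<open>x\<close> changes counts only at \<open>x\<close> itself, whereas
  the links for \<open>z\<close> use the counts at \<open>z - 1 > x\<close>, and those for
  \<open>x\<close> the counts at \<open>x - 1\<close>.\<close>

lemma refl_pair_commute:
  assumes "1 \<le> x" "Suc x < z"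
  shows "refl_pair x C (refl_pair z D M) = refl_pair z D (refl_pair x C M)"
proof -
  have f1: "free (refl_pair z D M) x = free M x"
    using assms by (auto simp: free_def refl_pair_other fun_eq_iff)
  have f2: "free (refl_pair x C M) z = free M z"
    using assms by (auto simp: free_def refl_pair_other fun_eq_iff)
  have l1: "lnk (refl_pair z D M) x C = lnk M x C"
    unfolding lnk_def f1 using assms by (simp add: cnt_refl_pair)
  have l2: "lnk (refl_pair x C M) z D = lnk M z D"
    unfolding lnk_def f2 using assms by (simp add: cnt_refl_pair)
  have m1: "x \<in> refl_pair z D M j \<longleftrightarrow> x \<in> M j" "Suc x \<in> refl_pair z D M j \<longleftrightarrow> Suc x \<in> M j"
    and m2: "z \<in> refl_pair x C M j \<longleftrightarrow> z \<in> M j" "Suc z \<in> refl_pair x C M j \<longleftrightarrow> Suc z \<in> M j" for j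
    using assms by (auto simp: refl_pair_other)
  have "q \<in> refl_pair x C (refl_pair z D M) j \<longleftrightarrow> q \<in> refl_pair z D (refl_pair x C M) j" for q j
  proof -
    have ne: "x \<noteq> z" "x \<noteq> Suc z" "z \<noteq> x" "z \<noteq> Suc x" "Suc x \<noteq> z" "Suc z \<noteq> x" using assms by auto
    consider "q = x" | "q = Suc x" | "q = z" | "q = Suc z" | "q \<noteq> x" "q \<noteq> Suc x" "q \<noteq> z" "q \<noteq> Suc z" by blast
    then show ?thesis
      by cases (simp_all only: refl_pair_x f1 f2 l1 l2 m1 m2, simp_all add: ne refl_pair_other refl_pair_x)
  qed
  then show ?thesis by (intro ext Set.set_eqI)
qed

text \<open>Counts change only at \<open>x\<close>, so only columns with equally many letters below
  \<open>x\<close> have to be compared there. Inside a run the reversal keeps the order. At the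
  border the premise on column \<open>C\<close> matters: an unmoved \<open>x\<close> without
  \<open>Suc x\<close> could follow a new \<open>Suc x\<close> in the same row.\<close>

lemma sst_refl_pair:
  assumes x: "1 \<le> x" and M: "sst M" and b: "x \<in> M C \<Longrightarrow> Suc x \<in> M C"
  shows "sst (refl_pair x C M)"
  unfolding sst_def
proof (intro allI)
  fix j p
  let ?N = "refl_pair x C M"
  show "cnt ?N (Suc j) p \<le> cnt ?N j p"
  proof (cases "p = x")
    case False
    then show ?thesis using M cnt_refl_pair[OF x False] by (simp add: sst_def)
  next
    case p: True
    obtain x' where x': "x = Suc x'" using x by (cases x) auto
    have k: "cnt ?N i x = cnt M i x' + of_bool (x \<in> ?N i)" "cnt M i x = cnt M i x' + of_bool (x \<in> M i)"
      "cnt M i (Suc x) = cnt M i x' + of_bool (x \<in> M i) + of_bool (Suc x \<in> M i)" for i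
      using cnt_refl_pair[OF x, of x' C M i] unfolding x' by (simp_all add: cnt_Suc)
    have s: "cnt M (Suc i) p \<le> cnt M i p" for i p using M by (simp add: sst_def)
    have s2: "x \<in> M (Suc i) \<longrightarrow> x \<in> M i"
      "of_bool (x \<in> M (Suc i)) + of_bool (Suc x \<in> M (Suc i)) \<le> (of_bool (x \<in> M i) + of_bool (Suc x \<in> M i) :: nat)"
      if "cnt M (Suc i) x' = cnt M i x'" for i
      using s[of i x] s[of i "Suc x"] that unfolding k by (cases "x \<in> M (Suc i)"; cases "x \<in> M i"; simp)+
    show ?thesis
    proof (cases "cnt M (Suc j) x' = cnt M j x'")
      case False
      then show ?thesis using s[of j x'] unfolding p k by simp
    next
      case eq: True
      have "x \<in> ?N (Suc j) \<longrightarrow> x \<in> ?N j"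
      proof
        assume a: "x \<in> ?N (Suc j)"
        show "x \<in> ?N j"
        proof (cases "j < C \<and> free M x j")
          case True
          then have one: "of_bool (x \<in> M j) + of_bool (Suc x \<in> M j) = (1::nat)" using of_bool_free by blast
          show ?thesis
          proof (cases "free M x (Suc j)")
            case f: True
            show ?thesis
            proof (cases "Suc j < C")
              case l: True
              let ?L = "lnk M x C"
              have L: "?L j" using True f l eq x' by (simp add: lnk_def)
              note rr = run_rev_Suc[of ?L C j, OF lnk_bd[of M x C] L]
              have "x \<notin> M (run_rev ?L (Suc j))" using a f l by (simp add: refl_pair_x)
              moreover have "x \<in> M (Suc (run_rev ?L (Suc j))) \<longrightarrow> x \<in> M (run_rev ?L (Suc j))"
                using s2(1)[of "run_rev ?L (Suc j)"] rr(2) x' by (simp add: lnk_def)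
              ultimately show ?thesis using True rr(1) by (simp add: refl_pair_x)
            next
              case l: False
              then have "Suc j = C" using True by simp
              then show ?thesis using a b f by (auto simp: refl_pair_x free_def)
            qed
          next
            case f: False
            then have "x \<in> M (Suc j)" "Suc x \<in> M (Suc j)" using a by (auto simp: refl_pair_x free_def)
            then show ?thesis using s2(2)[OF eq] one by simp
          qed
        next
          case False
          have "x \<in> M j"
          proof (cases "x \<in> M (Suc j)")
            case True
            then show ?thesis using s2(1)[OF eq] by blast
          next
            case nx: False
            then have f: "Suc j < C \<and> free M x (Suc j)" using a by (auto simp: refl_pair_x split: if_splits)
            then have "of_bool (x \<in> M j) + of_bool (Suc x \<in> M j) \<ge> (1::nat)"
              using s2(2)[OF eq] of_bool_free[of M x "Suc j"] by simp
            then show ?thesis using False f by (auto simp: free_def split: if_splits)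
          qed
          then show ?thesis using False by (auto simp: refl_pair_x)
        qed
      qed
      then show ?thesis unfolding p k eq by simp
    qed
  qed
qed

lemma card_refl_pair:
  assumes "1 \<le> x" "M \<in> arrays n r" "refl_pair x C M \<in> arrays n r"
  shows "card (refl_pair x C M j) = card (M j)"
proof -
  have "card (N j) = cnt N j (x + 2 * n + 1)" if "N \<in> arrays n r" for N
  proof -
    have "{q \<in> N j. q \<le> x + 2 * n + 1} = N j" using arrays_bd[OF that] by fastforce
    then show ?thesis by (simp add: cnt_def)
  qed
  then show ?thesis using cnt_refl_pair[OF assms(1), of "x + 2 * n + 1"] assms(2,3) by simp
qed

lemma refl_pair_arrays:
  assumes "M \<in> arrays n r" "1 \<le> x" "Suc x \<le> 2 * n"
  shows "refl_pair x C M \<in> arrays n r"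
  unfolding arrays_iff
proof (intro allI impI)
  fix j q assume q: "q \<in> refl_pair x C M j"
  show "j < r \<and> 1 \<le> q \<and> q \<le> 2 * n"
  proof (cases "free M x j")
    case True
    then have "j < r" using arrays_bd[OF assms(1)] unfolding free_def by blast
    then show ?thesis using q assms arrays_bd[OF assms(1), of q j] by (auto simp: refl_pair_def split: if_splits)
  next
    case False
    then show ?thesis using q arrays_bd[OF assms(1), of q j] by (simp add: refl_pair_def)
  qed
qed

lemma sum_refl_pair:
  "(\<Sum>j<C. of_bool (x \<in> refl_pair x C M j)) = (\<Sum>j<C. of_bool (Suc x \<in> M j) :: int)"
  "(\<Sum>j<C. of_bool (Suc x \<in> refl_pair x C M j)) = (\<Sum>j<C. of_bool (x \<in> M j) :: int)"
proof -
  let ?F = "{j \<in> {..<C}. free M x j}" and ?s = "run_rev (lnk M x C)"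
  have s: "(\<Sum>j<C. f j) = (\<Sum>j\<in>?F. f j) + (\<Sum>j\<in>{..<C} - ?F. f j)" for f :: "nat \<Rightarrow> int"
    by (rule sum.subset_diff[THEN trans, OF _ _ add.commute]) auto
  have b: "(\<Sum>j\<in>?F. f (?s j)) = (\<Sum>j\<in>?F. f j)" for f :: "nat \<Rightarrow> int"
    by (rule sum.reindex_bij_witness[of _ ?s ?s])
      (auto simp: free_run_rev intro: run_rev_run_rev[OF lnk_bd] run_rev_less[OF lnk_bd])
  have "(\<Sum>j\<in>?F. of_bool (x \<in> refl_pair x C M j)) = (\<Sum>j\<in>?F. (\<lambda>i. of_bool (Suc x \<in> M i) :: int) (?s j))"
  proof (rule sum.cong)
    fix j assume "j \<in> ?F"
    moreover from this have "free M x (?s j)" by (simp add: free_run_rev)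
    ultimately show "of_bool (x \<in> refl_pair x C M j) = (\<lambda>i. of_bool (Suc x \<in> M i) :: int) (?s j)"
      unfolding refl_pair_x free_def[of M x "?s j"] by auto
  qed simp
  moreover have "(\<Sum>j\<in>{..<C} - ?F. of_bool (x \<in> refl_pair x C M j)) = (\<Sum>j\<in>{..<C} - ?F. of_bool (Suc x \<in> M j) :: int)"
    by (rule sum.cong) (auto simp: refl_pair_x free_def)
  ultimately show "(\<Sum>j<C. of_bool (x \<in> refl_pair x C M j)) = (\<Sum>j<C. of_bool (Suc x \<in> M j) :: int)"
    unfolding s b[of "\<lambda>i. of_bool (Suc x \<in> M i)", symmetric] by (simp only:)
  have "(\<Sum>j\<in>?F. of_bool (Suc x \<in> refl_pair x C M j)) = (\<Sum>j\<in>?F. (\<lambda>i. of_bool (x \<in> M i) :: int) (?s j))"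
    by (rule sum.cong) (auto simp: refl_pair_x)
  moreover have "(\<Sum>j\<in>{..<C} - ?F. of_bool (Suc x \<in> refl_pair x C M j)) = (\<Sum>j\<in>{..<C} - ?F. of_bool (x \<in> M j) :: int)"
    by (rule sum.cong) (auto simp: refl_pair_x free_def)
  ultimately show "(\<Sum>j<C. of_bool (Suc x \<in> refl_pair x C M j)) = (\<Sum>j<C. of_bool (x \<in> M j) :: int)"
    unfolding s b[of "\<lambda>i. of_bool (x \<in> M i)", symmetric] by (simp only:)
qed

lemma refl_pair_props:
  assumes x: "1 \<le> x" "Suc x \<le> 2 * n" and M: "M \<in> arrays n r" "sst M" and b: "x \<in> M C \<Longrightarrow> Suc x \<in> M C"
  shows "refl_pair x C M \<in> arrays n r" "sst (refl_pair x C M)" "card (refl_pair x C M j) = card (M j)"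
proof -
  show "refl_pair x C M \<in> arrays n r" by (rule refl_pair_arrays[OF M(1) x])
  then show "card (refl_pair x C M j) = card (M j)" using card_refl_pair[OF x(1) M(1)] by blast
qed (rule sst_refl_pair[OF x(1) M(2) b])

section \<open>Reflection at the first exit from the chamber\<close>

definition lo :: "array \<Rightarrow> nat \<Rightarrow> nat \<Rightarrow> int" where
  "lo M C q = (\<Sum>j<C. of_bool (q \<in> M j))"

definition hi :: "nat \<Rightarrow> array \<Rightarrow> nat \<Rightarrow> nat \<Rightarrow> int" where
  "hi r M C q = (\<Sum>j\<in>{C..<r}. of_bool (q \<in> M j))"

text \<open>The number of letters \<open>q\<close> among those read up to letter \<open>l\<close> of column \<open>c\<close>, the columns being read
  from right to left.\<close>

definition pre :: "nat \<Rightarrow> array \<Rightarrow> nat \<Rightarrow> nat \<Rightarrow> nat \<Rightarrow> int" where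
  "pre r M c l q = hi r M (Suc c) q + of_bool (q \<in> M c \<and> q \<le> l)"

text \<open>Pairing of the content \<open>f\<close> with the i-th simple coroot of the path side;
  \<open>2 * n - i\<close> is the bar of \<open>Suc i\<close>.\<close>

definition hh :: "nat \<Rightarrow> (nat \<Rightarrow> int) \<Rightarrow> nat \<Rightarrow> int" where
  "hh n f i = (f i - f (2 * n + 1 - i)) - (if i < n then f (Suc i) - f (2 * n - i) else 0)"

definition viol :: "nat \<Rightarrow> nat \<Rightarrow> array \<Rightarrow> nat \<Rightarrow> nat \<Rightarrow> nat \<Rightarrow> bool" where
  "viol n r M c l i \<longleftrightarrow> 1 \<le> i \<and> i \<le> n \<and> hh n (pre r M c l) i < 0"

definition hatdom :: "nat \<Rightarrow> nat \<Rightarrow> array \<Rightarrow> bool" where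
  "hatdom n r M \<longleftrightarrow> (\<forall>c<r. \<forall>l\<le>2 * n. \<forall>i. \<not> viol n r M c l i)"

text \<open>The weight shifted by rho = (n, ..., 1), so that the inequalities of the chamber become
  strict.\<close>

definition gv :: "nat \<Rightarrow> nat \<Rightarrow> array \<Rightarrow> nat \<Rightarrow> int" where
  "gv n r M i = (if 1 \<le> i \<and> i \<le> n then lo M r i - lo M r (2 * n + 1 - i) + (int n + 1 - int i) else 0)"

definition anti_C :: "nat \<Rightarrow> ((nat \<Rightarrow> int) \<Rightarrow> int) \<Rightarrow> bool" where
  "anti_C n f \<longleftrightarrow> (\<forall>v i. 1 \<le> i \<longrightarrow> i < n \<longrightarrow> f (v(i := v (Suc i), Suc i := v i)) = - f v)
     \<and> (\<forall>v. f (v(n := - v n)) = - f v)"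

lemma hi_step: "c < r \<Longrightarrow> hi r M c q = hi r M (Suc c) q + of_bool (q \<in> M c)"
  by (simp only: hi_def sum.atLeast_Suc_lessThan add.commute)

lemma hi_empty: "r \<le> c \<Longrightarrow> hi r M c q = 0"
  by (simp add: hi_def)

lemma lo_hi: "C \<le> r \<Longrightarrow> lo M r q = lo M C q + hi r M C q"
  unfolding lo_def hi_def lessThan_atLeast0 by (rule sum.atLeastLessThan_concat[symmetric]) auto

text \<open>Only the letters \<open>Suc i\<close> and the bar of \<open>i\<close> pair negatively
  with the i-th coroot, and for \<open>i = n\<close> only the bar.\<close>

lemma hh_shift:
  assumes "1 \<le> i" "i \<le> n" "hh n f i < 0" "0 \<le> hh n g i" "\<And>q. q \<noteq> l \<Longrightarrow> f q = g q" "g l \<le> f l" "f l \<le> g l + 1"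
  shows "l = 2 * n + 1 - i \<or> i < n \<and> l = Suc i"
proof (rule ccontr)
  assume l: "\<not> ?thesis"
  then have "f (2 * n + 1 - i) = g (2 * n + 1 - i)" "i < n \<Longrightarrow> f (Suc i) = g (Suc i)" using assms(5) by auto
  moreover have "g q \<le> f q" for q using assms(5,6) by (cases "q = l") auto
  from this[of i] this[of "2 * n - i"] have "g i \<le> f i" "g (2 * n - i) \<le> f (2 * n - i)" .
  ultimately have "hh n g i \<le> hh n f i" unfolding hh_def by (cases "i < n") auto
  then show False using assms(3,4) by simp
qed

text \<open>Columns are read from the right and each column in increasing order, so
  \<open>(c, l)\<close> is the first place at which the path is outside the chamber.\<close>

locale first_violation =
  fixes n r :: nat and M :: "array" and c l i :: nat
  assumes M: "M \<in> arrays n r" and c: "c < r" and l: "l \<le> 2 * n" and v: "viol n r M c l i"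
    and before: "\<And>c' l' i. c < c' \<Longrightarrow> c' < r \<Longrightarrow> l' \<le> 2 * n \<Longrightarrow> \<not> viol n r M c' l' i"
      "\<And>l' i. l' < l \<Longrightarrow> \<not> viol n r M c l' i"
begin

lemma i_range: "1 \<le> i" "i \<le> n"
  using v by (auto simp: viol_def)

lemma start_nonneg: "0 \<le> hh n (hi r M (Suc c)) i"
proof (cases "Suc c < r")
  case True
  have "hh n (pre r M (Suc c) (2 * n)) i \<ge> 0"
    using before(1)[of "Suc c" "2 * n" i] True i_range by (simp add: viol_def)
  moreover have "pre r M (Suc c) (2 * n) q = hi r M (Suc c) q" if "q \<le> 2 * n" for q
    using hi_step[OF True, of M q] that by (simp add: pre_def)
  ultimately show ?thesis using i_range unfolding hh_def by (simp split: if_splits)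
next
  case False
  then show ?thesis by (simp add: hh_def hi_empty)
qed

lemma no_viol: "l' < l \<Longrightarrow> 0 \<le> hh n (pre r M c l') i"
  using before(2)[of l' i] i_range by (simp add: viol_def)

lemma is_viol: "hh n (pre r M c l) i < 0"
  using v by (simp add: viol_def)

lemma zero_notin: "0 \<notin> M j"
  by (rule arrays_0[OF M])

lemma l_pos: "1 \<le> l"
proof (rule ccontr)
  assume "\<not> 1 \<le> l"
  then have "l = 0" by simp
  then have "pre r M c l q = hi r M (Suc c) q" for q using zero_notin[of c] by (cases "q = 0") (auto simp: pre_def)
  then have "pre r M c l = hi r M (Suc c)" by (rule ext)
  then show False using is_viol start_nonneg by simp
qed

lemma l_cases: "l = 2 * n + 1 - i \<or> i < n \<and> l = Suc i"
proof (rule hh_shift[OF i_range is_viol no_viol[of "l - 1"]])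
  show "l - 1 < l" using l_pos by simp
  show "pre r M c l q = pre r M c (l - 1) q" if "q \<noteq> l" for q
  proof -
    have "q \<le> l \<longleftrightarrow> q \<le> l - 1" using that l_pos by linarith
    then show ?thesis by (simp add: pre_def)
  qed
qed (simp_all add: pre_def)

definition "b q = (of_bool (q \<in> M c) :: int)"
definition "a q = hi r M (Suc c) q"

lemma b01: "b q = 0 \<or> b q = 1"
  by (simp add: b_def)

lemma pre_ab: "pre r M c l' q = a q + (if q \<le> l' then b q else 0)"
  by (simp add: pre_def a_def b_def)

lemma hi_ab: "hi r M c q = a q + b q"
  using hi_step[OF c] by (simp add: a_def b_def)

lemma start_ab: "0 \<le> hh n a i"
  using start_nonneg unfolding a_def by simp

lemma case_A:
  assumes "i < n" "l = Suc i"
  shows "i \<notin> M c" "2 * n - i \<in> M (Suc c) \<Longrightarrow> Suc (2 * n - i) \<in> M (Suc c)"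
    "hi r M c i - hi r M c (Suc i) + hi r M (Suc c) (2 * n - i) - hi r M (Suc c) (Suc (2 * n - i)) = - 1"
proof -
  have e: "2 * n + 1 - i = Suc (2 * n - i)" "\<not> 2 * n - i \<le> Suc i" using assms by auto
  have v1: "a i + b i - a (Suc (2 * n - i)) - (a (Suc i) + b (Suc i)) + a (2 * n - i) < 0"
    using is_viol assms e unfolding hh_def pre_ab by simp
  have v2: "a i - a (Suc (2 * n - i)) - a (Suc i) + a (2 * n - i) \<ge> 0"
    using start_ab assms e unfolding hh_def by simp
  have bb: "b i = 0" "b (Suc i) = 1" using v1 v2 b01[of i] b01[of "Suc i"] by linarith+
  then show "i \<notin> M c" by (simp add: b_def)
  have s: "a i - a (Suc (2 * n - i)) - a (Suc i) + a (2 * n - i) = 0" using v1 v2 bb by linarith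
  then show "hi r M c i - hi r M c (Suc i) + hi r M (Suc c) (2 * n - i) - hi r M (Suc c) (Suc (2 * n - i)) = - 1"
    unfolding hi_ab a_def[symmetric] using bb by linarith
  assume z: "2 * n - i \<in> M (Suc c)"
  show "Suc (2 * n - i) \<in> M (Suc c)"
  proof (rule ccontr)
    assume w: "Suc (2 * n - i) \<notin> M (Suc c)"
    have cr: "Suc c < r" using arrays_bd[OF M z] by simp
    \<comment> \<open>Had column \<open>Suc c\<close> the letter \<open>2 * n - i\<close> without
      the bar of \<open>i\<close>, the pairing would have been -1 already just before that letter
      was read.\<close>
    let ?l = "2 * n - i - 1"
    have q: "pre r M (Suc c) ?l q = (if q \<le> ?l then a q else hi r M (Suc (Suc c)) q)" for q
      using hi_step[OF cr, of M q] by (simp add: pre_def a_def)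
    have az: "a (2 * n - i) = hi r M (Suc (Suc c)) (2 * n - i) + 1"
      "a (Suc (2 * n - i)) = hi r M (Suc (Suc c)) (Suc (2 * n - i))"
      using hi_step[OF cr, of M] z w by (simp_all add: a_def)
    have "0 \<le> hh n (pre r M (Suc c) ?l) i"
      using before(1)[of "Suc c" ?l i] cr i_range by (simp add: viol_def)
    moreover have "i \<le> ?l" "Suc i \<le> ?l" "\<not> 2 * n - i \<le> ?l" "\<not> Suc (2 * n - i) \<le> ?l" using assms(1) by auto
    ultimately show False using az s assms(1) e(1) unfolding hh_def q by simp
  qed
qed

text \<open>Here \<open>l\<close> is the bar of \<open>i\<close>, the last of the four letters
  concerned, so both pairs are frozen from column \<open>c\<close> on.\<close>

lemma case_B:
  assumes "i < n" "l = 2 * n + 1 - i"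
  shows "i \<in> M c \<Longrightarrow> Suc i \<in> M c" "2 * n - i \<notin> M c"
    "hi r M c i - hi r M c (Suc i) + hi r M c (2 * n - i) - hi r M c (Suc (2 * n - i)) = - 1"
proof -
  have e: "2 * n + 1 - i = Suc (2 * n - i)" using assms by auto
  have "i \<le> 2 * n - i" "Suc i \<le> 2 * n - i" using assms by auto
  then have v1: "(a i + b i) - (a (Suc (2 * n - i)) + b (Suc (2 * n - i))) - (a (Suc i) + b (Suc i)) + (a (2 * n - i) + b (2 * n - i)) < 0"
    using is_viol assms e unfolding hh_def pre_ab by simp
  have v2: "a i - a (Suc (2 * n - i)) - a (Suc i) + a (2 * n - i) \<ge> 0"
    using start_ab assms e unfolding hh_def by simp
  \<comment> \<open>The state just before the letter \<open>2 * n - i\<close> is still in the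
    chamber; comparing with it isolates the two barred letters.\<close>
  let ?l = "2 * n - i - 1"
  have "i \<le> ?l" "Suc i \<le> ?l" "\<not> 2 * n - i \<le> ?l" "\<not> Suc (2 * n - i) \<le> ?l" using assms(1) by auto
  moreover have "0 \<le> hh n (pre r M c ?l) i" using assms by (intro no_viol) auto
  ultimately have v3: "(a i + b i) - a (Suc (2 * n - i)) - (a (Suc i) + b (Suc i)) + a (2 * n - i) \<ge> 0"
    using assms e unfolding hh_def pre_ab by simp
  note bs = b01[of i] b01[of "Suc i"] b01[of "2 * n - i"] b01[of "Suc (2 * n - i)"]
  have z: "b (2 * n - i) = 0" using v1 v3 bs by linarith
  then show "2 * n - i \<notin> M c" by (simp add: b_def)
  show "hi r M c i - hi r M c (Suc i) + hi r M c (2 * n - i) - hi r M c (Suc (2 * n - i)) = - 1"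
    unfolding hi_ab using v1 v3 z bs by linarith
  assume "i \<in> M c"
  then have "b i = 1" by (simp add: b_def)
  then have "b (Suc i) = 1" using v1 v2 z bs by linarith
  then show "Suc i \<in> M c" by (simp add: b_def)
qed

lemma case_C:
  assumes "i = n" "l = Suc n"
  shows "n \<notin> M c" "hi r M c n - hi r M c (Suc n) = - 1"
proof -
  have "(a n + b n) - (a (Suc n) + b (Suc n)) < 0" using is_viol assms unfolding hh_def pre_ab by simp
  moreover have "a n - a (Suc n) \<ge> 0" using start_ab assms unfolding hh_def by simp
  ultimately have "b n = 0" "hi r M c n - hi r M c (Suc n) = - 1"
    unfolding hi_ab using b01[of n] b01[of "Suc n"] by linarith+
  then show "hi r M c n - hi r M c (Suc n) = - 1" "n \<notin> M c" by (auto simp: b_def)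
qed

end

text \<open>Given by the letter \<open>l\<close> instead of the violated index, so that the move can
  be found again from its image. The index is \<open>l - 1\<close> for \<open>l \<le> n\<close>, it
  is \<open>n\<close> for \<open>l = Suc n\<close>, and \<open>2 * n + 1 - l\<close> beyond.\<close>

definition hat_move :: "nat \<Rightarrow> nat \<Rightarrow> nat \<Rightarrow> array \<Rightarrow> array" where
  "hat_move n c l M = (if l \<le> n then refl_pair (2 * n + 1 - l) (Suc c) (refl_pair (l - 1) c M)
     else if l = Suc n then refl_pair n c M
     else refl_pair (l - 1) c (refl_pair (2 * n + 1 - l) c M))"

lemma lo_refl_pair:
  "q \<noteq> x \<Longrightarrow> q \<noteq> Suc x \<Longrightarrow> lo (refl_pair x C M) D q = lo M D q"
  "lo (refl_pair x C M) C x = lo M C (Suc x)" "lo (refl_pair x C M) C (Suc x) = lo M C x"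
  unfolding lo_def sum_refl_pair by (simp_all add: refl_pair_other)

lemma hi_refl_pair: "C \<le> D \<Longrightarrow> hi r (refl_pair x C M) D q = hi r M D q"
  unfolding hi_def by (intro sum.cong) (auto simp: refl_pair_ge)

lemma gv_two_reflections:
  assumes i: "1 \<le> i" "i < n" and CD: "C \<le> r" "D \<le> r"
    and e: "hi r M C i - hi r M C (Suc i) + hi r M D (2 * n - i) - hi r M D (Suc (2 * n - i)) = - 1"
  shows "gv n r (refl_pair (2 * n - i) D (refl_pair i C M)) = (gv n r M)(i := gv n r M (Suc i), Suc i := gv n r M i)"
proof
  fix k
  let ?z = "2 * n - i"
  let ?N = "refl_pair ?z D (refl_pair i C M)"
  have ne: "i \<noteq> ?z" "i \<noteq> Suc ?z" "Suc i \<noteq> ?z" "Suc i \<noteq> Suc ?z" using i by auto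
  have lx: "lo ?N r i = lo M C (Suc i) + hi r M C i" "lo ?N r (Suc i) = lo M C i + hi r M C (Suc i)"
    using lo_refl_pair(1)[of _ ?z D "refl_pair i C M" r] ne lo_hi[OF CD(1), of "refl_pair i C M"] lo_refl_pair(2,3)[of i C M]
      hi_refl_pair[of C C r i M] by simp_all
  have "refl_pair i C M' j = M' j" if "C \<le> j" for j M' using that by (rule refl_pair_ge)
  have hz: "hi r (refl_pair i C M) D q = hi r M D q" "lo (refl_pair i C M) D q = lo M D q" if "q = ?z \<or> q = Suc ?z" for q
    using that ne by (auto simp: hi_def lo_def refl_pair_other)
  have lz: "lo ?N r ?z = lo M D (Suc ?z) + hi r M D ?z" "lo ?N r (Suc ?z) = lo M D ?z + hi r M D (Suc ?z)"
    using lo_hi[OF CD(2), of ?N] lo_refl_pair(2,3)[of ?z D "refl_pair i C M"] hi_refl_pair[of D D r ?z "refl_pair i C M"] hz by simp_all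
  have w: "2 * n + 1 - i = Suc ?z" "2 * n + 1 - Suc i = ?z" using i by auto
  have M4: "lo M r i = lo M C i + hi r M C i" "lo M r (Suc i) = lo M C (Suc i) + hi r M C (Suc i)"
    "lo M r ?z = lo M D ?z + hi r M D ?z" "lo M r (Suc ?z) = lo M D (Suc ?z) + hi r M D (Suc ?z)"
    using lo_hi[OF CD(1)] lo_hi[OF CD(2)] by auto
  have gi: "gv n r N i = lo N r i - lo N r (Suc ?z) + (int n + 1 - int i)"
    "gv n r N (Suc i) = lo N r (Suc i) - lo N r ?z + (int n - int i)" for N
    unfolding gv_def w using i by simp_all
  consider "k = i" | "k = Suc i" | "k \<noteq> i" "k \<noteq> Suc i" by blast
  then show "gv n r ?N k = ((gv n r M)(i := gv n r M (Suc i), Suc i := gv n r M i)) k"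
  proof cases
    case 1
    then show ?thesis using e lx lz M4 gi by simp
  next
    case 2
    then show ?thesis using e lx lz M4 gi by simp
  next
    case 3
    show ?thesis
    proof (cases "1 \<le> k \<and> k \<le> n")
      case True
      have "k \<notin> {i, Suc i, ?z, Suc ?z}" "2 * n + 1 - k \<notin> {i, Suc i, ?z, Suc ?z}" using 3 True i by auto
      then have "lo ?N r k = lo M r k" "lo ?N r (2 * n + 1 - k) = lo M r (2 * n + 1 - k)"
        by (simp_all add: lo_refl_pair(1))
      then show ?thesis using 3 by (simp add: gv_def)
    qed (use 3 in \<open>auto simp: gv_def\<close>)
  qed
qed

lemma gv_one_reflection:
  assumes n: "1 \<le> n" and C: "C \<le> r" and e: "hi r M C n - hi r M C (Suc n) = - 1"
  shows "gv n r (refl_pair n C M) = (gv n r M)(n := - gv n r M n)"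
proof
  fix k
  let ?N = "refl_pair n C M"
  have lx: "lo ?N r n = lo M C (Suc n) + hi r M C n" "lo ?N r (Suc n) = lo M C n + hi r M C (Suc n)"
    using lo_hi[OF C, of ?N] lo_refl_pair(2,3)[of n C M] hi_refl_pair[of C C r n M] by simp_all
  have M4: "lo M r n = lo M C n + hi r M C n" "lo M r (Suc n) = lo M C (Suc n) + hi r M C (Suc n)"
    using lo_hi[OF C] by auto
  show "gv n r ?N k = ((gv n r M)(n := - gv n r M n)) k"
  proof (cases "k = n")
    case True
    then show ?thesis using n e lx M4 by (simp add: gv_def)
  next
    case False
    show ?thesis
    proof (cases "1 \<le> k \<and> k \<le> n")
      case True
      have "k \<notin> {n, Suc n}" "2 * n + 1 - k \<notin> {n, Suc n}" using False True by auto
      then have "lo ?N r k = lo M r k" "lo ?N r (2 * n + 1 - k) = lo M r (2 * n + 1 - k)"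
        by (simp_all add: lo_refl_pair(1))
      then show ?thesis using False by (simp add: gv_def)
    qed (use False in \<open>auto simp: gv_def\<close>)
  qed
qed

context first_violation
begin

lemma hat_move_props:
  assumes "sst M"
  defines "N \<equiv> hat_move n c l M"
  shows "N \<in> arrays n r" "sst N" "\<And>j. card (N j) = card (M j)" "hat_move n c l N = M"
    "\<And>j. c < j \<Longrightarrow> N j = M j" "\<And>q. q \<le> l \<Longrightarrow> q \<in> N c \<longleftrightarrow> q \<in> M c"
    "anti_C n f \<Longrightarrow> f (gv n r N) = - f (gv n r M)"
proof -
  let ?z = "2 * n - i"
  have cr: "c \<le> r" "Suc c \<le> r" using c by auto
  have "(N \<in> arrays n r \<and> sst N \<and> (\<forall>j. card (N j) = card (M j)) \<and> hat_move n c l N = M) \<and>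
    (\<forall>j>c. N j = M j) \<and> (\<forall>q\<le>l. q \<in> N c \<longleftrightarrow> q \<in> M c) \<and> (anti_C n f \<longrightarrow> f (gv n r N) = - f (gv n r M))"
  proof (cases "i < n")
    case True
    then have z: "Suc i < ?z" "1 \<le> ?z" "Suc ?z \<le> 2 * n" "Suc i \<le> 2 * n" using i_range by auto
    \<comment> \<open>\<open>D\<close> is the first column kept for the barred pair:
      \<open>c\<close> if column \<open>c\<close> has been read beyond that pair,
      \<open>Suc c\<close> if it has been read only up to \<open>Suc i\<close>.\<close>
    obtain D where D: "D = c \<and> l = Suc ?z \<or> D = Suc c \<and> l = Suc i"
        and h: "\<And>M. hat_move n c l M = refl_pair ?z D (refl_pair i c M)"
        and ca: "i \<in> M c \<Longrightarrow> Suc i \<in> M c" "?z \<in> M D \<Longrightarrow> Suc ?z \<in> M D"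
          "hi r M c i - hi r M c (Suc i) + hi r M D ?z - hi r M D (Suc ?z) = - 1"
    proof (cases "l = Suc i")
      case l: True
      then have "2 * n + 1 - l = ?z" "l - 1 = i" "l \<le> n" using True by auto
      then show thesis by (intro that[of "Suc c"]) (use l case_A[OF True l] in \<open>auto simp: hat_move_def\<close>)
    next
      case False
      then have l: "l = 2 * n + 1 - i" using l_cases by blast
      then have "l = Suc ?z" "2 * n + 1 - l = i" "l - 1 = ?z" "\<not> l \<le> n" "l \<noteq> Suc n" using True by auto
      then show thesis by (intro that[of c]) (use case_B[OF True l] in \<open>simp_all add: hat_move_def\<close>)
    qed
    note N = N_def[unfolded h]
    note p1 = refl_pair_props[OF i_range(1) z(4) M assms(1) ca(1)]
    have "?z \<in> refl_pair i c M D \<Longrightarrow> Suc ?z \<in> refl_pair i c M D" using ca(2) z by (simp add: refl_pair_other)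
    note p2 = refl_pair_props[OF z(2,3) p1(1,2) this, folded N]
    have inv: "hat_move n c l N = M" unfolding h N refl_pair_commute[OF i_range(1) z(1)]
      unfolding refl_pair_refl_pair[OF i_range(1)] by (rule refl_pair_refl_pair[OF z(2)])
    have "gv n r N = (gv n r M)(i := gv n r M (Suc i), Suc i := gv n r M i)"
      unfolding N by (rule gv_two_reflections) (use i_range True cr ca(3) D in auto)
    then have "anti_C n f \<Longrightarrow> f (gv n r N) = - f (gv n r M)" using True i_range by (simp add: anti_C_def)
    moreover have "N j = M j" if "j > c" for j unfolding N using that D by (auto simp: refl_pair_ge)
    moreover have "q \<in> N c \<longleftrightarrow> q \<in> M c" if "q \<le> l" for q
      unfolding N using that z D by (auto simp: refl_pair_other refl_pair_ge)
    ultimately show ?thesis using p2 p1(3) inv by simp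
  next
    case False
    then have n: "i = n" "1 \<le> n" "l = Suc n" using l_cases i_range by auto
    note ca = case_C[OF n(1,3)]
    have N: "N = refl_pair n c M" unfolding N_def hat_move_def using n by simp
    have "Suc n \<le> 2 * n" "n \<in> M c \<Longrightarrow> Suc n \<in> M c" using n(2) ca(1) by auto
    note p = refl_pair_props[OF n(2) this(1) M assms(1) this(2), folded N]
    have inv: "hat_move n c l N = M" unfolding hat_move_def N using n by (simp add: refl_pair_refl_pair)
    have "gv n r N = (gv n r M)(n := - gv n r M n)"
      unfolding N by (rule gv_one_reflection) (use n cr ca(2) in auto)
    then have "anti_C n f \<Longrightarrow> f (gv n r N) = - f (gv n r M)" by (simp add: anti_C_def)
    moreover have "N j = M j" if "j \<ge> c" for j unfolding N using that by (simp add: refl_pair_ge)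
    ultimately show ?thesis using p n inv by simp
  qed
  then show "N \<in> arrays n r" "sst N" "\<And>j. card (N j) = card (M j)" "hat_move n c l N = M"
    "\<And>j. c < j \<Longrightarrow> N j = M j" "\<And>q. q \<le> l \<Longrightarrow> q \<in> N c \<longleftrightarrow> q \<in> M c"
    "anti_C n f \<Longrightarrow> f (gv n r N) = - f (gv n r M)" by blast+
qed

end

text \<open>\<open>hat_move\<close> keeps everything read up to the first exit, the exit itself
  included. So the image leaves the chamber first at the same place, and the arrays that leave it
  cancel in pairs.\<close>

theorem sum_sst_hat_reflection:
  assumes f: "anti_C n f"
  shows "(\<Sum>M\<in>{M \<in> arrays n r. sst M \<and> (\<forall>j. card (M j) = k j)}. f (gv n r M))
    = (\<Sum>M\<in>{M \<in> arrays n r. sst M \<and> (\<forall>j. card (M j) = k j) \<and> hatdom n r M}. f (gv n r M))"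
proof -
  let ?X = "{M \<in> arrays n r. sst M \<and> (\<forall>j. card (M j) = k j)}"
  define A where "A = {M \<in> ?X. \<not> hatdom n r M}"
  define vc where "vc M = {c. c < r \<and> (\<exists>l\<le>2 * n. \<exists>i. viol n r M c l i)}" for M
  define cc where "cc M = Max (vc M)" for M
  define ll where "ll M = (LEAST l. l \<le> 2 * n \<and> (\<exists>i. viol n r M (cc M) l i))" for M
  define t where "t M = hat_move n (cc M) (ll M) M" for M
  have fin: "finite (vc M)" for M unfolding vc_def by (rule finite_subset[of _ "{..<r}"]) auto
  have main: "t M \<in> A \<and> t (t M) = M \<and> f (gv n r (t M)) = - f (gv n r M)" if MA: "M \<in> A" for M
  proof -
    have Ms: "M \<in> arrays n r" "sst M" "\<And>j. card (M j) = k j" using MA by (auto simp: A_def)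
    have "vc M \<noteq> {}" using MA unfolding A_def hatdom_def vc_def by blast
    then have cv: "cc M \<in> vc M" unfolding cc_def using fin by simp
    have cm: "c \<le> cc M" if "c \<in> vc M" for c unfolding cc_def using fin that by simp
    have "\<exists>l. l \<le> 2 * n \<and> (\<exists>i. viol n r M (cc M) l i)" using cv by (auto simp: vc_def)
    then have lv: "ll M \<le> 2 * n \<and> (\<exists>i. viol n r M (cc M) (ll M) i)" unfolding ll_def by (rule LeastI_ex)
    have lm: "\<not> viol n r M (cc M) l i" if "l < ll M" for l i
    proof
      assume "viol n r M (cc M) l i"
      moreover have "l \<le> 2 * n" using that lv by linarith
      ultimately show False using not_less_Least[of l "\<lambda>l. l \<le> 2 * n \<and> (\<exists>i. viol n r M (cc M) l i)"] that
        unfolding ll_def by blast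
    qed
    obtain i where i: "viol n r M (cc M) (ll M) i" using lv by blast
    interpret first_violation n r M "cc M" "ll M" i
    proof
      show "cc M < r" using cv by (simp add: vc_def)
      show "\<not> viol n r M c' l' i" if "cc M < c'" "c' < r" "l' \<le> 2 * n" for c' l' i
        using cm[of c'] that unfolding vc_def by force
    qed (use Ms lv i lm in auto)
    note P = hat_move_props[OF Ms(2), folded t_def]
    have pr: "pre r (t M) c l = pre r M c l" if "cc M < c \<or> c = cc M \<and> l \<le> ll M" for c l
    proof
      fix q
      have "hi r (t M) (Suc c) q = hi r M (Suc c) q"
        unfolding hi_def by (intro sum.cong) (use P(5) that in auto)
      moreover have "(q \<in> t M c \<and> q \<le> l) = (q \<in> M c \<and> q \<le> l)" using that P(5,6) by auto
      ultimately show "pre r (t M) c l q = pre r M c l q" by (simp add: pre_def)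
    qed
    have ve: "viol n r (t M) c l i = viol n r M c l i" if "cc M < c \<or> c = cc M \<and> l \<le> ll M" for c l i
      using pr[OF that] by (simp add: viol_def)
    have "cc (t M) = cc M"
    proof -
      have "cc M \<in> vc (t M)" using lv ve[of "cc M" "ll M"] cv unfolding vc_def by blast
      moreover have "c \<le> cc M" if "c \<in> vc (t M)" for c
      proof (rule ccontr)
        assume a: "\<not> c \<le> cc M"
        then have "c \<in> vc M" using that ve[of c] unfolding vc_def by auto
        then show False using cm a by blast
      qed
      ultimately show ?thesis unfolding cc_def[of "t M"] using fin by (intro Max_eqI) auto
    qed
    moreover have "ll (t M) = ll M"
      unfolding ll_def[of "t M"] calculation
    proof (rule Least_equality)
      show "ll M \<le> 2 * n \<and> (\<exists>i. viol n r (t M) (cc M) (ll M) i)" using lv ve by simp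
      show "ll M \<le> y" if "y \<le> 2 * n \<and> (\<exists>i. viol n r (t M) (cc M) y i)" for y
        using that ve lm by (metis linorder_le_cases not_le)
    qed
    ultimately have "t (t M) = M" using P(4) unfolding t_def[of "t M"] by simp
    moreover have "\<not> hatdom n r (t M)" using lv ve c unfolding hatdom_def by blast
    ultimately show ?thesis using P(1-3) P(7)[OF f] Ms(3) by (simp add: A_def)
  qed
  have finX: "finite ?X" by (rule finite_subset[OF _ finite_arrays]) auto
  have "(\<Sum>M\<in>A. f (gv n r M)) = 0"
    by (rule sum_involution_cancel[of A t]) (use main finite_subset[OF _ finX, of A] in \<open>auto simp: A_def\<close>)
  moreover have "{M \<in> arrays n r. sst M \<and> (\<forall>j. card (M j) = k j) \<and> hatdom n r M} = ?X - A" by (auto simp: A_def)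
  moreover have "(\<Sum>M\<in>?X - A. f (gv n r M)) = (\<Sum>M\<in>?X. f (gv n r M)) - (\<Sum>M\<in>A. f (gv n r M))"
    using finX by (rule sum_diff) (auto simp: A_def)
  ultimately show ?thesis by (simp only:)
qed

section \<open>Chebyshev alternants\<close>

text \<open>Chebyshev polynomials of the second kind at z/2. For z = x + 1/x this is the character
  (x^(k+1) - x^-(k+1)) / (x - 1/x) of SL(2).\<close>

fun cheb :: "nat \<Rightarrow> 'a::comm_ring_1 \<Rightarrow> 'a" where
  "cheb 0 z = 1"
| "cheb (Suc 0) z = z"
| "cheb (Suc (Suc k)) z = z * cheb (Suc k) z - cheb k z"

lemma cheb_minus: "cheb k (- z) = (- 1) ^ k * cheb k z"
  by (induction k z rule: cheb.induct) (simp_all add: algebra_simps)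

primrec newt :: "(nat \<Rightarrow> 'a::comm_ring_1) \<Rightarrow> nat \<Rightarrow> 'a \<Rightarrow> 'a" where
  "newt z 0 x = 1"
| "newt z (Suc k) x = newt z k x * (x - z k)"

text \<open>Coefficients of \<open>cheb j\<close> in the Newton basis with nodes \<open>z\<close>,
  found by putting \<open>newt_mult\<close> into the recursion of \<open>cheb\<close>.\<close>

fun ncoef :: "(nat \<Rightarrow> 'a::comm_ring_1) \<Rightarrow> nat \<Rightarrow> nat \<Rightarrow> 'a" where
  "ncoef z 0 k = (if k = 0 then 1 else 0)"
| "ncoef z (Suc 0) k = (if k = 0 then z 0 else if k = 1 then 1 else 0)"
| "ncoef z (Suc (Suc j)) k = (case k of 0 \<Rightarrow> 0 | Suc l \<Rightarrow> ncoef z (Suc j) l) + z k * ncoef z (Suc j) k - ncoef z j k"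

lemma ncoef_upper: "j < k \<Longrightarrow> ncoef z j k = 0"
  by (induction z j k rule: ncoef.induct) (auto split: nat.splits)

lemma ncoef_diag: "ncoef z j j = 1"
proof -
  have "ncoef z (Suc j) (Suc j) = 1" for j
    by (induction j) (simp_all add: ncoef_upper)
  then show ?thesis by (cases j) auto
qed

lemma newt_mult: "x * newt z k x = newt z (Suc k) x + z k * newt z k x"
  by (simp add: algebra_simps)

lemma cheb_newt: "j \<le> K \<Longrightarrow> cheb j x = (\<Sum>k\<le>K. ncoef z j k * newt z k x)"
proof (induction j x arbitrary: K rule: cheb.induct)
  case (1 x)
  have "(\<Sum>k\<le>K. ncoef z 0 k * newt z k x) = (\<Sum>k\<in>{0}. ncoef z 0 k * newt z k x)"
    by (rule sum.mono_neutral_right) auto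
  then show ?case by simp
next
  case (2 x)
  have "(\<Sum>k\<le>K. ncoef z (Suc 0) k * newt z k x) = (\<Sum>k\<in>{0, 1}. ncoef z (Suc 0) k * newt z k x)"
    by (rule sum.mono_neutral_right) (use 2 in auto)
  then show ?case by simp
next
  case (3 j x)
  obtain L where L: "K = Suc L" "Suc j \<le> L" using 3(3) by (cases K) auto
  have "x * cheb (Suc j) x = (\<Sum>k\<le>L. ncoef z (Suc j) k * (x * newt z k x))"
    using 3(1)[of L] L by (simp add: sum_distrib_left algebra_simps)
  also have "\<dots> = (\<Sum>k\<le>L. ncoef z (Suc j) k * newt z (Suc k) x) + (\<Sum>k\<le>L. z k * ncoef z (Suc j) k * newt z k x)"
    unfolding newt_mult sum.distrib[symmetric] by (rule sum.cong) (simp_all add: algebra_simps)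
  also have "(\<Sum>k\<le>L. ncoef z (Suc j) k * newt z (Suc k) x)
      = (\<Sum>k\<le>K. (case k of 0 \<Rightarrow> 0 | Suc l \<Rightarrow> ncoef z (Suc j) l) * newt z k x)"
    unfolding L(1) sum.atMost_Suc_shift by simp
  also have "(\<Sum>k\<le>L. z k * ncoef z (Suc j) k * newt z k x) = (\<Sum>k\<le>K. z k * ncoef z (Suc j) k * newt z k x)"
    unfolding L(1) using L(2) by (simp add: ncoef_upper)
  also have "cheb j x = (\<Sum>k\<le>K. ncoef z j k * newt z k x)" using 3(2)[of K] 3(3) by simp
  ultimately show ?case
    by (simp add: sum.distrib sum_subtractf algebra_simps)
qed

lemma newt_zero: "i < k \<Longrightarrow> newt z k (z i) = 0"
  by (induction k) (auto simp: less_Suc_eq)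

lemma newt_prod: "newt z k x = (\<Prod>i<k. x - z i)"
  by (induction k) (simp_all add: mult.commute)

text \<open>The matrix of values factors through the Newton basis at its own nodes: a lower
  triangular matrix, whose diagonal gives the Vandermonde product, times a unitriangular
  one.\<close>

theorem cheb_alternant:
  fixes z :: "nat \<Rightarrow> 'a::comm_ring_1"
  shows "(\<Sum>p\<in>{p. p permutes {0..<N}}. signof p * (\<Prod>i = 0..<N. cheb (p i) (z i))) = (\<Prod>i<N. \<Prod>j<i. z i - z j)"
proof -
  define A where "A = mat N N (\<lambda>(i, j). cheb j (z i))"
  define B where "B = mat N N (\<lambda>(i, k). newt z k (z i))"
  define T where "T = mat N N (\<lambda>(k, j). ncoef z j k)"
  have carr: "A \<in> carrier_mat N N" "B \<in> carrier_mat N N" "T \<in> carrier_mat N N" by (auto simp: A_def B_def T_def)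
  have "A = B * T"
  proof (rule eq_matI)
    fix i j assume ij: "i < dim_row (B * T)" "j < dim_col (B * T)"
    then have "i < N" "j < N" by (simp_all add: B_def T_def)
    then obtain K where K: "N = Suc K" by (cases N) auto
    have "(B * T) $$ (i, j) = (\<Sum>k = 0..<N. newt z k (z i) * ncoef z j k)"
      using \<open>i < N\<close> \<open>j < N\<close> by (simp add: B_def T_def scalar_prod_def)
    also have "\<dots> = (\<Sum>k\<le>K. ncoef z j k * newt z k (z i))"
      unfolding K atLeast0LessThan lessThan_Suc_atMost by (simp add: mult.commute)
    also have "\<dots> = cheb j (z i)" using cheb_newt[of j K "z i" z] \<open>j < N\<close> K by simp
    finally show "A $$ (i, j) = (B * T) $$ (i, j)" using \<open>i < N\<close> \<open>j < N\<close> by (simp add: A_def)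
  qed (simp_all add: A_def B_def T_def)
  then have "det A = det B * det T" using det_mult carr by blast
  also have "det T = 1"
  proof -
    have "det T = prod_list (diag_mat T)"
      by (rule det_upper_triangular[OF _ carr(3)]) (auto simp: upper_triangular_def T_def ncoef_upper)
    also have "diag_mat T = map (\<lambda>i. 1) [0..<N]" by (simp add: diag_mat_def T_def ncoef_diag)
    finally show ?thesis by (simp add: map_replicate_const)
  qed
  also have "det B = (\<Prod>i<N. \<Prod>j<i. z i - z j)"
  proof -
    have "det B = prod_list (diag_mat B)"
      by (rule det_lower_triangular[OF _ carr(2)]) (simp add: B_def newt_zero)
    also have "diag_mat B = map (\<lambda>i. \<Prod>j<i. z i - z j) [0..<N]" by (simp add: diag_mat_def B_def newt_prod)
    also have "prod_list (map f [0..<N]) = (\<Prod>i<N. f i)" for f :: "nat \<Rightarrow> 'a"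
      by (induction N) (simp_all add: mult.commute)
    finally show ?thesis .
  qed
  finally have "det A = (\<Prod>i<N. \<Prod>j<i. z i - z j)" by simp
  moreover have "det A = (\<Sum>p\<in>{p. p permutes {0..<N}}. signof p * (\<Prod>i = 0..<N. cheb (p i) (z i)))"
    unfolding det_def'[OF carr(1)]
  proof (rule sum.cong)
    fix p assume "p \<in> {p. p permutes {0..<N}}"
    then have "p i < N" if "i < N" for i using that permutes_in_image[of p "{0..<N}" i] by auto
    then show "signof p * (\<Prod>i = 0..<N. A $$ (i, p i)) = signof p * (\<Prod>i = 0..<N. cheb (p i) (z i))"
      by (intro arg_cong2[of _ _ _ _ "(*)"] prod.cong) (auto simp: A_def)
  qed simp
  ultimately show ?thesis by simp
qed

section \<open>The group ring of the weight lattice acting on functions\<close>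

type_synonym expo = "nat \<Rightarrow>\<^sub>0 int"

text \<open>Laurent polynomials act on functions on the lattice by shifts. A polynomial identity
  becomes an identity between sums of shifted values, without extracting coefficients or dividing by
  a denominator.\<close>

definition act :: "(expo \<Rightarrow>\<^sub>0 int) \<Rightarrow> ((nat \<Rightarrow> int) \<Rightarrow> int) \<Rightarrow> (nat \<Rightarrow> int) \<Rightarrow> int" where
  "act p f v = (\<Sum>w\<in>Poly_Mapping.keys p. Poly_Mapping.lookup p w * f (\<lambda>i. v i + Poly_Mapping.lookup w i))"

lemma act_superset:
  assumes "finite S" "Poly_Mapping.keys p \<subseteq> S"
  shows "act p f v = (\<Sum>w\<in>S. Poly_Mapping.lookup p w * f (\<lambda>i. v i + Poly_Mapping.lookup w i))"
  unfolding act_def using assms by (intro sum.mono_neutral_left) (auto simp: in_keys_iff)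

lemma act_add: "act (p + q) f v = act p f v + act q f v"
  using act_superset[of "Poly_Mapping.keys p \<union> Poly_Mapping.keys q" _ f v] keys_add[of p q]
  by (simp add: lookup_add sum.distrib algebra_simps)

lemma act_single: "act (Poly_Mapping.single w c) f v = c * f (\<lambda>i. v i + Poly_Mapping.lookup w i)"
  by (cases "c = 0") (simp_all add: act_def)

lemma act_zero: "act 0 f v = 0"
  by (simp add: act_def)

lemma act_one: "act 1 f = f"
proof
  fix v
  have "act (Poly_Mapping.single 0 1) f v = f v" unfolding act_single by simp
  then show "act 1 f v = f v" by (simp only: single_one)
qed

lemma act_sum: "act (sum g A) f v = (\<Sum>x\<in>A. act (g x) f v)"
  by (induction A rule: infinite_finite_induct) (simp_all add: act_add act_zero)

lemma act_minus: "act (- p) f v = - act p f v"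
  using act_add[of p "- p" f v] by (simp add: act_zero)

lemma act_diff: "act (p - q) f v = act p f v - act q f v"
  using act_add[of p "- q" f v] by (simp add: act_minus)

lemma poly_mapping_sum_single: "p = (\<Sum>w\<in>Poly_Mapping.keys p. Poly_Mapping.single w (Poly_Mapping.lookup p w))" for p :: "expo \<Rightarrow>\<^sub>0 int"
proof (rule poly_mapping_eqI)
  fix k
  show "Poly_Mapping.lookup p k = Poly_Mapping.lookup (\<Sum>w\<in>Poly_Mapping.keys p. Poly_Mapping.single w (Poly_Mapping.lookup p w)) k"
    by (auto simp: lookup_sum lookup_single when_def in_keys_iff)
qed

lemma act_mult: "act (p * q) f = act p (act q f)"
proof (rule ext)
  fix v
  have 1: "act (Poly_Mapping.single w c * q) f v = c * act q f (\<lambda>i. v i + Poly_Mapping.lookup w i)" for w c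
  proof -
    have "act (Poly_Mapping.single w c * q) f v
      = act (\<Sum>u\<in>Poly_Mapping.keys q. Poly_Mapping.single (w + u) (c * Poly_Mapping.lookup q u)) f v"
      by (subst (1) poly_mapping_sum_single[of q]) (simp add: sum_distrib_left mult_single)
    also have "\<dots> = c * act q f (\<lambda>i. v i + Poly_Mapping.lookup w i)"
      unfolding act_sum act_single by (simp add: act_def sum_distrib_left lookup_add algebra_simps)
    finally show ?thesis .
  qed
  have "act (p * q) f v = act (\<Sum>w\<in>Poly_Mapping.keys p. Poly_Mapping.single w (Poly_Mapping.lookup p w) * q) f v"
    by (subst (1) poly_mapping_sum_single[of p]) (simp add: sum_distrib_right)
  also have "\<dots> = act p (act q f) v" unfolding act_sum 1 by (simp add: act_def)
  finally show "act (p * q) f v = act p (act q f) v" .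
qed

lemma act_of_int: "act (of_int c * p) f v = c * act p f v"
  by (induction c rule: int_induct[of _ 0])
    (simp_all add: act_zero act_add act_diff distrib_right left_diff_distrib)

definition zv :: "nat \<Rightarrow> expo \<Rightarrow>\<^sub>0 int" where
  "zv i = Poly_Mapping.single (Poly_Mapping.single i 1) 1 + Poly_Mapping.single (Poly_Mapping.single i (- 1)) 1"

definition nanti :: "((nat \<Rightarrow> int) \<Rightarrow> int) \<Rightarrow> nat \<Rightarrow> bool" where
  "nanti f i \<longleftrightarrow> (\<forall>v. f (v(i := - v i)) = - f v)"

definition npres :: "(expo \<Rightarrow>\<^sub>0 int) \<Rightarrow> bool" where
  "npres p \<longleftrightarrow> (\<forall>f i. nanti f i \<longrightarrow> nanti (act p f) i)"

lemma act_zv: "act (zv j) f v = f (v(j := v j + 1)) + f (v(j := v j - 1))"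
proof -
  have "(\<lambda>i. v i + Poly_Mapping.lookup (Poly_Mapping.single j c) i) = v(j := v j + c)" for c :: int
    by (auto simp: fun_eq_iff lookup_single when_def)
  from this[of 1] this[of "- 1"] show ?thesis unfolding zv_def act_add act_single by (simp only: mult_1_left) simp
qed

lemma npres_zv: "npres (zv j)"
  unfolding npres_def
proof (intro allI impI)
  fix f i assume f: "nanti f i"
  show "nanti (act (zv j) f) i"
    unfolding nanti_def
  proof
    fix v
    show "act (zv j) f (v(i := - v i)) = - act (zv j) f v"
    proof (cases "i = j")
      case True
      have e: "- v i + 1 = - (v i - 1)" "- v i - 1 = - (v i + 1)" by auto
      have "f (v(i := - v i + 1)) = - f (v(i := v i - 1))" "f (v(i := - v i - 1)) = - f (v(i := v i + 1))"
        unfolding e using f[unfolded nanti_def, rule_format, of "v(i := v i - 1)"] f[unfolded nanti_def, rule_format, of "v(i := v i + 1)"]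
        by simp_all
      then show ?thesis using True by (simp add: act_zv)
    next
      case False
      have "f ((v(i := - v i))(j := c)) = - f (v(j := c))" for c
      proof -
        have "f ((v(i := - v i))(j := c)) = f ((v(j := c))(i := - (v(j := c)) i))"
          by (rule arg_cong[of _ _ f]) (use False in \<open>auto simp: fun_eq_iff\<close>)
        then show ?thesis using f unfolding nanti_def by metis
      qed
      then show ?thesis using False by (simp add: act_zv)
    qed
  qed
qed

lemma npres_one: "npres 1"
  by (simp add: npres_def act_one)

lemma npres_mult: "npres p \<Longrightarrow> npres q \<Longrightarrow> npres (p * q)"
  by (simp add: npres_def act_mult)

lemma npres_diff: "npres p \<Longrightarrow> npres q \<Longrightarrow> npres (p - q)"
  by (simp add: npres_def nanti_def act_diff)

lemma npres_prod: "(\<And>x. x \<in> A \<Longrightarrow> npres (g x)) \<Longrightarrow> npres (prod g A)"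
  by (induction A rule: infinite_finite_induct) (auto intro: npres_mult npres_one)

lemma npres_cheb: "npres (cheb k (zv i))"
  by (induction k "zv i" rule: cheb.induct) (auto intro: npres_mult npres_one npres_diff npres_zv)

lemma nanti_zero: "nanti f i \<Longrightarrow> v i = 0 \<Longrightarrow> f v = 0"
proof -
  assume "nanti f i" "v i = 0"
  then have "f (v(i := 0)) = - f v" unfolding nanti_def by (metis neg_0_equal_iff_equal)
  moreover have "v(i := 0) = v" using \<open>v i = 0\<close> by (auto simp: fun_eq_iff)
  ultimately show ?thesis by simp
qed

text \<open>The Weyl denominator x - 1/x turns the character into x^(k+1) - x^-(k+1). On a function
  odd in coordinate \<open>i\<close> this means that the operator, applied at 1, the rho of rank
  one, evaluates at k + 1. The recursion of \<open>cheb\<close> shows it, as odd functions vanish at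
  0.\<close>

lemma act_cheb:
  assumes "nanti f i" "v i = 1"
  shows "act (cheb k (zv i)) f v = f (v(i := int k + 1))"
  using assms
proof (induction k "zv i" arbitrary: f v rule: cheb.induct)
  case 1
  then show ?case by (simp add: act_one fun_upd_idem)
next
  case 2
  then show ?case using nanti_zero[of f i "v(i := 0)"] by (simp add: act_zv)
next
  case (3 k)
  have n: "nanti (act (zv i) f) i" using npres_zv 3(3) unfolding npres_def by blast
  have "act (cheb (Suc (Suc k)) (zv i)) f v = act (cheb (Suc k) (zv i)) (act (zv i) f) v - act (cheb k (zv i)) f v"
    by (simp add: act_diff mult.commute[of "zv i"] act_mult)
  also have "\<dots> = f (v(i := int (Suc (Suc k)) + 1))"
    using 3(1)[of "act (zv i) f" v, OF n 3(4)] 3(2)[of f v, OF 3(3,4)] by (simp add: act_zv algebra_simps)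
  finally show ?case .
qed

lemma act_cheb_prod:
  assumes "finite I" "\<And>i. i \<in> I \<Longrightarrow> nanti f i" "\<And>i. i \<in> I \<Longrightarrow> v i = 1"
  shows "act (\<Prod>i\<in>I. cheb (k i) (zv i)) f v = f (\<lambda>i. if i \<in> I then int (k i) + 1 else v i)"
  using assms
proof (induction I arbitrary: v rule: finite_induct)
  case empty
  then show ?case by (simp add: act_one)
next
  case (insert a I)
  have n: "nanti (act (\<Prod>i\<in>I. cheb (k i) (zv i)) f) a"
    using npres_prod[of I "\<lambda>i. cheb (k i) (zv i)"] npres_cheb insert.prems(1)[of a] unfolding npres_def by blast
  have "act (\<Prod>i\<in>insert a I. cheb (k i) (zv i)) f v = act (\<Prod>i\<in>I. cheb (k i) (zv i)) f (v(a := int (k a) + 1))"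
    using insert.hyps act_cheb[OF n, of v "k a"] insert.prems(2) by (simp add: act_mult)
  also have "\<dots> = f (\<lambda>i. if i \<in> I then int (k i) + 1 else (v(a := int (k a) + 1)) i)"
    by (rule insert.IH) (use insert.prems insert.hyps in auto)
  also have "(\<lambda>i. if i \<in> I then int (k i) + 1 else (v(a := int (k a) + 1)) i) = (\<lambda>i. if i \<in> insert a I then int (k i) + 1 else v i)"
    using insert.hyps by auto
  finally show ?case .
qed

section \<open>The kernel of the dual Cauchy identity\<close>

text \<open>In \<open>array_choice\<close> the two components of \<open>e\<close> tell whether b_m
  and a_m occur in a column. Then \<open>cx\<close> is the share of this pair in \<open>n\<close>
  minus the height, and \<open>cy\<close> its share in the weight.\<close>

definition cx :: "bool \<times> bool \<Rightarrow> int" where "cx e = 1 - of_bool (fst e) - of_bool (snd e)"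
definition cy :: "bool \<times> bool \<Rightarrow> int" where "cy e = of_bool (snd e) - of_bool (fst e)"

definition choices :: "nat \<Rightarrow> nat \<Rightarrow> (nat \<times> nat \<Rightarrow> bool \<times> bool) set" where
  "choices r n = PiE ({..<r} \<times> {r..<r + n}) (\<lambda>_. UNIV)"

definition cwt :: "nat \<Rightarrow> nat \<Rightarrow> (nat \<times> nat \<Rightarrow> bool \<times> bool) \<Rightarrow> nat \<Rightarrow> int" where
  "cwt r n g i = (if i < r then \<Sum>k\<in>{r..<r + n}. cx (g (i, k))
     else if i < r + n then \<Sum>j<r. cy (g (j, i)) else 0)"

text \<open>The product of all x + 1/x + y + 1/y, the character of the exterior algebra for both
  groups; the four terms of a factor are the four subsets of a pair of letters.\<close>

definition kern :: "nat \<Rightarrow> nat \<Rightarrow> expo \<Rightarrow>\<^sub>0 int" where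
  "kern r n = (\<Prod>x\<in>{..<r} \<times> {r..<r + n}. zv (fst x) + zv (snd x))"

definition letter_expo :: "nat \<times> nat \<Rightarrow> bool \<times> bool \<Rightarrow> expo" where
  "letter_expo x e = Poly_Mapping.single (fst x) (cx e) + Poly_Mapping.single (snd x) (cy e)"

lemma prod_single: "(\<Prod>x\<in>A. Poly_Mapping.single (a x) 1) = Poly_Mapping.single (\<Sum>x\<in>A. a x) (1::int)"
  by (induction A rule: infinite_finite_induct) (simp_all add: mult_single)

lemma UNIV_bool_pairs: "(UNIV :: (bool \<times> bool) set) = {(False, False), (True, True), (False, True), (True, False)}"
  by auto

lemma zv_add_choices: "zv j + zv k = (\<Sum>e\<in>UNIV. Poly_Mapping.single (letter_expo (j, k) e) 1)"
  unfolding UNIV_bool_pairs by (simp add: letter_expo_def zv_def cx_def cy_def algebra_simps)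

lemma lookup_letter_expo_sum:
  assumes "i < r + n"
  shows "Poly_Mapping.lookup (\<Sum>x\<in>{..<r} \<times> {r..<r + n}. letter_expo x (g x)) i = cwt r n g i"
proof -
  have "Poly_Mapping.lookup (\<Sum>x\<in>{..<r} \<times> {r..<r + n}. letter_expo x (g x)) i
    = (\<Sum>j<r. \<Sum>k\<in>{r..<r + n}. (if j = i then cx (g (j, k)) else 0) + (if k = i then cy (g (j, k)) else 0))"
    unfolding lookup_sum sum.cartesian_product
    by (rule sum.cong) (auto simp: letter_expo_def lookup_add lookup_single when_def)
  also have "\<dots> = cwt r n g i"
  proof (cases "i < r")
    case True
    have "(\<Sum>k\<in>{r..<r + n}. (if j = i then cx (g (j, k)) else 0) + (if k = i then cy (g (j, k)) else 0))
      = (if j = i then \<Sum>k\<in>{r..<r + n}. cx (g (i, k)) else 0)" for j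
      using True by (auto intro: sum.cong)
    then show ?thesis using True by (simp add: cwt_def)
  next
    case False
    have "(\<Sum>k\<in>{r..<r + n}. (if j = i then cx (g (j, k)) else 0) + (if k = i then cy (g (j, k)) else 0))
      = cy (g (j, i))" if "j < r" for j
      using False that assms by (simp add: sum.distrib)
    then show ?thesis using False assms by (simp add: cwt_def)
  qed
  finally show ?thesis .
qed

lemma act_kern:
  "act (kern r n) f v = (\<Sum>g\<in>choices r n. f (\<lambda>i. v i + cwt r n g i))"
proof -
  let ?A = "{..<r} \<times> {r..<r + n}"
  have "kern r n = (\<Sum>g\<in>choices r n. \<Prod>x\<in>?A. Poly_Mapping.single (letter_expo x (g x)) 1)"
  proof -
    have "kern r n = (\<Prod>x\<in>?A. \<Sum>e\<in>UNIV. Poly_Mapping.single (letter_expo x e) 1)"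
      unfolding kern_def by (simp only: zv_add_choices prod.collapse)
    then show ?thesis unfolding choices_def by (subst (asm) prod_sum_PiE) simp_all
  qed
  also have "\<dots> = (\<Sum>g\<in>choices r n. Poly_Mapping.single (\<Sum>x\<in>?A. letter_expo x (g x)) 1)"
    unfolding prod_single ..
  finally have k: "kern r n = (\<Sum>g\<in>choices r n. Poly_Mapping.single (\<Sum>x\<in>?A. letter_expo x (g x)) 1)" .
  have "Poly_Mapping.lookup (\<Sum>x\<in>?A. letter_expo x (g x)) i = cwt r n g i" for g i
  proof (cases "i < r + n")
    case False
    then have "Poly_Mapping.lookup (letter_expo x (g x)) i = 0" if "x \<in> ?A" for x
      using that by (auto simp: letter_expo_def lookup_add lookup_single when_def)
    then show ?thesis using False by (simp add: lookup_sum cwt_def)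
  qed (rule lookup_letter_expo_sum)
  then show ?thesis unfolding k act_sum act_single by simp
qed

definition blockperm :: "nat \<Rightarrow> nat \<Rightarrow> (nat \<Rightarrow> nat) \<Rightarrow> (nat \<Rightarrow> nat) \<Rightarrow> nat \<Rightarrow> nat" where
  "blockperm r n p q i = (if i < r then p i else if i < r + n then r + q (i - r) else i)"

definition block_anti :: "nat \<Rightarrow> nat \<Rightarrow> ((nat \<Rightarrow> int) \<Rightarrow> int) \<Rightarrow> bool" where
  "block_anti r n f \<longleftrightarrow> (\<forall>p q h. p permutes {0..<r} \<longrightarrow> q permutes {0..<n} \<longrightarrow>
     f (\<lambda>i. h (blockperm r n p q i)) = sign p * sign q * f h)"

lemma perm_lt: "p permutes {0..<k} \<Longrightarrow> i < k \<Longrightarrow> p i < k" for k :: nat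
  using permutes_in_image[of p "{0..<k}" i] by simp

text \<open>Permuting inside the two blocks of variables permutes the factors of
  \<open>kern\<close>, so the permutation can be moved from the argument to the choices.\<close>

lemma act_kern_blockperm:
  assumes f: "block_anti r n f" and p: "p permutes {0..<r}" and q: "q permutes {0..<n}"
  shows "act (kern r n) f (\<lambda>i. v (blockperm r n p q i)) = sign p * sign q * act (kern r n) f v"
proof -
  let ?s = "blockperm r n p q" and ?s' = "blockperm r n (inv_into UNIV p) (inv_into UNIV q)"
  have pp: "p i < r" "inv_into UNIV p i < r" "p (inv_into UNIV p i) = i" "inv_into UNIV p (p i) = i" if "i < r" for i
    using that perm_lt[OF p] perm_lt[OF permutes_inv[OF p]] permutes_inverses[OF p] by auto
  have qq: "q i < n" "inv_into UNIV q i < n" "q (inv_into UNIV q i) = i" "inv_into UNIV q (q i) = i" if "i < n" for i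
    using that perm_lt[OF q] perm_lt[OF permutes_inv[OF q]] permutes_inverses[OF q] by auto
  have s: "?s (?s' i) = i" "?s' (?s i) = i" "?s i < r \<longleftrightarrow> i < r" "?s' i < r \<longleftrightarrow> i < r"
    "?s i < r + n \<longleftrightarrow> i < r + n" "?s' i < r + n \<longleftrightarrow> i < r + n" for i
    using pp[of i] qq[of "i - r"] by (auto simp: blockperm_def)
  define t where "t g = (\<lambda>x \<in> {..<r} \<times> {r..<r + n}. g (?s' (fst x), ?s' (snd x)))" for g :: "nat \<times> nat \<Rightarrow> bool \<times> bool"
  define t' where "t' g = (\<lambda>x \<in> {..<r} \<times> {r..<r + n}. g (?s (fst x), ?s (snd x)))" for g :: "nat \<times> nat \<Rightarrow> bool \<times> bool"
  have b1: "bij_betw ?s' {..<r} {..<r}"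
    by (rule bij_betwI[of _ _ _ ?s]) (use s in auto)
  have b2: "bij_betw ?s' {r..<r + n} {r..<r + n}"
    by (rule bij_betwI[of _ _ _ ?s]) (use s in \<open>auto simp: not_less[symmetric]\<close>)
  have w: "cwt r n (t g) (?s i) = cwt r n g i" for g i
  proof -
    consider "i < r" | "\<not> i < r" "i < r + n" | "\<not> i < r + n" by blast
    then show ?thesis
    proof cases
      case 1
      then have "cwt r n (t g) (?s i) = (\<Sum>k\<in>{r..<r + n}. cx (g (i, ?s' k)))"
        using s by (simp add: cwt_def t_def)
      also have "\<dots> = (\<Sum>k\<in>{r..<r + n}. cx (g (i, k)))"
        by (rule sum.reindex_bij_betw[OF b2, of "\<lambda>k. cx (g (i, k))"])
      finally show ?thesis using 1 by (simp add: cwt_def)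
    next
      case 2
      then have "cwt r n (t g) (?s i) = (\<Sum>j<r. cy (g (?s' j, i)))"
        using s by (simp add: cwt_def t_def not_less[symmetric])
      also have "\<dots> = (\<Sum>j<r. cy (g (j, i)))"
        by (rule sum.reindex_bij_betw[OF b1, of "\<lambda>j. cy (g (j, i))"])
      finally show ?thesis using 2 by (simp add: cwt_def)
    next
      case 3
      then show ?thesis using s by (simp add: cwt_def)
    qed
  qed
  have tt: "t g \<in> choices r n" "t' g \<in> choices r n" for g by (auto simp: t_def t'_def choices_def)
  have "t' (t g) = g" "t (t' g) = g" if "g \<in> choices r n" for g
  proof -
    have "t' (t g) x = g x" "t (t' g) x = g x" for x
    proof -
      have "g x = undefined" if "x \<notin> {..<r} \<times> {r..<r + n}"
        using \<open>g \<in> choices r n\<close> that unfolding choices_def by (rule PiE_arb)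
      moreover have "(?s (fst x), ?s (snd x)) \<in> {..<r} \<times> {r..<r + n} \<longleftrightarrow> x \<in> {..<r} \<times> {r..<r + n}"
        "(?s' (fst x), ?s' (snd x)) \<in> {..<r} \<times> {r..<r + n} \<longleftrightarrow> x \<in> {..<r} \<times> {r..<r + n}"
        using s by (cases x, simp add: not_less[symmetric])+
      ultimately show "t' (t g) x = g x" "t (t' g) x = g x"
        unfolding t_def t'_def using s(1,2) by (simp_all add: restrict_apply del: mem_Times_iff)
    qed
    then show "t' (t g) = g" "t (t' g) = g" by auto
  qed
  note ti = this
  have fs: "f (\<lambda>i. h (?s i)) = sign p * sign q * f h" for h
    using f p q unfolding block_anti_def by blast
  have "act (kern r n) f (\<lambda>i. v (?s i)) = (\<Sum>g\<in>choices r n. f (\<lambda>i. v (?s i) + cwt r n (t g) (?s i)))"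
    unfolding act_kern w ..
  also have "\<dots> = (\<Sum>g\<in>choices r n. sign p * sign q * f (\<lambda>i. v i + cwt r n (t g) i))"
    by (intro sum.cong refl) (rule fs[of "\<lambda>i. v i + cwt r n (t g) i" for g])
  also have "\<dots> = (\<Sum>g\<in>choices r n. sign p * sign q * f (\<lambda>i. v i + cwt r n g i))"
    by (rule sum.reindex_bij_witness[of _ t' t]) (use tt ti in auto)
  finally show ?thesis unfolding act_kern by (simp add: sum_distrib_left)
qed

definition zmap :: "nat \<Rightarrow> nat \<Rightarrow> expo \<Rightarrow>\<^sub>0 int" where
  "zmap r i = (if i < r then zv i else - zv i)"

lemma prod_lessThan_add: "(\<Prod>i<r + n. f i) = (\<Prod>i<r. f i) * (\<Prod>i<n. f (r + i))" for f :: "nat \<Rightarrow> 'a::comm_monoid_mult"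
  by (induction n) (simp_all add: mult.assoc)

text \<open>Negating the last \<open>n\<close> variables turns the differences across the two groups
  into the sums that are the factors of \<open>kern\<close>; inside a group only signs
  arise.\<close>

lemma vandermonde_split:
  "(\<Prod>i<r + n. \<Prod>j<i. zmap r i - zmap r j)
    = of_int (\<Prod>i<n. (- 1) ^ (r + i)) * ((\<Prod>i<r. \<Prod>j<i. zv i - zv j) * (\<Prod>i<n. \<Prod>j<i. zv (r + i) - zv (r + j)) * kern r n)"
proof -
  have "(\<Prod>i<r. \<Prod>j<i. zmap r i - zmap r j) = (\<Prod>i<r. \<Prod>j<i. zv i - zv j)"
    by (intro prod.cong) (auto simp: zmap_def)
  moreover have "(\<Prod>j<r + i. zmap r (r + i) - zmap r j)
    = of_int ((- 1) ^ (r + i)) * ((\<Prod>j<i. zv (r + i) - zv (r + j)) * (\<Prod>j<r. zv j + zv (r + i)))" for i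
  proof -
    have "(\<Prod>j<r. zmap r (r + i) - zmap r j) = (\<Prod>j<r. (- 1) * (zv j + zv (r + i)))"
      by (intro prod.cong) (auto simp: zmap_def)
    moreover have "(\<Prod>j<i. zmap r (r + i) - zmap r (r + j)) = (\<Prod>j<i. (- 1) * (zv (r + i) - zv (r + j)))"
      by (intro prod.cong) (auto simp: zmap_def)
    ultimately show ?thesis
      unfolding prod_lessThan_add prod.distrib by (simp add: power_add algebra_simps)
  qed
  moreover have "kern r n = (\<Prod>i<n. \<Prod>j<r. zv j + zv (r + i))"
  proof -
    have "kern r n = (\<Prod>j<r. \<Prod>k\<in>{r..<r + n}. zv j + zv k)"
      unfolding kern_def prod.cartesian_product by (simp add: case_prod_unfold)
    also have "\<dots> = (\<Prod>k\<in>{r..<r + n}. \<Prod>j<r. zv j + zv k)" by (rule prod.swap)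
    also have "\<dots> = (\<Prod>i<n. \<Prod>j<r. zv j + zv (r + i))"
      by (rule prod.reindex_bij_witness[of _ "\<lambda>i. r + i" "\<lambda>k. k - r"]) auto
    finally show ?thesis .
  qed
  ultimately show ?thesis
    unfolding prod_lessThan_add by (simp add: prod.distrib mult.assoc mult.left_commute)
qed

text \<open>The rho of each of the two symplectic groups, in increasing order, one after the
  other.\<close>

definition rho_base :: "nat \<Rightarrow> nat \<Rightarrow> nat \<Rightarrow> int" where
  "rho_base r n i = (if i < r then int i + 1 else if i < r + n then int (i - r) + 1 else 1)"

text \<open>Up to sign the Vandermonde product of all variables is that of each group times
  \<open>kern\<close>, and all three products are alternants of \<open>cheb\<close>. Applied to
  \<open>f\<close> at (1, ..., 1), the large alternant yields only values that vanish by
  \<open>van\<close>. The two small ones act on the wanted sum, and by block antisymmetry their r!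
  n! terms are all equal to it.\<close>

theorem dual_pair_sum_zero:
  assumes na: "\<And>i. i < r + n \<Longrightarrow> nanti f i" and ba: "block_anti r n f"
    and van: "\<And>p. p permutes {0..<r + n} \<Longrightarrow> f (\<lambda>i. if i < r + n then int (p i) + 1 else 1) = 0"
  shows "(\<Sum>g\<in>choices r n. f (\<lambda>i. rho_base r n i + cwt r n g i)) = 0"
proof -
  let ?one = "\<lambda>i::nat. 1::int" and ?S = "act (kern r n) f"
  have "act (\<Prod>i<r + n. \<Prod>j<i. zmap r i - zmap r j) f ?one = 0"
  proof -
    \<comment> \<open>The sign of a negated variable leaves \<open>cheb\<close> as a constant
      factor, so it cannot disturb the vanishing.\<close>
    have c: "cheb k (zmap r i) = of_int ((if i < r then 1 else - 1) ^ k) * cheb k (zv i)" for k i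
      by (simp add: zmap_def cheb_minus)
    have "(\<Prod>i<r + n. \<Prod>j<i. zmap r i - zmap r j)
      = (\<Sum>p\<in>{p. p permutes {0..<r + n}}. of_int (sign p * (\<Prod>i = 0..<r + n. (if i < r then 1 else - 1) ^ p i)) * (\<Prod>i = 0..<r + n. cheb (p i) (zv i)))"
      unfolding cheb_alternant[symmetric] c prod.distrib by (simp add: mult.assoc)
    moreover have "act (\<Prod>i = 0..<r + n. cheb (p i) (zv i)) f ?one = 0" if "p permutes {0..<r + n}" for p
      using act_cheb_prod[of "{0..<r + n}" f ?one p] na van[OF that] by simp
    ultimately show ?thesis by (simp only: act_sum act_of_int) simp
  qed
  then have z: "act ((\<Prod>i<r. \<Prod>j<i. zv i - zv j) * (\<Prod>i<n. \<Prod>j<i. zv (r + i) - zv (r + j)) * kern r n) f ?one = 0"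
    unfolding vandermonde_split act_of_int by simp
  have e: "(\<Prod>i<r. \<Prod>j<i. zv i - zv j) * (\<Prod>i<n. \<Prod>j<i. zv (r + i) - zv (r + j))
    = (\<Sum>p\<in>{p. p permutes {0..<r}}. \<Sum>q\<in>{q. q permutes {0..<n}}.
        of_int (sign p * sign q) * (\<Prod>i<r + n. cheb (if i < r then p i else q (i - r)) (zv i)))"
    unfolding cheb_alternant[where N = r and z = zv, symmetric] cheb_alternant[where N = n and z = "\<lambda>i. zv (r + i)", symmetric] sum_product
    by (intro sum.cong refl) (simp add: prod_lessThan_add atLeast0LessThan mult.assoc mult.left_commute)
  \<comment> \<open>\<open>kern\<close> preserves oddness in each coordinate, so after it has acted
    the factors \<open>cheb\<close> still act as evaluations.\<close>
  have b: "act (\<Prod>i<r + n. cheb (if i < r then p i else q (i - r)) (zv i)) ?S ?one = sign p * sign q * ?S (rho_base r n)"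
    if "p permutes {0..<r}" "q permutes {0..<n}" for p q
  proof -
    have np: "npres (kern r n)"
    proof -
      have "npres (p + q)" if "npres p" "npres q" for p q using that by (simp add: npres_def nanti_def act_add)
      then show ?thesis unfolding kern_def by (intro npres_prod) (simp add: npres_zv)
    qed
    have "act (\<Prod>i<r + n. cheb (if i < r then p i else q (i - r)) (zv i)) ?S ?one
      = ?S (\<lambda>i. if i \<in> {..<r + n} then int (if i < r then p i else q (i - r)) + 1 else 1)"
      by (rule act_cheb_prod) (use np na in \<open>auto simp: npres_def\<close>)
    also have "(\<lambda>i. if i \<in> {..<r + n} then int (if i < r then p i else q (i - r)) + 1 else 1)
      = (\<lambda>i. rho_base r n (blockperm r n p q i))"
      using perm_lt[OF that(1)] perm_lt[OF that(2)] by (auto simp: rho_base_def blockperm_def fun_eq_iff trans_less_add1)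
    finally show ?thesis using act_kern_blockperm[OF ba that] by simp
  qed
  have "(\<Sum>p\<in>{p. p permutes {0..<r}}. \<Sum>q\<in>{q. q permutes {0..<n}}.
      (sign p * sign q) * (sign p * sign q * ?S (rho_base r n)))
    = (\<Sum>p\<in>{p. p permutes {0..<r}}. \<Sum>q\<in>{q. q permutes {0..<n}}.
      (sign p * sign q) * act (\<Prod>i<r + n. cheb (if i < r then p i else q (i - r)) (zv i)) ?S ?one)"
    by (intro sum.cong refl) (simp only: b mem_Collect_eq)
  also have "\<dots> = 0"
  proof -
    have "act ((\<Prod>i<r. \<Prod>j<i. zv i - zv j) * (\<Prod>i<n. \<Prod>j<i. zv (r + i) - zv (r + j))) ?S ?one = 0"
      using z by (simp only: act_mult)
    then show ?thesis unfolding e by (simp only: act_sum act_of_int)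
  qed
  finally have z2: "(\<Sum>p\<in>{p. p permutes {0..<r}}. \<Sum>q\<in>{q. q permutes {0..<n}}.
      (sign p * sign q) * (sign p * sign q * ?S (rho_base r n))) = 0" .
  have "(sign p * sign q) * (sign p * sign q * a) = a" for p q :: "nat \<Rightarrow> nat" and a :: int
  proof -
    have "(sign p * sign q) * (sign p * sign q * a) = (sign p * sign p) * (sign q * sign q) * a" by (simp only: ac_simps)
    then show ?thesis by (simp only: sign_idempotent mult_1)
  qed
  then have "(\<Sum>p\<in>{p. p permutes {0..<r}}. \<Sum>q\<in>{q. q permutes {0..<n}}. ?S (rho_base r n)) = 0"
    using z2 by (simp only:)
  then have "int (card {p. p permutes {0..<r}}) * (int (card {q. q permutes {0..<n}}) * ?S (rho_base r n)) = 0"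
    by (simp only: sum_constant)
  moreover have "card {p. p permutes {0..<k}} \<noteq> 0" for k :: nat by (simp add: card_permutations[of "{0..<k}" k])
  ultimately have "?S (rho_base r n) = 0" by simp
  then show ?thesis unfolding act_kern .
qed

section \<open>Chains of raising operators\<close>

definition areach :: "nat \<Rightarrow> nat \<Rightarrow> array \<Rightarrow> array \<Rightarrow> bool" where
  "areach n r M N \<longleftrightarrow> (\<exists>is. apath n r is M N)"

lemma apath_append: "apath n r is M X \<Longrightarrow> apath n r js X N \<Longrightarrow> apath n r (is @ js) M N"
  by (induction "is" arbitrary: M) auto

lemma areach_refl: "areach n r M M"
  unfolding areach_def using apath.simps(1) by blast

lemma areach_trans: "areach n r M X \<Longrightarrow> areach n r X N \<Longrightarrow> areach n r M N"
  unfolding areach_def using apath_append by blast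

lemma areach_step: "astep n r i M N \<Longrightarrow> areach n r M N"
  unfolding areach_def using apath.simps by blast

lemma areach_arrays: "areach n r M N \<Longrightarrow> M \<in> arrays n r \<Longrightarrow> N \<in> arrays n r"
  unfolding areach_def using apath_aconn aconn_arrays by blast

lemma areach_upper:
  fixes F :: "nat set"
  assumes "finite F" "\<And>q. q \<in> F \<Longrightarrow> areach n r (A {x \<in> F. q < x}) (A {x \<in> F. q \<le> x})"
  shows "areach n r (A {}) (A F)"
proof -
  have "areach n r (A {}) (A {x \<in> F. q \<le> x})" for q
  proof -
    have "areach n r (A {}) (A {x \<in> F. Suc (Max F) - k \<le> x})" for k
    proof (induction k)
      case 0
      have "{x \<in> F. Suc (Max F) - 0 \<le> x} = {}" using Max_ge[OF assms(1)] by fastforce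
      then show ?case by (simp only: areach_refl)
    next
      case (Suc k)
      let ?q = "Suc (Max F) - Suc k"
      show ?case
      proof (cases "?q \<in> F \<and> k < Suc (Max F)")
        case True
        then have "{x \<in> F. Suc (Max F) - k \<le> x} = {x \<in> F. ?q < x}" by auto
        then show ?thesis using Suc.IH assms(2)[of ?q] True areach_trans by metis
      next
        case False
        then have "{x \<in> F. Suc (Max F) - k \<le> x} = {x \<in> F. ?q \<le> x}"
          by (auto simp: le_less Suc_diff_Suc not_less dest: Suc_leI)
        then show ?thesis using Suc.IH by simp
      qed
    qed
    from this[of "Suc (Max F) - q"] show ?thesis
    proof (cases "q \<le> Suc (Max F)")
      case False
      then have "{x \<in> F. q \<le> x} = {}" using Max_ge[OF assms(1)] by fastforce
      then show ?thesis by (simp only: areach_refl)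
    qed simp
  qed
  from this[of 0] show ?thesis by simp
qed

definition bump :: "nat \<Rightarrow> nat \<Rightarrow> array \<Rightarrow> nat set" where
  "bump n j M = unm (asg M j) (2 * n + 1)"

lemma bump_iff: "p \<in> bump n j M \<longleftrightarrow> p \<le> 2 * n \<and> p \<notin> M j \<and> p \<in> M (Suc j) \<and> up (map (asg M j) [0..<p]) = 0"
  by (auto simp: bump_def unm_def asg_neg_iff)

text \<open>The letters move one at a time, the largest first; by \<open>ctx_unm\<close> each is the
  one on which the operator acts at that moment.\<close>

lemma areach_bump:
  assumes M: "M \<in> arrays n r" and j: "Suc j < r"
  shows "areach n r M (M(j := M j \<union> bump n j M, Suc j := M (Suc j) - bump n j M))"
proof -
  define A where "A G = M(j := M j \<union> G, Suc j := M (Suc j) - G)" for G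
  have "areach n r (A {}) (A (bump n j M))"
  proof (rule areach_upper)
    show "finite (bump n j M)" by (simp add: bump_def finite_unm)
    fix q assume q: "q \<in> bump n j M"
    let ?G = "{x \<in> bump n j M. q < x}"
    have a: "asg (A ?G) j = (\<lambda>x. if x \<in> unm (asg M j) (2 * n + 1) \<and> q < x then 1 else asg M j x)"
    proof
      fix x
      show "asg (A ?G) j x = (if x \<in> unm (asg M j) (2 * n + 1) \<and> q < x then 1 else asg M j x)"
        using bump_iff[of x n j M] by (auto simp: A_def asg_def bump_def)
    qed
    have "ctx (asg (A ?G) j) (2 * n + 1) q"
      unfolding a by (rule ctx_unm) (use q in \<open>auto simp: bump_def asg_def\<close>)
    moreover have "asg (A ?G) j q = - 1" using q unfolding a by (auto simp: bump_iff asg_neg_iff)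
    moreover have "A {x \<in> bump n j M. q \<le> x} = (A ?G)(j := insert q (A ?G j), Suc j := A ?G (Suc j) - {q})"
    proof -
      have "{x \<in> bump n j M. q \<le> x} = insert q ?G" using q by (auto simp: le_less)
      then show ?thesis unfolding A_def by (auto simp: fun_eq_iff)
    qed
    ultimately have g: "glstep n j (A ?G) (A {x \<in> bump n j M. q \<le> x})" unfolding glstep_def by blast
    have "A ?G \<in> arrays n r"
      using M j bump_iff unfolding arrays_iff A_def by (auto split: if_splits)
    moreover have "r - 2 - (r - 2 - j) = j" "Suc (r - 2 - j) \<noteq> r" "r - 2 - j < r" using j by auto
    ultimately have "astep n r (r - 2 - j) (A ?G) (A {x \<in> bump n j M. q \<le> x})"
      using g unfolding astep_def by simp
    then show "areach n r (A ?G) (A {x \<in> bump n j M. q \<le> x})" by (rule areach_step)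
  qed
  moreover have "A {} = M" by (simp add: A_def)
  ultimately show ?thesis by (simp add: A_def)
qed

definition zset :: "nat \<Rightarrow> array \<Rightarrow> nat set" where
  "zset n M = unm (zsg M) (Suc n)"

definition pairs :: "nat set \<Rightarrow> nat set" where
  "pairs G = (\<Union>m\<in>G. {2 * m - 1, 2 * m})"

lemma pairs_iff:
  assumes "0 \<notin> G" "1 \<le> x"
  shows "2 * x - 1 \<in> pairs G \<longleftrightarrow> x \<in> G" "2 * x \<in> pairs G \<longleftrightarrow> x \<in> G"
proof -
  have "2 * x - 1 = 2 * m - 1 \<longleftrightarrow> x = m" "2 * x - 1 \<noteq> 2 * m" "2 * x \<noteq> 2 * m - 1" if "m \<in> G" for m
  proof -
    have "1 \<le> m" using that assms(1) by (cases m) auto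
    then show "2 * x - 1 = 2 * m - 1 \<longleftrightarrow> x = m" "2 * x - 1 \<noteq> 2 * m" "2 * x \<noteq> 2 * m - 1"
      using assms(2) by presburger+
  qed
  moreover have "x \<in> pairs G \<longleftrightarrow> (\<exists>m\<in>G. x = 2 * m - 1 \<or> x = 2 * m)" for x
    unfolding pairs_def by blast
  moreover have "2 * x = 2 * m \<longleftrightarrow> x = m" for m by simp
  ultimately show "2 * x - 1 \<in> pairs G \<longleftrightarrow> x \<in> G" "2 * x \<in> pairs G \<longleftrightarrow> x \<in> G" by metis+
qed

lemma zset_iff: "m \<in> zset n M \<longleftrightarrow> 1 \<le> m \<and> m \<le> n \<and> 2 * m - 1 \<in> M 0 \<and> 2 * m \<in> M 0 \<and> up (map (zsg M) [0..<m]) = 0"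
  by (auto simp: zset_def unm_def zsg_neg_iff)

lemma areach_zset:
  assumes M: "M \<in> arrays n r" and r: "0 < r"
  shows "areach n r M (M(0 := M 0 - pairs (zset n M)))"
proof -
  define A where "A G = M(0 := M 0 - pairs G)" for G
  have "areach n r (A {}) (A (zset n M))"
  proof (rule areach_upper)
    show "finite (zset n M)" by (simp add: zset_def finite_unm)
    fix q assume q: "q \<in> zset n M"
    let ?G = "{x \<in> zset n M. q < x}"
    note pr = pairs_iff
    have z: "0 \<notin> ?G" by (auto simp: zset_iff)
    have a: "zsg (A ?G) = (\<lambda>x. if x \<in> unm (zsg M) (Suc n) \<and> q < x then 1 else zsg M x)"
    proof
      fix x
      show "zsg (A ?G) x = (if x \<in> unm (zsg M) (Suc n) \<and> q < x then 1 else zsg M x)"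
        using pr[OF z, of x] by (cases "x = 0") (auto simp: A_def zsg_def zset_def)
    qed
    have "ctx (zsg (A ?G)) (Suc n) q"
      unfolding a by (rule ctx_unm) (use q in \<open>auto simp: zset_def zsg_bounds\<close>)
    moreover have "zsg (A ?G) q = - 1" using q unfolding a by (auto simp: zset_iff zsg_neg_iff)
    moreover have "A {x \<in> zset n M. q \<le> x} = (A ?G)(0 := A ?G 0 - {2 * q - 1, 2 * q})"
    proof -
      have "{x \<in> zset n M. q \<le> x} = insert q ?G" using q by (auto simp: le_less)
      then show ?thesis unfolding A_def pairs_def by (auto simp: fun_eq_iff)
    qed
    ultimately have g: "zstep n (A ?G) (A {x \<in> zset n M. q \<le> x})" unfolding zstep_def by blast
    have "A ?G \<in> arrays n r" using M unfolding arrays_iff A_def by (auto split: if_splits)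
    then have "astep n r (r - 1) (A ?G) (A {x \<in> zset n M. q \<le> x})"
      using g r unfolding astep_def by simp
    then show "areach n r (A ?G) (A {x \<in> zset n M. q \<le> x})" by (rule areach_step)
  qed
  moreover have "A {} = M" by (simp add: A_def pairs_def)
  ultimately show ?thesis by (simp add: A_def)
qed

section \<open>Highest weight arrays\<close>

lemma sum_asg:
  assumes "M \<in> arrays n r"
  shows "sum_list (map (asg M j) [0..<Suc p]) = int (cnt M j p) - int (cnt M (Suc j) p)"
proof (induction p)
  case 0
  show ?case using arrays_0[OF assms] by (simp add: asg_def cnt_0[OF assms])
next
  case (Suc p)
  show ?case using Suc.IH by (simp add: cnt_Suc asg_def)
qed

lemma sum_zsg:
  assumes "M \<in> arrays n r"
  shows "sum_list (map (zsg M) [0..<Suc m]) = int m - int (cnt M 0 (2 * m))"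
proof (induction m)
  case 0
  show ?case by (simp add: zsg_def cnt_0[OF assms])
next
  case (Suc m)
  have "cnt M 0 (2 * Suc m) = cnt M 0 (2 * m) + of_bool (2 * Suc m - 1 \<in> M 0) + of_bool (2 * Suc m \<in> M 0)"
    using cnt_Suc[of M 0 "2 * m"] cnt_Suc[of M 0 "Suc (2 * m)"] by simp
  then show ?case using Suc.IH by (simp add: zsg_def)
qed

lemma cnt_beyond: "M \<in> arrays n r \<Longrightarrow> 2 * n \<le> p \<Longrightarrow> cnt M j p = card (M j)"
  unfolding cnt_def by (rule arg_cong[of _ _ card]) (use arrays_bd in fastforce)

lemma dn_asg_0_iff:
  assumes "M \<in> arrays n r"
  shows "dn (map (asg M j) [0..<2 * n + 1]) = 0 \<longleftrightarrow> (\<forall>p. cnt M (Suc j) p \<le> cnt M j p)"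
proof -
  have "dn (map (asg M j) [0..<2 * n + 1]) = 0 \<longleftrightarrow> (\<forall>p\<le>2 * n. cnt M (Suc j) p \<le> cnt M j p)"
    unfolding dn_upt_0_iff
  proof (intro iffI allI impI)
    fix p assume h: "\<forall>k\<le>2 * n + 1. 0 \<le> sum_list (map (asg M j) [0..<k])" and p: "p \<le> 2 * n"
    then show "cnt M (Suc j) p \<le> cnt M j p" using h[rule_format, of "Suc p"] unfolding sum_asg[OF assms] by simp
  next
    fix k assume h: "\<forall>p\<le>2 * n. cnt M (Suc j) p \<le> cnt M j p" and k: "k \<le> 2 * n + 1"
    show "0 \<le> sum_list (map (asg M j) [0..<k])"
    proof (cases k)
      case (Suc p)
      then show ?thesis using h k unfolding Suc sum_asg[OF assms] by simp
    qed simp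
  qed
  also have "\<dots> \<longleftrightarrow> (\<forall>p. cnt M (Suc j) p \<le> cnt M j p)"
    using cnt_beyond[OF assms] by (metis le_refl nle_le)
  finally show ?thesis .
qed

lemma dn_zsg_0_iff:
  assumes "M \<in> arrays n r"
  shows "dn (map (zsg M) [0..<Suc n]) = 0 \<longleftrightarrow> king n M"
  unfolding dn_upt_0_iff king_def
proof (intro iffI allI impI)
  fix m assume h: "\<forall>k\<le>Suc n. 0 \<le> sum_list (map (zsg M) [0..<k])" and m: "m \<le> n"
  then show "cnt M 0 (2 * m) \<le> m" using h[rule_format, of "Suc m"] unfolding sum_zsg[OF assms] by simp
next
  fix k assume h: "\<forall>m\<le>n. cnt M 0 (2 * m) \<le> m" and k: "k \<le> Suc n"
  show "0 \<le> sum_list (map (zsg M) [0..<k])"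
  proof (cases k)
    case (Suc m)
    then show ?thesis using h k unfolding Suc sum_zsg[OF assms] by simp
  qed simp
qed

lemma ex_astep_dn_iff:
  assumes M: "M \<in> arrays n r" and i: "i < r"
  shows "(\<exists>N. astep n r i M N) \<longleftrightarrow> dn (alist n r i M) \<noteq> 0"
proof
  assume "\<exists>N. astep n r i M N"
  then obtain x where "cstep r i (wrd n r M) x" using astep_cstep by blast
  then have "0 < dn (map (csg r i) (wrd n r M))" using ctx_neg_dn by (auto simp: cstep_def map_wsg[symmetric])
  then show "dn (alist n r i M) \<noteq> 0" using dn_alist[OF i M] by simp
next
  assume "dn (alist n r i M) \<noteq> 0"
  then show "\<exists>N. astep n r i M N" using ex_astep[OF i M] dn_nonneg[of "alist n r i M"] by (simp add: order_le_neq_trans)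
qed

lemma glhigh_iff_sst:
  assumes M: "M \<in> arrays n r"
  shows "glhigh n r M \<longleftrightarrow> sst M"
proof
  assume g: "glhigh n r M"
  show "sst M" unfolding sst_def
  proof (intro allI)
    fix j p
    show "cnt M (Suc j) p \<le> cnt M j p"
    proof (cases "Suc j < r")
      case True
      then have "Suc (r - 2 - j) < r" "r - 2 - (r - 2 - j) = j" "Suc (r - 2 - j) \<noteq> r" by auto
      then have "dn (map (asg M j) [0..<2 * n + 1]) = 0"
        using g ex_astep_dn_iff[OF M, of "r - 2 - j"] unfolding glhigh_def alist_def by (simp del: upt_Suc)
      then show ?thesis using dn_asg_0_iff[OF M] by blast
    next
      case False
      then have "M (Suc j) = {}" using M by (auto simp: arrays_def)
      then show ?thesis by (simp add: cnt_def)
    qed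
  qed
next
  assume s: "sst M"
  show "glhigh n r M" unfolding glhigh_def
  proof (intro allI impI)
    fix i N assume i: "Suc i < r"
    have "dn (map (asg M (r - 2 - i)) [0..<2 * n + 1]) = 0" using s dn_asg_0_iff[OF M] unfolding sst_def by blast
    then have "dn (alist n r i M) = 0" using i unfolding alist_def by (simp del: upt_Suc)
    then show "\<not> astep n r i M N" using ex_astep_dn_iff[OF M, of i] i by auto
  qed
qed

text \<open>By \<open>dn_upt_0_iff\<close> being highest means nonnegative prefix sums. For
  \<open>asg\<close> these compare the counts of two columns, for \<open>zsg\<close> they are
  \<open>m\<close> minus the number of letters up to \<open>2 * m\<close> in column 0.\<close>

lemma ahigh_iff:
  assumes M: "M \<in> arrays n r"
  shows "ahigh n r M \<longleftrightarrow> sst M \<and> king n M"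
proof (cases "r = 0")
  case True
  then have e: "M j = {}" for j using M by (simp add: arrays_def)
  then show ?thesis using True by (simp add: ahigh_def astep_def sst_def king_def cnt_def)
next
  case False
  have "ahigh n r M \<longleftrightarrow> glhigh n r M \<and> (\<forall>N. \<not> astep n r (r - 1) M N)"
  proof -
    have "i < r" if "astep n r i M N" for i N using that by (simp add: astep_def)
    then have "ahigh n r M \<longleftrightarrow> (\<forall>i N. i < r \<longrightarrow> \<not> astep n r i M N)" unfolding ahigh_def by blast
    also have "\<dots> \<longleftrightarrow> glhigh n r M \<and> (\<forall>N. \<not> astep n r (r - 1) M N)"
      unfolding glhigh_def using False by (metis Suc_lessD Suc_lessI Suc_pred' diff_Suc_1 diff_less less_numeral_extra(1) neq0_conv)
    finally show ?thesis .
  qed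
  moreover have "(\<exists>N. astep n r (r - 1) M N) \<longleftrightarrow> \<not> king n M"
    using ex_astep_dn_iff[OF M, of "r - 1"] False dn_zsg_0_iff[OF M] unfolding alist_def by (simp del: upt_Suc)
  ultimately show ?thesis using glhigh_iff_sst[OF M] by blast
qed

section \<open>Column insertion\<close>

definition dsg :: "nat set \<Rightarrow> nat set \<Rightarrow> nat \<Rightarrow> int" where
  "dsg A B p = of_bool (p \<in> A) - of_bool (p \<in> B)"

lemma dsg_bounds: "- 1 \<le> dsg A B p" "dsg A B p \<le> 1"
  by (auto simp: dsg_def)

lemma up_raise:
  assumes f: "\<And>x. - 1 \<le> f x" and g: "g c = f c + 1" "\<And>x. x \<noteq> c \<Longrightarrow> g x = f x"
  shows "up (map g [0..<b]) = up (map f [0..<b]) + of_bool (c < b \<and> (\<forall>q\<in>unm f b. q < c))"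
proof (induction b)
  case (Suc b)
  have nn: "0 \<le> up (map f [0..<b])" by (rule up_nonneg)
  consider "b < c" | "b = c" | "c < b" by linarith
  then show ?case
  proof cases
    case 1
    then show ?thesis using Suc.IH g(2)[of b] unfolding up_upt_Suc by simp
  next
    case 2
    have "\<forall>q\<in>unm f c. q < c" by (auto simp: unm_def)
    then show ?thesis using Suc.IH 2 f[of c] nn g(1) unfolding up_upt_Suc unm_Suc by auto
  next
    case 3
    then show ?thesis using Suc.IH f[of b] nn g(2)[of b] unfolding up_upt_Suc unm_Suc by auto
  qed
qed simp

text \<open>Raising the sign at \<open>c\<close> uses up the first unmatched minus at or after
  \<open>c\<close>, if there is one. This is exactly the letter that column insertion of
  \<open>c\<close> bumps.\<close>

lemma unm_raise:
  assumes f: "\<And>x. - 1 \<le> f x" and g: "g c = f c + 1" "\<And>x. x \<noteq> c \<Longrightarrow> g x = f x"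
  shows "unm g N = {p \<in> unm f N. p < c \<or> (\<exists>q\<in>unm f N. c \<le> q \<and> q < p)}"
proof (intro Set.set_eqI)
  fix p
  have "p \<in> unm g N \<longleftrightarrow> p < N \<and> p \<noteq> c \<and> f p = - 1 \<and> up (map f [0..<p]) = 0
      \<and> \<not> (c < p \<and> (\<forall>q\<in>unm f p. q < c))"
  proof (cases "p = c")
    case True
    then show ?thesis using f[of c] g(1) by (auto simp: unm_def)
  next
    case False
    have "up (map g [0..<p]) = up (map f [0..<p]) + of_bool (c < p \<and> (\<forall>q\<in>unm f p. q < c))"
      using up_raise[of f g c p] assms by blast
    then show ?thesis using up_nonneg[of "map f [0..<p]"] g(2)[OF False] False
      unfolding unm_def[of g] by (auto split: if_splits simp: of_bool_def)
  qed
  also have "\<dots> \<longleftrightarrow> p \<in> unm f N \<and> p \<noteq> c \<and> \<not> (c < p \<and> (\<forall>q\<in>unm f p. q < c))"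
    by (auto simp: unm_def)
  also have "\<dots> \<longleftrightarrow> p \<in> unm f N \<and> (p < c \<or> (\<exists>q\<in>unm f N. c \<le> q \<and> q < p))"
  proof -
    have "q \<in> unm f p \<longleftrightarrow> q \<in> unm f N \<and> q < p" if "p \<in> unm f N" for q
      using that by (auto simp: unm_def)
    note e = this
    show ?thesis
    proof (cases "p \<in> unm f N")
      case True
      have "p \<noteq> c \<and> \<not> (c < p \<and> (\<forall>q\<in>unm f p. q < c)) \<longleftrightarrow> p < c \<or> (c < p \<and> (\<exists>q\<in>unm f p. c \<le> q))"
        by (cases p c rule: linorder_cases) (simp_all add: not_less)
      also have "(c < p \<and> (\<exists>q\<in>unm f p. c \<le> q)) \<longleftrightarrow> (\<exists>q\<in>unm f N. c \<le> q \<and> q < p)"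
        using e[OF True] le_less_trans by blast
      finally show ?thesis using True by blast
    qed blast
  qed
  finally show "p \<in> unm g N \<longleftrightarrow> p \<in> {p \<in> unm f N. p < c \<or> (\<exists>q\<in>unm f N. c \<le> q \<and> q < p)}"
    by simp
qed

fun ins_step :: "nat \<Rightarrow> nat list \<times> nat list \<Rightarrow> nat list \<times> nat list" where
  "ins_step m (c, D) =
    (if \<forall>x\<in>set c. x < m then (c @ [m], D)
     else (map (\<lambda>x. if x = Min {x \<in> set c. m \<le> x} then m else x) c, D @ [Min {x \<in> set c. m \<le> x}]))"

text \<open>A later column only sees the letters bumped from the first one, so inserting them can
  wait until the first column is finished.\<close>

lemma fold_col_insert_Cons:
  "fold ins_step C (c, D) = (c', D') \<Longrightarrow>
    fold col_insert C (c # fold col_insert D S) = c' # fold col_insert D' S"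
proof (induction C arbitrary: c D)
  case (Cons m C)
  show ?case
  proof (cases "\<forall>x\<in>set c. x < m")
    case True
    then show ?thesis using Cons by simp
  next
    case False
    let ?p = "Min {x \<in> set c. m \<le> x}" and ?c = "map (\<lambda>x. if x = Min {x \<in> set c. m \<le> x} then m else x) c"
    have "fold ins_step C (?c, D @ [?p]) = (c', D')" using Cons.prems False by simp
    moreover have "col_insert m (c # fold col_insert D S) = ?c # fold col_insert (D @ [?p]) S"
      unfolding col_insert.simps if_not_P[OF False] by (simp add: Let_def)
    moreover have "fold col_insert (m # C) (c # fold col_insert D S) = fold col_insert C (col_insert m (c # fold col_insert D S))"
      by (simp only: fold_simps)
    ultimately show ?thesis using Cons.IH by (simp only:)
  qed
qed simp

text \<open>Invariant: the letters of \<open>R\<close> unmatched against the inserted part of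
  \<open>C\<close> are still in the column, all others have been bumped. By \<open>unm_raise\<close>
  each new letter is matched with the one it bumps.\<close>

lemma ins_steps:
  assumes "sorted_wrt (<) R" "sorted_wrt (<) C" "set R \<subseteq> {..<N}" "set C \<subseteq> {..<N}"
    "fold ins_step C (R, []) = (c, D)"
  shows "sorted_wrt (<) c \<and> sorted_wrt (<) D \<and> set c = set C \<union> unm (dsg (set C) (set R)) N
    \<and> set D = set R - unm (dsg (set C) (set R)) N"
  using assms
proof (induction C arbitrary: c D rule: rev_induct)
  case Nil
  have "up (map (dsg {} (set R)) [0..<p]) = 0" for p
    by (induction p) (simp, auto simp: up_upt_Suc dsg_def simp del: upt_Suc)
  then have "unm (dsg {} (set R)) N = set R"
    using Nil.prems(3) by (auto simp: unm_def dsg_def)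
  then show ?case using Nil by simp
next
  case (snoc m C)
  obtain c1 D1 where st: "fold ins_step C (R, []) = (c1, D1)" by fastforce
  define f where "f = dsg (set C) (set R)"
  define F where "F = unm f N"
  have IH: "sorted_wrt (<) c1" "sorted_wrt (<) D1" "set c1 = set C \<union> F" "set D1 = set R - F"
    using snoc.IH[OF snoc.prems(1) _ snoc.prems(3) _ st] snoc.prems(2,4)
    by (auto simp: sorted_wrt_append F_def f_def)
  have m: "\<forall>x\<in>set C. x < m" "m < N" using snoc.prems by (auto simp: sorted_wrt_append)
  have f1: "- 1 \<le> f x" for x by (simp add: f_def dsg_bounds)
  have FR: "F \<subseteq> set R" "finite F" by (auto simp: F_def unm_def f_def dsg_def of_bool_def finite_unm split: if_splits)
  have "m \<notin> set C" using m(1) by blast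
  then have upd: "dsg (set (C @ [m])) (set R) m = f m + 1" "\<And>x. x \<noteq> m \<Longrightarrow> dsg (set (C @ [m])) (set R) x = f x"
    by (auto simp: f_def dsg_def)
  have F': "unm (dsg (set (C @ [m])) (set R)) N = {p \<in> F. p < m \<or> (\<exists>q\<in>F. m \<le> q \<and> q < p)}"
    unfolding F_def by (rule unm_raise[of f "dsg (set (C @ [m])) (set R)" m, OF f1]) (use upd in blast)+
  have st': "ins_step m (c1, D1) = (c, D)" using snoc.prems(5) st by simp
  show ?case
  proof (cases "\<forall>x\<in>set c1. x < m")
    case True
    then have cD: "c = c1 @ [m]" "D = D1" using st' by auto
    have "{p \<in> F. p < m \<or> (\<exists>q\<in>F. m \<le> q \<and> q < p)} = F" using True IH(3) by auto
    then show ?thesis using IH True unfolding F' cD by (auto simp: sorted_wrt_append)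
  next
    case False
    define q where "q = Min {x \<in> set c1. m \<le> x}"
    have cD: "c = map (\<lambda>x. if x = q then m else x) c1" "D = D1 @ [q]"
      using st' False by (auto simp: q_def)
    have "{x \<in> set c1. m \<le> x} \<noteq> {}" using False by (auto simp: not_less)
    then have q1: "q \<in> {x \<in> set c1. m \<le> x}" unfolding q_def by (intro Min_in) auto
    have q2: "q \<le> x" if "x \<in> set c1" "m \<le> x" for x using that unfolding q_def by simp
    have qF: "q \<in> F" "m \<le> q" "q \<notin> set C" using q1 IH(3) m(1) by auto
    have F'q: "{p \<in> F. p < m \<or> (\<exists>q\<in>F. m \<le> q \<and> q < p)} = F - {q}"
    proof (intro Set.set_eqI iffI)
      fix p assume "p \<in> {p \<in> F. p < m \<or> (\<exists>q\<in>F. m \<le> q \<and> q < p)}"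
      then show "p \<in> F - {q}" using q2 IH(3) qF by fastforce
    next
      fix p assume "p \<in> F - {q}"
      then show "p \<in> {p \<in> F. p < m \<or> (\<exists>q\<in>F. m \<le> q \<and> q < p)}" using q2[of p] qF IH(3) by fastforce
    qed
    have "sorted_wrt (<) c"
      unfolding cD(1) sorted_wrt_map
    proof (rule sorted_wrt_mono_rel[OF _ IH(1)])
      fix x y assume xy: "x \<in> set c1" "y \<in> set c1" "x < y"
      show "(if x = q then m else x) < (if y = q then m else y)"
        using xy q2[of x] qF(2) by (auto simp: not_le[symmetric])
    qed
    moreover have "sorted_wrt (<) D"
    proof -
      \<comment> \<open>Bumped letters come out in increasing order, so that they again form a
        column for the next insertion.\<close>
      have "d < q" if d: "d \<in> set D1" for d
      proof (rule ccontr)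
        assume "\<not> d < q"
        have dR: "d \<in> set R" "d \<notin> F" using d IH(4) by auto
        then have dq: "q < d" using \<open>\<not> d < q\<close> qF(1) by (metis linorder_neqE_nat)
        \<comment> \<open>All letters of \<open>C\<close> are smaller than \<open>m\<close> and
          hence than \<open>q\<close>. So no plus follows \<open>q\<close>, and a letter of
          \<open>R\<close> beyond it would be unmatched too.\<close>
        have z: "up (map f [0..<b]) = 0" if "q \<le> b" for b
          using that
        proof (induction b rule: dec_induct)
          case base
          show ?case using qF(1) by (simp add: F_def unm_def)
        next
          case (step b)
          have "b \<notin> set C" using step.hyps qF(2) m(1) by (meson le_trans not_less)
          then have "f b \<le> 0" by (simp add: f_def dsg_def)
          then show ?case using step.IH unfolding up_upt_Suc by simp
        qed
        have "d \<notin> set C" using dq qF(2) m(1) by (meson le_trans less_imp_le not_less)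
        then have "f d = - 1" using dR by (simp add: f_def dsg_def)
        then have "d \<in> F" using z[of d] dq dR snoc.prems(3) by (auto simp: F_def unm_def)
        then show False using dR by blast
      qed
      then show ?thesis using IH(2) unfolding cD by (simp add: sorted_wrt_append)
    qed
    moreover have "set c = set (C @ [m]) \<union> (F - {q})"
    proof -
      have "set c = insert m (set c1 - {q})" unfolding cD using q1 by auto
      then show ?thesis using IH(3) qF(3) by auto
    qed
    moreover have "set D = set R - (F - {q})" unfolding cD using IH(4) qF FR by auto
    ultimately show ?thesis unfolding F' F'q by blast
  qed
qed

definition cfirst :: "nat \<Rightarrow> nat list \<Rightarrow> nat list \<Rightarrow> nat list" where
  "cfirst N C R = fst (fold ins_step C (R, []))"

definition cbump :: "nat \<Rightarrow> nat list \<Rightarrow> nat list \<Rightarrow> nat list" where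
  "cbump N C R = snd (fold ins_step C (R, []))"

lemma col_star_Cons: "col_star C (c # S) = cfirst N C c # col_star (cbump N C c) S"
  using fold_col_insert_Cons[of C c "[]" "cfirst N C c" "cbump N C c" S]
  by (simp add: col_star_def cfirst_def cbump_def)

lemma cfirst_cbump:
  assumes "sorted_wrt (<) R" "sorted_wrt (<) C" "set R \<subseteq> {..<N}" "set C \<subseteq> {..<N}"
  shows "sorted_wrt (<) (cfirst N C R)" "sorted_wrt (<) (cbump N C R)"
    "set (cfirst N C R) = set C \<union> unm (dsg (set C) (set R)) N"
    "set (cbump N C R) = set R - unm (dsg (set C) (set R)) N"
  using ins_steps[OF assms, of "cfirst N C R" "cbump N C R"] by (auto simp: cfirst_def cbump_def)

lemma col_star_Nil: "sorted_wrt (<) D \<Longrightarrow> col_star D [] = (if D = [] then [] else [D])"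
proof (induction D rule: rev_induct)
  case (snoc x xs)
  then show ?case by (cases "xs = []") (auto simp: col_star_def sorted_wrt_append)
qed (simp add: col_star_def)

definition tab_arr :: "tableau \<Rightarrow> array" where
  "tab_arr T j = (if j < length T then set (T ! j) else {})"

lemma tab_arr_simps: "tab_arr [] j = {}" "tab_arr (c # T) 0 = set c" "tab_arr (c # T) (Suc j) = tab_arr T j"
  by (simp_all add: tab_arr_def)

definition col_ok :: "nat \<Rightarrow> nat list \<Rightarrow> bool" where
  "col_ok n c \<longleftrightarrow> sorted_wrt (<) c \<and> set c \<subseteq> {1..2 * n}"

definition tabl :: "nat \<Rightarrow> tableau \<Rightarrow> bool" where
  "tabl n T \<longleftrightarrow> (\<forall>c\<in>set T. c \<noteq> [] \<and> col_ok n c) \<and> sst (tab_arr T)"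

lemma tab_arr_arrays: "\<forall>c\<in>set T. col_ok n c \<Longrightarrow> length T \<le> r \<Longrightarrow> tab_arr T \<in> arrays n r"
  by (auto simp: arrays_def tab_arr_def col_ok_def)

lemma col_ok_lessThan: "col_ok n c \<Longrightarrow> set c \<subseteq> {..<2 * n + 1}"
  by (auto simp: col_ok_def)

lemma asg_dsg: "asg M j = dsg (M j) (M (Suc j))"
  by (simp add: asg_def dsg_def fun_eq_iff)

text \<open>Inserting into the column \<open>c\<close> moves the unmatched letters of
  \<open>c\<close> to column \<open>j0\<close> and leaves the bumped ones in column
  \<open>Suc j0\<close>, where they are the column inserted next. So each stage is one full power of
  an operator.\<close>

lemma areach_col_star:
  assumes "M \<in> arrays n r" "j0 + length T < r" "col_ok n C" "\<forall>c\<in>set T. col_ok n c"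
    "M j0 = set C" "\<And>i. M (Suc j0 + i) = tab_arr T i"
  shows "areach n r M (\<lambda>j. if j < j0 then M j else tab_arr (col_star C T) (j - j0))"
  using assms
proof (induction T arbitrary: M j0 C)
  case Nil
  have "M j = (if j < j0 then M j else tab_arr (col_star C []) (j - j0))" for j
  proof (cases "j \<le> j0")
    case True
    then show ?thesis using Nil.prems(3,5) by (auto simp: col_star_Nil col_ok_def tab_arr_simps)
  next
    case False
    then have "j = Suc j0 + (j - Suc j0)" "j - j0 = Suc (j - Suc j0)" by auto
    then show ?thesis using Nil.prems(3) Nil.prems(6)[of "j - Suc j0"] False
      by (auto simp: col_star_Nil col_ok_def tab_arr_simps)
  qed
  then have "(\<lambda>j. if j < j0 then M j else tab_arr (col_star C []) (j - j0)) = M" by (intro ext) simp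
  then show ?case by (simp only: areach_refl)
next
  case (Cons c T)
  let ?N = "2 * n + 1"
  define F where "F = bump n j0 M"
  have c: "col_ok n c" using Cons.prems(4) by simp
  have M1: "M (Suc j0) = set c" using Cons.prems(6)[of 0] by (simp add: tab_arr_simps)
  have F: "F = unm (dsg (set C) (set c)) ?N" unfolding F_def bump_def asg_dsg Cons.prems(5) M1 ..
  note cf = cfirst_cbump[of c C ?N, folded F]
  have cf': "set (cfirst ?N C c) = set C \<union> F" "col_ok n (cbump ?N C c)" "set (cbump ?N C c) = set c - F"
    using cf col_ok_lessThan c Cons.prems(3) by (auto simp: col_ok_def)
  define M' where "M' = M(j0 := M j0 \<union> F, Suc j0 := M (Suc j0) - F)"
  have r: "Suc j0 < r" using Cons.prems(2) by simp
  have a1: "areach n r M M'" unfolding M'_def F_def by (rule areach_bump[OF Cons.prems(1) r])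
  have "areach n r M' (\<lambda>j. if j < Suc j0 then M' j else tab_arr (col_star (cbump ?N C c) T) (j - Suc j0))"
  proof (rule Cons.IH)
    show "M' \<in> arrays n r" using a1 Cons.prems(1) areach_arrays by blast
    show "M' (Suc (Suc j0) + i) = tab_arr T i" for i
      using Cons.prems(6)[of "Suc i"] by (simp add: M'_def tab_arr_simps)
  qed (use Cons.prems cf' M1 in \<open>auto simp: M'_def\<close>)
  also have "(\<lambda>j. if j < Suc j0 then M' j else tab_arr (col_star (cbump ?N C c) T) (j - Suc j0))
    = (\<lambda>j. if j < j0 then M j else tab_arr (col_star C (c # T)) (j - j0))"
  proof
    fix j
    consider "j < j0" | "j = j0" | "Suc j0 \<le> j" by linarith
    then show "(if j < Suc j0 then M' j else tab_arr (col_star (cbump ?N C c) T) (j - Suc j0))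
      = (if j < j0 then M j else tab_arr (col_star C (c # T)) (j - j0))"
    proof cases
      case 3
      then have "j - j0 = Suc (j - Suc j0)" by auto
      then show ?thesis using 3 by (simp add: col_star_Cons[of C c T ?N] tab_arr_simps)
    qed (simp_all add: col_star_Cons[of C c T ?N] tab_arr_simps M'_def cf'(1)[simplified] Cons.prems(5))
  qed
  finally show ?case using a1 areach_trans by blast
qed

definition cn :: "nat set \<Rightarrow> nat \<Rightarrow> nat" where
  "cn A p = card {q \<in> A. q \<le> p}"

lemma cnt_cn: "cnt M j p = cn (M j) p"
  by (simp add: cnt_def cn_def)

lemma cn_Suc: "cn A (Suc p) = cn A p + of_bool (Suc p \<in> A)"
  using cnt_Suc[of "\<lambda>_. A" 0 p] by (simp add: cnt_cn)

lemma cn_mono: "p \<le> q \<Longrightarrow> cn A p \<le> cn A q"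
  using cnt_mono[of p q "\<lambda>_. A" 0] by (simp add: cnt_cn)

lemma cn_0: "0 \<notin> A \<Longrightarrow> cn A 0 = 0"
proof -
  assume "0 \<notin> A"
  then have "{q \<in> A. q \<le> 0} = {}" by auto
  then show ?thesis by (simp add: cn_def)
qed

lemma cn_Un_disjoint: "A \<inter> B = {} \<Longrightarrow> cn (A \<union> B) p = cn A p + cn B p"
proof -
  assume a: "A \<inter> B = {}"
  have "{q \<in> A \<union> B. q \<le> p} = {q \<in> A. q \<le> p} \<union> {q \<in> B. q \<le> p}" by blast
  moreover have "finite {q \<in> X. q \<le> p}" for X by simp
  ultimately show ?thesis using a unfolding cn_def by (subst card_Un_disjoint[symmetric]) auto
qed

lemma sum_dsg:
  assumes "0 \<notin> A" "0 \<notin> B"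
  shows "sum_list (map (dsg A B) [0..<Suc p]) = int (cn A p) - int (cn B p)"
proof (induction p)
  case 0
  show ?case using assms by (simp add: dsg_def cn_0)
next
  case (Suc p)
  show ?case using Suc.IH by (simp add: cn_Suc dsg_def)
qed

lemma cn_unm:
  assumes "0 \<notin> A" "0 \<notin> B" "B \<subseteq> {..<N}"
  shows "int (cn (unm (dsg A B) N) p) = dn (map (dsg A B) [0..<Suc p])"
proof -
  have "{q \<in> unm (dsg A B) N. q \<le> p} = unm (dsg A B) (Suc p)"
    using assms(3) by (auto simp: unm_def dsg_def of_bool_def split: if_splits)
  then show ?thesis using card_unm[of "dsg A B" "Suc p"] dsg_bounds by (simp add: cn_def)
qed

lemma cn_unm_ge:
  assumes "0 \<notin> A" "0 \<notin> B" "B \<subseteq> {..<N}"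
  shows "cn B p \<le> cn A p + cn (unm (dsg A B) N) p"
  using cn_unm[OF assms, of p] up_nonneg[of "map (dsg A B) [0..<Suc p]"] sum_dsg[OF assms(1,2), of p]
  unfolding up_def by linarith

text \<open>With \<open>cn_unm_ge\<close>: the count of unmatched letters is the least monotone
  excess of \<open>B\<close> over \<open>A\<close>. It can only grow where \<open>B\<close> attains
  the excess exactly.\<close>

lemma cn_unm_le:
  assumes z: "0 \<notin> A" "0 \<notin> B" "B \<subseteq> {..<N}" and g: "mono g" "\<And>p. cn B p \<le> cn A p + g p"
  shows "cn (unm (dsg A B) N) p \<le> g p"
proof (induction p)
  case 0
  have "0 \<notin> unm (dsg A B) N" using z(2) by (auto simp: unm_def dsg_def)
  then show ?case by (simp add: cn_0)
next
  case (Suc p)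
  show ?case
  proof (cases "Suc p \<in> unm (dsg A B) N")
    case True
    then have u: "up (map (dsg A B) [0..<Suc p]) = 0" "dsg A B (Suc p) = - 1" by (auto simp: unm_def)
    then have "cn B p = cn A p + cn (unm (dsg A B) N) p"
      using cn_unm[OF z, of p] sum_dsg[OF z(1,2), of p] unfolding up_def by linarith
    moreover have "cn B (Suc p) = Suc (cn B p)" "cn A (Suc p) = cn A p"
      using u(2) by (auto simp: cn_Suc dsg_def of_bool_def split: if_splits)
    ultimately show ?thesis using g(2)[of "Suc p"] True by (simp add: cn_Suc)
  next
    case False
    then show ?thesis using Suc.IH monoD[OF g(1), of p "Suc p"] by (simp add: cn_Suc)
  qed
qed

lemma sst_tab_Cons: "sst (tab_arr (c # T)) \<longleftrightarrow> sst (tab_arr T) \<and> (\<forall>p. cn (tab_arr T 0) p \<le> cn (set c) p)"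
proof -
  have "sst (tab_arr (c # T)) \<longleftrightarrow> (\<forall>p. cn (tab_arr T 0) p \<le> cn (set c) p) \<and> (\<forall>j p. cn (tab_arr T (Suc j)) p \<le> cn (tab_arr T j) p)"
    unfolding sst_def cnt_cn by (metis (no_types, lifting) not0_implies_Suc tab_arr_simps(2,3))
  then show ?thesis unfolding sst_def cnt_cn by blast
qed

text \<open>The last claim, with an arbitrary monotone \<open>g\<close>, carries the induction: with
  the count of the retained letters as \<open>g\<close>, it compares the column that follows with
  the new first column.\<close>

lemma col_star_tabl:
  assumes "col_ok n C" "tabl n T"
  shows "tabl n (col_star C T)" "length (col_star C T) \<le> Suc (length T)"
    "sum_list (map length (col_star C T)) = length C + sum_list (map length T)"
    "\<lbrakk>mono g; \<And>p. cn (tab_arr T 0) p \<le> cn (set C) p + g p\<rbrakk> \<Longrightarrow> cn (tab_arr (col_star C T) 0) p \<le> cn (set C) p + g p"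
proof -
  have "tabl n (col_star C T) \<and> length (col_star C T) \<le> Suc (length T)
    \<and> sum_list (map length (col_star C T)) = length C + sum_list (map length T)
    \<and> (\<forall>g. mono g \<longrightarrow> (\<forall>p. cn (tab_arr T 0) p \<le> cn (set C) p + g p) \<longrightarrow> (\<forall>p. cn (tab_arr (col_star C T) 0) p \<le> cn (set C) p + g p))"
    using assms
  proof (induction T arbitrary: C)
    case Nil
    then show ?case by (auto simp: col_star_Nil col_ok_def tabl_def tab_arr_simps sst_def cnt_cn cn_def tab_arr_def)
  next
    case (Cons c T)
    let ?N = "2 * n + 1"
    define F where "F = unm (dsg (set C) (set c)) ?N"
    have c: "col_ok n c" "c \<noteq> []" and T: "tabl n T" "\<And>p. cn (tab_arr T 0) p \<le> cn (set c) p"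
      using Cons.prems(2) by (auto simp: tabl_def sst_tab_Cons)
    have b: "set c \<subseteq> {..<?N}" "set C \<subseteq> {..<?N}" "0 \<notin> set c" "0 \<notin> set C"
      using c(1) Cons.prems(1) by (auto simp: col_ok_def)
    note cf = cfirst_cbump[of c C ?N, folded F_def]
    have cf': "sorted_wrt (<) (cfirst ?N C c)" "set (cfirst ?N C c) = set C \<union> F" "sorted_wrt (<) (cbump ?N C c)"
      "set (cbump ?N C c) = set c - F"
      using cf b(1,2) c Cons.prems(1) by (auto simp: col_ok_def)
    have FC: "F \<subseteq> set c" "F \<inter> set C = {}" by (auto simp: F_def unm_def dsg_def of_bool_def split: if_splits)
    have ok: "col_ok n (cfirst ?N C c)" "col_ok n (cbump ?N C c)"
      using cf' FC c(1) Cons.prems(1) by (auto simp: col_ok_def)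
    have cc: "cn (set c) p = cn (set c - F) p + cn F p" for p
    proof -
      have "(set c - F) \<union> F = set c" "(set c - F) \<inter> F = {}" using FC(1) by auto
      then show ?thesis using cn_Un_disjoint[of "set c - F" F p] by simp
    qed
    have cC: "cn (set C \<union> F) p = cn (set C) p + cn F p" for p
      using cn_Un_disjoint[of "set C" F p] FC(2) by (simp add: Int_commute)
    note IH = Cons.IH[OF ok(2) T(1)]
    have eq: "col_star C (c # T) = cfirst ?N C c # col_star (cbump ?N C c) T" by (rule col_star_Cons)
    have ne: "cfirst ?N C c \<noteq> []"
    proof
      assume e: "cfirst ?N C c = []"
      then have "set C = {}" "F = {}" using cf'(2) by auto
      moreover have "cn (set c) (2 * n) \<noteq> 0"
      proof -
        have "hd c \<in> {q \<in> set c. q \<le> 2 * n}" using c by (auto simp: col_ok_def dest!: hd_in_set)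
        then have "{q \<in> set c. q \<le> 2 * n} \<noteq> {}" by blast
        then show ?thesis unfolding cn_def by simp
      qed
      moreover have "cn {} p = 0" for p by (simp add: cn_def)
      ultimately show False using cn_unm_ge[OF b(4,3,1), of "2 * n"] unfolding F_def[symmetric] by simp
    qed
    have "cn (tab_arr (col_star (cbump ?N C c) T) 0) p \<le> cn (set (cbump ?N C c)) p + cn F p" for p
    proof -
      have "mono (cn F)" by (intro monoI cn_mono)
      moreover have "\<forall>p. cn (tab_arr T 0) p \<le> cn (set (cbump ?N C c)) p + cn F p"
        using T(2) cc cf'(4) by metis
      ultimately show ?thesis using IH by blast
    qed
    then have "cn (tab_arr (col_star (cbump ?N C c) T) 0) p \<le> cn (set (cfirst ?N C c)) p" for p
      using cc[of p] cC[of p] cn_unm_ge[OF b(4,3,1), of p] unfolding cf' F_def[symmetric] by (metis le_trans)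
    then have "tabl n (col_star C (c # T))"
      using IH ok(1) ne unfolding eq tabl_def by (auto simp: sst_tab_Cons)
    moreover have "length (cfirst ?N C c) + length (cbump ?N C c) = length C + length c"
    proof -
      have len: "length xs = card (set xs)" if "sorted_wrt (<) xs" for xs :: "nat list"
        using that by (simp add: distinct_card strict_sorted_iff)
      have "card (set C \<union> F) = card (set C) + card F" "card (set c) = card (set c - F) + card F"
        using FC card_Un_disjoint[of "set C" F] card_Un_disjoint[of "set c - F" F] finite_subset[OF FC(1)]
        by (auto simp: Int_commute Un_absorb2)
      then show ?thesis using len cf' c(1) Cons.prems(1) by (simp add: col_ok_def)
    qed
    moreover have "cn (tab_arr (col_star C (c # T)) 0) p \<le> cn (set C) p + g p"
      if "mono g" "\<forall>p. cn (tab_arr (c # T) 0) p \<le> cn (set C) p + g p" for g p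
    proof -
      have "cn F p \<le> g p" unfolding F_def
        using that by (intro cn_unm_le b) (simp_all add: tab_arr_simps)
      then show ?thesis unfolding eq tab_arr_simps cf' cC by simp
    qed
    ultimately show ?case using IH unfolding eq by auto
  qed
  then show "tabl n (col_star C T)" "length (col_star C T) \<le> Suc (length T)"
    "sum_list (map length (col_star C T)) = length C + sum_list (map length T)"
    "\<lbrakk>mono g; \<And>p. cn (tab_arr T 0) p \<le> cn (set C) p + g p\<rbrakk> \<Longrightarrow> cn (tab_arr (col_star C T) 0) p \<le> cn (set C) p + g p"
    by blast+
qed

text \<open>In a tableau no letter of a column is unmatched against its left neighbour, so each
  insertion returns the column inserted and bumps the whole next one.\<close>

lemma col_star_fixed:
  assumes "tabl n (c # T)"
  shows "col_star c T = c # T"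
  using assms
proof (induction T arbitrary: c)
  case Nil
  then show ?case by (auto simp: col_star_Nil tabl_def col_ok_def)
next
  case (Cons d T)
  let ?N = "2 * n + 1"
  have d: "col_ok n d" and c: "col_ok n c" and t: "tabl n (d # T)" "\<And>p. cn (set d) p \<le> cn (set c) p"
    using Cons.prems by (auto simp: tabl_def sst_tab_Cons tab_arr_simps)
  have b: "set d \<subseteq> {..<?N}" "set c \<subseteq> {..<?N}" "0 \<notin> set d" "0 \<notin> set c"
    using c d by (auto simp: col_ok_def)
  have F: "unm (dsg (set c) (set d)) ?N = {}"
  proof -
    have "cn (unm (dsg (set c) (set d)) ?N) ?N \<le> 0"
      by (rule cn_unm_le[OF b(4,3,1), of "\<lambda>_. 0"]) (use t in \<open>auto simp: mono_def\<close>)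
    then have "card {q \<in> unm (dsg (set c) (set d)) ?N. q \<le> ?N} = 0" by (simp add: cn_def)
    then have "{q \<in> unm (dsg (set c) (set d)) ?N. q \<le> ?N} = {}" using finite_unm by simp
    then show ?thesis by (auto simp: unm_def)
  qed
  note cf = cfirst_cbump[of d c ?N, unfolded F]
  have "cfirst ?N c d = c" "cbump ?N c d = d"
    using cf b c d by (auto simp: col_ok_def intro: strict_sorted_equal)
  then show ?case using Cons.IH[OF t(1)] by (simp add: col_star_Cons[of c d T ?N])
qed

section \<open>Reduction and iteration\<close>

text \<open>The largest letter can only complete the last pair, so removing it leaves the signs of
  all smaller pairs.\<close>

lemma zset_max:
  assumes x: "x \<in> M 0" "\<And>y. y \<in> M 0 \<Longrightarrow> y \<le> x" and M': "M' 0 = M 0 - {x}"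
  shows "zset n M = zset n M' \<union>
    (if even x \<and> x div 2 \<in> {1..n} \<and> x - 1 \<in> M 0 \<and> up (map (zsg M') [0..<x div 2]) = 0 then {x div 2} else {})"
proof -
  have z: "zsg M p = zsg M' p" if "2 * p < x" for p
    using that by (auto simp: zsg_def M')
  have u: "up (map (zsg M) [0..<m]) = up (map (zsg M') [0..<m])" if "2 * m \<le> x" for m
  proof -
    have "map (zsg M) [0..<m] = map (zsg M') [0..<m]" using that by (auto intro!: z)
    then show ?thesis by (simp only:)
  qed
  have "m \<in> zset n M \<longleftrightarrow> m \<in> zset n M' \<or>
      (even x \<and> x div 2 \<in> {1..n} \<and> x - 1 \<in> M 0 \<and> up (map (zsg M') [0..<x div 2]) = 0 \<and> m = x div 2)" for m
  proof (cases "2 * m \<in> M 0")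
    case True
    then have le: "2 * m \<le> x" using x(2) by blast
    show ?thesis
    proof (cases "2 * m = x")
      case True
      then have "m \<notin> zset n M'" using M' by (simp add: zset_iff)
      then show ?thesis using True x(1) u[OF le] by (auto simp: zset_iff)
    next
      case False
      then have "2 * m - 1 \<noteq> x" "m \<noteq> x div 2 \<or> odd x" using le by auto
      then show ?thesis using False u[OF le] M' by (auto simp: zset_iff)
    qed
  next
    case False
    then have "m \<notin> zset n M" "m \<notin> zset n M'" using M' by (auto simp: zset_iff)
    then show ?thesis using False x(1) by auto
  qed
  then show ?thesis by auto
qed

lemma card_pairs:
  assumes "finite G" "0 \<notin> G"
  shows "card (pairs G) = 2 * card G"
  using assms
proof (induction G)
  case (insert m G)
  have "pairs (insert m G) = {2 * m - 1, 2 * m} \<union> pairs G" by (simp add: pairs_def)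
  moreover have "{2 * m - 1, 2 * m} \<inter> pairs G = {}" using pairs_iff[of G m] insert by auto
  moreover have "finite (pairs G)" using insert(1) by (simp add: pairs_def)
  ultimately have "card (pairs (insert m G)) = card {2 * m - 1, 2 * m} + card (pairs G)"
    by (simp only: card_Un_disjoint finite.intros)
  moreover have "card {2 * m - 1, 2 * m} = 2" using insert.prems by auto
  ultimately show ?case using insert by simp
qed (simp add: pairs_def)

lemma col_ok_butlast: "col_ok n S \<Longrightarrow> col_ok n (butlast S)"
  by (auto simp: col_ok_def sorted_wrt_append dest: in_set_butlastD)
    (metis append_butlast_last_id butlast.simps(1) sorted_wrt_append)

text \<open>The recursion of \<open>rem\<close> is the signature rule. With last letter 2m,
  \<open>S2\<close> the column without its last two letters, and c unmatched pairs in
  \<open>S2\<close>, the inequality in \<open>rem\<close> reads m - 1 - \<open>length S2\<close> + c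
  \<le> 0. The left side is the number of unmatched plus signs before \<open>m\<close>.\<close>

lemma rem_zset: "col_ok n S \<Longrightarrow> rem S = pairs (zset n (tab_arr [S]))"
proof (induction "length S" arbitrary: S rule: less_induct)
  case less
  show ?case
  proof (cases "length S \<le> 1")
    case True
    have "zset n (tab_arr [S]) = {}"
    proof -
      have False if m: "m \<in> zset n (tab_arr [S])" for m
      proof -
        have "2 * m - 1 \<in> set S" "2 * m \<in> set S" "1 \<le> m" using m by (auto simp: zset_iff tab_arr_simps)
        then have "card {2 * m - 1, 2 * m} \<le> card (set S)" by (intro card_mono) auto
        moreover have "card {2 * m - 1, 2 * m} = 2" using \<open>1 \<le> m\<close> by auto
        ultimately show False using card_length[of S] True by simp
      qed
      then show ?thesis by blast
    qed
    then show ?thesis using True by (simp add: rem.simps pairs_def)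
  next
    case False
    define x y S1 S2 where "x = S ! (length S - 1)" and "y = S ! (length S - 2)"
      and "S1 = butlast S" and "S2 = butlast (butlast S)"
    have S: "S = S2 @ [y, x]" "S1 = S2 @ [y]" "length S = length S2 + 2"
    proof -
      obtain a b R where R: "S = R @ [b, a]"
        using False by (metis append.assoc append_Cons append_Nil append_butlast_last_id butlast.simps(2) le_0_eq length_0_conv length_butlast nat_le_linear not_less_eq_eq One_nat_def diff_is_0_eq)
      then show "S = S2 @ [y, x]" "S1 = S2 @ [y]" "length S = length S2 + 2"
        by (simp_all add: x_def y_def S1_def S2_def nth_append butlast_append)
    qed
    have so: "sorted_wrt (<) S" and bd: "set S \<subseteq> {1..2 * n}" using less.prems by (auto simp: col_ok_def)
    have S2y: "\<forall>z\<in>set S2. z < y" "y < x" and xb: "1 \<le> y" "x \<le> 2 * n"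
      using so bd unfolding S(1) by (auto simp: sorted_wrt_append)
    have ok: "col_ok n S1" "col_ok n S2" using col_ok_butlast less.prems by (auto simp: S1_def S2_def)
    let ?C = "even x \<and> int y = int x - 1 \<and> int x < 2 * int (length S) - int (card (rem S2)) - 1"
    have rem: "rem S = (if ?C then rem S2 \<union> {y, x} else rem S1)"
      using False unfolding rem.simps[of S] x_def y_def S1_def S2_def by simp
    have r1: "rem S1 = pairs (zset n (tab_arr [S1]))" and r2: "rem S2 = pairs (zset n (tab_arr [S2]))"
      using less.hyps ok S by auto
    let ?M = "tab_arr [S]" and ?M1 = "tab_arr [S1]" and ?M2 = "tab_arr [S2]"
    have z1: "zset n ?M = zset n ?M1 \<union>
      (if even x \<and> x div 2 \<in> {1..n} \<and> x - 1 \<in> set S \<and> up (map (zsg ?M1) [0..<x div 2]) = 0 then {x div 2} else {})"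
    proof -
      have "x \<in> ?M 0" "\<And>z. z \<in> ?M 0 \<Longrightarrow> z \<le> x" "?M1 0 = ?M 0 - {x}"
        using S2y unfolding S by (auto simp: tab_arr_simps)
      from zset_max[of x ?M ?M1 n, OF this] show ?thesis unfolding tab_arr_simps .
    qed
    have adj: "x - 1 \<in> set S \<longleftrightarrow> int y = int x - 1"
      using S2y xb unfolding S(1) by auto
    show ?thesis
    proof (cases "even x \<and> int y = int x - 1")
      case True
      then obtain m where m: "x = 2 * m" "y = 2 * m - 1" "1 \<le> m" "m \<le> n" using S2y(2) xb by (auto elim!: evenE)
      have z2: "zset n ?M1 = zset n ?M2"
      proof -
        have "y \<in> ?M1 0" "\<And>z. z \<in> ?M1 0 \<Longrightarrow> z \<le> y" "?M2 0 = ?M1 0 - {y}"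
          using S2y unfolding S by (auto simp: tab_arr_simps)
        moreover have "odd y" using m by simp
        ultimately show ?thesis using zset_max[of y ?M1 ?M2 n] by simp
      qed
      have zl: "p < m" if "p \<in> zset n ?M2" for p
        using that S2y m by (auto simp: zset_iff tab_arr_simps)
      have u2: "map (zsg ?M1) [0..<m] = map (zsg ?M2) [0..<m]"
        using m by (intro map_cong refl) (auto simp: zsg_def tab_arr_simps S)
      have "unm (zsg ?M2) m = zset n ?M2" using zl m(4) by (auto simp: zset_def unm_def)
      then have c: "dn (map (zsg ?M2) [0..<m]) = int (card (zset n ?M2))"
        using card_unm[of "zsg ?M2" m] zsg_bounds(1) by simp
      have "sum_list (map (zsg ?M2) [0..<Suc (m - 1)]) = int (m - 1) - int (cnt ?M2 0 (2 * (m - 1)))"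
        by (rule sum_zsg[OF tab_arr_arrays[of _ n 1]]) (use ok in simp_all)
      moreover have "cnt ?M2 0 (2 * (m - 1)) = length S2"
      proof -
        have "{q \<in> set S2. q \<le> 2 * (m - 1)} = set S2" using S2y(1) m by auto
        then show ?thesis using ok(2) by (simp add: cnt_cn cn_def tab_arr_simps col_ok_def distinct_card strict_sorted_iff)
      qed
      ultimately have "sum_list (map (zsg ?M2) [0..<m]) = int m - 1 - int (length S2)" using m(3) by (simp del: upt_Suc)
      then have up: "up (map (zsg ?M1) [0..<m]) = int m - 1 - int (length S2) + int (card (zset n ?M2))"
        unfolding u2 up_def c by simp
      have cr: "card (pairs (zset n ?M2)) = 2 * card (zset n ?M2)"
        by (rule card_pairs) (auto simp: zset_def finite_unm, simp add: unm_def zsg_def)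
      show ?thesis
      proof (cases ?C)
        case C: True
        have "up (map (zsg ?M1) [0..<m]) = 0"
          using C up up_nonneg[of "map (zsg ?M1) [0..<m]"] unfolding r2 cr S(3) m by simp
        then have "zset n ?M = insert m (zset n ?M2)" using z1 z2 m adj True by auto
        then show ?thesis using rem C r2 m by (auto simp: pairs_def)
      next
        case C: False
        have "rem S = rem S1" using rem C by simp
        moreover note r1
        moreover have "up (map (zsg ?M1) [0..<m]) \<noteq> 0"
          using C True up unfolding r2 cr S(3) m by simp
        then have "zset n ?M = zset n ?M1" using z1 m by auto
        ultimately show ?thesis by simp
      qed
    next
      case Fa: False
      then have "rem S = rem S1" unfolding rem by (simp only: if_False conj_assoc[symmetric] simp_thms)
      moreover note r1
      moreover have "zset n ?M = zset n ?M1" using z1 Fa adj by auto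
      ultimately show ?thesis by simp
    qed
  qed
qed

lemma col_ok_red: "col_ok n c \<Longrightarrow> col_ok n (red c)"
  by (auto simp: col_ok_def red_def sorted_wrt_filter)

lemma zset_cong: "M 0 = N 0 \<Longrightarrow> zset n M = zset n N"
proof -
  assume "M 0 = N 0"
  then have "zsg M = zsg N" by (simp add: zsg_def fun_eq_iff)
  then show ?thesis by (simp add: zset_def)
qed

lemma set_red: "col_ok n c \<Longrightarrow> set (red c) = set c - pairs (zset n (tab_arr (c # T)))"
  using rem_zset[of n c] zset_cong[of "tab_arr [c]" "tab_arr (c # T)" n] by (auto simp: red_def tab_arr_simps)

lemma tabl_Cons: "tabl n (c # T) \<Longrightarrow> col_ok n c \<and> c \<noteq> [] \<and> tabl n T"
  by (auto simp: tabl_def sst_tab_Cons)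

lemma areach_suc:
  assumes "tabl n T" "length T \<le> r"
  shows "areach n r (tab_arr T) (tab_arr (suc T))"
proof (cases T)
  case Nil
  then show ?thesis by (simp add: areach_refl)
next
  case (Cons c S)
  have ok: "col_ok n c" "\<forall>c\<in>set T. col_ok n c" "\<forall>c\<in>set S. col_ok n c" using assms(1) Cons by (auto simp: tabl_def)
  define M where "M = (tab_arr T)(0 := set (red c))"
  have 1: "areach n r (tab_arr T) M"
    using areach_zset[OF tab_arr_arrays[OF ok(2) assms(2)]] assms(2) set_red[OF ok(1), of S]
    unfolding M_def Cons by (simp add: tab_arr_simps)
  have "areach n r M (\<lambda>j. if j < 0 then M j else tab_arr (col_star (red c) S) (j - 0))"
    by (rule areach_col_star[OF areach_arrays[OF 1 tab_arr_arrays[OF ok(2) assms(2)]]])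
      (use ok assms(2) col_ok_red in \<open>auto simp: Cons M_def tab_arr_simps\<close>)
  then have "areach n r M (tab_arr (suc T))" by (simp add: Cons)
  then show ?thesis using 1 areach_trans by blast
qed

text \<open>Insertion keeps the number of boxes and reduction lowers it, unless nothing is removed.
  In that case insertion rebuilds the same tableau, and the absence of unmatched pairs is the
  symplectic condition.\<close>

lemma suc_tabl:
  assumes "tabl n T"
  shows "tabl n (suc T)" "length (suc T) \<le> length T"
    "suc T \<noteq> T \<Longrightarrow> sum_list (map length (suc T)) < sum_list (map length T)"
    "suc T = T \<Longrightarrow> king n (tab_arr T)"
proof -
  have "tabl n (suc T) \<and> length (suc T) \<le> length T
    \<and> (suc T \<noteq> T \<longrightarrow> sum_list (map length (suc T)) < sum_list (map length T)) \<and> (suc T = T \<longrightarrow> king n (tab_arr T))"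
  proof (cases T)
    case Nil
    then show ?thesis by (auto simp: tabl_def sst_def cnt_def king_def tab_arr_simps)
  next
    case (Cons c S)
    note t = tabl_Cons[OF assms[unfolded Cons]]
    have ok: "\<forall>c\<in>set T. col_ok n c" using assms by (simp add: tabl_def)
    note p = col_star_tabl[OF col_ok_red, of n c S]
    have le: "length (red c) \<le> length c" by (simp add: red_def)
    have eq: "red c = c" if "length (red c) = length c"
      using that unfolding red_def by (metis filter_True length_filter_less less_irrefl)
    have "sum_list (map length (suc T)) < sum_list (map length T)" if "suc T \<noteq> T"
    proof -
      have "red c \<noteq> c" using that col_star_fixed[of n c S] assms Cons by auto
      then show ?thesis using p(3) t eq le Cons by fastforce
    qed
    moreover have "king n (tab_arr T)" if s: "suc T = T"
    proof -
      have "red c = c" using p(3) t s eq Cons by auto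
      then have "set c = set c - pairs (zset n (tab_arr T))" using set_red[of n c S] t Cons by simp
      then have "zset n (tab_arr T) = {}"
        unfolding Cons by (auto simp: pairs_def zset_iff tab_arr_simps)
      then have "dn (map (zsg (tab_arr T)) [0..<Suc n]) = 0"
        using card_unm[of "zsg (tab_arr T)" "Suc n"] zsg_bounds(1) unfolding zset_def by simp
      then show ?thesis using dn_zsg_0_iff[OF tab_arr_arrays[OF ok, of "length T"]] by blast
    qed
    ultimately show ?thesis using p(1,2) t Cons by simp
  qed
  then show "tabl n (suc T)" "length (suc T) \<le> length T"
    "suc T \<noteq> T \<Longrightarrow> sum_list (map length (suc T)) < sum_list (map length T)"
    "suc T = T \<Longrightarrow> king n (tab_arr T)" by blast+
qed

lemma P_AII_props:
  assumes "tabl n T" "length T \<le> r"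
  shows "tabl n (P_AII T)" "length (P_AII T) \<le> r" "king n (tab_arr (P_AII T))"
    "areach n r (tab_arr T) (tab_arr (P_AII T))"
proof -
  have "\<exists>N. (suc ^^ Suc N) T = (suc ^^ N) T \<and> tabl n ((suc ^^ N) T) \<and> length ((suc ^^ N) T) \<le> r
    \<and> king n (tab_arr ((suc ^^ N) T)) \<and> areach n r (tab_arr T) (tab_arr ((suc ^^ N) T))"
    using assms
  proof (induction "sum_list (map length T)" arbitrary: T rule: less_induct)
    case less
    show ?case
    proof (cases "suc T = T")
      case True
      then show ?thesis using less.prems suc_tabl areach_refl by (intro exI[of _ 0]) auto
    next
      case False
      then obtain N where N: "(suc ^^ Suc N) (suc T) = (suc ^^ N) (suc T)" "tabl n ((suc ^^ N) (suc T))"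
        "length ((suc ^^ N) (suc T)) \<le> r" "king n (tab_arr ((suc ^^ N) (suc T)))"
        "areach n r (tab_arr (suc T)) (tab_arr ((suc ^^ N) (suc T)))"
        using less.hyps[of "suc T"] suc_tabl[OF less.prems(1)] less.prems by auto
      then show ?thesis using areach_trans[OF areach_suc[OF less.prems]]
        by (intro exI[of _ "Suc N"]) (simp add: funpow_Suc_right del: funpow.simps)
    qed
  qed
  then show "tabl n (P_AII T)" "length (P_AII T) \<le> r" "king n (tab_arr (P_AII T))"
    "areach n r (tab_arr T) (tab_arr (P_AII T))"
    using P_AII_eq by auto
qed

section \<open>Tableaux as arrays\<close>

lemma sorted_nth_le_iff:
  fixes c :: "nat list"
  assumes c: "sorted_wrt (<) c" and y: "y < length c"
  shows "c ! y \<le> p \<longleftrightarrow> y < cn (set c) p"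
proof -
  have cn: "cn (set c) p = card {z. z < length c \<and> c ! z \<le> p}"
  proof -
    have "{q \<in> set c. q \<le> p} = (!) c ` {z. z < length c \<and> c ! z \<le> p}" by (auto simp: in_set_conv_nth)
    moreover have "inj_on ((!) c) {z. z < length c \<and> c ! z \<le> p}"
      using c by (intro inj_onI) (auto simp: nth_eq_iff_index_eq strict_sorted_iff)
    ultimately show ?thesis by (simp add: cn_def card_image)
  qed
  have mono: "c ! z < c ! z'" if "z < z'" "z' < length c" for z z'
    using c that by (simp add: sorted_wrt_iff_nth_less)
  have "y < cn (set c) p \<longleftrightarrow> y < length c \<and> c ! y \<le> p"
    unfolding cn
  proof (rule card_initial)
    fix z z' assume "z' < length c \<and> c ! z' \<le> p" "z \<le> z'"
    then show "z < length c \<and> c ! z \<le> p" using mono[of z z'] by (cases "z = z'") auto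
  qed simp
  then show ?thesis using y by simp
qed

lemma cn_le_length: "cn (set c) p \<le> length c"
proof -
  have "cn (set c) p \<le> card (set c)" unfolding cn_def by (intro card_mono) auto
  then show ?thesis using card_length[of c] by (rule order_trans)
qed

lemma column_le_iff:
  assumes c: "sorted_wrt (<) c" and d: "sorted_wrt (<) (d :: nat list)"
  shows "(\<forall>p. cn (set d) p \<le> cn (set c) p) \<longleftrightarrow> length d \<le> length c \<and> (\<forall>y<length d. c ! y \<le> d ! y)"
proof
  assume a: "\<forall>p. cn (set d) p \<le> cn (set c) p"
  have "y < length c \<and> c ! y \<le> d ! y" if y: "y < length d" for y
  proof -
    have "y < cn (set c) (d ! y)" using sorted_nth_le_iff[OF d y, of "d ! y"] a by (meson le_refl less_le_trans)
    moreover have "y < length c" using calculation cn_le_length[of c] by (meson less_le_trans)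
    ultimately show ?thesis using sorted_nth_le_iff[OF c] by blast
  qed
  then show "length d \<le> length c \<and> (\<forall>y<length d. c ! y \<le> d ! y)" by (metis leI less_irrefl)
next
  assume a: "length d \<le> length c \<and> (\<forall>y<length d. c ! y \<le> d ! y)"
  show "\<forall>p. cn (set d) p \<le> cn (set c) p"
  proof
    fix p
    show "cn (set d) p \<le> cn (set c) p"
    proof (cases "cn (set d) p")
      case (Suc y)
      then have y: "y < length d" "y < cn (set d) p" using cn_le_length[of d p] by auto
      then have "d ! y \<le> p" using sorted_nth_le_iff[OF d] by blast
      then have "c ! y \<le> p" using a y(1) by (meson le_trans)
      then have "y < cn (set c) p" using sorted_nth_le_iff[OF c, of y p] y(1) a by auto
      then show ?thesis using Suc by simp
    qed simp
  qed
qed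

lemma sst_tab_iff:
  assumes "\<forall>c\<in>set T. sorted_wrt (<) c"
  shows "sst (tab_arr T) \<longleftrightarrow> (\<forall>x. Suc x < length T \<longrightarrow>
    length (T ! Suc x) \<le> length (T ! x) \<and> (\<forall>y<length (T ! Suc x). T ! x ! y \<le> T ! Suc x ! y))"
proof -
  have "(\<forall>p. cnt (tab_arr T) (Suc x) p \<le> cnt (tab_arr T) x p) \<longleftrightarrow> (Suc x < length T \<longrightarrow>
    length (T ! Suc x) \<le> length (T ! x) \<and> (\<forall>y<length (T ! Suc x). T ! x ! y \<le> T ! Suc x ! y))" for x
  proof (cases "Suc x < length T")
    case True
    then show ?thesis using column_le_iff[of "T ! x" "T ! Suc x"] assms by (simp add: cnt_cn tab_arr_def)
  next
    case False
    then show ?thesis by (simp add: cnt_cn tab_arr_def cn_def)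
  qed
  then show ?thesis unfolding sst_def by blast
qed

definition conj_part :: "nat list \<Rightarrow> nat \<Rightarrow> nat" where
  "conj_part lam j = card {y. y < length lam \<and> j < lam ! y}"

lemma conj_part_iff:
  assumes "is_partition lam"
  shows "y < conj_part lam j \<longleftrightarrow> y < length lam \<and> j < lam ! y"
proof -
  have mono: "lam ! z' \<le> lam ! z" if "z < z'" "z' < length lam" for z z'
    using assms that unfolding is_partition_def by (simp add: sorted_wrt_iff_nth_less)
  show ?thesis
    unfolding conj_part_def
  proof (rule card_initial)
    fix z z' assume "z' < length lam \<and> j < lam ! z'" "z \<le> z'"
    then show "z < length lam \<and> j < lam ! z" using mono[of z z'] by (cases "z = z'") auto
  qed simp
qed

lemma diagram_conj_part: "is_partition lam \<Longrightarrow> diagram lam = {(x, y). y < conj_part lam x}"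
  by (simp add: diagram_def conj_part_iff)

lemma card_tab_arr: "\<forall>c\<in>set T. sorted_wrt (<) c \<Longrightarrow> card (tab_arr T j) = (if j < length T then length (T ! j) else 0)"
  by (auto simp: tab_arr_def distinct_card strict_sorted_iff)

lemma boxes_card: "\<forall>c\<in>set T. sorted_wrt (<) c \<Longrightarrow> boxes T = {(x, y). y < card (tab_arr T x)}"
  by (auto simp: boxes_def card_tab_arr split: if_splits)

lemma SST_tabl_iff:
  assumes "is_partition lam"
  shows "T \<in> SST (2 * n) lam \<longleftrightarrow> tabl n T \<and> (\<forall>j. card (tab_arr T j) = conj_part lam j)"
proof -
  have srt: "(\<forall>x y. (x, y) \<in> boxes T \<longrightarrow> (x, Suc y) \<in> boxes T \<longrightarrow> T ! x ! y < T ! x ! Suc y) \<longleftrightarrow> (\<forall>c\<in>set T. sorted_wrt (<) c)"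
    unfolding boxes_def all_set_conv_all_nth sorted_wrt_iff_nth_Suc_transp[OF transp_on_less] by auto
  have ent: "(\<forall>(x, y)\<in>boxes T. T ! x ! y \<in> {1..2 * n}) \<longleftrightarrow> (\<forall>c\<in>set T. set c \<subseteq> {1..2 * n})"
    unfolding boxes_def all_set_conv_all_nth subset_iff in_set_conv_nth by auto
  have eq: "T \<in> SST (2 * n) lam \<longleftrightarrow> ([] \<notin> set T \<and> (\<forall>c\<in>set T. col_ok n c)) \<and> boxes T = diagram lam
     \<and> (\<forall>x y. (x, y) \<in> boxes T \<longrightarrow> (Suc x, y) \<in> boxes T \<longrightarrow> T ! x ! y \<le> T ! Suc x ! y)"
    unfolding SST_def mem_Collect_eq srt ent col_ok_def by auto
  show ?thesis
  proof (cases "\<forall>c\<in>set T. col_ok n c")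
    case True
    then have s: "\<forall>c\<in>set T. sorted_wrt (<) c" by (simp add: col_ok_def)
    have "boxes T = diagram lam \<longleftrightarrow> (\<forall>j. card (tab_arr T j) = conj_part lam j)"
    proof -
      have "{(x, y). y < f x} = {(x, y). y < g x} \<longleftrightarrow> (\<forall>x. f x = g x)" for f g :: "nat \<Rightarrow> nat"
      proof
        assume a: "{(x, y). y < f x} = {(x, y). y < g x}"
        have "y < f x \<longleftrightarrow> y < g x" for x y using a by (auto simp: set_eq_iff)
        then show "\<forall>x. f x = g x" by (metis less_irrefl linorder_neqE_nat)
      qed simp
      then show ?thesis unfolding boxes_card[OF s] diagram_conj_part[OF assms] .
    qed
    moreover have "(\<forall>x y. (x, y) \<in> boxes T \<longrightarrow> (Suc x, y) \<in> boxes T \<longrightarrow> T ! x ! y \<le> T ! Suc x ! y) \<longleftrightarrow> sst (tab_arr T)"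
      if d: "boxes T = diagram lam"
    proof -
      have "length (T ! Suc x) \<le> length (T ! x)" if "Suc x < length T" for x
      proof -
        have "(x, y) \<in> boxes T" if "(Suc x, y) \<in> boxes T" for y
          using that unfolding d diagram_def by auto
        then show ?thesis using that unfolding boxes_def by (auto simp: not_less[symmetric])
      qed
      then have "y < length (T ! x)" if "Suc x < length T" "y < length (T ! Suc x)" for x y
        using that less_le_trans by blast
      then show ?thesis using \<open>\<And>x. Suc x < length T \<Longrightarrow> length (T ! Suc x) \<le> length (T ! x)\<close>
        unfolding sst_tab_iff[OF s] boxes_def mem_Collect_eq case_prod_conv by (meson Suc_lessD)
    qed
    ultimately show ?thesis using True unfolding eq tabl_def by auto
  next
    case False
    then show ?thesis unfolding eq tabl_def by blast
  qed
qed

lemma tab_arr_inj: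
  assumes "tabl n T" "tabl n T'" "tab_arr T = tab_arr T'"
  shows "T = T'"
proof -
  have ne: "tab_arr T j \<noteq> {} \<longleftrightarrow> j < length T" "tab_arr T' j \<noteq> {} \<longleftrightarrow> j < length T'" for j
    using assms(1,2) by (auto simp: tabl_def tab_arr_def)
  have l: "length T = length T'"
    using ne assms(3) by (metis less_irrefl linorder_neqE_nat)
  show ?thesis
  proof (rule nth_equalityI[OF l])
    fix j assume j: "j < length T"
    then have "set (T ! j) = set (T' ! j)" using fun_cong[OF assms(3), of j] l by (simp add: tab_arr_def)
    moreover have "sorted_wrt (<) (T ! j)" "sorted_wrt (<) (T' ! j)"
      using assms(1,2) j l by (auto simp: tabl_def col_ok_def)
    ultimately show "T ! j = T' ! j" using strict_sorted_equal by metis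
  qed
qed

lemma ex_tab_arr:
  assumes M: "M \<in> arrays n r" and s: "sst M"
  obtains T where "tabl n T" "tab_arr T = M" "length T \<le> r"
proof -
  define l where "l = (LEAST j. M j = {})"
  have ex: "M r = {}" using M by (simp add: arrays_def)
  have l: "M l = {}" "l \<le> r" unfolding l_def
    by (rule LeastI[of "\<lambda>j. M j = {}", OF ex], rule Least_le[of "\<lambda>j. M j = {}", OF ex])
  have lt: "M j \<noteq> {}" if "j < l" for j using not_less_Least that unfolding l_def by blast
  have fin: "finite (M j)" for j
    using M by (auto simp: arrays_iff intro: finite_subset[of _ "{1..2 * n}"])
  \<comment> \<open>Heights decrease from left to right, so all columns from the first empty one on
    are empty.\<close>
  have em: "M j = {}" if "l \<le> j" for j
    using that
  proof (induction j rule: dec_induct)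
    case base
    show ?case by (rule l)
  next
    case (step j)
    have "cnt M (Suc j) (2 * n) \<le> cnt M j (2 * n)" using s by (simp add: sst_def)
    then have "card (M (Suc j)) = 0" using step.IH cnt_beyond[OF M, of "2 * n"] by simp
    then show ?case using fin by simp
  qed
  define T where "T = map (\<lambda>j. sorted_list_of_set (M j)) [0..<l]"
  have e: "tab_arr T = M"
  proof
    fix j
    show "tab_arr T j = M j" using em[of j] fin by (cases "j < l") (auto simp: T_def tab_arr_def)
  qed
  moreover have "tabl n T"
    using s lt fin M unfolding tabl_def e by (auto simp: T_def col_ok_def arrays_iff)
  moreover have "length T \<le> r" using l(2) by (simp add: T_def)
  ultimately show ?thesis using that by blast
qed

lemma length_le_if_arrays:
  assumes "tabl n T" "tab_arr T \<in> arrays n r"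
  shows "length T \<le> r"
proof (rule ccontr)
  assume "\<not> ?thesis"
  then have "r < length T" "tab_arr T r = {}" using assms(2) by (auto simp: arrays_def)
  then show False using assms(1) by (auto simp: tab_arr_def tabl_def)
qed

definition SA :: "nat \<Rightarrow> nat \<Rightarrow> (nat \<Rightarrow> nat) \<Rightarrow> array set" where
  "SA n r k = {M \<in> arrays n r. sst M \<and> (\<forall>j. card (M j) = k j)}"

text \<open>Absent columns are empty sets in an array, so a tableau without empty columns can be
  recovered from it.\<close>

lemma bij_betw_SST_SA:
  assumes lam: "is_partition lam" and r: "\<And>j. r \<le> j \<Longrightarrow> conj_part lam j = 0"
  shows "bij_betw tab_arr (SST (2 * n) lam) (SA n r (conj_part lam))"
  unfolding bij_betw_def
proof (intro conjI Set.set_eqI)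
  show "inj_on tab_arr (SST (2 * n) lam)"
    using tab_arr_inj SST_tabl_iff[OF lam] by (intro inj_onI) blast
  fix M
  show "M \<in> tab_arr ` SST (2 * n) lam \<longleftrightarrow> M \<in> SA n r (conj_part lam)"
  proof
    assume "M \<in> tab_arr ` SST (2 * n) lam"
    then obtain T where T: "M = tab_arr T" "tabl n T" "\<forall>j. card (tab_arr T j) = conj_part lam j"
      using SST_tabl_iff[OF lam] by blast
    have "length T \<le> r"
    proof (rule ccontr)
      assume "\<not> ?thesis"
      then have "r < length T" "card (tab_arr T r) = 0" using T(3) r[of r] by auto
      then show False using T(2) by (auto simp: tab_arr_def tabl_def)
    qed
    then have "M \<in> arrays n r" unfolding T(1) using T(2) by (intro tab_arr_arrays) (auto simp: tabl_def)
    then show "M \<in> SA n r (conj_part lam)" using T by (auto simp: SA_def tabl_def)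
  next
    assume "M \<in> SA n r (conj_part lam)"
    then show "M \<in> tab_arr ` SST (2 * n) lam"
      using SST_tabl_iff[OF lam] by (auto simp: SA_def elim!: ex_tab_arr)
  qed
qed

lemma entry_count_letter_count:
  assumes "\<forall>c\<in>set T. sorted_wrt (<) c" "length T \<le> r"
  shows "entry_count T q = letter_count r (tab_arr T) q"
proof -
  have c: "count_list c q = of_bool (q \<in> set c)" if "sorted_wrt (<) c" for c
    using that by (induction c) (auto simp: count_list_0_iff)
  have "count_list (concat T) q = (\<Sum>j<length T. count_list (T ! j) q)"
  proof -
    have "count_list (concat T) q = sum_list (map (\<lambda>c. count_list c q) T)" by (induction T) auto
    then show ?thesis by (simp add: sum_list_sum_nth atLeast0LessThan)
  qed
  also have "\<dots> = (\<Sum>j<length T. of_bool (q \<in> tab_arr T j))"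
    using assms(1) c by (intro sum.cong) (auto simp: tab_arr_def)
  also have "\<dots> = (\<Sum>j<r. of_bool (q \<in> tab_arr T j))"
    using assms(2) by (intro sum.mono_neutral_left) (auto simp: tab_arr_def)
  finally show ?thesis by (simp add: entry_count_def letter_count_def)
qed

section \<open>Alternating delta functions\<close>

text \<open>Signed indicator of the orbit of \<open>m\<close>, under permutations for
  \<open>s = 0\<close> and under signed permutations for \<open>s = 1\<close>.\<close>

definition Dl :: "int \<Rightarrow> nat set \<Rightarrow> (nat \<Rightarrow> int) \<Rightarrow> (nat \<Rightarrow> int) \<Rightarrow> int" where
  "Dl s I m v = (\<Sum>p\<in>{p. p permutes I}. sign p * (\<Prod>i\<in>I. of_bool (v i = m (p i)) - s * of_bool (v i = - m (p i))))"

lemma Dl_cong: "(\<And>i. i \<in> I \<Longrightarrow> v i = w i) \<Longrightarrow> Dl s I m v = Dl s I m w"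
  unfolding Dl_def by (intro sum.cong refl arg_cong2[of _ _ _ _ "(*)"] prod.cong) auto

lemma Dl_perm:
  assumes I: "finite I" and q: "q permutes I"
  shows "Dl s I m (\<lambda>i. v (q i)) = sign q * Dl s I m v"
proof -
  let ?t = "\<lambda>a b. of_bool (a = m b) - s * of_bool (a = - m b) :: int"
  have "Dl s I m (\<lambda>i. v (q i)) = (\<Sum>p\<in>{p. p permutes I}. sign (p \<circ> q) * (\<Prod>i\<in>I. ?t (v (q i)) ((p \<circ> q) i)))"
    unfolding Dl_def by (rule sum_permutations_compose_right[OF q])
  also have "\<dots> = (\<Sum>p\<in>{p. p permutes I}. sign q * (sign p * (\<Prod>i\<in>I. ?t (v i) (p i))))"
  proof (intro sum.cong refl)
    fix p assume "p \<in> {p. p permutes I}"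
    then have p: "p permutes I" by simp
    have "(\<Prod>i\<in>I. ?t (v (q i)) ((p \<circ> q) i)) = (\<Prod>i\<in>I. ?t (v i) (p i))"
      using prod.permute[OF q, of "\<lambda>i. ?t (v i) (p i)"] by (simp add: o_def)
    moreover have "sign (p \<circ> q) = sign p * sign q"
      using sign_compose permutation_permutes I p q by blast
    ultimately show "sign (p \<circ> q) * (\<Prod>i\<in>I. ?t (v (q i)) ((p \<circ> q) i)) = sign q * (sign p * (\<Prod>i\<in>I. ?t (v i) (p i)))"
      by simp
  qed
  finally show ?thesis unfolding Dl_def by (simp add: sum_distrib_left)
qed

lemma Dl_swap:
  assumes "finite I" "a \<in> I" "b \<in> I" "a \<noteq> b"
  shows "Dl s I m (\<lambda>i. v (transpose a b i)) = - Dl s I m v"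
  using Dl_perm[OF assms(1) permutes_swap_id[OF assms(2,3)], of s m v] assms(4) by (simp add: sign_swap_id)

lemma Dl_neg:
  assumes I: "finite I" "a \<in> I"
  shows "Dl 1 I m (v(a := - v a)) = - Dl 1 I m v"
proof -
  let ?t = "\<lambda>a b. of_bool (a = m b) - 1 * of_bool (a = - m b) :: int"
  have "(\<Prod>i\<in>I. ?t ((v(a := - v a)) i) (p i)) = - (\<Prod>i\<in>I. ?t (v i) (p i))" for p
  proof -
    have "(\<Prod>i\<in>I - {a}. ?t ((v(a := - v a)) i) (p i)) = (\<Prod>i\<in>I - {a}. ?t (v i) (p i))"
      by (intro prod.cong) auto
    moreover have "?t (- x) b = - ?t x b" for x b
      by (auto simp: of_bool_def)
    ultimately show ?thesis
      by (subst (1 2) prod.remove[OF I]) (simp only: fun_upd_same minus_mult_left)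
  qed
  then show ?thesis unfolding Dl_def by (simp only: mult_minus_right sum_negf)
qed

lemma Dl_nonzero:
  assumes "finite I" "Dl s I m v \<noteq> 0"
  obtains p where "p permutes I" "\<And>i. i \<in> I \<Longrightarrow> v i = m (p i) \<or> v i = - m (p i)"
proof -
  obtain p where p: "p permutes I" "(\<Prod>i\<in>I. of_bool (v i = m (p i)) - s * of_bool (v i = - m (p i))) \<noteq> 0"
    using assms(2) unfolding Dl_def by (metis (no_types, lifting) mem_Collect_eq mult_zero_right sum.neutral)
  have "v i = m (p i) \<or> v i = - m (p i)" if "i \<in> I" for i
  proof (rule ccontr)
    assume "\<not> ?thesis"
    then have "of_bool (v i = m (p i)) - s * of_bool (v i = - m (p i)) = 0" by simp
    then show False using p(2) that unfolding prod_zero_iff[OF assms(1)] by blast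
  qed
  then show ?thesis using that p(1) by blast
qed

lemma permutes_strict_mono_id:
  assumes "p permutes I" "finite I" "\<And>i j. i \<in> I \<Longrightarrow> j \<in> I \<Longrightarrow> i < j \<Longrightarrow> p i < (p j :: nat)"
  shows "p = id"
proof -
  have "p i = i" if "i \<in> I" for i
    using that
  proof (induction i rule: less_induct)
    case (less i)
    have pi: "p i \<in> I" using assms(1) less.prems permutes_in_image by metis
    consider "p i < i" | "i < p i" | "p i = i" by linarith
    then show ?case
    proof cases
      case 1
      then have "p (p i) = p i" using less.IH pi by blast
      then show ?thesis using assms(1) permutes_inj by (metis injD)
    next
      case 2
      obtain j where j: "p j = i" using assms(1) by (metis permutes_surj surjD)
      then have jI: "j \<in> I" using assms(1) less.prems permutes_in_image by metis
      consider "j < i" | "i \<le> j" by linarith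
      then show ?thesis
      proof cases
        case 1
        then show ?thesis using less.IH[OF 1 jI] j by simp
      next
        case b: 2
        then show ?thesis using assms(3)[OF less.prems jI] j 2 by (cases "i = j") auto
      qed
    qed
  qed
  then show ?thesis using assms(1) by (auto simp: permutes_def fun_eq_iff)
qed

text \<open>A permutation that matches two strictly increasing sequences is order preserving, hence
  the identity; positivity excludes the negated values.\<close>

lemma Dl_strict:
  assumes I: "finite I" and v: "\<And>i j. i \<in> I \<Longrightarrow> j \<in> I \<Longrightarrow> i < j \<Longrightarrow> v i < v j"
    and m: "\<And>i j. i \<in> I \<Longrightarrow> j \<in> I \<Longrightarrow> i < j \<Longrightarrow> m i < m j"
    and pos: "s = 0 \<or> (\<forall>i\<in>I. 0 < v i \<and> 0 < m i)"
  shows "Dl s I m v = of_bool (\<forall>i\<in>I. v i = m i)"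
proof -
  let ?t = "\<lambda>a b. of_bool (a = m b) - s * of_bool (a = - m b) :: int"
  have t: "?t (v i) (p i) = of_bool (v i = m (p i))" if "p permutes I" "i \<in> I" for p i
  proof -
    have "p i \<in> I" using that permutes_in_image by metis
    then have "s = 0 \<or> 0 < v i \<and> 0 < m (p i)" using pos that(2) by blast
    then have "s = 0 \<or> v i \<noteq> - m (p i)" by linarith
    then show ?thesis by auto
  qed
  have z: "(\<Prod>i\<in>I. ?t (v i) (p i)) = 0" if p: "p permutes I" "p \<noteq> id" for p
  proof (rule ccontr)
    assume nz: "(\<Prod>i\<in>I. ?t (v i) (p i)) \<noteq> 0"
    have e: "v i = m (p i)" if "i \<in> I" for i
      using nz t[OF p(1) that] that I by (auto simp: prod_zero_iff)
    have mm: "i < j" if "i \<in> I" "j \<in> I" "m i < m j" for i j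
      using m that by (metis less_asym linorder_neqE_nat less_irrefl)
    have "p i < p j" if "i \<in> I" "j \<in> I" "i < j" for i j
      using v[OF that] e that mm p(1) permutes_in_image by metis
    then show False using permutes_strict_mono_id[OF p(1) I] p(2) by blast
  qed
  have "Dl s I m v = (\<Sum>p\<in>{id}. sign p * (\<Prod>i\<in>I. ?t (v i) (p i)))"
    unfolding Dl_def using I z by (intro sum.mono_neutral_right) (auto simp: finite_permutations permutes_id)
  also have "\<dots> = (\<Prod>i\<in>I. of_bool (v i = m i))"
  proof -
    have "(\<Prod>i\<in>I. ?t (v i) (id i)) = (\<Prod>i\<in>I. of_bool (v i = m (id i)))"
      by (intro prod.cong refl t permutes_id)
    then show ?thesis by simp
  qed
  also have "\<dots> = of_bool (\<forall>i\<in>I. v i = m i)"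
    using I by (induction I) auto
  finally show ?thesis .
qed

section \<open>Highest and lowest weight arrays\<close>

text \<open>Dominant weights that fit into \<open>r\<close> columns, extended by 0 outside the
  indices from 1 to \<open>n\<close>.\<close>

definition dwt :: "nat \<Rightarrow> nat \<Rightarrow> (nat \<Rightarrow> nat) \<Rightarrow> bool" where
  "dwt n r \<mu> \<longleftrightarrow> (\<forall>i. \<mu> i \<le> (if 1 \<le> i \<and> i \<le> n then r else 0)) \<and> (\<forall>i j. 1 \<le> i \<longrightarrow> i \<le> j \<longrightarrow> \<mu> j \<le> \<mu> i)"

definition Tarr :: "nat \<Rightarrow> (nat \<Rightarrow> nat) \<Rightarrow> (nat \<Rightarrow> nat) \<Rightarrow> array" where
  "Tarr n f \<mu> j = f ` {i \<in> {1..n}. j < \<mu> i}"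

text \<open>One letter from each pair: the common property of \<open>a_seq\<close> and
  \<open>b_seq\<close> by which constant rows are increasing downwards and satisfy King's
  bound.\<close>

definition ab_seq :: "(nat \<Rightarrow> nat) \<Rightarrow> bool" where
  "ab_seq f \<longleftrightarrow> (\<forall>i\<ge>1. 2 * i - 1 \<le> f i \<and> f i \<le> 2 * i)"

lemma ab_seq: "ab_seq a_seq" "ab_seq b_seq"
  by (auto simp: ab_seq_def a_seq_def b_seq_def)

lemma ab_seq_less: "ab_seq f \<Longrightarrow> 1 \<le> i \<Longrightarrow> i < j \<Longrightarrow> f i < f j"
proof -
  assume a: "ab_seq f" "1 \<le> i" "i < j"
  then have "f i \<le> 2 * i" "2 * j - 1 \<le> f j" by (auto simp: ab_seq_def)
  then show ?thesis using a(3) by linarith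
qed

lemma ab_seq_inj: "ab_seq f \<Longrightarrow> inj_on f {1..n}"
  by (rule linorder_inj_onI') (use ab_seq_less in fastforce)

lemma Tarr_arrays: "dwt n r \<mu> \<Longrightarrow> ab_seq f \<Longrightarrow> Tarr n f \<mu> \<in> arrays n r"
proof -
  assume d: "dwt n r \<mu>" and f: "ab_seq f"
  have "j < r \<and> 1 \<le> f i \<and> f i \<le> 2 * n" if "i \<in> {1..n}" "j < \<mu> i" for i j
  proof -
    have "\<mu> i \<le> r" "2 * i - 1 \<le> f i" "f i \<le> 2 * i" using d f that(1) by (auto simp: dwt_def ab_seq_def split: if_splits)
    then show ?thesis using that by auto
  qed
  then show ?thesis unfolding arrays_iff Tarr_def by blast
qed

lemma card_Tarr: "ab_seq f \<Longrightarrow> card (Tarr n f \<mu> j) = card {i \<in> {1..n}. j < \<mu> i}"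
  unfolding Tarr_def by (rule card_image, rule inj_on_subset[OF ab_seq_inj]) auto

lemma Tarr_high:
  assumes "dwt n r \<mu>" "ab_seq f"
  shows "ahigh n r (Tarr n f \<mu>)"
proof -
  have fin: "finite (Tarr n f \<mu> j)" for j by (simp add: Tarr_def)
  have "sst (Tarr n f \<mu>)"
  proof -
    have "Tarr n f \<mu> (Suc j) \<subseteq> Tarr n f \<mu> j" for j by (auto simp: Tarr_def)
    then show ?thesis unfolding sst_def cnt_def by (intro allI card_mono) (auto simp: fin)
  qed
  moreover have "king n (Tarr n f \<mu>)" unfolding king_def cnt_def
  proof (intro allI impI)
    fix m
    have "{q \<in> Tarr n f \<mu> 0. q \<le> 2 * m} \<subseteq> f ` {1..m}"
    proof
      fix q assume "q \<in> {q \<in> Tarr n f \<mu> 0. q \<le> 2 * m}"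
      then obtain i where i: "i \<in> {1..n}" "q = f i" "q \<le> 2 * m" by (auto simp: Tarr_def)
      then have "2 * i - 1 \<le> q" using assms(2) by (auto simp: ab_seq_def)
      then have "i \<le> m" using i(3) by linarith
      then show "q \<in> f ` {1..m}" using i by auto
    qed
    then have "card {q \<in> Tarr n f \<mu> 0. q \<le> 2 * m} \<le> card (f ` {1..m})" by (intro card_mono) auto
    also have "\<dots> \<le> m" using card_image_le[of "{1..m}" f] by simp
    finally show "card {q \<in> Tarr n f \<mu> 0. q \<le> 2 * m} \<le> m" .
  qed
  ultimately show ?thesis using ahigh_iff[OF Tarr_arrays[OF assms]] by blast
qed

lemma dwt_initial:
  assumes "dwt n r \<mu>"
  shows "{i \<in> {1..n}. j < \<mu> i} = {1..card {i \<in> {1..n}. j < \<mu> i}}"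
proof -
  have "k < card {i. 1 \<le> Suc i \<and> Suc i \<le> n \<and> j < \<mu> (Suc i)} \<longleftrightarrow> 1 \<le> Suc k \<and> Suc k \<le> n \<and> j < \<mu> (Suc k)" for k
  proof (rule card_initial)
    show "finite {i. 1 \<le> Suc i \<and> Suc i \<le> n \<and> j < \<mu> (Suc i)}" by (rule finite_subset[of _ "{..n}"]) auto
    fix i i' assume "1 \<le> Suc i' \<and> Suc i' \<le> n \<and> j < \<mu> (Suc i')" "i \<le> i'"
    moreover from this have "\<mu> (Suc i') \<le> \<mu> (Suc i)" using assms by (simp add: dwt_def)
    ultimately show "1 \<le> Suc i \<and> Suc i \<le> n \<and> j < \<mu> (Suc i)" by auto
  qed
  moreover have "card {i. 1 \<le> Suc i \<and> Suc i \<le> n \<and> j < \<mu> (Suc i)} = card {i \<in> {1..n}. j < \<mu> i}"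
  proof (rule bij_betw_same_card[of Suc])
    show "bij_betw Suc {i. 1 \<le> Suc i \<and> Suc i \<le> n \<and> j < \<mu> (Suc i)} {i \<in> {1..n}. j < \<mu> i}"
      by (rule bij_betwI[of _ _ _ "\<lambda>i. i - 1"]) auto
  qed
  ultimately have k: "k < card {i \<in> {1..n}. j < \<mu> i} \<longleftrightarrow> Suc k \<le> n \<and> j < \<mu> (Suc k)" for k by simp
  show ?thesis
  proof (intro Set.set_eqI)
    fix i
    show "i \<in> {i \<in> {1..n}. j < \<mu> i} \<longleftrightarrow> i \<in> {1..card {i \<in> {1..n}. j < \<mu> i}}"
      using k[of "i - 1"] by (cases i) auto
  qed
qed

lemma rows_const_iff:
  assumes T: "tabl n T" "length T \<le> r" and f: "ab_seq f"
  shows "rows_const n f T \<longleftrightarrow> (\<exists>\<mu>. dwt n r \<mu> \<and> tab_arr T = Tarr n f \<mu>)"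
proof
  assume rc: "rows_const n f T"
  \<comment> \<open>The length of row \<open>i\<close>, with the rows counted from 1.\<close>
  define \<mu> where "\<mu> i = (if 1 \<le> i \<and> i \<le> n then card {j. j < length T \<and> i \<le> length (T ! j)} else 0)" for i
  have s: "\<forall>c\<in>set T. sorted_wrt (<) c" using T(1) by (simp add: tabl_def col_ok_def)
  have dec: "length (T ! Suc j) \<le> length (T ! j)" if "Suc j < length T" for j
    using T(1) that unfolding tabl_def sst_tab_iff[OF s] by blast
  have dec': "length (T ! j) \<le> length (T ! i)" if "i \<le> j" "j < length T" for i j
    using that
  proof (induction j rule: dec_induct)
    case (step k)
    then show ?case using dec[of k] by simp
  qed simp
  have \<mu>: "j < \<mu> i \<longleftrightarrow> j < length T \<and> i \<le> length (T ! j)" if "1 \<le> i" "i \<le> n" for i j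
  proof -
    have "j < card {j. j < length T \<and> i \<le> length (T ! j)} \<longleftrightarrow> j < length T \<and> i \<le> length (T ! j)"
      by (rule card_initial) (use dec' in \<open>auto intro: le_trans\<close>)
    then show ?thesis using that by (simp add: \<mu>_def)
  qed
  have "dwt n r \<mu>"
  proof -
    have "card {j. j < length T \<and> i \<le> length (T ! j)} \<le> card {..<length T}" for i by (intro card_mono) auto
    then have "\<mu> i \<le> (if 1 \<le> i \<and> i \<le> n then r else 0)" for i
      using T(2) by (auto simp: \<mu>_def intro: le_trans)
    moreover have "\<mu> j \<le> \<mu> i" if "1 \<le> i" "i \<le> j" for i j
    proof (cases "j \<le> n")
      case True
      then show ?thesis using that by (auto simp: \<mu>_def intro!: card_mono)
    qed (simp add: \<mu>_def)
    ultimately show ?thesis by (auto simp: dwt_def)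
  qed
  moreover have "tab_arr T = Tarr n f \<mu>"
  proof
    fix j
    show "tab_arr T j = Tarr n f \<mu> j"
    proof (cases "j < length T")
      case True
      then have c: "length (T ! j) \<le> n" "\<forall>k\<in>{1..length (T ! j)}. (T ! j) ! (k - 1) = f k"
        using rc unfolding rows_const_def by auto
      have "set (T ! j) = (\<lambda>k. T ! j ! (k - 1)) ` {1..length (T ! j)}"
      proof -
        have "{1..length (T ! j)} = Suc ` {..<length (T ! j)}" by (auto simp: image_iff Bex_def gr0_conv_Suc Suc_le_eq)
        then show ?thesis by (auto simp: image_image set_conv_nth)
      qed
      also have "\<dots> = f ` {1..length (T ! j)}" using c(2) by (intro image_cong) auto
      also have "{1..length (T ! j)} = {i \<in> {1..n}. j < \<mu> i}" using \<mu>[of _ j] c(1) True by auto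
      finally show ?thesis using True by (simp add: tab_arr_def Tarr_def)
    next
      case False
      then show ?thesis using \<mu> by (auto simp: tab_arr_def Tarr_def)
    qed
  qed
  ultimately show "\<exists>\<mu>. dwt n r \<mu> \<and> tab_arr T = Tarr n f \<mu>" by blast
next
  assume "\<exists>\<mu>. dwt n r \<mu> \<and> tab_arr T = Tarr n f \<mu>"
  then obtain \<mu> where \<mu>: "dwt n r \<mu>" "tab_arr T = Tarr n f \<mu>" by blast
  show "rows_const n f T" unfolding rows_const_def
  proof (intro ballI conjI)
    fix c assume c: "c \<in> set T"
    then obtain j where j: "j < length T" "T ! j = c" by (auto simp: in_set_conv_nth)
    define L where "L = card {i \<in> {1..n}. j < \<mu> i}"
    have L: "L \<le> n"
    proof -
      have "L \<le> card {1..n}" unfolding L_def by (intro card_mono) auto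
      then show ?thesis by simp
    qed
    have "set c = f ` {1..L}"
      using fun_cong[OF \<mu>(2), of j] j dwt_initial[OF \<mu>(1), of j] by (simp add: tab_arr_def Tarr_def L_def)
    also have "{1..L} = set [1..<Suc L]" by auto
    finally have "set c = set (map f [1..<Suc L])" by simp
    moreover have "sorted_wrt (<) c" using T(1) c by (simp add: tabl_def col_ok_def)
    moreover have "sorted_wrt (<) (map f [1..<Suc L])"
      unfolding sorted_wrt_map by (rule sorted_wrt_mono_rel[of _ "(<)"]) (use ab_seq_less[OF f] sorted_wrt_upt in \<open>simp_all del: upt_Suc\<close>)
    ultimately have cm: "c = map f [1..<Suc L]" using strict_sorted_equal by metis
    show "length c \<le> n" using L by (simp add: cm del: upt_Suc)
    fix k assume k: "k \<in> {1..length c}"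
    then have k': "1 \<le> k" "k \<le> L" by (simp_all add: cm del: upt_Suc)
    then have "[1..<Suc L] ! (k - 1) = k" by (subst nth_upt) auto
    moreover have "k - 1 < length [1..<Suc L]" using k' by (simp del: upt_Suc)
    ultimately show "c ! (k - 1) = f k" unfolding cm by (simp only: nth_map)
  qed
qed

definition kw :: "nat \<Rightarrow> array \<Rightarrow> nat \<Rightarrow> int" where
  "kw r M i = int (letter_count r M (a_seq i)) - int (letter_count r M (b_seq i))"

text \<open>a_i is 2i for odd i and 2i - 1 for even i, so the weight for k is, up to signs, the
  invariant \<open>ew\<close> of the crystal.\<close>

lemma kw_ew: "kw r M i = (if odd i then ew r M i else - ew r M i)"
  by (simp add: kw_def ew_def a_seq_def b_seq_def)

lemma letter_count_Tarr:
  assumes "dwt n r \<mu>" "ab_seq f" "1 \<le> i" "i \<le> n"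
  shows "letter_count r (Tarr n f \<mu>) (f i) = \<mu> i"
proof -
  have "f i \<in> Tarr n f \<mu> j \<longleftrightarrow> j < \<mu> i" for j
    using ab_seq_inj[OF assms(2), of n] assms(3,4) by (auto simp: Tarr_def dest: inj_onD)
  then have "letter_count r (Tarr n f \<mu>) (f i) = card {j. j < r \<and> j < \<mu> i}"
    by (simp add: letter_count_def of_bool_def sum.If_cases lessThan_def Collect_conj_eq)
  also have "{j. j < r \<and> j < \<mu> i} = {..<\<mu> i}"
  proof -
    have "\<mu> i \<le> r" using assms(1,3,4) unfolding dwt_def by metis
    then show ?thesis by auto
  qed
  finally show ?thesis by simp
qed

lemma letter_count_Tarr_0: "q \<notin> f ` {1..n} \<Longrightarrow> letter_count r (Tarr n f \<mu>) q = 0"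
  by (auto simp: letter_count_def Tarr_def)

lemma a_seq_ne_b_seq:
  assumes "1 \<le> i" "1 \<le> j"
  shows "a_seq i \<noteq> b_seq j"
  using assms by (cases "even i"; cases "even j") (auto simp: a_seq_def b_seq_def elim!: evenE oddE, presburger+)

lemma kw_Tarr:
  assumes "dwt n r \<mu>" "1 \<le> i" "i \<le> n"
  shows "kw r (Tarr n a_seq \<mu>) i = int (\<mu> i)" "kw r (Tarr n b_seq \<mu>) i = - int (\<mu> i)"
proof -
  have "b_seq i \<notin> a_seq ` {1..n}" "a_seq i \<notin> b_seq ` {1..n}"
    using a_seq_ne_b_seq[of _ i] a_seq_ne_b_seq[of i] assms(2) unfolding image_iff by (metis atLeastAtMost_iff)+
  then show "kw r (Tarr n a_seq \<mu>) i = int (\<mu> i)" "kw r (Tarr n b_seq \<mu>) i = - int (\<mu> i)"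
    unfolding kw_def using letter_count_Tarr[OF assms(1) _ assms(2,3)] ab_seq letter_count_Tarr_0 by auto
qed

lemma kw_aconn: "aconn n r M N \<Longrightarrow> kw r N = kw r M"
  by (auto simp: kw_ew aconn_ew fun_eq_iff)

text \<open>All chains of operators from one array to a highest array end at the same place, so the
  particular chain taken by \<open>suc\<close> is immaterial.\<close>

lemma P_AII_unique:
  assumes T: "tabl n T" "length T \<le> r" and U: "areach n r (tab_arr T) U" "ahigh n r U"
  shows "tab_arr (P_AII T) = U"
proof -
  note P = P_AII_props[OF T]
  have A: "tab_arr T \<in> arrays n r" using T by (auto intro: tab_arr_arrays simp: tabl_def)
  have A': "tab_arr (P_AII T) \<in> arrays n r" using areach_arrays[OF P(4) A] .
  have "ahigh n r (tab_arr (P_AII T))" using P(1,3) ahigh_iff[OF A'] by (simp add: tabl_def)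
  moreover have "aconn n r (tab_arr (P_AII T)) U"
    using P(4) U(1) apath_aconn aconn_sym aconn_trans unfolding areach_def by blast
  ultimately show ?thesis using ahigh_unique A' U(2) by blast
qed

lemma wt_k_kw:
  assumes T: "tabl n T" "length T \<le> r"
  shows "wt_k n T i = (if 1 \<le> i \<and> i \<le> n then of_int (kw r (tab_arr T) i) else 0)"
  using entry_count_letter_count[of T r] T by (simp add: wt_k_def kw_def tabl_def col_ok_def)

lemma card_bij_restrict:
  assumes b: "bij_betw f A B" and PQ: "\<And>a. a \<in> A \<Longrightarrow> P a \<longleftrightarrow> Q (f a)"
  shows "card {a \<in> A. P a} = card {b \<in> B. Q b}"
proof (rule bij_betw_same_card[of f])
  have "inj_on f {a \<in> A. P a}" by (rule inj_on_subset[OF bij_betw_imp_inj_on[OF b]]) auto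
  moreover have "f ` {a \<in> A. P a} = {b \<in> B. Q b}"
    using bij_betw_imp_surj_on[OF b] PQ by blast
  ultimately show "bij_betw f {a \<in> A. P a} {b \<in> B. Q b}" by (simp add: bij_betw_def)
qed

text \<open>The sign \<sigma> is 1 for highest and -1 for lowest weight tableaux, so that \<sigma>
  times the weight is dominant in both cases.\<close>

context
  fixes n r :: nat and lam :: "nat list" and f :: "nat \<Rightarrow> nat" and \<sigma> :: int
  assumes lam: "is_partition lam" and r: "\<And>j. r \<le> j \<Longrightarrow> conj_part lam j = 0"
    and f: "ab_seq f" and \<sigma>: "\<sigma> * \<sigma> = 1"
    and kwf: "\<And>\<mu> i. dwt n r \<mu> \<Longrightarrow> 1 \<le> i \<Longrightarrow> i \<le> n \<Longrightarrow> kw r (Tarr n f \<mu>) i = \<sigma> * int (\<mu> i)"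
begin

lemma SST_props:
  assumes "T \<in> SST (2 * n) lam"
  shows "tabl n T" "length T \<le> r"
proof -
  show t: "tabl n T" using assms SST_tabl_iff[OF lam] by blast
  have "tab_arr T \<in> arrays n r" using bij_betw_SST_SA[where r = r and n = n, OF lam r] assms unfolding bij_betw_def SA_def by blast
  then show "length T \<le> r" using length_le_if_arrays[OF t] by blast
qed

lemma const_rows_weight:
  assumes S: "S \<in> SST (2 * n) lam" and rc: "rows_const n f (P_AII S)"
  obtains \<mu> where "dwt n r \<mu>" "(\<lambda>i. of_int \<sigma> * wt_k n S i) = (\<lambda>i. real (\<mu> i))" "tab_arr (P_AII S) = Tarr n f \<mu>"
proof -
  note t = SST_props[OF S]
  note P = P_AII_props[OF t]
  obtain \<mu> where \<mu>: "dwt n r \<mu>" "tab_arr (P_AII S) = Tarr n f \<mu>" using rows_const_iff[OF P(1,2) f] rc by blast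
  have k: "kw r (tab_arr S) i = kw r (Tarr n f \<mu>) i" for i
    using kw_aconn[of n r "tab_arr S"] P(4) apath_aconn \<mu>(2) unfolding areach_def by metis
  have "of_int \<sigma> * wt_k n S i = real (\<mu> i)" for i
  proof (cases "1 \<le> i \<and> i \<le> n")
    case True
    then have "of_int \<sigma> * wt_k n S i = of_int (\<sigma> * (\<sigma> * int (\<mu> i)))"
      by (simp only: wt_k_kw[OF t] k kwf[OF \<mu>(1)] if_True of_int_mult simp_thms)
    also have "\<sigma> * (\<sigma> * int (\<mu> i)) = int (\<mu> i)" using \<sigma> by (simp only: mult.assoc[symmetric] mult_1)
    finally show ?thesis by simp
  next
    case False
    then have "\<mu> i \<le> 0" using \<mu>(1) unfolding dwt_def by metis
    moreover have "wt_k n S i = 0" unfolding wt_k_kw[OF t] using False by (rule if_not_P)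
    ultimately show ?thesis by simp
  qed
  then show ?thesis using that \<mu> by blast
qed

text \<open>By uniqueness of highest elements, ending in \<open>Tarr n f \<mu>\<close> under
  \<open>P_AII\<close> is the same as reaching it by operators. The weight, constant on the way, in
  turn determines \<mu>.\<close>

lemma card_const_rows:
  assumes \<mu>: "dwt n r \<mu>"
  shows "card {S \<in> SST (2 * n) lam. rows_const n f (P_AII S) \<and> (\<lambda>i. of_int \<sigma> * wt_k n S i) = (\<lambda>i. real (\<mu> i))}
    = card (fibre n r (conj_part lam) (Tarr n f \<mu>))"
proof -
  let ?F = "fibre n r (conj_part lam) (Tarr n f \<mu>)" and ?SA = "SA n r (conj_part lam)"
  have bij: "bij_betw tab_arr (SST (2 * n) lam) ?SA" by (rule bij_betw_SST_SA[where r = r, OF lam r])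
  have "rows_const n f (P_AII S) \<and> (\<lambda>i. of_int \<sigma> * wt_k n S i) = (\<lambda>i. real (\<mu> i)) \<longleftrightarrow> tab_arr S \<in> ?F"
    if S: "S \<in> SST (2 * n) lam" for S
  proof -
    note t = SST_props[OF S]
    note P = P_AII_props[OF t]
    have A: "tab_arr S \<in> ?SA" using bij S unfolding bij_betw_def by blast
    then have "tab_arr S \<in> ?F \<longleftrightarrow> areach n r (tab_arr S) (Tarr n f \<mu>)"
      using glhigh_iff_sst unfolding fibre_def SA_def areach_def by blast
    also have "\<dots> \<longleftrightarrow> tab_arr (P_AII S) = Tarr n f \<mu>"
      using P_AII_unique[OF t _ Tarr_high[OF \<mu> f]] P(4) by metis
    also have "\<dots> \<longleftrightarrow> rows_const n f (P_AII S) \<and> (\<lambda>i. of_int \<sigma> * wt_k n S i) = (\<lambda>i. real (\<mu> i))"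
    proof
      assume e: "tab_arr (P_AII S) = Tarr n f \<mu>"
      then have rc: "rows_const n f (P_AII S)" using rows_const_iff[OF P(1,2) f] \<mu> by blast
      obtain \<nu> where \<nu>: "dwt n r \<nu>" "(\<lambda>i. of_int \<sigma> * wt_k n S i) = (\<lambda>i. real (\<nu> i))" "tab_arr (P_AII S) = Tarr n f \<nu>"
        using const_rows_weight[OF S rc] by blast
      have "\<nu> i = \<mu> i" for i
      proof (cases "1 \<le> i \<and> i \<le> n")
        case True
        then show ?thesis using letter_count_Tarr[OF \<mu> f, of i] letter_count_Tarr[OF \<nu>(1) f, of i] e \<nu>(3) by simp
      next
        case False
        then have "\<mu> i \<le> 0" "\<nu> i \<le> 0" using \<mu> \<nu>(1) unfolding dwt_def by metis+
        then show ?thesis by simp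
      qed
      then show "rows_const n f (P_AII S) \<and> (\<lambda>i. of_int \<sigma> * wt_k n S i) = (\<lambda>i. real (\<mu> i))" using \<nu> rc by simp
    next
      assume X: "rows_const n f (P_AII S) \<and> (\<lambda>i. of_int \<sigma> * wt_k n S i) = (\<lambda>i. real (\<mu> i))"
      then obtain \<nu> where \<nu>: "dwt n r \<nu>" "(\<lambda>i. of_int \<sigma> * wt_k n S i) = (\<lambda>i. real (\<nu> i))" "tab_arr (P_AII S) = Tarr n f \<nu>"
        using const_rows_weight[OF S] by blast
      then have "\<nu> = \<mu>" using X by (simp add: fun_eq_iff)
      then show "tab_arr (P_AII S) = Tarr n f \<mu>" using \<nu> by simp
    qed
    finally show ?thesis by simp
  qed
  moreover have "{M \<in> ?SA. M \<in> ?F} = ?F" using glhigh_iff_sst unfolding fibre_def SA_def by blast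
  ultimately show ?thesis using card_bij_restrict[OF bij, of "\<lambda>S. rows_const n f (P_AII S) \<and> (\<lambda>i. of_int \<sigma> * wt_k n S i) = (\<lambda>i. real (\<mu> i))" "\<lambda>M. M \<in> ?F"] by simp
qed

end

section \<open>Sums over all arrays\<close>

lemma arrays_finite_col: "M \<in> arrays n r \<Longrightarrow> finite (M j)"
  unfolding arrays_iff by (rule finite_subset[of _ "{1..2 * n}"]) auto

lemma cnt_split: "finite (M j) \<Longrightarrow> card (M j) = cnt M j p + card {q \<in> M j. p < q}"
proof -
  assume f: "finite (M j)"
  have "M j = {q \<in> M j. q \<le> p} \<union> {q \<in> M j. p < q}" by auto
  then have "card (M j) = card ({q \<in> M j. q \<le> p} \<union> {q \<in> M j. p < q})" by simp
  also have "\<dots> = card {q \<in> M j. q \<le> p} + card {q \<in> M j. p < q}"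
    using f by (intro card_Un_disjoint) auto
  finally show ?thesis by (simp add: cnt_def)
qed

lemma card_tswap:
  assumes M: "M \<in> arrays n r" and c: "cnt M (Suc j) p = Suc (cnt M j p)"
  shows "Suc (card (tswap j p M j)) = card (M (Suc j))" "card (tswap j p M (Suc j)) = Suc (card (M j))"
proof -
  have f: "finite (M k)" for k by (rule arrays_finite_col[OF M])
  have "card (tswap j p M j) = card {q \<in> M j. q \<le> p} + card {q \<in> M (Suc j). p < q}"
    unfolding tswap_def using f by (simp, subst card_Un_disjoint) auto
  then show "Suc (card (tswap j p M j)) = card (M (Suc j))"
    using c cnt_split[of M "Suc j" p, OF f] by (simp add: cnt_def)
  have "card (tswap j p M (Suc j)) = card {q \<in> M (Suc j). q \<le> p} + card {q \<in> M j. p < q}"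
    unfolding tswap_def using f by (simp, subst card_Un_disjoint) auto
  then show "card (tswap j p M (Suc j)) = Suc (card (M j))"
    using c cnt_split[of M j p, OF f] by (simp add: cnt_def)
qed

lemma card_tflip:
  assumes M: "M \<in> arrays n r" and c: "cnt M 0 (2 * m) = Suc m" and m: "m \<le> n"
  shows "card (tflip n m M 0) + card (M 0) = 2 * n + 2"
proof -
  have f: "finite (M 0)" by (rule arrays_finite_col[OF M])
  let ?B = "{2 * m + 1..2 * n}" and ?X = "{q \<in> M 0. 2 * m < q}"
  have XB: "?X \<subseteq> ?B" using arrays_bd[OF M] by fastforce
  have "{q \<in> ?B. mate q \<notin> M 0} = mate ` (?B - ?X)"
  proof (intro Set.set_eqI iffI)
    fix q assume q: "q \<in> {q \<in> ?B. mate q \<notin> M 0}"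
    then have "mate q \<in> ?B - ?X" "q = mate (mate q)" using mate_range[of m q n] mate_mate[of q] by auto
    then show "q \<in> mate ` (?B - ?X)" by blast
  next
    fix q assume "q \<in> mate ` (?B - ?X)"
    then obtain s where s: "s \<in> ?B" "s \<notin> ?X" "q = mate s" by blast
    then show "q \<in> {q \<in> ?B. mate q \<notin> M 0}" using mate_range[of m s n] mate_mate[of s] by auto
  qed
  moreover have "inj_on mate (?B - ?X)"
    by (rule inj_on_inverseI[of _ mate]) (use mate_mate in auto)
  ultimately have "card {q \<in> ?B. mate q \<notin> M 0} = card (?B - ?X)" by (simp add: card_image)
  also have "\<dots> = card ?B - card ?X" using XB by (intro card_Diff_subset) (auto intro: finite_subset)
  finally have k: "card {q \<in> ?B. mate q \<notin> M 0} = card ?B - card ?X" .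
  have "card ?X \<le> card ?B" using XB by (intro card_mono) auto
  moreover have "card (tflip n m M 0) = card {q \<in> M 0. q \<le> 2 * m} + card {q \<in> ?B. mate q \<notin> M 0}"
    unfolding tflip_def using f by (simp only: fun_upd_same, subst card_Un_disjoint) auto
  ultimately show ?thesis using k c m cnt_split[of M 0 "2 * m", OF f] by (simp add: cnt_def)
qed

lemma letter_count_tswap:
  assumes "Suc j < r"
  shows "letter_count r (tswap j p M) q = letter_count r M q"
proof (cases "q \<le> p")
  case True
  then show ?thesis unfolding letter_count_def tswap_def by (intro sum.cong) auto
next
  case False
  then have "letter_count r (tswap j p M) q = (\<Sum>x<r. (\<lambda>x. of_bool (q \<in> M x)) (if x = j then Suc j else if x = Suc j then j else x))"
    unfolding letter_count_def tswap_def by (intro sum.cong) auto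
  also have "\<dots> = letter_count r M q"
    unfolding letter_count_def by (rule sum_transpose_Suc[OF assms(1)])
  finally show ?thesis .
qed

lemma ew_tflip:
  assumes "0 < r" "m \<le> n" "1 \<le> t" "t \<le> n"
  shows "ew r (tflip n m M) t = ew r M t"
proof -
  have s: "(\<Sum>j\<in>{1..<r}. of_bool (q \<in> tflip n m M j)) = (\<Sum>j\<in>{1..<r}. of_bool (q \<in> M j) :: nat)" for q
    unfolding tflip_def by (intro sum.cong) auto
  have mt: "mate (2 * t) = 2 * t - 1" "mate (2 * t - 1) = 2 * t" using assms(3) by (auto simp: mate_def)
  have "2 * t \<in> tflip n m M 0 \<longleftrightarrow> (if t \<le> m then 2 * t \<in> M 0 else 2 * t - 1 \<notin> M 0)"
    using assms(3,4) by (auto simp: tflip_def mt)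
  moreover have "2 * t - 1 \<in> tflip n m M 0 \<longleftrightarrow> (if t \<le> m then 2 * t - 1 \<in> M 0 else 2 * t \<notin> M 0)"
  proof -
    have "2 * t - 1 \<le> 2 * m \<longleftrightarrow> t \<le> m" "2 * t - 1 \<in> {2 * m + 1..2 * n} \<longleftrightarrow> m < t"
      using assms(3,4) unfolding atLeastAtMost_iff by presburger+
    then show ?thesis using mt(2) unfolding tflip_def by auto
  qed
  ultimately show ?thesis unfolding ew_def letter_count_head[OF assms(1)] s by (auto simp: of_bool_def)
qed

lemma sst_card_decreasing: "M \<in> arrays n r \<Longrightarrow> sst M \<Longrightarrow> card (M (Suc j)) \<le> card (M j)"
  using cnt_beyond[of M n r "2 * n"] unfolding sst_def by (metis le_refl)

lemma strict_of_Suc: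
  fixes v :: "nat \<Rightarrow> int"
  assumes s: "\<And>j. Suc j < r \<Longrightarrow> v j < v (Suc j)" and "i < j" "j < r"
  shows "v i < v j"
  using assms(2,3)
proof (induction j)
  case (Suc j)
  then show ?case using s[of j] by (cases "i = j") auto
qed simp

text \<open>Heights shifted so that \<open>tswap\<close> at an excess of one, which turns heights
  (a, b) into (b - 1, a + 1), simply exchanges two values.\<close>

definition cgap :: "(nat \<Rightarrow> nat) \<Rightarrow> nat \<Rightarrow> int" where
  "cgap k j = int j - int (k j)"

lemma cgap_strict:
  assumes k: "\<And>j. Suc j < r \<Longrightarrow> k (Suc j) \<le> k j" and ij: "i < j" "j < r"
  shows "cgap k i < cgap k j"
proof (rule strict_of_Suc[OF _ ij])
  fix j assume "Suc j < r"
  then have "k (Suc j) \<le> k j" by (rule k)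
  then show "cgap k j < cgap k (Suc j)" by (simp add: cgap_def)
qed

lemma delta_swap:
  assumes M: "M \<in> arrays n r" and j: "Suc j < r" and c: "cnt M (Suc j) p = Suc (cnt M j p)"
  shows "Dl s {..<r} t (\<lambda>i. cgap (\<lambda>l. card (tswap j p M l)) i + d) = - Dl s {..<r} t (\<lambda>i. cgap (\<lambda>j. card (M j)) i + d)"
proof -
  have e: "cgap (\<lambda>l. card (tswap j p M l)) i + d = cgap (\<lambda>j. card (M j)) (transpose j (Suc j) i) + d" for i
  proof -
    consider "i = j" | "i = Suc j" | "i \<noteq> j" "i \<noteq> Suc j" by blast
    then show ?thesis using card_tswap[OF M c]
      by cases (auto simp: cgap_def transpose_def, simp add: tswap_def)
  qed
  have "Dl s {..<r} t (\<lambda>i. cgap (\<lambda>j. card (M j)) (transpose j (Suc j) i) + d) = - Dl s {..<r} t (\<lambda>i. cgap (\<lambda>j. card (M j)) i + d)"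
    using Dl_swap[of "{..<r}" j "Suc j" s t "\<lambda>i. cgap (\<lambda>j. card (M j)) i + d"] j by auto
  then show ?thesis unfolding e .
qed

lemma arrays_card_eq_iff:
  assumes "M \<in> arrays n r" "\<And>j. r \<le> j \<Longrightarrow> k j = 0"
  shows "(\<forall>i\<in>{..<r}. card (M i) = k i) \<longleftrightarrow> (\<forall>j. card (M j) = k j)"
proof
  assume a: "\<forall>i\<in>{..<r}. card (M i) = k i"
  show "\<forall>j. card (M j) = k j"
  proof
    fix j
    show "card (M j) = k j" using a assms by (cases "j < r") (auto simp: arrays_def)
  qed
qed simp

lemma sum_of_bool_mult:
  fixes H :: "'a \<Rightarrow> int"
  assumes "finite A"
  shows "(\<Sum>x\<in>A. of_bool (P x) * H x) = (\<Sum>x\<in>{x \<in> A. P x}. H x)"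
proof -
  have "(\<Sum>x\<in>A. of_bool (P x) * H x) = (\<Sum>x\<in>A. if P x then H x else 0)" by (intro sum.cong) auto
  then show ?thesis by (simp add: sum.inter_filter[OF assms])
qed

definition KA :: "nat \<Rightarrow> nat \<Rightarrow> (nat \<Rightarrow> nat) \<Rightarrow> array set" where
  "KA n r k = {M \<in> SA n r k. king n M}"

text \<open>The further shift turns \<open>tflip\<close>, which replaces the height h of column 0 by
  2n + 2 - h, into a change of sign.\<close>

definition ugap :: "nat \<Rightarrow> (nat \<Rightarrow> nat) \<Rightarrow> nat \<Rightarrow> int" where
  "ugap n k j = cgap k j + (int n + 1)"

text \<open>The factor in the heights changes sign under both tail moves while \<open>H\<close> is
  invariant, so only semistandard (and, if \<open>b\<close>, symplectic) arrays remain. On these the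
  shifted heights are strictly increasing, and the factor is the indicator of the heights
  \<open>k\<close>. The flag \<open>b\<close> chooses between type A and type C.\<close>

lemma sum_arrays_delta:
  fixes b :: bool
  assumes k: "\<And>j. Suc j < r \<Longrightarrow> k (Suc j) \<le> k j" "\<And>j. r \<le> j \<Longrightarrow> k j = 0" "\<And>j. b \<Longrightarrow> k j \<le> n"
    and H: "\<And>M j p. M \<in> arrays n r \<Longrightarrow> Suc j < r \<Longrightarrow> H (tswap j p M) = H M"
      "\<And>M m. b \<Longrightarrow> M \<in> arrays n r \<Longrightarrow> 0 < r \<Longrightarrow> m \<le> n \<Longrightarrow> H (tflip n m M) = H M"
    and d: "d = (if b then int n + 1 else 0)"
  shows "(\<Sum>M\<in>arrays n r. Dl (of_bool b) {..<r} (\<lambda>j. cgap k j + d) (\<lambda>j. cgap (\<lambda>j. card (M j)) j + d) * H M)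
    = (\<Sum>M\<in>{M \<in> SA n r k. b \<longrightarrow> king n M}. H M)"
proof -
  let ?u = "\<lambda>M j. cgap (\<lambda>j. card (M j)) j + d" and ?v = "\<lambda>j. cgap k j + d"
  let ?D = "\<lambda>M. Dl (of_bool b) {..<r} ?v (?u M)" and ?K = "{M \<in> arrays n r. sst M \<and> (b \<longrightarrow> king n M)}"
  have "(\<Sum>M\<in>arrays n r. ?D M * H M) = (\<Sum>M\<in>?K. ?D M * H M)"
  proof (rule sum_arrays_tail_reflection)
    fix M j p assume M: "M \<in> arrays n r" "Suc j < r" "cnt M (Suc j) p = Suc (cnt M j p)"
    show "?D (tswap j p M) * H (tswap j p M) = - (?D M * H M)"
      using delta_swap[OF M, of "of_bool b" ?v d] H(1)[OF M(1,2)] by simp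
  next
    fix M m assume b: b and M: "M \<in> arrays n r" "0 < r" "m \<le> n" "cnt M 0 (2 * m) = Suc m"
    have "?u (tflip n m M) = (?u M)(0 := - ?u M 0)"
    proof
      fix i
      show "?u (tflip n m M) i = ((?u M)(0 := - ?u M 0)) i"
        using card_tflip[OF M(1,4,3)] b d by (cases "i = 0") (auto simp: cgap_def tflip_def)
    qed
    then show "?D (tflip n m M) * H (tflip n m M) = - (?D M * H M)"
      using Dl_neg[of "{..<r}" 0 ?v "?u M"] b M(2) H(2)[OF b M(1-3)] by simp
  qed
  also have "\<dots> = (\<Sum>M\<in>?K. of_bool (\<forall>j. card (M j) = k j) * H M)"
  proof (rule sum.cong[OF refl])
    fix M assume "M \<in> ?K"
    then have M: "M \<in> arrays n r" "sst M" "b \<Longrightarrow> king n M" by auto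
    have dec: "card (M j) \<le> card (M i)" if "i \<le> j" for i j
      by (rule lift_Suc_antimono_le[of "\<lambda>j. card (M j)", OF _ that]) (rule sst_card_decreasing[OF M(1,2)])
    have n: "card (M j) \<le> n" if b for j
      using M(3)[OF that] cnt_beyond[OF M(1), of "2 * n" 0] dec[of 0 j] by (force simp: king_def)
    have "?D M = of_bool (\<forall>i\<in>{..<r}. ?u M i = ?v i)"
    proof (rule Dl_strict)
      fix i j assume ij: "i \<in> {..<r}" "j \<in> {..<r}" "i < j"
      show "?u M i < ?u M j" using dec[of i j] ij(3) by (simp add: cgap_def)
      show "?v i < ?v j" using cgap_strict[of r k i j] ij k(1) by simp
    next
      have "0 < ?u M i \<and> 0 < ?v i" if b for i
        using n[OF that, of i] k(3)[OF that, of i] that d by (simp add: cgap_def)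
      then show "of_bool b = (0::int) \<or> (\<forall>i\<in>{..<r}. 0 < ?u M i \<and> 0 < ?v i)" by (cases b) auto
    qed simp
    also have "(\<forall>i\<in>{..<r}. ?u M i = ?v i) \<longleftrightarrow> (\<forall>j. card (M j) = k j)"
      using arrays_card_eq_iff[of M n r k] k(2) M(1) by (simp add: cgap_def)
    finally show "?D M * H M = of_bool (\<forall>j. card (M j) = k j) * H M" by simp
  qed
  also have "\<dots> = (\<Sum>M\<in>{M \<in> ?K. \<forall>j. card (M j) = k j}. H M)"
    by (rule sum_of_bool_mult) (simp add: finite_arrays)
  also have "{M \<in> ?K. \<forall>j. card (M j) = k j} = {M \<in> SA n r k. b \<longrightarrow> king n M}" by (auto simp: SA_def)
  finally show ?thesis .
qed

lemma SA_sum_delta: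
  assumes "\<And>j. Suc j < r \<Longrightarrow> k (Suc j) \<le> k j" "\<And>j. r \<le> j \<Longrightarrow> k j = 0"
    and "\<And>M j p. M \<in> arrays n r \<Longrightarrow> Suc j < r \<Longrightarrow> H (tswap j p M) = H M"
  shows "(\<Sum>M\<in>arrays n r. Dl 0 {..<r} (cgap k) (cgap (\<lambda>j. card (M j))) * H M) = (\<Sum>M\<in>SA n r k. H M)"
  using sum_arrays_delta[of r k False n H 0] assms by simp

lemma KA_sum_delta:
  assumes "\<And>j. Suc j < r \<Longrightarrow> k (Suc j) \<le> k j" "\<And>j. r \<le> j \<Longrightarrow> k j = 0" "\<And>j. k j \<le> n"
    and "\<And>M j p. M \<in> arrays n r \<Longrightarrow> Suc j < r \<Longrightarrow> H (tswap j p M) = H M"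
    and "\<And>M m. M \<in> arrays n r \<Longrightarrow> 0 < r \<Longrightarrow> m \<le> n \<Longrightarrow> H (tflip n m M) = H M"
  shows "(\<Sum>M\<in>arrays n r. Dl 1 {..<r} (ugap n k) (ugap n (\<lambda>j. card (M j))) * H M) = (\<Sum>M\<in>KA n r k. H M)"
  using sum_arrays_delta[of r k True n H "int n + 1"] assms unfolding ugap_def[abs_def] KA_def by simp

section \<open>The alternating sum of a weight\<close>

text \<open>\<mu> + rho with the coordinates in reverse, so that the sequence increases as
  \<open>Dl_strict\<close> requires.\<close>

definition mm :: "nat \<Rightarrow> (nat \<Rightarrow> nat) \<Rightarrow> nat \<Rightarrow> int" where
  "mm n \<mu> i = int (\<mu> (n - i)) + int i + 1"

definition psi :: "nat \<Rightarrow> (nat \<Rightarrow> nat) \<Rightarrow> (nat \<Rightarrow> int) \<Rightarrow> int" where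
  "psi n \<mu> v = Dl 1 {..<n} (mm n \<mu>) (\<lambda>i. v (n - i))"

definition kv :: "nat \<Rightarrow> nat \<Rightarrow> array \<Rightarrow> nat \<Rightarrow> int" where
  "kv n r M i = kw r M i + (int n + 1 - int i)"

lemma psi_cong: "(\<And>i. 1 \<le> i \<Longrightarrow> i \<le> n \<Longrightarrow> v i = w i) \<Longrightarrow> psi n \<mu> v = psi n \<mu> w"
  unfolding psi_def by (rule Dl_cong) auto

lemma mm_strict: "dwt n r \<mu> \<Longrightarrow> i < j \<Longrightarrow> j < n \<Longrightarrow> mm n \<mu> i < mm n \<mu> j"
proof -
  assume d: "dwt n r \<mu>" "i < j" "j < n"
  then have "1 \<le> n - j" "n - j \<le> n - i" by auto
  then have "\<mu> (n - i) \<le> \<mu> (n - j)" using d(1) unfolding dwt_def by blast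
  then show ?thesis using d(2) by (simp add: mm_def)
qed

lemma mm_pos: "0 < mm n \<mu> i"
  by (simp add: mm_def)

lemma anti_C_psi:
  assumes n: "1 \<le> n"
  shows "anti_C n (psi n \<mu>)"
  unfolding anti_C_def
proof (intro conjI allI impI)
  fix v :: "nat \<Rightarrow> int" and i assume i: "1 \<le> i" "i < n"
  have "psi n \<mu> (v(i := v (Suc i), Suc i := v i))
    = Dl 1 {..<n} (mm n \<mu>) (\<lambda>k. (\<lambda>k. v (n - k)) (transpose (n - i) (n - Suc i) k))"
    unfolding psi_def
  proof (rule Dl_cong)
    fix k assume "k \<in> {..<n}"
    then have k: "k < n" by simp
    consider "k = n - i" | "k = n - Suc i" | "k \<noteq> n - i" "k \<noteq> n - Suc i" by blast
    then show "(v(i := v (Suc i), Suc i := v i)) (n - k) = v (n - transpose (n - i) (n - Suc i) k)"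
    proof cases
      case 3
      then have "n - k \<noteq> i" "n - k \<noteq> Suc i" using k by auto
      then show ?thesis using 3 by (simp add: transpose_def)
    qed (use i in \<open>auto simp: transpose_def\<close>)
  qed
  also have "\<dots> = - psi n \<mu> v"
    unfolding psi_def by (rule Dl_swap) (use i in auto)
  finally show "psi n \<mu> (v(i := v (Suc i), Suc i := v i)) = - psi n \<mu> v" .
next
  fix v :: "nat \<Rightarrow> int"
  have "psi n \<mu> (v(n := - v n)) = Dl 1 {..<n} (mm n \<mu>) ((\<lambda>k. v (n - k))(0 := - (\<lambda>k. v (n - k)) 0))"
    unfolding psi_def by (rule Dl_cong) auto
  also have "\<dots> = - psi n \<mu> v" unfolding psi_def by (rule Dl_neg) (use n in auto)
  finally show "psi n \<mu> (v(n := - v n)) = - psi n \<mu> v" .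
qed

lemma lo_letter_count: "lo M r q = int (letter_count r M q)"
  by (simp add: lo_def letter_count_def)

definition relabel :: "nat \<Rightarrow> nat \<Rightarrow> nat" where
  "relabel n q = (if q \<le> n then a_seq q else b_seq (2 * n + 1 - q))"

lemma bij_relabel: "bij_betw (relabel n) {1..2 * n} {1..2 * n}"
proof -
  have "relabel n ` {1..2 * n} \<subseteq> {1..2 * n}"
  proof
    fix x assume "x \<in> relabel n ` {1..2 * n}"
    then obtain q where q: "q \<in> {1..2 * n}" "x = relabel n q" by blast
    define i where "i = (if q \<le> n then q else 2 * n + 1 - q)"
    have i: "1 \<le> i" "i \<le> n" using q(1) by (auto simp: i_def)
    have "2 * i - 1 \<le> x" "x \<le> 2 * i"
      unfolding q(2) relabel_def i_def using ab_seq i unfolding ab_seq_def i_def by (auto split: if_splits)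
    then show "x \<in> {1..2 * n}" using i by auto
  qed
  moreover have "inj_on (relabel n) {1..2 * n}"
  proof (rule inj_onI)
    fix p q assume p: "p \<in> {1..2 * n}" "q \<in> {1..2 * n}" "relabel n p = relabel n q"
    then show "p = q"
      using inj_onD[OF ab_seq_inj[OF ab_seq(1)], of p q n] inj_onD[OF ab_seq_inj[OF ab_seq(2)], of "2 * n + 1 - p" "2 * n + 1 - q" n]
        a_seq_ne_b_seq[of p "2 * n + 1 - q"] a_seq_ne_b_seq[of q "2 * n + 1 - p"]
      by (cases "p \<le> n"; cases "q \<le> n") (auto simp: relabel_def Suc_le_eq, arith)
  qed
  ultimately show ?thesis unfolding bij_betw_def using endo_inj_surj[of "{1..2 * n}"] by blast
qed

text \<open>Over arbitrary arrays only heights and letter counts enter, so a bijection of the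
  letters may be applied to every column. It sends i to a_i and the bar of i to b_i, which turns one
  weight into the other.\<close>

lemma sum_relabel:
  "(\<Sum>M\<in>arrays n r. D (\<lambda>j. card (M j)) * psi n \<mu> (gv n r M)) = (\<Sum>M\<in>arrays n r. D (\<lambda>j. card (M j)) * psi n \<mu> (kv n r M))"
proof (rule sum.reindex_bij_witness[of _ "\<lambda>M j. inv_into {1..2 * n} (relabel n) ` M j" "\<lambda>M j. relabel n ` M j"])
  note b = bij_relabel[of n]
  have inj: "inj_on (relabel n) {1..2 * n}" and im: "relabel n ` {1..2 * n} = {1..2 * n}"
    using b by (auto simp: bij_betw_def)
  fix M assume M: "M \<in> arrays n r"
  have sub: "M j \<subseteq> {1..2 * n}" for j using arrays_bd[OF M] by auto
  have im1: "relabel n ` A \<subseteq> {1..2 * n}" if "A \<subseteq> {1..2 * n}" for A using that im by blast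
  have im2: "inv_into {1..2 * n} (relabel n) ` A \<subseteq> {1..2 * n}" if "A \<subseteq> {1..2 * n}" for A
    by (rule image_subsetI, rule inv_into_into) (use that im in blast)
  show "(\<lambda>j. inv_into {1..2 * n} (relabel n) ` relabel n ` M j) = M"
    using sub by (intro ext inv_into_image_cancel[OF inj])
  show "(\<lambda>j. relabel n ` inv_into {1..2 * n} (relabel n) ` M j) = M"
    using sub by (intro ext image_inv_into_cancel[OF im])
  show "(\<lambda>j. relabel n ` M j) \<in> arrays n r" "(\<lambda>j. inv_into {1..2 * n} (relabel n) ` M j) \<in> arrays n r"
    using M im1[OF sub] im2[OF sub] unfolding arrays_def by simp_all
  have "card (relabel n ` M j) = card (M j)" for j
    by (rule card_image, rule inj_on_subset[OF inj sub])
  moreover have "psi n \<mu> (kv n r (\<lambda>j. relabel n ` M j)) = psi n \<mu> (gv n r M)"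
  proof (rule psi_cong)
    fix i assume i: "1 \<le> i" "i \<le> n"
    have lc: "letter_count r (\<lambda>j. relabel n ` M j) (relabel n q) = letter_count r M q" if "q \<in> {1..2 * n}" for q
      unfolding letter_count_def using inj_on_image_mem_iff[OF inj that sub] by simp
    have "2 * n + 1 - (2 * n + 1 - i) = i" "\<not> 2 * n + 1 - i \<le> n" using i by auto
    then have "relabel n i = a_seq i" "relabel n (2 * n + 1 - i) = b_seq i"
      using i unfolding relabel_def by presburger+
    moreover have "2 * n + 1 - i \<in> {1..2 * n}" "i \<in> {1..2 * n}" using i by auto
    ultimately show "kv n r (\<lambda>j. relabel n ` M j) i = gv n r M i"
      using lc[of i] lc[of "2 * n + 1 - i"] i by (simp add: kv_def gv_def kw_def lo_letter_count)
  qed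
  ultimately show "D (\<lambda>j. card (relabel n ` M j)) * psi n \<mu> (kv n r (\<lambda>j. relabel n ` M j)) = D (\<lambda>j. card (M j)) * psi n \<mu> (gv n r M)"
    by simp
qed

section \<open>Vanishing of the off-diagonal terms\<close>

definition dual_fun :: "nat \<Rightarrow> nat \<Rightarrow> (nat \<Rightarrow> nat) \<Rightarrow> (nat \<Rightarrow> nat) \<Rightarrow> (nat \<Rightarrow> int) \<Rightarrow> int" where
  "dual_fun n r k \<mu> h = Dl 1 {..<r} (ugap n k) h * Dl 1 {..<n} (mm n \<mu>) (\<lambda>i. h (r + i))"

lemma nanti_dual_fun:
  assumes "i < r + n"
  shows "nanti (dual_fun n r k \<mu>) i"
  unfolding nanti_def
proof
  fix v :: "nat \<Rightarrow> int"
  show "dual_fun n r k \<mu> (v(i := - v i)) = - dual_fun n r k \<mu> v"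
  proof (cases "i < r")
    case True
    then have "(\<lambda>l. (v(i := - v i)) (r + l)) = (\<lambda>l. v (r + l))" by auto
    then show ?thesis using Dl_neg[of "{..<r}" i "ugap n k" v] True by (simp add: dual_fun_def)
  next
    case False
    have 1: "Dl 1 {..<r} (ugap n k) (v(i := - v i)) = Dl 1 {..<r} (ugap n k) v"
      by (rule Dl_cong) (use False in auto)
    have "(\<lambda>l. (v(i := - v i)) (r + l)) = (\<lambda>l. v (r + l))(i - r := - (\<lambda>l. v (r + l)) (i - r))"
      using False by (auto simp: fun_eq_iff)
    then have "Dl 1 {..<n} (mm n \<mu>) (\<lambda>l. (v(i := - v i)) (r + l)) = - Dl 1 {..<n} (mm n \<mu>) (\<lambda>l. v (r + l))"
      using Dl_neg[of "{..<n}" "i - r" "mm n \<mu>" "\<lambda>l. v (r + l)"] False assms by auto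
    then show ?thesis using 1 by (simp add: dual_fun_def)
  qed
qed

lemma block_anti_dual_fun: "block_anti r n (dual_fun n r k \<mu>)"
  unfolding block_anti_def
proof (intro allI impI)
  fix p q and h :: "nat \<Rightarrow> int"
  assume p: "p permutes {0..<r}" and q: "q permutes {0..<n}"
  have p': "p permutes {..<r}" and q': "q permutes {..<n}" using p q by (simp_all add: atLeast0LessThan)
  have "Dl 1 {..<r} (ugap n k) (\<lambda>i. h (blockperm r n p q i)) = Dl 1 {..<r} (ugap n k) (\<lambda>i. h (p i))"
    by (rule Dl_cong) (simp add: blockperm_def)
  also have "\<dots> = sign p * Dl 1 {..<r} (ugap n k) h" by (rule Dl_perm[OF _ p']) simp
  finally have 1: "Dl 1 {..<r} (ugap n k) (\<lambda>i. h (blockperm r n p q i)) = sign p * Dl 1 {..<r} (ugap n k) h" .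
  have "Dl 1 {..<n} (mm n \<mu>) (\<lambda>i. h (blockperm r n p q (r + i))) = Dl 1 {..<n} (mm n \<mu>) (\<lambda>i. (\<lambda>l. h (r + l)) (q i))"
    by (rule Dl_cong) (simp add: blockperm_def)
  also have "\<dots> = sign q * Dl 1 {..<n} (mm n \<mu>) (\<lambda>l. h (r + l))" by (rule Dl_perm[OF _ q']) simp
  finally have 2: "Dl 1 {..<n} (mm n \<mu>) (\<lambda>i. h (blockperm r n p q (r + i))) = sign q * Dl 1 {..<n} (mm n \<mu>) (\<lambda>l. h (r + l))" .
  show "dual_fun n r k \<mu> (\<lambda>i. h (blockperm r n p q i)) = sign p * sign q * dual_fun n r k \<mu> h"
    unfolding dual_fun_def 1 2 by simp
qed

text \<open>The index \<open>r + i\<close> stands for the pair of letters with number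
  \<open>n - i\<close>, in the reversed order used by \<open>psi\<close>.\<close>

definition array_choice :: "nat \<Rightarrow> nat \<Rightarrow> array \<Rightarrow> nat \<times> nat \<Rightarrow> bool \<times> bool" where
  "array_choice n r M = (\<lambda>x\<in>{..<r} \<times> {r..<r + n}.
     (b_seq (n - (snd x - r)) \<in> M (fst x), a_seq (n - (snd x - r)) \<in> M (fst x)))"

definition choice_array :: "nat \<Rightarrow> nat \<Rightarrow> (nat \<times> nat \<Rightarrow> bool \<times> bool) \<Rightarrow> array" where
  "choice_array n r g j = (if j < r then
     {b_seq m |m. m \<in> {1..n} \<and> fst (g (j, r + n - m))} \<union> {a_seq m |m. m \<in> {1..n} \<and> snd (g (j, r + n - m))} else {})"

lemma a_or_b:
  assumes "q \<in> {1..2 * n}"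
  shows "\<exists>m\<in>{1..n}. q = a_seq m \<or> q = b_seq m"
proof -
  define m where "m = (q + 1) div 2"
  have m: "m \<in> {1..n}" "q = 2 * m \<or> q = 2 * m - 1" using assms unfolding m_def by (simp, presburger)+
  then have "q = a_seq m \<or> q = b_seq m" unfolding a_seq_def b_seq_def by auto
  then show ?thesis using m(1) by blast
qed

lemma ab_in_range:
  assumes "m \<in> {1..n}"
  shows "a_seq m \<in> {1..2 * n}" "b_seq m \<in> {1..2 * n}"
  using assms by (auto simp: a_seq_def b_seq_def of_bool_def)

text \<open>A column is a choice of a subset of {b_m, a_m} for every m. The sums of
  \<open>cx\<close> and \<open>cy\<close>, shifted by \<open>rho_base\<close>, are the shifted
  heights and the shifted weight.\<close>

lemma sum_arrays_choices:
  "(\<Sum>M\<in>arrays n r. Dl 1 {..<r} (ugap n k) (ugap n (\<lambda>j. card (M j))) * psi n \<mu> (kv n r M))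
    = (\<Sum>g\<in>choices r n. dual_fun n r k \<mu> (\<lambda>i. rho_base r n i + cwt r n g i))"
proof (rule sum.reindex_bij_witness[of _ "choice_array n r" "array_choice n r"])
  fix M assume M: "M \<in> arrays n r"
  show "choice_array n r (array_choice n r M) = M"
  proof (intro ext Set.set_eqI)
    fix j q
    show "q \<in> choice_array n r (array_choice n r M) j \<longleftrightarrow> q \<in> M j"
    proof (cases "j < r")
      case True
      have e: "array_choice n r M (j, r + n - m) = (b_seq m \<in> M j, a_seq m \<in> M j)" if "m \<in> {1..n}" for m
      proof -
        have "(j, r + n - m) \<in> {..<r} \<times> {r..<r + n}" "n - (r + n - m - r) = m" using that True by auto
        then show ?thesis by (simp add: array_choice_def)
      qed
      have "q \<in> choice_array n r (array_choice n r M) j \<longleftrightarrow> (\<exists>m\<in>{1..n}. (q = b_seq m \<or> q = a_seq m) \<and> q \<in> M j)"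
        using True e unfolding choice_array_def by auto
      also have "\<dots> \<longleftrightarrow> q \<in> M j" using a_or_b arrays_bd[OF M] by (metis atLeastAtMost_iff)
      finally show ?thesis .
    next
      case False
      then show ?thesis using M by (auto simp: choice_array_def arrays_def)
    qed
  qed
  show "array_choice n r M \<in> choices r n" unfolding array_choice_def choices_def by auto
  have 1: "rho_base r n i + cwt r n (array_choice n r M) i = ugap n (\<lambda>j. card (M j)) i" if i: "i < r" for i
  proof -
    have "cwt r n (array_choice n r M) i
      = (\<Sum>x\<in>{r..<r + n}. 1 - of_bool (b_seq (n - (x - r)) \<in> M i) - of_bool (a_seq (n - (x - r)) \<in> M i))"
      using i unfolding cwt_def if_P[OF i] by (intro sum.cong refl) (simp add: array_choice_def cx_def)
    also have "\<dots> = (\<Sum>m\<in>{1..n}. 1 - of_bool (b_seq m \<in> M i) - of_bool (a_seq m \<in> M i))"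
      by (rule sum.reindex_bij_witness[of _ "\<lambda>m. r + n - m" "\<lambda>x. n - (x - r)"]) auto
    also have "\<dots> = (\<Sum>m\<in>{1..n}. 1 - (of_bool (2 * m - 1 \<in> M i) + of_bool (2 * m \<in> M i)))"
      by (intro sum.cong refl) (auto simp: a_seq_def b_seq_def)
    also have "\<dots> = int n - int (card (M i))"
      unfolding card_column[OF M] by (simp only: sum_subtractf sum.distrib of_nat_add of_nat_sum of_nat_of_bool sum_constant card_atLeastAtMost; simp)
    finally show ?thesis using i by (simp add: rho_base_def ugap_def cgap_def)
  qed
  have 2: "rho_base r n (r + i) + cwt r n (array_choice n r M) (r + i) = kv n r M (n - i)" if i: "i < n" for i
  proof -
    have "cwt r n (array_choice n r M) (r + i) = (\<Sum>j<r. of_bool (a_seq (n - i) \<in> M j) - of_bool (b_seq (n - i) \<in> M j))"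
      using i unfolding cwt_def by (simp, intro sum.cong refl) (simp add: array_choice_def cy_def)
    also have "\<dots> = kw r M (n - i)"
      unfolding kw_def letter_count_def by (simp only: sum_subtractf of_nat_sum of_nat_of_bool)
    finally show ?thesis using i by (simp add: rho_base_def kv_def)
  qed
  show "dual_fun n r k \<mu> (\<lambda>i. rho_base r n i + cwt r n (array_choice n r M) i)
    = Dl 1 {..<r} (ugap n k) (ugap n (\<lambda>j. card (M j))) * psi n \<mu> (kv n r M)"
    unfolding dual_fun_def psi_def by (intro arg_cong2[of _ _ _ _ "(*)"] Dl_cong) (use 1 2 in auto)
next
  fix g assume g: "g \<in> choices r n"
  show "choice_array n r g \<in> arrays n r"
    unfolding arrays_def choice_array_def using ab_in_range[of _ n] by auto
  show "array_choice n r (choice_array n r g) = g"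
  proof
    fix x
    show "array_choice n r (choice_array n r g) x = g x"
    proof (cases "x \<in> {..<r} \<times> {r..<r + n}")
      case True
      define m where "m = n - (snd x - r)"
      have m: "m \<in> {1..n}" "r + n - m = snd x" "fst x < r" using True unfolding m_def by auto
      have "b_seq m \<in> choice_array n r g (fst x) \<longleftrightarrow> fst (g x)"
      proof -
        have "m' = m" if "b_seq m = b_seq m'" "m' \<in> {1..n}" for m'
          using inj_onD[OF ab_seq_inj[OF ab_seq(2)]] that m(1) by metis
        moreover have "b_seq m \<noteq> a_seq m'" if "m' \<in> {1..n}" for m'
          using a_seq_ne_b_seq[of m' m] that m(1) by auto
        ultimately show ?thesis using m unfolding choice_array_def by (auto simp del: atLeastAtMost_iff)
      qed
      moreover have "a_seq m \<in> choice_array n r g (fst x) \<longleftrightarrow> snd (g x)"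
      proof -
        have "m' = m" if "a_seq m = a_seq m'" "m' \<in> {1..n}" for m'
          using inj_onD[OF ab_seq_inj[OF ab_seq(1)]] that m(1) by metis
        moreover have "a_seq m \<noteq> b_seq m'" if "m' \<in> {1..n}" for m'
          using a_seq_ne_b_seq[of m m'] that m(1) by auto
        ultimately show ?thesis using m unfolding choice_array_def by (auto simp del: atLeastAtMost_iff)
      qed
      ultimately show ?thesis using True unfolding array_choice_def restrict_def m_def by simp
    next
      case False
      have "g x = undefined" using g False unfolding choices_def by (rule PiE_arb)
      then show ?thesis unfolding array_choice_def using False by (simp only: restrict_apply if_False)
    qed
  qed
qed

definition kappa :: "nat \<Rightarrow> (nat \<Rightarrow> nat) \<Rightarrow> nat \<Rightarrow> nat" where
  "kappa n \<mu> j = card {i \<in> {1..n}. j < \<mu> i}"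

lemma kappa_props:
  assumes "dwt n r \<mu>"
  shows "kappa n \<mu> (Suc j) \<le> kappa n \<mu> j" "r \<le> j \<Longrightarrow> kappa n \<mu> j = 0" "kappa n \<mu> j \<le> n"
    "1 \<le> i \<Longrightarrow> i \<le> n \<Longrightarrow> j < \<mu> i \<longleftrightarrow> i \<le> kappa n \<mu> j"
proof -
  show "kappa n \<mu> (Suc j) \<le> kappa n \<mu> j" unfolding kappa_def by (intro card_mono) auto
  have "kappa n \<mu> j \<le> card {1..n}" unfolding kappa_def by (intro card_mono) auto
  then show "kappa n \<mu> j \<le> n" by simp
  show "kappa n \<mu> j = 0" if "r \<le> j"
  proof -
    have "\<mu> i \<le> r" if "i \<in> {1..n}" for i using assms that unfolding dwt_def by (metis atLeastAtMost_iff)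
    then have "{i \<in> {1..n}. j < \<mu> i} = {}" using that by fastforce
    then show ?thesis by (simp add: kappa_def)
  qed
  show "j < \<mu> i \<longleftrightarrow> i \<le> kappa n \<mu> j" if "1 \<le> i" "i \<le> n"
    using dwt_initial[OF assms, of j, folded kappa_def] that by (auto simp: set_eq_iff)
qed

lemma strict_image_unique:
  fixes f g :: "nat \<Rightarrow> int"
  assumes f: "\<And>i j. i < j \<Longrightarrow> j < r \<Longrightarrow> f i < f j" and g: "\<And>i j. i < j \<Longrightarrow> j < r \<Longrightarrow> g i < g j"
    and im: "f ` {..<r} = g ` {..<r}" and i: "i < r"
  shows "f i = g i"
proof -
  have pos: "card {x \<in> h ` {..<r}. x < h i} = i" if h: "\<And>i j. i < j \<Longrightarrow> j < r \<Longrightarrow> h i < (h j :: int)" and "i < r" for h :: "nat \<Rightarrow> int" and i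
  proof -
    have "h a < h i \<longleftrightarrow> a < i" if "a < r" for a
      using h[of a i] h[of i a] that \<open>i < r\<close> by (cases a i rule: linorder_cases) auto
    then have "{x \<in> h ` {..<r}. x < h i} = h ` {..<i}" using \<open>i < r\<close> by (auto intro: less_trans)
    moreover have "inj_on h {..<i}"
      by (rule linorder_inj_onI') (use h \<open>i < r\<close> in \<open>metis lessThan_iff less_trans less_irrefl\<close>)
    ultimately show ?thesis by (simp add: card_image)
  qed
  have "f i \<in> g ` {..<r}" using im i by blast
  then obtain a where a: "a < r" "f i = g a" by blast
  have "card {x \<in> f ` {..<r}. x < f i} = i" by (rule pos[OF f i])
  moreover have "card {x \<in> g ` {..<r}. x < g a} = a" by (rule pos[OF g a(1)])
  ultimately have "a = i" using im a(2) by simp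
  then show ?thesis using a(2) by simp
qed

text \<open>A nonzero value would make the \<open>r\<close> numbers \<open>ugap n k\<close> and the
  \<open>n\<close> numbers \<open>mm n \<mu>\<close> partition {1, ..., r + n}. But the complement
  of the latter is formed by the numbers of the conjugate of \<mu>, the classical complementary
  description of conjugate partitions, so \<open>k\<close> would be that conjugate.\<close>

lemma dual_fun_zero:
  assumes d: "dwt n r \<mu>" and k: "\<And>j. Suc j < r \<Longrightarrow> k (Suc j) \<le> k j" "\<And>j. r \<le> j \<Longrightarrow> k j = 0" "\<And>j. k j \<le> n"
    and ne: "k \<noteq> kappa n \<mu>" and p: "p permutes {0..<r + n}"
  shows "dual_fun n r k \<mu> (\<lambda>i. if i < r + n then int (p i) + 1 else 1) = 0"
proof (rule ccontr)
  let ?h = "\<lambda>i. if i < r + n then int (p i) + 1 else 1"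
  assume nz: "dual_fun n r k \<mu> ?h \<noteq> 0"
  then have nz1: "Dl 1 {..<r} (ugap n k) ?h \<noteq> 0" and nz2: "Dl 1 {..<n} (mm n \<mu>) (\<lambda>i. ?h (r + i)) \<noteq> 0"
    by (auto simp: dual_fun_def)
  obtain s where s: "s permutes {..<r}" "\<And>i. i < r \<Longrightarrow> ?h i = ugap n k (s i) \<or> ?h i = - ugap n k (s i)"
    using Dl_nonzero[OF _ nz1] by (metis finite_lessThan lessThan_iff)
  obtain t where t: "t permutes {..<n}" "\<And>i. i < n \<Longrightarrow> ?h (r + i) = mm n \<mu> (t i) \<or> ?h (r + i) = - mm n \<mu> (t i)"
    using Dl_nonzero[OF _ nz2] by (metis finite_lessThan lessThan_iff)
  have upos: "0 < ugap n k j" for j using k(3)[of j] by (simp add: ugap_def cgap_def)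
  have s': "int (p i) + 1 = ugap n k (s i)" if "i < r" for i
    using s(2)[OF that] upos[of "s i"] that by auto
  have t': "int (p (r + i)) + 1 = mm n \<mu> (t i)" if "i < n" for i
    using t(2)[OF that] mm_pos[of n \<mu> "t i"] that by auto
  have u1: "ugap n k ` {..<r} = (\<lambda>i. int (p i) + 1) ` {..<r}"
  proof -
    have "ugap n k ` {..<r} = (\<lambda>i. ugap n k (s i)) ` {..<r}"
      using permutes_image[OF s(1)] by (metis image_image)
    also have "\<dots> = (\<lambda>i. int (p i) + 1) ` {..<r}" by (rule image_cong) (use s' in auto)
    finally show ?thesis .
  qed
  have u2: "mm n \<mu> ` {..<n} = (\<lambda>i. int (p i) + 1) ` {r..<r + n}"
  proof -
    have "mm n \<mu> ` {..<n} = (\<lambda>i. mm n \<mu> (t i)) ` {..<n}"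
      using permutes_image[OF t(1)] by (metis image_image)
    also have "\<dots> = (\<lambda>i. int (p (r + i)) + 1) ` {..<n}" by (rule image_cong) (use t' in auto)
    also have "\<dots> = (\<lambda>i. int (p i) + 1) ` {r..<r + n}"
      by (auto simp: image_iff Bex_def) (metis add_diff_inverse_nat less_diff_conv2 add.commute not_less)
    finally show ?thesis .
  qed
  have all: "(\<lambda>i. int (p i) + 1) ` {..<r} \<union> (\<lambda>i. int (p i) + 1) ` {r..<r + n} = {1..int (r + n)}"
  proof -
    have "(\<lambda>i. int (p i) + 1) ` {..<r} \<union> (\<lambda>i. int (p i) + 1) ` {r..<r + n} = (\<lambda>i. int i + 1) ` p ` {0..<r + n}"
      by (auto simp: image_image image_Un[symmetric] ivl_disj_un atLeast0LessThan)
    also have "\<dots> = {1..int (r + n)}"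
    proof (intro Set.set_eqI iffI)
      fix x assume "x \<in> {1..int (r + n)}"
      then have "x = int (nat (x - 1)) + 1" "nat (x - 1) \<in> p ` {0..<r + n}"
        unfolding permutes_image[OF p] by auto
      then show "x \<in> (\<lambda>i. int i + 1) ` p ` {0..<r + n}" by (rule image_eqI)
    qed (auto simp: permutes_image[OF p])
    finally show ?thesis .
  qed
  have kd: "ugap n (kappa n \<mu>) i < ugap n (kappa n \<mu>) j" if "i < j" "j < r" for i j
    using cgap_strict[of r "kappa n \<mu>" i j] kappa_props(1)[OF d] that by (simp add: ugap_def)
  have kk: "ugap n k i < ugap n k j" if "i < j" "j < r" for i j
    using cgap_strict[of r k i j] k(1) that by (simp add: ugap_def)
  have sub: "ugap n (kappa n \<mu>) ` {..<r} \<subseteq> ugap n k ` {..<r}"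
  proof
    fix x assume "x \<in> ugap n (kappa n \<mu>) ` {..<r}"
    then obtain j where j: "j < r" "x = ugap n (kappa n \<mu>) j" by auto
    have "x \<in> {1..int (r + n)}" using j kappa_props(3)[OF d, of j] by (auto simp: ugap_def cgap_def)
    moreover have "x \<notin> mm n \<mu> ` {..<n}"
    proof
      assume "x \<in> mm n \<mu> ` {..<n}"
      then obtain i where i: "i < n" "x = mm n \<mu> i" by auto
      \<comment> \<open>Equality would say that \<open>\<mu> (n - i) - j\<close> equals
        \<open>n - i - kappa n \<mu> j\<close>, as integers; but one of them is positive exactly
        when the other is not.\<close>
      then have "j < \<mu> (n - i) \<longleftrightarrow> n - i \<le> kappa n \<mu> j" by (intro kappa_props(4)[OF d]) auto
      then show False using i(2) j(2) i(1) unfolding mm_def ugap_def cgap_def by (cases "j < \<mu> (n - i)") auto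
    qed
    ultimately show "x \<in> ugap n k ` {..<r}" using all u1 u2 by blast
  qed
  have "ugap n (kappa n \<mu>) ` {..<r} = ugap n k ` {..<r}"
  proof (rule card_subset_eq[OF _ sub])
    have "inj_on (ugap n (kappa n \<mu>)) {..<r}" "inj_on (ugap n k) {..<r}"
      using kd kk by (auto intro!: linorder_inj_onI' simp: less_imp_neq)
    then show "card (ugap n (kappa n \<mu>) ` {..<r}) = card (ugap n k ` {..<r})" by (simp add: card_image)
  qed simp
  then have "ugap n (kappa n \<mu>) j = ugap n k j" if "j < r" for j
    using strict_image_unique[of r "ugap n (kappa n \<mu>)" "ugap n k" j] kd kk that by blast
  then have "k j = kappa n \<mu> j" for j
    using k(2)[of j] kappa_props(2)[OF d, of j] by (cases "j < r") (auto simp: ugap_def cgap_def)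
  then show False using ne by auto
qed

lemma sum_arrays_zero:
  assumes "dwt n r \<mu>" "\<And>j. Suc j < r \<Longrightarrow> k (Suc j) \<le> k j" "\<And>j. r \<le> j \<Longrightarrow> k j = 0" "\<And>j. k j \<le> n" "k \<noteq> kappa n \<mu>"
  shows "(\<Sum>M\<in>arrays n r. Dl 1 {..<r} (ugap n k) (ugap n (\<lambda>j. card (M j))) * psi n \<mu> (kv n r M)) = 0"
  unfolding sum_arrays_choices
  by (rule dual_pair_sum_zero[OF nanti_dual_fun block_anti_dual_fun dual_fun_zero[OF assms]])

section \<open>The diagonal term\<close>

lemma letter_count_sum:
  assumes "finite S" "inj_on f S"
  shows "(\<Sum>m\<in>S. letter_count r U (f m)) = (\<Sum>j<r. card {m \<in> S. f m \<in> U j})"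
proof -
  have "(\<Sum>m\<in>S. letter_count r U (f m)) = (\<Sum>j<r. \<Sum>m\<in>S. of_bool (f m \<in> U j))"
    unfolding letter_count_def by (rule sum.swap)
  also have "\<dots> = (\<Sum>j<r. card {m \<in> S. f m \<in> U j})"
    using assms(1) by (intro sum.cong refl) (simp add: of_bool_def sum.If_cases Collect_conj_eq)
  finally show ?thesis .
qed

lemma dwt_le:
  assumes "dwt n r \<mu>"
  shows "\<mu> i \<le> r"
proof -
  have "\<mu> i \<le> (if 1 \<le> i \<and> i \<le> n then r else 0)" using assms unfolding dwt_def by blast
  then show ?thesis by (simp split: if_splits)
qed

text \<open>Both sides count the boxes in the first \<open>s\<close> rows of \<mu>, once by columns
  and once by rows.\<close>

lemma sum_min_kappa:
  assumes d: "dwt n r \<mu>" and s: "s \<le> n"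
  shows "(\<Sum>j<r. min s (kappa n \<mu> j)) = (\<Sum>t\<in>{1..s}. \<mu> t)"
proof -
  have "min s (kappa n \<mu> j) = (\<Sum>t\<in>{1..s}. of_bool (j < \<mu> t))" for j
  proof -
    have "(\<Sum>t\<in>{1..s}. of_bool (j < \<mu> t)) = card {t \<in> {1..s}. j < \<mu> t}"
      by (simp add: of_bool_def sum.If_cases Int_def)
    also have "{t \<in> {1..s}. j < \<mu> t} = {1..min s (kappa n \<mu> j)}"
      using kappa_props(4)[OF d] s by auto
    finally show ?thesis by simp
  qed
  then have "(\<Sum>j<r. min s (kappa n \<mu> j)) = (\<Sum>t\<in>{1..s}. \<Sum>j<r. of_bool (j < \<mu> t))"
    by (simp only:) (rule sum.swap)
  also have "\<dots> = (\<Sum>t\<in>{1..s}. \<mu> t)"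
  proof (intro sum.cong refl)
    fix t assume t: "t \<in> {1..s}"
    have "\<mu> t \<le> r" by (rule dwt_le[OF d])
    then have "{j. j < r \<and> j < \<mu> t} = {..<\<mu> t}" by auto
    then show "(\<Sum>j<r. of_bool (j < \<mu> t)) = \<mu> t"
      by (simp add: of_bool_def sum.If_cases lessThan_def Collect_conj_eq)
  qed
  finally show ?thesis .
qed

lemma card_column_ab:
  assumes "M \<in> arrays n r"
  shows "card (M j) = (\<Sum>m\<in>{1..n}. of_bool (a_seq m \<in> M j) + of_bool (b_seq m \<in> M j))"
  unfolding card_column[OF assms] sum.distrib[symmetric] by (intro sum.cong) (auto simp: a_seq_def b_seq_def)

text \<open>Comparing \<open>\<Sum>i. \<bar>v i\<bar>\<close> with \<open>\<Sum>i. m i\<close> shows that every box contributes positively to the weight.\<close>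

lemma psi_nonzero_positive:
  assumes d: "dwt n r \<mu>" and U: "U \<in> arrays n r" "\<And>j. card (U j) = kappa n \<mu> j" and nz: "psi n \<mu> (kv n r U) \<noteq> 0"
  obtains \<sigma> where "\<sigma> permutes {..<n}"
    "\<And>i. i < n \<Longrightarrow> int (letter_count r U (a_seq (n - i))) + int i + 1 = mm n \<mu> (\<sigma> i)"
    "\<And>m. m \<in> {1..n} \<Longrightarrow> letter_count r U (b_seq m) = 0"
proof -
  let ?A = "\<lambda>m. int (letter_count r U (a_seq m))" and ?B = "\<lambda>m. int (letter_count r U (b_seq m))"
  let ?y = "\<lambda>i. kv n r U (n - i)"
  obtain \<sigma> where \<sigma>: "\<sigma> permutes {..<n}" "\<And>i. i < n \<Longrightarrow> ?y i = mm n \<mu> (\<sigma> i) \<or> ?y i = - mm n \<mu> (\<sigma> i)"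
    using Dl_nonzero[OF _ nz[unfolded psi_def]] by (metis finite_lessThan lessThan_iff)
  have y: "?y i = ?A (n - i) - ?B (n - i) + int i + 1" if "i < n" for i
    using that by (simp add: kv_def kw_def)
  have abs: "\<bar>?y i\<bar> = mm n \<mu> (\<sigma> i)" if "i < n" for i
    using \<sigma>(2)[OF that] mm_pos[of n \<mu> "\<sigma> i"] by auto
  have rev: "(\<Sum>i<n. g (n - i)) = (\<Sum>m\<in>{1..n}. g m)" for g :: "nat \<Rightarrow> int"
    by (rule sum.reindex_bij_witness[of _ "\<lambda>m. n - m" "\<lambda>i. n - i"]) auto
  have tot: "(\<Sum>m\<in>{1..n}. ?A m + ?B m) = (\<Sum>m\<in>{1..n}. int (\<mu> m))"
  proof -
    have "(\<Sum>m\<in>{1..n}. letter_count r U (a_seq m) + letter_count r U (b_seq m))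
      = (\<Sum>m\<in>{1..n}. \<Sum>j<r. of_bool (a_seq m \<in> U j) + of_bool (b_seq m \<in> U j))"
      unfolding letter_count_def sum.distrib ..
    also have "\<dots> = (\<Sum>j<r. card (U j))"
      unfolding card_column_ab[OF U(1)] by (rule sum.swap)
    also have "\<dots> = (\<Sum>j<r. min n (kappa n \<mu> j))"
      using kappa_props(3)[OF d] by (intro sum.cong refl) (simp add: U(2) min_absorb2)
    also have "\<dots> = (\<Sum>m\<in>{1..n}. \<mu> m)" by (rule sum_min_kappa[OF d order_refl])
    finally have "int (\<Sum>m\<in>{1..n}. letter_count r U (a_seq m) + letter_count r U (b_seq m)) = int (\<Sum>m\<in>{1..n}. \<mu> m)"
      by (rule arg_cong)
    then show ?thesis by (simp only: of_nat_sum of_nat_add)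
  qed
  have s1: "(\<Sum>i<n. \<bar>?y i\<bar>) = (\<Sum>i<n. mm n \<mu> i)"
  proof -
    have "(\<Sum>i<n. \<bar>?y i\<bar>) = (\<Sum>i<n. mm n \<mu> (\<sigma> i))" by (intro sum.cong) (use abs in auto)
    then show ?thesis using sum.permute[OF \<sigma>(1), of "mm n \<mu>"] by (simp add: o_def)
  qed
  have s2: "(\<Sum>i<n. ?A (n - i) + ?B (n - i) + (int i + 1)) = (\<Sum>i<n. mm n \<mu> i)"
  proof -
    have "(\<Sum>i<n. ?A (n - i) + ?B (n - i) + (int i + 1)) = (\<Sum>m\<in>{1..n}. ?A m + ?B m) + (\<Sum>i<n. int i + 1)"
      using rev[of "\<lambda>m. ?A m + ?B m"] by (simp only: sum.distrib)
    also have "\<dots> = (\<Sum>i<n. int (\<mu> (n - i))) + (\<Sum>i<n. int i + 1)"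
      unfolding tot rev[of "\<lambda>m. int (\<mu> m)"] ..
    also have "\<dots> = (\<Sum>i<n. mm n \<mu> i)"
      unfolding mm_def by (simp only: sum.distrib ac_simps)
    finally show ?thesis .
  qed
  have "(\<Sum>i<n. ?A (n - i) + ?B (n - i) + (int i + 1) - \<bar>?y i\<bar>) = 0"
    unfolding sum_subtractf s1 s2 by simp
  moreover have "0 \<le> ?A (n - i) + ?B (n - i) + (int i + 1) - \<bar>?y i\<bar>" if "i \<in> {..<n}" for i
    using y[of i] that by auto
  ultimately have "\<forall>i\<in>{..<n}. ?A (n - i) + ?B (n - i) + (int i + 1) - \<bar>?y i\<bar> = 0"
    by (subst (asm) sum_nonneg_eq_0_iff) auto
  then have e: "\<bar>?y i\<bar> = ?A (n - i) + ?B (n - i) + int i + 1" if "i < n" for i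
    using that by (metis add.assoc eq_iff_diff_eq_0 lessThan_iff)
  have B: "?B (n - i) = 0" "?y i = ?A (n - i) + int i + 1" "0 < ?y i" if "i < n" for i
    using e[OF that] y[OF that] by linarith+
  have "letter_count r U (b_seq m) = 0" if "m \<in> {1..n}" for m
  proof -
    have "n - m < n" "n - (n - m) = m" using that by auto
    then show ?thesis using B(1)[of "n - m"] by simp
  qed
  moreover have "int (letter_count r U (a_seq (n - i))) + int i + 1 = mm n \<mu> (\<sigma> i)" if "i < n" for i
    using B(2,3)[OF that] abs[OF that] by simp
  ultimately show ?thesis using that \<sigma>(1) by blast
qed

text \<open>Any s of the letters a_m occur at most \<mu>_1 + ... + \<mu>_s times in columns of these
  heights. Against this bound, the permutation that the alternant provides can only give a_s the
  multiplicity \<mu>_s. Equality in the bound then fixes every column.\<close>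

lemma psi_nonzero_Tarr:
  assumes d: "dwt n r \<mu>" and U: "U \<in> arrays n r" "\<And>j. card (U j) = kappa n \<mu> j" and nz: "psi n \<mu> (kv n r U) \<noteq> 0"
  shows "U = Tarr n a_seq \<mu>"
proof -
  obtain \<sigma> where \<sigma>: "\<sigma> permutes {..<n}"
    "\<And>i. i < n \<Longrightarrow> int (letter_count r U (a_seq (n - i))) + int i + 1 = mm n \<mu> (\<sigma> i)"
    and B: "\<And>m. m \<in> {1..n} \<Longrightarrow> letter_count r U (b_seq m) = 0"
    using psi_nonzero_positive[OF assms] by metis
  let ?A = "\<lambda>m. letter_count r U (a_seq m)"
  have fin: "finite (U j)" for j by (rule arrays_finite_col[OF U(1)])
  have le: "card {m \<in> S. a_seq m \<in> U j} \<le> min (card S) (kappa n \<mu> j)" if S: "S \<subseteq> {1..n}" for S j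
  proof -
    have fS: "finite S" using S finite_subset by blast
    have "card {m \<in> S. a_seq m \<in> U j} \<le> card S" using fS by (intro card_mono) auto
    moreover have "card {m \<in> S. a_seq m \<in> U j} \<le> card (U j)"
    proof (rule card_inj_on_le[of a_seq])
      show "inj_on a_seq {m \<in> S. a_seq m \<in> U j}"
        by (rule inj_on_subset[OF ab_seq_inj[OF ab_seq(1)]]) (use S in auto)
    qed (use fin in auto)
    ultimately show ?thesis using U(2) by simp
  qed
  have bound: "(\<Sum>m\<in>S. ?A m) \<le> (\<Sum>t\<in>{1..card S}. \<mu> t)" if S: "S \<subseteq> {1..n}" for S
  proof -
    have fS: "finite S" using S finite_subset by blast
    have cS: "card S \<le> n" using card_mono[OF _ S] by simp
    have "(\<Sum>m\<in>S. ?A m) = (\<Sum>j<r. card {m \<in> S. a_seq m \<in> U j})"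
      by (rule letter_count_sum[OF fS inj_on_subset[OF ab_seq_inj[OF ab_seq(1)] S]])
    also have "\<dots> \<le> (\<Sum>j<r. min (card S) (kappa n \<mu> j))" by (rule sum_mono) (rule le[OF S])
    also have "\<dots> = (\<Sum>t\<in>{1..card S}. \<mu> t)" by (rule sum_min_kappa[OF d cS])
    finally show ?thesis .
  qed
  have A: "?A s = \<mu> s" if "s \<in> {1..n}" for s
    using that
  proof (induction s rule: less_induct)
    case (less s)
    have s: "1 \<le> s" "s \<le> n" using less.prems by auto
    have "n - s \<in> \<sigma> ` {..<n}" unfolding permutes_image[OF \<sigma>(1)] using s by auto
    then obtain i where i: "i < n" "\<sigma> i = n - s" by auto
    define m where "m = n - i"
    have m: "1 \<le> m" "m \<le> n" "i = n - m" using i by (auto simp: m_def)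
    have ns: "n - (n - s) = s" using s by simp
    have "int (?A m) + int i + 1 = int (\<mu> s) + int (n - s) + 1"
      using \<sigma>(2)[OF i(1)] unfolding i(2) mm_def ns m_def[symmetric] .
    then have eq: "int (?A m) = int (\<mu> s) + int m - int s" using m s by simp
    \<comment> \<open>For \<open>m < s\<close> the multiplicity is \<open>\<mu> m\<close>, at least
      \<open>\<mu> s\<close>, against \<open>eq\<close>. For \<open>s < m\<close> the bound for the
      letters below \<open>s\<close> together with \<open>m\<close> gives at most
      \<open>\<mu> s\<close>, again against \<open>eq\<close>.\<close>
    consider "m < s" | "m = s" | "s < m" by linarith
    then show ?case
    proof cases
      case 1
      then have "?A m = \<mu> m" using less.IH m by auto
      moreover have "\<mu> s \<le> \<mu> m" using d 1 m unfolding dwt_def by auto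
      ultimately show ?thesis using eq 1 s by auto
    next
      case 2
      then show ?thesis using eq by simp
    next
      case 3
      have "(\<Sum>t\<in>insert m {1..<s}. ?A t) \<le> (\<Sum>t\<in>{1..card (insert m {1..<s})}. \<mu> t)"
        by (rule bound) (use m s in auto)
      moreover have "card (insert m {1..<s}) = s" using 3 s by simp
      moreover have "(\<Sum>t\<in>insert m {1..<s}. ?A t) = ?A m + (\<Sum>t\<in>{1..<s}. \<mu> t)"
        using 3 less.IH s by simp
      moreover have "(\<Sum>t\<in>{1..s}. \<mu> t) = \<mu> s + (\<Sum>t\<in>{1..<s}. \<mu> t)"
      proof -
        have "{1..s} = insert s {1..<s}" using s by auto
        then show ?thesis by simp
      qed
      ultimately have "?A m \<le> \<mu> s" by simp
      then show ?thesis using eq 3 m(2) by simp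
    qed
  qed
  have col: "card {m \<in> {1..s}. a_seq m \<in> U j} = min s (kappa n \<mu> j)" if s: "s \<le> n" and j: "j < r" for s j
  proof -
    have S: "{1..s} \<subseteq> {1..n}" using s by auto
    have "(\<Sum>j<r. card {m \<in> {1..s}. a_seq m \<in> U j}) = (\<Sum>m\<in>{1..s}. ?A m)"
      by (rule letter_count_sum[symmetric]) (use inj_on_subset[OF ab_seq_inj[OF ab_seq(1)] S] in auto)
    also have "\<dots> = (\<Sum>m\<in>{1..s}. \<mu> m)" by (intro sum.cong) (use A s in auto)
    also have "\<dots> = (\<Sum>j<r. min s (kappa n \<mu> j))" by (rule sum_min_kappa[OF d s, symmetric])
    finally have e: "(\<Sum>j<r. card {m \<in> {1..s}. a_seq m \<in> U j}) = (\<Sum>j<r. min s (kappa n \<mu> j))" .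
    \<comment> \<open>Termwise bounds with equal totals are equalities.\<close>
    show ?thesis
      by (rule sum_mono_inv[OF e]) (use le[OF S] j in auto)
  qed
  have a: "a_seq s \<in> U j \<longleftrightarrow> j < \<mu> s" if s: "s \<in> {1..n}" and j: "j < r" for s j
  proof -
    obtain t where t: "s = Suc t" using s by (cases s) auto
    have "{m \<in> {1..s}. a_seq m \<in> U j} = (if a_seq s \<in> U j then insert s {m \<in> {1..t}. a_seq m \<in> U j} else {m \<in> {1..t}. a_seq m \<in> U j})"
      using t by (auto simp: le_Suc_eq)
    then have "card {m \<in> {1..s}. a_seq m \<in> U j} = card {m \<in> {1..t}. a_seq m \<in> U j} + of_bool (a_seq s \<in> U j)"
      using t by simp
    then have "min s (kappa n \<mu> j) = min t (kappa n \<mu> j) + of_bool (a_seq s \<in> U j)"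
      using col[of s j] col[of t j] s j t by simp
    then show ?thesis using kappa_props(4)[OF d, of s j] s t by (auto simp: min_def of_bool_def split: if_splits)
  qed
  have b: "b_seq s \<notin> U j" if s: "s \<in> {1..n}" and j: "j < r" for s j
  proof -
    have "(\<Sum>j<r. of_bool (b_seq s \<in> U j)) = (0::nat)" using B[OF s] by (simp only: letter_count_def)
    then have "\<forall>j\<in>{..<r}. of_bool (b_seq s \<in> U j) = (0::nat)" by (simp only: sum_eq_0_iff finite_lessThan)
    then show ?thesis using j by simp
  qed
  show ?thesis
  proof (intro ext Set.set_eqI)
    fix j q
    show "q \<in> U j \<longleftrightarrow> q \<in> Tarr n a_seq \<mu> j"
    proof (cases "j < r")
      case True
      show ?thesis
      proof
        assume q: "q \<in> U j"
        then obtain m where m: "m \<in> {1..n}" "q = a_seq m \<or> q = b_seq m" using a_or_b[of q n] arrays_bd[OF U(1) q] by auto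
        then have "q = a_seq m" using b[OF m(1) True] q by blast
        then show "q \<in> Tarr n a_seq \<mu> j" using a[OF m(1) True] q m(1) by (auto simp: Tarr_def)
      next
        assume "q \<in> Tarr n a_seq \<mu> j"
        then show "q \<in> U j" using a[OF _ True] by (auto simp: Tarr_def)
      qed
    next
      case False
      then have "U j = {}" "Tarr n a_seq \<mu> j = {}"
        using U(1) Tarr_arrays[OF d ab_seq(1)] by (auto simp: arrays_def)
      then show ?thesis by simp
    qed
  qed
qed

lemma psi_at: "dwt n r \<mu> \<Longrightarrow> (\<And>i. i < n \<Longrightarrow> v (n - i) = mm n \<mu> i) \<Longrightarrow> psi n \<mu> v = 1"
proof -
  assume d: "dwt n r \<mu>" and v: "\<And>i. i < n \<Longrightarrow> v (n - i) = mm n \<mu> i"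
  have "psi n \<mu> v = Dl 1 {..<n} (mm n \<mu>) (mm n \<mu>)" unfolding psi_def by (rule Dl_cong) (use v in auto)
  also have "\<dots> = of_bool (\<forall>i\<in>{..<n}. mm n \<mu> i = mm n \<mu> i)"
    by (rule Dl_strict) (use mm_strict[OF d] mm_pos in auto)
  finally show ?thesis by simp
qed

lemma psi_kv_Tarr: "dwt n r \<mu> \<Longrightarrow> psi n \<mu> (kv n r (Tarr n a_seq \<mu>)) = 1"
  by (rule psi_at) (auto simp: kv_def mm_def kw_Tarr)

lemma card_Tarr_kappa: "ab_seq f \<Longrightarrow> card (Tarr n f \<mu> j) = kappa n \<mu> j"
  by (simp add: card_Tarr kappa_def)

lemma Tarr_KA:
  assumes "dwt n r \<mu>"
  shows "Tarr n a_seq \<mu> \<in> KA n r (kappa n \<mu>)"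
proof -
  have A: "Tarr n a_seq \<mu> \<in> arrays n r" by (rule Tarr_arrays[OF assms ab_seq(1)])
  moreover have "sst (Tarr n a_seq \<mu>) \<and> king n (Tarr n a_seq \<mu>)"
    using ahigh_iff[OF A] Tarr_high[OF assms ab_seq(1)] by blast
  ultimately show ?thesis using card_Tarr_kappa[OF ab_seq(1)] by (simp add: KA_def SA_def)
qed

lemma sum_KA_diagonal:
  assumes d: "dwt n r \<mu>"
  shows "(\<Sum>U\<in>KA n r (kappa n \<mu>). psi n \<mu> (kv n r U)) = 1"
proof -
  have fin: "finite (KA n r (kappa n \<mu>))" by (rule finite_subset[OF _ finite_arrays[of n r]]) (auto simp: KA_def SA_def)
  have "(\<Sum>U\<in>KA n r (kappa n \<mu>). psi n \<mu> (kv n r U)) = (\<Sum>U\<in>{Tarr n a_seq \<mu>}. psi n \<mu> (kv n r U))"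
  proof (rule sum.mono_neutral_right[OF fin])
    show "\<forall>U\<in>KA n r (kappa n \<mu>) - {Tarr n a_seq \<mu>}. psi n \<mu> (kv n r U) = 0"
      using psi_nonzero_Tarr[OF d] unfolding KA_def SA_def by blast
  qed (use Tarr_KA[OF d] in simp)
  then show ?thesis using psi_kv_Tarr[OF d] by simp
qed

lemma kv_tswap: "Suc j < r \<Longrightarrow> kv n r (tswap j p M) = kv n r M"
  by (simp add: kv_def kw_def letter_count_tswap fun_eq_iff)

lemma gv_tswap: "Suc j < r \<Longrightarrow> gv n r (tswap j p M) = gv n r M"
  by (simp add: gv_def lo_letter_count letter_count_tswap fun_eq_iff)

lemma psi_kv_tflip: "0 < r \<Longrightarrow> m \<le> n \<Longrightarrow> psi n \<mu> (kv n r (tflip n m M)) = psi n \<mu> (kv n r M)"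
  by (rule psi_cong) (simp add: kv_def kw_ew ew_tflip)

lemma sum_KA_zero:
  assumes d: "dwt n r \<mu>" and k: "\<And>j. Suc j < r \<Longrightarrow> k (Suc j) \<le> k j" "\<And>j. r \<le> j \<Longrightarrow> k j = 0" "\<And>j. k j \<le> n"
    and ne: "k \<noteq> kappa n \<mu>"
  shows "(\<Sum>U\<in>KA n r k. psi n \<mu> (kv n r U)) = 0"
proof -
  have "(\<Sum>M\<in>arrays n r. Dl 1 {..<r} (ugap n k) (ugap n (\<lambda>j. card (M j))) * psi n \<mu> (kv n r M)) = (\<Sum>M\<in>KA n r k. psi n \<mu> (kv n r M))"
    by (rule KA_sum_delta) (simp_all add: k kv_tswap psi_kv_tflip)
  then show ?thesis using sum_arrays_zero[OF d k ne] by simp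
qed

section \<open>Counting dominant arrays\<close>

lemma hatdom_gv:
  assumes M: "M \<in> arrays n r" "hatdom n r M"
  shows "1 \<le> i \<Longrightarrow> i < n \<Longrightarrow> gv n r M (Suc i) < gv n r M i" "1 \<le> n \<Longrightarrow> 0 < gv n r M n"
proof -
  have h: "0 \<le> hh n (lo M r) i" if "1 \<le> i" "i \<le> n" for i
  proof (cases "r = 0")
    case True
    then show ?thesis by (simp add: hh_def lo_def)
  next
    case False
    have "pre r M 0 (2 * n) q = lo M r q" for q
    proof -
      have "q \<in> M 0 \<and> q \<le> 2 * n \<longleftrightarrow> q \<in> M 0" using arrays_bd[OF M(1)] by blast
      then show ?thesis using False lo_hi[of 0 r M q] hi_step[of 0 r M q] by (simp add: pre_def lo_def)
    qed
    then have "pre r M 0 (2 * n) = lo M r" by (rule ext)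
    moreover have "\<not> viol n r M 0 (2 * n) i" using M(2) False unfolding hatdom_def by auto
    ultimately show ?thesis using that by (simp add: viol_def)
  qed
  show "gv n r M (Suc i) < gv n r M i" if "1 \<le> i" "i < n"
    using h[of i] that by (simp add: hh_def gv_def)
  show "0 < gv n r M n" if "1 \<le> n"
    using h[of n] that by (simp add: hh_def gv_def)
qed

text \<open>Inside the chamber the shifted weight is strictly decreasing and positive, so of the
  alternant only the plain indicator remains.\<close>

lemma psi_hatdom:
  assumes d: "dwt n r \<mu>" and M: "M \<in> arrays n r" "hatdom n r M"
  shows "psi n \<mu> (gv n r M) = of_bool (\<forall>i\<in>{..<n}. gv n r M (n - i) = mm n \<mu> i)"
  unfolding psi_def
proof (rule Dl_strict)
  have st: "gv n r M (n - i) < gv n r M (n - j)" if "i < j" "j < n" for i j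
  proof (rule strict_of_Suc[of n "\<lambda>i. gv n r M (n - i)", OF _ that])
    fix j assume j: "Suc j < n"
    then have "n - j = Suc (n - Suc j)" "1 \<le> n - Suc j" "n - Suc j < n" by auto
    then show "gv n r M (n - j) < gv n r M (n - Suc j)" using hatdom_gv(1)[OF M, of "n - Suc j"] by simp
  qed
  show "gv n r M (n - i) < gv n r M (n - j)" if "i \<in> {..<n}" "j \<in> {..<n}" "i < j" for i j using st that by simp
  have "0 < gv n r M (n - i)" if "i < n" for i
    using st[of 0 i] hatdom_gv(2)[OF M] that by (cases "i = 0") auto
  then show "1 = (0::int) \<or> (\<forall>i\<in>{..<n}. 0 < gv n r M (n - i) \<and> 0 < mm n \<mu> i)" using mm_pos by auto
qed (use mm_strict[OF d] in auto)

definition top_array :: "nat \<Rightarrow> nat \<Rightarrow> array \<Rightarrow> array" where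
  "top_array n r M = (SOME U. areach n r M U \<and> ahigh n r U)"

lemma top_array:
  assumes M: "M \<in> arrays n r" "sst M"
  shows "areach n r M (top_array n r M)" "ahigh n r (top_array n r M)"
    "areach n r M U \<Longrightarrow> ahigh n r U \<Longrightarrow> top_array n r M = U"
proof -
  obtain T where T: "tabl n T" "tab_arr T = M" "length T \<le> r" using ex_tab_arr[OF M] by blast
  note P = P_AII_props[OF T(1,3)]
  have "tab_arr (P_AII T) \<in> arrays n r" using areach_arrays[OF P(4)] M(1) T(2) by simp
  then have "ahigh n r (tab_arr (P_AII T))" using ahigh_iff P(1,3) by (simp add: tabl_def)
  then have "\<exists>U. areach n r M U \<and> ahigh n r U" using P(4) T(2) by auto
  then have "areach n r M (top_array n r M) \<and> ahigh n r (top_array n r M)"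
    unfolding top_array_def by (rule someI_ex)
  then show 1: "areach n r M (top_array n r M)" "ahigh n r (top_array n r M)" by auto
  assume U: "areach n r M U" "ahigh n r U"
  then have "aconn n r (top_array n r M) U"
    using 1(1) apath_aconn aconn_sym aconn_trans unfolding areach_def by blast
  then show "top_array n r M = U" using ahigh_unique 1(2) U(2) areach_arrays[OF 1(1) M(1)] by blast
qed

lemma kv_areach: "areach n r M U \<Longrightarrow> kv n r U = kv n r M"
  unfolding areach_def kv_def using apath_aconn kw_aconn by (metis (no_types, lifting))

lemma sum_SA_fibres:
  "(\<Sum>M\<in>SA n r k. psi n \<mu> (kv n r M))
    = (\<Sum>U\<in>{U \<in> arrays n r. sst U \<and> king n U}. int (card (fibre n r k U)) * psi n \<mu> (kv n r U))"
proof -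
  let ?K = "{U \<in> arrays n r. sst U \<and> king n U}"
  have fin: "finite (SA n r k)" "finite ?K"
    by (auto intro: finite_subset[OF _ finite_arrays[of n r]] simp: SA_def)
  have img: "top_array n r ` SA n r k \<subseteq> ?K"
    using top_array(1,2)[of _ n r] areach_arrays ahigh_iff unfolding SA_def by blast
  have fib: "{M \<in> SA n r k. top_array n r M = U} = fibre n r k U" if U: "U \<in> ?K" for U
  proof -
    have "ahigh n r U" using U ahigh_iff by blast
    then have "M \<in> SA n r k \<and> top_array n r M = U \<longleftrightarrow> M \<in> fibre n r k U" for M
      using top_array[of M n r] glhigh_iff_sst[of M n r] unfolding SA_def fibre_def areach_def by blast
    then show ?thesis by blast
  qed
  have "(\<Sum>M\<in>SA n r k. psi n \<mu> (kv n r M)) = (\<Sum>U\<in>?K. \<Sum>M\<in>{M \<in> SA n r k. top_array n r M = U}. psi n \<mu> (kv n r M))"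
    by (rule sum.group[OF fin img, symmetric])
  also have "\<dots> = (\<Sum>U\<in>?K. \<Sum>M\<in>fibre n r k U. psi n \<mu> (kv n r U))"
  proof (rule sum.cong[OF refl])
    fix U assume U: "U \<in> ?K"
    have "kv n r M = kv n r U" if "M \<in> fibre n r k U" for M
      using that kv_areach[of n r M U] unfolding fibre_def areach_def by auto
    then show "(\<Sum>M\<in>{M \<in> SA n r k. top_array n r M = U}. psi n \<mu> (kv n r M)) = (\<Sum>M\<in>fibre n r k U. psi n \<mu> (kv n r U))"
      unfolding fib[OF U] by simp
  qed
  finally show ?thesis by simp
qed

text \<open>Fibres over highest arrays of equal heights have equal size, so each shape contributes
  this size times a sum over all of \<open>KA\<close>. That sum is 1 for the conjugate of \<mu> and
  0 otherwise.\<close>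

lemma sum_fibres:
  assumes d: "dwt n r \<mu>"
  shows "(\<Sum>U\<in>{U \<in> arrays n r. sst U \<and> king n U}. int (card (fibre n r k U)) * psi n \<mu> (kv n r U))
    = int (card (fibre n r k (Tarr n a_seq \<mu>)))"
proof -
  let ?K = "{U \<in> arrays n r. sst U \<and> king n U}" and ?c = "\<lambda>U j. card (U j) :: nat"
  let ?T = "Tarr n a_seq \<mu>"
  have fin: "finite ?K" by (auto intro: finite_subset[OF _ finite_arrays[of n r]])
  have KA: "{U \<in> ?K. ?c U = k'} = KA n r k'" for k' by (auto simp: KA_def SA_def fun_eq_iff)
  have TK: "?T \<in> ?K" "?c ?T = kappa n \<mu>" using Tarr_KA[OF d] by (auto simp: KA_def SA_def fun_eq_iff)
  have inner: "(\<Sum>U\<in>{U \<in> ?K. ?c U = k'}. int (card (fibre n r k U)) * psi n \<mu> (kv n r U))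
      = (if k' = kappa n \<mu> then int (card (fibre n r k ?T)) else 0)" if k': "k' \<in> ?c ` ?K" for k'
  proof -
    obtain V where V: "V \<in> arrays n r" "sst V" "king n V" "k' = ?c V" using k' by blast
    have ce: "card (fibre n r k U) = card (fibre n r k V)" if "U \<in> KA n r k'" for U
      by (rule card_fibre_eq) (use that V ahigh_iff in \<open>auto simp: KA_def SA_def\<close>)
    have "(\<Sum>U\<in>{U \<in> ?K. ?c U = k'}. int (card (fibre n r k U)) * psi n \<mu> (kv n r U))
      = int (card (fibre n r k V)) * (\<Sum>U\<in>KA n r k'. psi n \<mu> (kv n r U))"
      unfolding KA sum_distrib_left by (intro sum.cong refl) (simp add: ce)
    also have "\<dots> = (if k' = kappa n \<mu> then int (card (fibre n r k ?T)) else 0)"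
    proof (cases "k' = kappa n \<mu>")
      case True
      then have "card (fibre n r k ?T) = card (fibre n r k V)" using ce Tarr_KA[OF d] by blast
      then show ?thesis using sum_KA_diagonal[OF d] True by simp
    next
      case False
      have dec: "card (V j) \<le> card (V i)" if "i \<le> j" for i j
        by (rule lift_Suc_antimono_le[of "\<lambda>j. card (V j)", OF _ that]) (rule sst_card_decreasing[OF V(1,2)])
      have "card (V 0) \<le> n" using V(3) cnt_beyond[OF V(1), of "2 * n" 0] by (auto simp: king_def)
      then have "k' j \<le> n" for j using dec[of 0 j] V(4) by simp
      moreover have "k' (Suc j) \<le> k' j" for j using dec[of j "Suc j"] V(4) by simp
      moreover have "k' j = 0" if "r \<le> j" for j using V that by (simp add: arrays_def)
      ultimately show ?thesis using sum_KA_zero[OF d _ _ _ False] False by simp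
    qed
    finally show ?thesis .
  qed
  have "(\<Sum>U\<in>?K. int (card (fibre n r k U)) * psi n \<mu> (kv n r U))
    = (\<Sum>k'\<in>?c ` ?K. \<Sum>U\<in>{U \<in> ?K. ?c U = k'}. int (card (fibre n r k U)) * psi n \<mu> (kv n r U))"
    by (rule sum.group[symmetric]) (use fin in auto)
  also have "\<dots> = (\<Sum>k'\<in>?c ` ?K. if k' = kappa n \<mu> then int (card (fibre n r k ?T)) else 0)"
    by (intro sum.cong refl) (rule inner)
  also have "\<dots> = int (card (fibre n r k ?T))"
  proof -
    have "kappa n \<mu> \<in> ?c ` ?K" using TK(2)[symmetric] TK(1) by (rule image_eqI)
    moreover have "finite (?c ` ?K)" using fin by blast
    ultimately show ?thesis by (simp only: sum.delta if_True)
  qed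
  finally show ?thesis .
qed

text \<open>The alternant in the heights is the same before and after the change of letters, since
  relabelling keeps heights; so the passage to all arrays and back returns to the same
  shape.\<close>

theorem card_hatdom:
  assumes d: "dwt n r \<mu>" and n: "1 \<le> n" and k: "\<And>j. Suc j < r \<Longrightarrow> k (Suc j) \<le> k j" "\<And>j. r \<le> j \<Longrightarrow> k j = 0"
  shows "card {M \<in> SA n r k. hatdom n r M \<and> (\<forall>i\<in>{..<n}. gv n r M (n - i) = mm n \<mu> i)}
    = card (fibre n r k (Tarr n a_seq \<mu>))"
proof -
  have fin: "finite {M \<in> SA n r k. hatdom n r M}"
    by (auto intro: finite_subset[OF _ finite_arrays[of n r]] simp: SA_def)
  have e: "{M \<in> arrays n r. sst M \<and> (\<forall>j. card (M j) = k j) \<and> hatdom n r M} = {M \<in> SA n r k. hatdom n r M}"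
    "{M \<in> arrays n r. sst M \<and> (\<forall>j. card (M j) = k j)} = SA n r k" by (auto simp: SA_def)
  have "int (card {M \<in> SA n r k. hatdom n r M \<and> (\<forall>i\<in>{..<n}. gv n r M (n - i) = mm n \<mu> i)})
    = (\<Sum>M\<in>{M \<in> {M \<in> SA n r k. hatdom n r M}. \<forall>i\<in>{..<n}. gv n r M (n - i) = mm n \<mu> i}. 1)"
    by simp
  also have "\<dots> = (\<Sum>M\<in>{M \<in> SA n r k. hatdom n r M}. of_bool (\<forall>i\<in>{..<n}. gv n r M (n - i) = mm n \<mu> i) * 1)"
    by (rule sum_of_bool_mult[OF fin, symmetric])
  also have "\<dots> = (\<Sum>M\<in>{M \<in> SA n r k. hatdom n r M}. psi n \<mu> (gv n r M))"
    by (intro sum.cong refl) (simp add: psi_hatdom[OF d] SA_def)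
  also have "\<dots> = (\<Sum>M\<in>SA n r k. psi n \<mu> (gv n r M))"
    using sum_sst_hat_reflection[OF anti_C_psi[OF n, of \<mu>], where r = r and k = k] unfolding e by simp
  also have "\<dots> = (\<Sum>M\<in>arrays n r. Dl 0 {..<r} (cgap k) (cgap (\<lambda>j. card (M j))) * psi n \<mu> (gv n r M))"
    by (rule SA_sum_delta[symmetric]) (simp_all add: k gv_tswap)
  also have "\<dots> = (\<Sum>M\<in>arrays n r. Dl 0 {..<r} (cgap k) (cgap (\<lambda>j. card (M j))) * psi n \<mu> (kv n r M))"
    by (rule sum_relabel)
  also have "\<dots> = (\<Sum>M\<in>SA n r k. psi n \<mu> (kv n r M))"
    by (rule SA_sum_delta) (simp_all add: k kv_tswap)
  also have "\<dots> = int (card (fibre n r k (Tarr n a_seq \<mu>)))"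
    unfolding sum_SA_fibres by (rule sum_fibres[OF d])
  finally show ?thesis by simp
qed

section \<open>Dominant paths\<close>

definition path_vertex :: "nat \<Rightarrow> nat list \<Rightarrow> nat \<Rightarrow> nat \<Rightarrow> real" where
  "path_vertex n w k i = (\<Sum>l<k. eps_hat n (w ! l) i)"

lemma pi_word_vertex:
  assumes "k \<le> length w" "w \<noteq> []"
  shows "pi_word n w (real k / real (length w)) = path_vertex n w k"
proof -
  have N: "0 < length w" using assms(2) by simp
  have t: "real (length w) * (real k / real (length w)) = real k" using N by simp
  show ?thesis
  proof (cases "k < length w")
    case True
    then have "min (nat \<lfloor>real k\<rfloor>) (length w - 1) = k" by simp
    then show ?thesis unfolding pi_word_def Let_def t path_vertex_def by (simp add: fun_eq_iff)
  next
    case False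
    then obtain m where m: "k = Suc m" "length w = Suc m" using assms(1) N by (cases "length w") auto
    then have "min (nat \<lfloor>real k\<rfloor>) (length w - 1) = m" by simp
    then show ?thesis unfolding pi_word_def Let_def t path_vertex_def by (simp add: m(1) fun_eq_iff)
  qed
qed

lemma dominant_chamber_convex:
  assumes x: "x \<in> dominant_chamber n" and y: "y \<in> dominant_chamber n" and s: "0 \<le> s" "s \<le> 1"
  shows "(\<lambda>i. (1 - s) * x i + s * y i) \<in> dominant_chamber n"
  using assms unfolding dominant_chamber_def by (auto intro!: add_mono mult_left_mono add_nonneg_nonneg mult_nonneg_nonneg)

text \<open>Between two vertices the path is a segment and the chamber is convex.\<close>

lemma pi_word_dominant_iff:
  "pi_word n w ` {0..1} \<subseteq> dominant_chamber n \<longleftrightarrow> (\<forall>k\<le>length w. path_vertex n w k \<in> dominant_chamber n)"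
proof (cases "w = []")
  case True
  then show ?thesis by (auto simp: pi_word_Nil path_vertex_def dominant_chamber_def image_subset_iff)
next
  case ne: False
  then have N: "0 < length w" by simp
  show ?thesis
  proof
    assume a: "pi_word n w ` {0..1} \<subseteq> dominant_chamber n"
    show "\<forall>k\<le>length w. path_vertex n w k \<in> dominant_chamber n"
    proof (intro allI impI)
      fix k assume k: "k \<le> length w"
      then have "real k / real (length w) \<in> {0..1}" using N by (simp add: divide_simps)
      then have "pi_word n w (real k / real (length w)) \<in> dominant_chamber n" using a by blast
      then show "path_vertex n w k \<in> dominant_chamber n" unfolding pi_word_vertex[OF k ne] .
    qed
  next
    assume a: "\<forall>k\<le>length w. path_vertex n w k \<in> dominant_chamber n"
    show "pi_word n w ` {0..1} \<subseteq> dominant_chamber n"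
    proof (rule image_subsetI)
      fix t :: real assume t: "t \<in> {0..1}"
      define j where "j = min (nat \<lfloor>real (length w) * t\<rfloor>) (length w - 1)"
      define s where "s = real (length w) * t - real j"
      have nt: "0 \<le> real (length w) * t" "real (length w) * t \<le> real (length w)"
        using t by (simp_all add: mult_left_le)
      have "j \<le> length w - 1" unfolding j_def by (rule min.cobounded2)
      then have j: "Suc j \<le> length w" using N by linarith
      have "real j \<le> real (length w) * t"
      proof -
        have "real (nat \<lfloor>real (length w) * t\<rfloor>) \<le> real (length w) * t" using nt(1) by (simp add: of_nat_nat)
        moreover have "real j \<le> real (nat \<lfloor>real (length w) * t\<rfloor>)" by (simp add: j_def)
        ultimately show ?thesis by linarith
      qed
      then have s0: "0 \<le> s" by (simp add: s_def)
      have s1: "s \<le> 1"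
      proof (cases "nat \<lfloor>real (length w) * t\<rfloor> \<le> length w - 1")
        case True
        then have "real j = of_int \<lfloor>real (length w) * t\<rfloor>" using nt(1) by (simp add: j_def of_nat_nat)
        then show ?thesis unfolding s_def by linarith
      next
        case False
        then have "Suc j = length w" using N by (simp add: j_def min_def)
        then have "real j = real (length w) - 1" by linarith
        then show ?thesis using nt(2) unfolding s_def by linarith
      qed
      have "pi_word n w t = (\<lambda>i. (1 - s) * path_vertex n w j i + s * path_vertex n w (Suc j) i)"
        unfolding pi_word_def Let_def j_def[symmetric] s_def[symmetric] path_vertex_def
        by (simp add: fun_eq_iff algebra_simps)
      then show "pi_word n w t \<in> dominant_chamber n"
        using dominant_chamber_convex[OF _ _ s0 s1] a j by simp
    qed
  qed
qed

definition hdom :: "nat \<Rightarrow> (nat \<Rightarrow> int) \<Rightarrow> bool" where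
  "hdom n f \<longleftrightarrow> (\<forall>i. 1 \<le> i \<longrightarrow> i \<le> n \<longrightarrow> 0 \<le> hh n f i)"

lemma path_vertex_count:
  assumes "set w \<subseteq> {1..2 * n}" "k \<le> length w"
  shows "path_vertex n w k i = (if 1 \<le> i \<and> i \<le> n
    then of_int (int (count_list (take k w) i) - int (count_list (take k w) (2 * n + 1 - i))) else 0)"
  using assms(2)
proof (induction k)
  case 0
  show ?case by (simp add: path_vertex_def)
next
  case (Suc k)
  define m where "m = w ! k"
  have m: "1 \<le> m" "m \<le> 2 * n" using assms(1) Suc.prems unfolding m_def by (auto simp: subset_iff dest!: nth_mem[of k w])
  have tk: "take (Suc k) w = take k w @ [m]" using Suc.prems by (simp add: take_Suc_conv_app_nth m_def)
  have cl: "count_list (take (Suc k) w) q = count_list (take k w) q + of_bool (q = m)" for q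
    unfolding tk by simp
  have pv: "path_vertex n w (Suc k) i = path_vertex n w k i + eps_hat n m i"
    by (simp add: path_vertex_def m_def)
  have ep: "eps_hat n m i = (if 1 \<le> i \<and> i \<le> n then of_bool (i = m) - of_bool (2 * n + 1 - i = m) else 0)"
    using m by (auto simp: eps_hat_def)
  show ?case unfolding pv ep cl using Suc by simp
qed

lemma path_vertex_dominant_iff:
  assumes "set w \<subseteq> {1..2 * n}" "k \<le> length w" "1 \<le> n"
  shows "path_vertex n w k \<in> dominant_chamber n \<longleftrightarrow> hdom n (\<lambda>q. int (count_list (take k w) q))"
proof -
  let ?f = "\<lambda>q. int (count_list (take k w) q)"
  have v: "path_vertex n w k i = of_int (?f i - ?f (2 * n + 1 - i))" if "1 \<le> i" "i \<le> n" for i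
    using path_vertex_count[OF assms(1,2), of i] that by simp
  have "path_vertex n w k \<in> dominant_chamber n \<longleftrightarrow>
    (\<forall>i\<in>{1..<n}. 0 \<le> hh n ?f i) \<and> 0 \<le> hh n ?f n"
  proof -
    have "path_vertex n w k (Suc i) \<le> path_vertex n w k i \<longleftrightarrow> 0 \<le> hh n ?f i" if i: "i \<in> {1..<n}" for i
    proof -
      have "path_vertex n w k (Suc i) \<le> path_vertex n w k i
        \<longleftrightarrow> ?f (Suc i) - ?f (2 * n + 1 - Suc i) \<le> ?f i - ?f (2 * n + 1 - i)"
      proof -
        have "1 \<le> i" "i \<le> n" "1 \<le> Suc i" "Suc i \<le> n" using i by auto
        then show ?thesis by (simp only: v of_int_le_iff)
      qed
      then show ?thesis using i by (simp add: hh_def)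
    qed
    moreover have "0 \<le> path_vertex n w k n \<longleftrightarrow> 0 \<le> hh n ?f n"
      using v[of n] assms(3) by (simp add: hh_def)
    ultimately show ?thesis unfolding dominant_chamber_def by simp
  qed
  also have "\<dots> \<longleftrightarrow> hdom n ?f"
    unfolding hdom_def using assms(3) by (metis atLeastLessThan_iff le_neq_implies_less less_imp_le order_refl)
  finally show ?thesis .
qed

lemma count_take_column:
  fixes c :: "nat list"
  assumes c: "sorted_wrt (<) c" and m: "m \<le> length c" and l: "\<And>y. y < length c \<Longrightarrow> y < m \<longleftrightarrow> c ! y \<le> l"
  shows "count_list (take m c) q = of_bool (q \<in> set c \<and> q \<le> l)"
proof -
  have "sorted_wrt (<) (take m c)" using c by (rule sorted_wrt_take)
  moreover have "count_list u q = of_bool (q \<in> set u)" if "sorted_wrt (<) u" for u :: "nat list"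
    using that by (induction u) (auto simp: count_list_0_iff)
  ultimately have "count_list (take m c) q = of_bool (q \<in> set (take m c))" by blast
  moreover have "q \<in> set (take m c) \<longleftrightarrow> q \<in> set c \<and> q \<le> l"
  proof -
    have "q \<in> set (take m c) \<longleftrightarrow> (\<exists>i<m. c ! i = q)"
      using m by (auto simp: in_set_conv_nth)
    also have "\<dots> \<longleftrightarrow> (\<exists>i<length c. i < m \<and> c ! i = q)" using less_le_trans[OF _ m] by blast
    also have "\<dots> \<longleftrightarrow> (\<exists>i<length c. c ! i \<le> l \<and> c ! i = q)" using l by blast
    also have "\<dots> \<longleftrightarrow> q \<in> set c \<and> q \<le> l" by (auto simp: in_set_conv_nth)
    finally show ?thesis .
  qed
  ultimately show ?thesis by simp
qed

lemma count_concat_rev: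
  assumes "\<forall>c\<in>set T. sorted_wrt (<) c"
  shows "int (count_list (concat (rev T)) q) = hi (length T) (tab_arr T) 0 q"
proof -
  have "count_list (concat (rev T)) q = count_list (concat T) q" by (induction T) auto
  also have "\<dots> = letter_count (length T) (tab_arr T) q"
    using entry_count_letter_count[OF assms order_refl] by (simp add: entry_count_def)
  finally show ?thesis by (simp add: hi_def letter_count_def lessThan_atLeast0)
qed

lemma hatdom_Cons:
  "hatdom n (length (c # T)) (tab_arr (c # T)) \<longleftrightarrow> hatdom n (length T) (tab_arr T)
    \<and> (\<forall>l\<le>2 * n. hdom n (\<lambda>q. hi (length T) (tab_arr T) 0 q + of_bool (q \<in> set c \<and> q \<le> l)))"
proof -
  have hS: "hi (Suc (length T)) (tab_arr (c # T)) (Suc x) q = hi (length T) (tab_arr T) x q" for x q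
    unfolding hi_def by (rule sum.reindex_bij_witness[of _ Suc "\<lambda>j. j - 1"]) (auto simp: tab_arr_def nth_Cons')
  have p: "pre (Suc (length T)) (tab_arr (c # T)) (Suc x) l = pre (length T) (tab_arr T) x l"
    "pre (Suc (length T)) (tab_arr (c # T)) 0 l = (\<lambda>q. hi (length T) (tab_arr T) 0 q + of_bool (q \<in> set c \<and> q \<le> l))" for x l
    by (simp_all add: pre_def hS tab_arr_simps fun_eq_iff)
  have h: "hatdom n r M \<longleftrightarrow> (\<forall>c<r. \<forall>l\<le>2 * n. hdom n (pre r M c l))" for r M
    unfolding hatdom_def viol_def hdom_def by (auto simp: not_less)
  have "hatdom n (Suc (length T)) (tab_arr (c # T)) \<longleftrightarrow>
    (\<forall>l\<le>2 * n. hdom n (pre (Suc (length T)) (tab_arr (c # T)) 0 l)) \<and> (\<forall>x<length T. \<forall>l\<le>2 * n. hdom n (pre (Suc (length T)) (tab_arr (c # T)) (Suc x) l))"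
    unfolding h by (auto simp: less_Suc_eq_0_disj)
  then show ?thesis unfolding p h[of "length T"] by auto
qed

text \<open>The path counts letters read, \<open>hatdom\<close> uses a bound \<open>l\<close> on the
  letters of the current column. Every prefix of an increasing column consists of its letters up to
  some \<open>l\<close>, though several \<open>l\<close> may give the same prefix.\<close>

lemma prefixes_dominant_iff:
  assumes "\<forall>c\<in>set T. col_ok n c"
  shows "(\<forall>k\<le>length (concat (rev T)). hdom n (\<lambda>q. int (count_list (take k (concat (rev T))) q)))
    \<longleftrightarrow> hatdom n (length T) (tab_arr T)"
  using assms
proof (induction T)
  case Nil
  then show ?case by (simp add: hatdom_def hdom_def hh_def)
next
  case (Cons c T)
  let ?w = "concat (rev T)"
  have c: "sorted_wrt (<) c" "set c \<subseteq> {1..2 * n}" and T: "\<forall>c\<in>set T. sorted_wrt (<) c"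
    using Cons.prems by (auto simp: col_ok_def)
  let ?P = "\<lambda>u. hdom n (\<lambda>q. int (count_list u q))"
  let ?h = "hi (length T) (tab_arr T) 0"
  have "(\<forall>k\<le>length (concat (rev (c # T))). ?P (take k (concat (rev (c # T)))))
    \<longleftrightarrow> (\<forall>k\<le>length ?w. ?P (take k ?w)) \<and> (\<forall>m\<le>length c. ?P (?w @ take m c))"
  proof
    assume a: "\<forall>k\<le>length (concat (rev (c # T))). ?P (take k (concat (rev (c # T))))"
    have "?P (take k ?w)" if "k \<le> length ?w" for k using a[rule_format, of k] that by simp
    moreover have "?P (?w @ take m c)" if "m \<le> length c" for m
      using a[rule_format, of "length ?w + m"] that by simp
    ultimately show "(\<forall>k\<le>length ?w. ?P (take k ?w)) \<and> (\<forall>m\<le>length c. ?P (?w @ take m c))" by blast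
  next
    assume a: "(\<forall>k\<le>length ?w. ?P (take k ?w)) \<and> (\<forall>m\<le>length c. ?P (?w @ take m c))"
    show "\<forall>k\<le>length (concat (rev (c # T))). ?P (take k (concat (rev (c # T))))"
    proof (intro allI impI)
      fix k assume k: "k \<le> length (concat (rev (c # T)))"
      show "?P (take k (concat (rev (c # T))))"
      proof (cases "k \<le> length ?w")
        case False
        then have "take k (concat (rev (c # T))) = ?w @ take (k - length ?w) c" by simp
        moreover have "k - length ?w \<le> length c" using k by simp
        ultimately show ?thesis using a by (simp only:)
      qed (use a in simp)
    qed
  qed
  also have "(\<forall>m\<le>length c. ?P (?w @ take m c)) \<longleftrightarrow> (\<forall>l\<le>2 * n. hdom n (\<lambda>q. ?h q + of_bool (q \<in> set c \<and> q \<le> l)))"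
  proof -
    have eq: "(\<lambda>q. int (count_list (?w @ take m c) q)) = (\<lambda>q. ?h q + of_bool (q \<in> set c \<and> q \<le> l))"
      if "m \<le> length c" "\<And>y. y < length c \<Longrightarrow> y < m \<longleftrightarrow> c ! y \<le> l" for m l
      using count_concat_rev[OF T] count_take_column[OF c(1) that] by (simp add: fun_eq_iff)
    show ?thesis
    proof
      assume a: "\<forall>m\<le>length c. ?P (?w @ take m c)"
      show "\<forall>l\<le>2 * n. hdom n (\<lambda>q. ?h q + of_bool (q \<in> set c \<and> q \<le> l))"
      proof (intro allI impI)
        fix l assume "l \<le> 2 * n"
        have "(\<lambda>q. int (count_list (?w @ take (cn (set c) l) c) q)) = (\<lambda>q. ?h q + of_bool (q \<in> set c \<and> q \<le> l))"
          by (rule eq) (simp_all add: cn_le_length sorted_nth_le_iff[OF c(1)])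
        then show "hdom n (\<lambda>q. ?h q + of_bool (q \<in> set c \<and> q \<le> l))" using a cn_le_length by metis
      qed
    next
      assume a: "\<forall>l\<le>2 * n. hdom n (\<lambda>q. ?h q + of_bool (q \<in> set c \<and> q \<le> l))"
      show "\<forall>m\<le>length c. ?P (?w @ take m c)"
      proof (intro allI impI)
        fix m assume m: "m \<le> length c"
        \<comment> \<open>The empty prefix of the column is given by \<open>l = 0\<close>, any other
          by its last letter.\<close>
        obtain l where l: "l \<le> 2 * n" "\<And>y. y < length c \<Longrightarrow> y < m \<longleftrightarrow> c ! y \<le> l"
        proof (cases m)
          case 0
          have "1 \<le> c ! y" if "y < length c" for y using c(2) that by (meson atLeastAtMost_iff nth_mem subsetD)
          then show ?thesis using that[of 0] 0 by force
        next
          case (Suc p)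
          then have p: "p < length c" using m by simp
          have "c ! p \<le> 2 * n" using c(2) p by (meson atLeastAtMost_iff nth_mem subsetD)
          moreover have "y < m \<longleftrightarrow> c ! y \<le> c ! p" if "y < length c" for y
            using c(1) that p Suc unfolding sorted_wrt_iff_nth_less
            by (cases y p rule: linorder_cases) (auto simp: less_imp_le not_le)
          ultimately show ?thesis using that by blast
        qed
        then show "?P (?w @ take m c)" using eq[OF m l(2)] a by simp
      qed
    qed
  qed
  finally show ?case using Cons unfolding hatdom_Cons by simp
qed

lemma g_dominant_iff:
  assumes T: "tabl n T" and n: "1 \<le> n"
  shows "g_dominant n T \<longleftrightarrow> hatdom n (length T) (tab_arr T)"
proof -
  have ok: "\<forall>c\<in>set T. col_ok n c" using T by (simp add: tabl_def)
  then have w: "set (concat (rev T)) \<subseteq> {1..2 * n}" by (auto simp: col_ok_def)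
  show ?thesis
    unfolding g_dominant_def pi_hat_def inv_col_word_def pi_word_dominant_iff prefixes_dominant_iff[OF ok, symmetric]
    using path_vertex_dominant_iff[OF w _ n] by blast
qed

lemma wt_g_gv:
  assumes T: "tabl n T" "length T \<le> r"
  shows "wt_g n T i = (if 1 \<le> i \<and> i \<le> n then of_int (gv n r (tab_arr T) i - (int n + 1 - int i)) else 0)"
proof -
  have w: "set (concat (rev T)) \<subseteq> {1..2 * n}" "set (concat T) \<subseteq> {1..2 * n}" using T by (auto simp: tabl_def col_ok_def)
  have s: "\<forall>c\<in>set T. sorted_wrt (<) c" using T by (simp add: tabl_def col_ok_def)
  show ?thesis
  proof (cases "1 \<le> i \<and> i \<le> n")
    case True
    then have "wt_g n T i = real (entry_count T i) - real (entry_count T (2 * n + 1 - i))"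
      by (intro wt_g_eq[OF w(2)]) auto
    then show ?thesis using True by (simp add: entry_count_letter_count[OF s T(2)] gv_def lo_letter_count)
  next
    case False
    show ?thesis
    proof (cases "concat (rev T) = []")
      case True
      have "wt_g n T i = 0" unfolding wt_g_def pi_hat_def inv_col_word_def True by (simp add: pi_word_Nil)
      then show ?thesis using False by auto
    next
      case ne: False
      have "wt_g n T i = path_vertex n (concat (rev T)) (length (concat (rev T))) i"
      proof -
        have "real (length (concat (rev T))) / real (length (concat (rev T))) = 1" using ne by simp
        then show ?thesis using pi_word_vertex[OF order_refl ne, of n]
          unfolding wt_g_def pi_hat_def inv_col_word_def by (simp only:)
      qed
      then show ?thesis using path_vertex_count[OF w(1) order_refl, of i] False by (simp only: if_False)
    qed
  qed
qed

section \<open>Assembling the bijections\<close>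

lemma bij_of_fibre_cards:
  fixes f :: "'a \<Rightarrow> 'w" and g :: "'b \<Rightarrow> 'w"
  assumes A: "finite A" and B: "finite B" and c: "\<And>w. card {a \<in> A. f a = w} = card {b \<in> B. g b = w}"
  shows "\<exists>\<Phi>. bij_betw \<Phi> A B \<and> (\<forall>a\<in>A. f a = g (\<Phi> a))"
proof -
  have "\<forall>w. \<exists>h. bij_betw h {a \<in> A. f a = w} {b \<in> B. g b = w}"
    using A B c by (intro allI finite_same_card_bij) auto
  then obtain h where h: "\<And>w. bij_betw (h w) {a \<in> A. f a = w} {b \<in> B. g b = w}" by metis
  define \<Phi> where "\<Phi> a = h (f a) a" for a
  have in_B: "\<Phi> a \<in> B \<and> g (\<Phi> a) = f a" if "a \<in> A" for a
    using bij_betwE[OF h[of "f a"]] that unfolding \<Phi>_def by blast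
  have "bij_betw \<Phi> A B" unfolding bij_betw_def
  proof
    show "inj_on \<Phi> A"
    proof (rule inj_onI)
      fix a a' assume a: "a \<in> A" "a' \<in> A" "\<Phi> a = \<Phi> a'"
      then have "f a = f a'" using in_B by metis
      then show "a = a'" using inj_onD[OF bij_betw_imp_inj_on[OF h[of "f a"]], of a a'] a unfolding \<Phi>_def by simp
    qed
    show "\<Phi> ` A = B"
    proof
      show "\<Phi> ` A \<subseteq> B" using in_B by blast
      show "B \<subseteq> \<Phi> ` A"
      proof
        fix b assume "b \<in> B"
        then have "b \<in> h (g b) ` {a \<in> A. f a = g b}" using bij_betw_imp_surj_on[OF h[of "g b"]] by blast
        then obtain a where "a \<in> A" "f a = g b" "b = h (g b) a" by blast
        then have "b = \<Phi> a" "a \<in> A" by (simp_all add: \<Phi>_def)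
        then show "b \<in> \<Phi> ` A" by blast
      qed
    qed
  qed
  then show ?thesis using in_B by metis
qed

definition ncols :: "nat list \<Rightarrow> nat" where
  "ncols lam = (if lam = [] then 0 else lam ! 0)"

lemma conj_part_pos_iff: "is_partition lam \<Longrightarrow> 0 < conj_part lam j \<longleftrightarrow> j < ncols lam"
  by (simp add: conj_part_iff ncols_def)

text \<open>\<open>g_dominant_iff\<close> reads exactly as many columns as the tableau has, so the
  number of columns of arrays is taken to be this common length.\<close>

lemma SST_length:
  assumes lam: "is_partition lam" and T: "T \<in> SST (2 * n) lam"
  shows "length T = ncols lam"
proof -
  have t: "tabl n T" "\<And>j. card (tab_arr T j) = conj_part lam j" using T SST_tabl_iff[OF lam] by auto
  have "j < length T \<longleftrightarrow> j < ncols lam" for j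
  proof -
    have "card (tab_arr T j) = 0 \<longleftrightarrow> \<not> j < length T" using t(1) by (auto simp: tab_arr_def tabl_def)
    then show ?thesis using conj_part_pos_iff[OF lam, of j] t(2) by auto
  qed
  then show ?thesis by (metis less_irrefl linorder_neqE_nat)
qed

context
  fixes n :: nat and lam :: "nat list"
  assumes n: "1 \<le> n" and lam: "is_partition lam"
begin

lemma conj_part_0: "ncols lam \<le> j \<Longrightarrow> conj_part lam j = 0"
  using conj_part_pos_iff[OF lam, of j] by auto

lemma conj_part_decreasing: "conj_part lam (Suc j) \<le> conj_part lam j"
proof -
  have "y < conj_part lam j" if "y < conj_part lam (Suc j)" for y
    using that unfolding conj_part_iff[OF lam] by auto
  then show ?thesis by (meson less_irrefl not_le)
qed

lemma bij_SST: "bij_betw tab_arr (SST (2 * n) lam) (SA n (ncols lam) (conj_part lam))"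
  by (rule bij_betw_SST_SA[where r = "ncols lam", OF lam conj_part_0])

lemma finite_SST: "finite (SST (2 * n) lam)"
proof -
  have "finite (SA n (ncols lam) (conj_part lam))"
    by (rule finite_subset[OF _ finite_arrays[of n "ncols lam"]]) (auto simp: SA_def)
  then show ?thesis using bij_betw_finite[OF bij_SST] by simp
qed

lemma wt_g_iff:
  assumes \<mu>: "dwt n r \<mu>" and T: "tabl n T" "length T \<le> r"
  shows "wt_g n T = (\<lambda>i. real (\<mu> i)) \<longleftrightarrow> (\<forall>i\<in>{..<n}. gv n r (tab_arr T) (n - i) = mm n \<mu> i)"
proof -
  have "wt_g n T i = real (\<mu> i) \<longleftrightarrow> (1 \<le> i \<and> i \<le> n \<longrightarrow> gv n r (tab_arr T) i = mm n \<mu> (n - i))" for i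
  proof (cases "1 \<le> i \<and> i \<le> n")
    case True
    have "real (\<mu> i) = of_int (int (\<mu> i))" "mm n \<mu> (n - i) = int (\<mu> i) + (int n + 1 - int i)"
      using True by (simp_all add: mm_def of_nat_diff)
    then show ?thesis using True unfolding wt_g_gv[OF T] if_P[OF True] by (simp only: of_int_eq_iff) auto
  next
    case False
    have "\<mu> i \<le> (if 1 \<le> i \<and> i \<le> n then r else 0)" using \<mu> unfolding dwt_def by blast
    then show ?thesis using False unfolding wt_g_gv[OF T] if_not_P[OF False] by auto
  qed
  then have "wt_g n T = (\<lambda>i. real (\<mu> i)) \<longleftrightarrow> (\<forall>i\<in>{1..n}. gv n r (tab_arr T) i = mm n \<mu> (n - i))"
    by (simp add: fun_eq_iff Ball_def)
  also have "{1..n} = (\<lambda>i. n - i) ` {..<n}"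
  proof -
    have "x \<in> (\<lambda>i. n - i) ` {..<n}" if "x \<in> {1..n}" for x
      using that by (intro image_eqI[of _ _ "n - x"]) auto
    then show ?thesis by auto
  qed
  finally show ?thesis by simp
qed

lemma card_gdom:
  assumes \<mu>: "dwt n (ncols lam) \<mu>"
  shows "card {T \<in> SST_gdom n lam. wt_g n T = (\<lambda>i. real (\<mu> i))} = card (fibre n (ncols lam) (conj_part lam) (Tarr n a_seq \<mu>))"
proof -
  let ?r = "ncols lam"
  have "{T \<in> SST_gdom n lam. wt_g n T = (\<lambda>i. real (\<mu> i))} = {T \<in> SST (2 * n) lam. g_dominant n T \<and> wt_g n T = (\<lambda>i. real (\<mu> i))}"
    by (auto simp: SST_gdom_def)
  also have "card \<dots> = card {M \<in> SA n ?r (conj_part lam). hatdom n ?r M \<and> (\<forall>i\<in>{..<n}. gv n ?r M (n - i) = mm n \<mu> i)}"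
  proof (rule card_bij_restrict[OF bij_SST])
    fix T assume T: "T \<in> SST (2 * n) lam"
    have t: "tabl n T" using T SST_tabl_iff[OF lam] by blast
    have l: "length T = ?r" by (rule SST_length[OF lam T])
    show "g_dominant n T \<and> wt_g n T = (\<lambda>i. real (\<mu> i)) \<longleftrightarrow>
      hatdom n ?r (tab_arr T) \<and> (\<forall>i\<in>{..<n}. gv n ?r (tab_arr T) (n - i) = mm n \<mu> i)"
      using g_dominant_iff[OF t n] wt_g_iff[OF \<mu> t] l by simp
  qed
  also have "\<dots> = card (fibre n ?r (conj_part lam) (Tarr n a_seq \<mu>))"
    by (rule card_hatdom[OF \<mu> n]) (use conj_part_decreasing conj_part_0 in auto)
  finally show ?thesis .
qed

text \<open>The end point of the path lies in the chamber, and a letter occurs at most once in each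
  of the columns, which bounds the coordinates.\<close>

lemma gdom_weight:
  assumes "T \<in> SST_gdom n lam"
  shows "\<exists>\<mu>. dwt n (ncols lam) \<mu> \<and> wt_g n T = (\<lambda>i. real (\<mu> i))"
proof -
  let ?r = "ncols lam"
  have T: "T \<in> SST (2 * n) lam" "g_dominant n T" using assms by (auto simp: SST_gdom_def)
  have t: "tabl n T" using T SST_tabl_iff[OF lam] by blast
  have l: "length T = ?r" by (rule SST_length[OF lam T(1)])
  have A: "tab_arr T \<in> arrays n ?r" by (rule tab_arr_arrays) (use t l in \<open>auto simp: tabl_def\<close>)
  have h: "hatdom n ?r (tab_arr T)" using g_dominant_iff[OF t n] T(2) l by simp
  define x where "x i = gv n ?r (tab_arr T) i - (int n + 1 - int i)" for i
  have dec: "x (Suc i) \<le> x i" if "1 \<le> i" "i < n" for i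
    using hatdom_gv(1)[OF A h that] that by (simp add: x_def)
  have xn: "0 \<le> x n" using hatdom_gv(2)[OF A h n] by (simp add: x_def)
  have dec': "x j \<le> x i" if "1 \<le> i" "i \<le> j" "j \<le> n" for i j
    using that(2,3)
  proof (induction j rule: dec_induct)
    case (step k)
    then show ?case using dec[of k] that(1) by simp
  qed simp
  have pos: "0 \<le> x i" if "1 \<le> i" "i \<le> n" for i using dec'[OF that order_refl] xn by simp
  have le: "x i \<le> int ?r" if "1 \<le> i" "i \<le> n" for i
  proof -
    have "letter_count ?r (tab_arr T) i \<le> (\<Sum>j<?r. 1)" unfolding letter_count_def by (rule sum_mono) simp
    then show ?thesis using that by (simp add: x_def gv_def lo_letter_count)
  qed
  define \<mu> where "\<mu> i = (if 1 \<le> i \<and> i \<le> n then nat (x i) else 0)" for i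
  have "dwt n ?r \<mu>" unfolding dwt_def
  proof (intro conjI allI impI)
    fix i show "\<mu> i \<le> (if 1 \<le> i \<and> i \<le> n then ?r else 0)" using le[of i] by (simp add: \<mu>_def nat_le_iff)
  next
    fix i j :: nat assume "1 \<le> i" "i \<le> j"
    then show "\<mu> j \<le> \<mu> i" using dec'[of i j] by (auto simp: \<mu>_def intro: nat_mono)
  qed
  moreover have "wt_g n T = (\<lambda>i. real (\<mu> i))"
  proof
    fix i show "wt_g n T i = real (\<mu> i)"
      using wt_g_gv[OF t, of ?r i] l pos[of i] by (auto simp: \<mu>_def x_def of_nat_nat)
  qed
  ultimately show ?thesis by blast
qed

text \<open>The comparison is made weight by weight. A weight that is not a dominant \<mu> fitting
  into the columns occurs on neither side; for the others both counts are sizes of fibres.\<close>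

lemma gdom_bij:
  assumes f: "ab_seq f" and \<sigma>: "\<sigma> * \<sigma> = 1"
    and kwf: "\<And>\<mu> i. dwt n (ncols lam) \<mu> \<Longrightarrow> 1 \<le> i \<Longrightarrow> i \<le> n \<Longrightarrow> kw (ncols lam) (Tarr n f \<mu>) i = \<sigma> * int (\<mu> i)"
  shows "\<exists>\<Phi>. bij_betw \<Phi> (SST_gdom n lam) {S \<in> SST (2 * n) lam. rows_const n f (P_AII S)}
    \<and> (\<forall>T\<in>SST_gdom n lam. wt_g n T = (\<lambda>i. of_int \<sigma> * wt_k n (\<Phi> T) i))"
proof (rule bij_of_fibre_cards)
  let ?r = "ncols lam" and ?B = "{S \<in> SST (2 * n) lam. rows_const n f (P_AII S)}"
  show "finite (SST_gdom n lam)" "finite ?B" using finite_SST by (auto simp: SST_gdom_def)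
  fix w
  show "card {T \<in> SST_gdom n lam. wt_g n T = w} = card {S \<in> ?B. (\<lambda>i. of_int \<sigma> * wt_k n S i) = w}"
  proof (cases "\<exists>\<mu>. dwt n ?r \<mu> \<and> w = (\<lambda>i. real (\<mu> i))")
    case True
    then obtain \<mu> where \<mu>: "dwt n ?r \<mu>" "w = (\<lambda>i. real (\<mu> i))" by blast
    have "card {S \<in> ?B. (\<lambda>i. of_int \<sigma> * wt_k n S i) = w} = card {S \<in> SST (2 * n) lam. rows_const n f (P_AII S) \<and> (\<lambda>i. of_int \<sigma> * wt_k n S i) = (\<lambda>i. real (\<mu> i))}"
      unfolding \<mu>(2) by (rule arg_cong[of _ _ card]) auto
    also have "\<dots> = card (fibre n ?r (conj_part lam) (Tarr n f \<mu>))"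
      using card_const_rows[where r = ?r and n = n and f = f and \<sigma> = \<sigma>] lam conj_part_0 f \<sigma> kwf \<mu>(1) by blast
    \<comment> \<open>The constant-row arrays for \<open>f\<close> and for \<open>a_seq\<close> have
      the same heights, the conjugate of \<mu>, so their fibres have the same size.\<close>
    also have "\<dots> = card (fibre n ?r (conj_part lam) (Tarr n a_seq \<mu>))"
      by (rule card_fibre_eq) (use Tarr_arrays[OF \<mu>(1)] Tarr_high[OF \<mu>(1)] ab_seq f in \<open>auto simp: card_Tarr_kappa\<close>)
    also have "\<dots> = card {T \<in> SST_gdom n lam. wt_g n T = w}" unfolding \<mu>(2) by (rule card_gdom[OF \<mu>(1), symmetric])
    finally show ?thesis by simp
  next
    case False
    have "{T \<in> SST_gdom n lam. wt_g n T = w} = {}" using gdom_weight False by blast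
    moreover have "{S \<in> ?B. (\<lambda>i. of_int \<sigma> * wt_k n S i) = w} = {}"
    proof -
      have "\<exists>\<mu>. dwt n ?r \<mu> \<and> (\<lambda>i. of_int \<sigma> * wt_k n S i) = (\<lambda>i. real (\<mu> i))" if S: "S \<in> ?B" for S
      proof -
        have S': "S \<in> SST (2 * n) lam" "rows_const n f (P_AII S)" using S by auto
        show ?thesis
          by (rule const_rows_weight[where r = ?r and n = n and f = f and \<sigma> = \<sigma> and lam = lam and S = S,
                OF lam conj_part_0 f \<sigma> kwf S']) blast+
      qed
      then show ?thesis using False by blast
    qed
    ultimately show ?thesis by (simp only: card.empty)
  qed
qed

end

theorem theoremB:
  fixes n :: nat and lam :: "nat list"
  assumes "n \<ge> 2"
    and "is_partition lam"
    and "length lam \<le> 2 * n"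
  shows "\<exists>\<Phi> \<Psi>.
      bij_betw \<Phi> (SST_gdom n lam) (SST_khw n lam) \<and>
      bij_betw \<Psi> (SST_gdom n lam) (SST_klw n lam) \<and>
      (\<forall>T\<in>SST_gdom n lam.
         wt_g n T = wt_k n (\<Phi> T) \<and>
         wt_g n T = (\<lambda>i. - wt_k n (\<Psi> T) i))"
proof -
  have n: "1 \<le> n" using assms(1) by simp
  obtain \<Phi> where \<Phi>: "bij_betw \<Phi> (SST_gdom n lam) (SST_khw n lam)" "\<forall>T\<in>SST_gdom n lam. wt_g n T = wt_k n (\<Phi> T)"
    using gdom_bij[OF n assms(2) ab_seq(1), of 1] kw_Tarr(1) unfolding SST_khw_def by auto
  \<comment> \<open>Constant rows with entries \<open>b_seq\<close> carry the weight
    \<open>- \<mu>\<close>, hence the sign -1.\<close>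
  obtain \<Psi> where "bij_betw \<Psi> (SST_gdom n lam) (SST_klw n lam)" "\<forall>T\<in>SST_gdom n lam. wt_g n T = (\<lambda>i. - wt_k n (\<Psi> T) i)"
    using gdom_bij[OF n assms(2) ab_seq(2), of "- 1"] kw_Tarr(2) unfolding SST_klw_def by auto
  then show ?thesis using \<Phi> by blast
qed

end
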